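(* The problem \textsc{Routing Plan} is $\mathsf{NP}$-complete, even if each asset crosses at most six traps.
   Context: An instance of \textsc{Routing Plan} consists of a finite set $A$ of $m$ assets (listed explicitly), a finite undirected graph $G=(V,E)$ (the topology), distinct vertices $s,t\in V$ (initial and target), a set of traps $R\subseteq V\setminus\{s,t\}$, a reload time function $c\colon R\to\mathbb{N}$ (positive integers), and a goal $k\in\{1,\dots,|A|\}$. The question is whether there is a valid plan with at least $k$ surviving assets. A plan is a map $\rho\colon A\times\mathbb{N}_0\to V\cup\{\dagger\}$, where $\dagger\notin V$ is a special location for eliminated assets. Every trap is initially active. If an asset enters the vertex of an active trap $r$, then the asset is eliminated and $r$ is triggered; $r$ then remains inactive for $c(r)$ rounds after it was triggered (that is, if triggered at time $j$, it is inactive at times $j+1,\dots,j+c(r)$) and then becomes active again. Assets can pass an inactive trap without being eliminated. The plan $\rho$ is valid if: (1) $\rho(a,0)=s$ for all $a\in A$, and for $j>0$, $\rho(a,j)=s$ implies $\rho(a,j-1)=s$; (2) if $\rho(a,j)\in\{t,\dagger\}$ then $\rho(a,j+1)=\rho(a,j)$; (3) for all $a\in A$, $j\ge 1$: if $\rho(a,j)\ne\dagger$ then $\rho(a,j)$ is equal or adjacent to $\rho(a,j-1)$; (4) no two distinct assets occupy the same vertex at the same time, except at $s$, $t$ or $\dagger$: for distinct $a,a'\in A$ and $j\ge 0$, if $\rho(a,j)=\rho(a',j)$ then $\rho(a,j)\in\{s,t,\dagger\}$; (5) an asset that steps on an active trap is eliminated: if $\rho(a,j)=r\in R$ and $r$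 is active at time $j$, then $\rho(a,j+1)=\dagger$ (and assets are eliminated only in this way); (6) for every $j\ge 1$, if some $a\in A$ has $\rho(a,j)\notin\{t,\dagger\}$, then some $a'\in A$ has $\rho(a',j)\ne\rho(a',j+1)$; (7) there is $\mathrm{len}(\rho)\in\mathbb{N}$ (the length of $\rho$) such that $\rho(a,\mathrm{len}(\rho))\in\{t,\dagger\}$ for all $a\in A$, and some $a\in A$ has $\rho(a,\mathrm{len}(\rho)-1)\notin\{t,\dagger\}$. An asset $a$ survives in a valid plan $\rho$ if $\rho(a,\mathrm{len}(\rho))=t$. An asset crosses a trap if it moves through the vertex carrying that trap on its way. *)

theory Defs
  imports Main
begin

section \<open>Turing machines, polynomial time and NP\<close>

text \<open>
  Deterministic multi-tape Turing machines with two-way infinite tapes. Symbols are numbers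
  below \<open>tm_symbols\<close>; 0 is the blank and 1, 2 stand for the bits False, True. States are numbers
  below \<open>tm_states\<close>; 0 is the start state, 1 the accepting and 2 the rejecting halting state.
  The transition function is only relevant on the finite domain that \<open>wf_tm\<close> refers to.
\<close>

datatype dir = MoveL | Stay | MoveR

record tm =
  tm_tapes :: nat
  tm_symbols :: nat
  tm_states :: nat
  tm_delta :: "nat \<Rightarrow> nat list \<Rightarrow> nat \<times> (nat \<times> dir) list"

definition wf_tm :: "tm \<Rightarrow> bool" where
  "wf_tm M \<longleftrightarrow> 2 \<le> tm_tapes M \<and> 3 \<le> tm_symbols M \<and> 3 \<le> tm_states M \<and>
     (\<forall>q<tm_states M. \<forall>ss. length ss = tm_tapes M \<and> (\<forall>a\<in>set ss. a < tm_symbols M) \<longrightarrow>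
        (case tm_delta M q ss of (q', acts) \<Rightarrow>
           q' < tm_states M \<and> length acts = tm_tapes M \<and> (\<forall>(a, d)\<in>set acts. a < tm_symbols M)))"

text \<open>A tape is its content together with the position of the head.\<close>

type_synonym tape = "(int \<Rightarrow> nat) \<times> int"
type_synonym tm_config = "nat \<times> tape list"

fun tape_read :: "tape \<Rightarrow> nat" where
  "tape_read (f, h) = f h"

fun tape_act :: "nat \<times> dir \<Rightarrow> tape \<Rightarrow> tape" where
  "tape_act (a, d) (f, h) =
     (f(h := a), case d of MoveL \<Rightarrow> h - 1 | Stay \<Rightarrow> h | MoveR \<Rightarrow> h + 1)"

fun halted :: "tm_config \<Rightarrow> bool" where
  "halted (q, ts) \<longleftrightarrow> q = 1 \<or> q = 2"

fun tm_step :: "tm \<Rightarrow> tm_config \<Rightarrow> tm_config" where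
  "tm_step M (q, ts) =
     (if halted (q, ts) then (q, ts)
      else (case tm_delta M q (map tape_read ts) of (q', acts) \<Rightarrow> (q', map2 tape_act acts ts)))"

definition bit_symbol :: "bool \<Rightarrow> nat" where
  "bit_symbol b = (if b then 2 else 1)"

definition input_tape :: "bool list \<Rightarrow> tape" where
  "input_tape x =
     (\<lambda>i. if 0 \<le> i \<and> i < int (length x) then bit_symbol (x ! nat i) else 0, 0)"

text \<open>The input strings are placed on the first tapes; the remaining tapes are blank.\<close>

definition tm_init :: "tm \<Rightarrow> bool list list \<Rightarrow> tm_config" where
  "tm_init M xs = (0, map input_tape xs @ replicate (tm_tapes M - length xs) (input_tape []))"

definition tm_run :: "tm \<Rightarrow> bool list list \<Rightarrow> nat \<Rightarrow> tm_config" where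
  "tm_run M xs n = (tm_step M ^^ n) (tm_init M xs)"

definition tm_accepts :: "tm \<Rightarrow> bool list list \<Rightarrow> bool" where
  "tm_accepts M xs \<longleftrightarrow> (\<exists>n. fst (tm_run M xs n) = 1)"

text \<open>The string on a tape: the bits from position 0 up to the first blank.\<close>

definition tape_holds :: "tape \<Rightarrow> bool list \<Rightarrow> bool" where
  "tape_holds tp y \<longleftrightarrow>
     (\<forall>i<length y. fst tp (int i) = bit_symbol (y ! i)) \<and> fst tp (int (length y)) = 0"

text \<open>Function machines read their argument from tape 0 and leave the value on tape 1.\<close>

definition polytime_computable :: "(bool list \<Rightarrow> bool list) \<Rightarrow> bool" where
  "polytime_computable f \<longleftrightarrow>
     (\<exists>M c d. wf_tm M \<and>
        (\<forall>x. \<exists>n \<le> c * length x ^ d + c.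
           halted (tm_run M [x] n) \<and> tape_holds (snd (tm_run M [x] n) ! 1) (f x)))"

text \<open>
  NP by polynomial-time verifiers. The input is on tape 0, the certificate on tape 1.
\<close>

definition in_NP :: "bool list set \<Rightarrow> bool" where
  "in_NP L \<longleftrightarrow>
     (\<exists>M c d c' d'. wf_tm M \<and>
        (\<forall>x u. \<exists>n \<le> c * (length x + length u) ^ d + c. halted (tm_run M [x, u] n)) \<and>
        (\<forall>x. x \<in> L \<longleftrightarrow> (\<exists>u. length u \<le> c' * length x ^ d' + c' \<and> tm_accepts M [x, u])))"

text \<open>
  Many-one hardness where all instances produced by the reduction lie in the class \<open>P\<close>, i.e.
  hardness of \<open>L\<close> restricted to the instances in \<open>P\<close>.
\<close>

definition NP_hard_on :: "bool list set \<Rightarrow> bool list set \<Rightarrow> bool" where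
  "NP_hard_on P L \<longleftrightarrow>
     (\<forall>L'. in_NP L' \<longrightarrow>
        (\<exists>f. polytime_computable f \<and> (\<forall>x. f x \<in> P) \<and> (\<forall>x. x \<in> L' \<longleftrightarrow> f x \<in> L)))"

definition NP_complete :: "bool list set \<Rightarrow> bool" where
  "NP_complete L \<longleftrightarrow> in_NP L \<and> NP_hard_on UNIV L"

definition NP_complete_on :: "bool list set \<Rightarrow> bool list set \<Rightarrow> bool" where
  "NP_complete_on P L \<longleftrightarrow> in_NP L \<and> NP_hard_on P L"

section \<open>Routing plans\<close>

record ('a, 'v) routing =
  assets :: "'a set"
  verts :: "'v set"
  edges :: "'v set set"
  source :: 'v
  target :: 'v
  traps :: "'v set"
  reload :: "'v \<Rightarrow> nat"
  goal :: nat

definition wf_routing :: "('a, 'v) routing \<Rightarrow> bool" where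
  "wf_routing I \<longleftrightarrow>
     finite (assets I) \<and> finite (verts I) \<and>
     (\<forall>e\<in>edges I. e \<subseteq> verts I \<and> card e = 2) \<and>
     source I \<in> verts I \<and> target I \<in> verts I \<and> source I \<noteq> target I \<and>
     traps I \<subseteq> verts I - {source I, target I} \<and>
     (\<forall>r\<in>traps I. 0 < reload I r) \<and>
     1 \<le> goal I \<and> goal I \<le> card (assets I)"

text \<open>\<open>None\<close> is the location of eliminated assets.\<close>

type_synonym ('a, 'v) plan = "'a \<Rightarrow> nat \<Rightarrow> 'v option"

text \<open>
  A trap is active at time \<open>j\<close> unless it was triggered (occupied while active) at some time
  \<open>i\<close> with \<open>i + 1 \<le> j \<le> i + c\<close>, where \<open>c\<close> is its reload time.
\<close>

fun active :: "('a, 'v) routing \<Rightarrow> ('a, 'v) plan \<Rightarrow> 'v \<Rightarrow> nat \<Rightarrow> bool" where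
  "active I \<rho> r j \<longleftrightarrow>
     (\<forall>i\<in>{..<j}. active I \<rho> r i \<longrightarrow> (\<exists>a\<in>assets I. \<rho> a i = Some r) \<longrightarrow> i + reload I r < j)"

declare active.simps [simp del]

definition finished :: "('a, 'v) routing \<Rightarrow> 'v option \<Rightarrow> bool" where
  "finished I p \<longleftrightarrow> p = Some (target I) \<or> p = None"

definition has_length :: "('a, 'v) routing \<Rightarrow> ('a, 'v) plan \<Rightarrow> nat \<Rightarrow> bool" where
  "has_length I \<rho> n \<longleftrightarrow> 1 \<le> n \<and> (\<forall>a\<in>assets I. finished I (\<rho> a n)) \<and>
     (\<exists>a\<in>assets I. \<not> finished I (\<rho> a (n - 1)))"

definition valid_plan :: "('a, 'v) routing \<Rightarrow> ('a, 'v) plan \<Rightarrow> bool" where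
  "valid_plan I \<rho> \<longleftrightarrow>
     (\<forall>a\<in>assets I. \<forall>j. \<rho> a j \<in> insert None (Some ` verts I)) \<and>
     (\<forall>a\<in>assets I. \<rho> a 0 = Some (source I) \<and>
        (\<forall>j>0. \<rho> a j = Some (source I) \<longrightarrow> \<rho> a (j - 1) = Some (source I))) \<and>
     (\<forall>a\<in>assets I. \<forall>j. finished I (\<rho> a j) \<longrightarrow> \<rho> a (j + 1) = \<rho> a j) \<and>
     (\<forall>a\<in>assets I. \<forall>j\<ge>1. \<rho> a j \<noteq> None \<longrightarrow>
        \<rho> a j = \<rho> a (j - 1) \<or>
        (\<exists>u v. \<rho> a (j - 1) = Some u \<and> \<rho> a j = Some v \<and> {u, v} \<in> edges I)) \<and>
     (\<forall>a\<in>assets I. \<forall>a'\<in>assets I. \<forall>j. a \<noteq> a' \<and> \<rho> a j = \<rho> a' j \<longrightarrow>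
        \<rho> a j \<in> {Some (source I), Some (target I), None}) \<and>
     (\<forall>a\<in>assets I. \<forall>j. \<forall>r\<in>traps I. \<rho> a j = Some r \<and> active I \<rho> r j \<longrightarrow> \<rho> a (j + 1) = None) \<and>
     (\<forall>a\<in>assets I. \<forall>j. \<rho> a j \<noteq> None \<and> \<rho> a (j + 1) = None \<longrightarrow>
        (\<exists>r\<in>traps I. \<rho> a j = Some r \<and> active I \<rho> r j)) \<and>
     (\<forall>j\<ge>1. (\<exists>a\<in>assets I. \<not> finished I (\<rho> a j)) \<longrightarrow>
        (\<exists>a'\<in>assets I. \<rho> a' j \<noteq> \<rho> a' (j + 1))) \<and>
     (\<exists>n. has_length I \<rho> n)"

definition plan_length :: "('a, 'v) routing \<Rightarrow> ('a, 'v) plan \<Rightarrow> nat" where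
  "plan_length I \<rho> = (THE n. has_length I \<rho> n)"

definition survives :: "('a, 'v) routing \<Rightarrow> ('a, 'v) plan \<Rightarrow> 'a \<Rightarrow> bool" where
  "survives I \<rho> a \<longleftrightarrow> \<rho> a (plan_length I \<rho>) = Some (target I)"

text \<open>The trap that eliminates an asset counts among the traps the asset crosses.\<close>

definition crosses :: "('a, 'v) routing \<Rightarrow> ('a, 'v) plan \<Rightarrow> 'a \<Rightarrow> 'v set" where
  "crosses I \<rho> a = {r \<in> traps I. \<exists>j. \<rho> a j = Some r}"

definition solution :: "('a, 'v) routing \<Rightarrow> ('a, 'v) plan \<Rightarrow> bool" where
  "solution I \<rho> \<longleftrightarrow> valid_plan I \<rho> \<and> goal I \<le> card {a \<in> assets I. survives I \<rho> a}"

section \<open>The decision problem\<close>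

text \<open>
  Explicit listing of an instance: assets, vertices, edges, initial vertex, target vertex, pairs
  (trap, reload time), goal.
\<close>

type_synonym listing =
  "nat list \<times> nat list \<times> (nat \<times> nat) list \<times> nat \<times> nat \<times> (nat \<times> nat) list \<times> nat"

fun routing_of :: "listing \<Rightarrow> (nat, nat) routing" where
  "routing_of (as, vs, es, s, t, rs, k) =
     \<lparr> assets = set as, verts = set vs, edges = (\<lambda>(u, v). {u, v}) ` set es,
       source = s, target = t, traps = fst ` set rs,
       reload = (\<lambda>r. case map_of rs r of Some n \<Rightarrow> n | None \<Rightarrow> 0), goal = k \<rparr>"

fun wf_listing :: "listing \<Rightarrow> bool" where
  "wf_listing (as, vs, es, s, t, rs, k) \<longleftrightarrow>
     distinct as \<and> distinct vs \<and> distinct (map (\<lambda>(u, v). {u, v}) es) \<and> distinct (map fst rs) \<and>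
     wf_routing (routing_of (as, vs, es, s, t, rs, k))"

text \<open>
  Numbers are written in binary, least significant digit first. The digits 0, 1, the separator
  closing a number and the separator closing a list are coded by two bits each.
\<close>

fun binary :: "nat \<Rightarrow> bool list" where
  "binary n = (if n = 0 then [] else odd n # binary (n div 2))"

declare binary.simps [simp del]

definition encode_nat :: "nat \<Rightarrow> bool list" where
  "encode_nat n = concat (map (\<lambda>b. [False, b]) (binary n)) @ [True, False]"

definition encode_list :: "nat list \<Rightarrow> bool list" where
  "encode_list ns = concat (map encode_nat ns) @ [True, True]"

definition unpair :: "(nat \<times> nat) list \<Rightarrow> nat list" where
  "unpair ps = concat (map (\<lambda>(u, v). [u, v]) ps)"

fun encode :: "listing \<Rightarrow> bool list" where
  "encode (as, vs, es, s, t, rs, k) =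
     encode_list as @ encode_list vs @ encode_list (unpair es) @ encode_list [s, t] @
     encode_list (unpair rs) @ encode_list [k]"

definition ROUTING_PLAN :: "bool list set" where
  "ROUTING_PLAN = {encode I | I. wf_listing I \<and> (\<exists>\<rho>. solution (routing_of I) \<rho>)}"

text \<open>
  The instances in which it suffices to consider plans where each asset crosses at most \<open>b\<close> traps:
  if there is a solution at all, then there is one of this form. On this class the question for a
  solution and the question for a solution with at most \<open>b\<close> crossings per asset coincide.
\<close>

definition crossing_bounded :: "nat \<Rightarrow> bool list set" where
  "crossing_bounded b =
     {encode I | I. wf_listing I \<and>
        ((\<exists>\<rho>. solution (routing_of I) \<rho>) \<longrightarrow>
         (\<exists>\<rho>. solution (routing_of I) \<rho> \<and>
              (\<forall>a\<in>assets (routing_of I). card (crosses (routing_of I) \<rho> a) \<le> b)))}"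

end

theory Submission
  imports Defs "HOL-Combinatorics.Transposition"
begin

text \<open>
  Hardness. A Cook-Levin formula with \<open>K\<close> variables becomes an instance in which \<open>K + 4\<close> assets may
  die. The assets enter through a trap. The target is behind two further traps, which can be opened
  in time only by an asset that walks through a long corridor; until then the other assets have to
  wait in slots behind the traps of the literals. One death each for the entrance, the corridor and
  the two exits leaves one death per variable for opening the traps of literals. Then all slots are
  occupied, and the slots of the clauses can be occupied only if every clause contains a literal
  whose trap is open.

  Membership. Plans may be exponentially long, because reload times are written in binary. Between
  the few rounds in which an asset leaves the source or is finished, or a trap changes its state,
  assets move only among ordinary vertices and inactive traps. There every reachable configuration
  is reached in few rounds, since assets can swap along edges, and the remaining rounds are spent by
  moving back and forth, so that only their parity matters.

  The reduction and the verifier are programs of a small loop language, which is compiled to Turing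
  machines.
\<close>

section \<open>Compiling bounded-loop programs to polynomial-time Turing machines\<close>

section \<open>Structured tape programs\<close>

text \<open>The sizes are balanced so that the budget is tight everywhere. One death at a literal
  trap lets \<open>q\<close> assets pass, so \<open>K\<close> deaths admit \<open>NS = K * q\<close>
  assets, one per slot; a triggered exit passes \<open>NS - 1\<close> assets, as many as must
  survive. The corridor trap has reload time 1, so every asset that it admits costs a death, and
  replacing literal traps or exits by the corridor never pays. The corridor takes longer than the
  entrance stays open; hence all assets are inside, and parked, before anyone can leave. A slot
  attached to both literals of a variable forces one of them to be opened, and the budget then
  forbids opening both, which makes the opened literals an assignment.

  For membership, the obstacle is that plans may not pause: until all assets are finished, some
  asset has to move in every round after the first, so long stretches can only be bridged by
  oscillation. Numbers with exponentially large values appear only as rows of bits, since all values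
  of the loop language are polynomial. The verifier does not parse its input; it prints the instance
  stored in the certificate and has it compared.\<close>

datatype scom =
    Act nat "nat => nat \<times> dir"
  | SSeq scom scom
  | SIf nat "nat set" scom scom
  | SWhile nat "nat set" scom

type_synonym tapes = "nat => tape"

text \<open>The costs are chosen to agree exactly with \<open>sstep\<close>: every action, every
  test and every unfolding of a sequence is one small step.\<close>

inductive exec :: "scom => tapes => nat => tapes => bool" where
  Act: "exec (Act k g) v 1 (v(k := tape_act (g (tape_read (v k))) (v k)))"
| Seq: "exec a v m v' ==> exec b v' n v'' ==> exec (SSeq a b) v (m + n + 1) v''"
| IfT: "tape_read (v k) \<in> P ==> exec a v n v' ==> exec (SIf k P a b) v (n + 1) v'"
| IfF: "tape_read (v k) \<notin> P ==> exec b v n v' ==> exec (SIf k P a b) v (n + 1) v'"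
| WhileT: "tape_read (v k) \<in> P ==> exec a v m v' ==> exec (SWhile k P a) v' n v'' ==>
    exec (SWhile k P a) v (m + n + 1) v''"
| WhileF: "tape_read (v k) \<notin> P ==> exec (SWhile k P a) v 1 v"

fun sstep :: "scom list \<times> tapes => scom list \<times> tapes" where
  "sstep ([], v) = ([], v)"
| "sstep (Act k g # K, v) = (K, v(k := tape_act (g (tape_read (v k))) (v k)))"
| "sstep (SSeq a b # K, v) = (a # b # K, v)"
| "sstep (SIf k P a b # K, v) = ((if tape_read (v k) \<in> P then a else b) # K, v)"
| "sstep (SWhile k P a # K, v) =
    (if tape_read (v k) \<in> P then a # SWhile k P a # K else K, v)"

lemma exec_sstep: "exec c v n v' ==> (sstep ^^ n) (c # K, v) = (K, v')"
proof (induction arbitrary: K rule: exec.induct)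
  case (Seq a v m v' b n v'')
  have "(sstep ^^ (m + n + 1)) (SSeq a b # K, v) = (sstep ^^ n) ((sstep ^^ m) (a # b # K, v))"
    by (simp add: funpow_add[of n m] add.commute[of m n] funpow_swap1)
  with Seq show ?case by simp
next
  case (WhileT v k P a m v' n v'')
  have "(sstep ^^ (m + n + 1)) (SWhile k P a # K, v) =
      (sstep ^^ n) ((sstep ^^ m) (a # SWhile k P a # K, v))"
    using WhileT(1) by (simp add: funpow_add[of n m] add.commute[of m n] funpow_swap1)
  with WhileT show ?case by simp
qed (simp_all add: funpow_swap1)

text \<open>The stacks that can occur while \<open>c\<close> runs on top of \<open>K\<close>; they become the states of the machine.\<close>

fun stacks :: "scom => scom list => scom list set" where
  "stacks (Act k g) K = {Act k g # K}"
| "stacks (SSeq a b) K = {SSeq a b # K} \<union> stacks a (b # K) \<union> stacks b K"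
| "stacks (SIf k P a b) K = {SIf k P a b # K} \<union> stacks a K \<union> stacks b K"
| "stacks (SWhile k P a) K = {SWhile k P a # K} \<union> stacks a (SWhile k P a # K)"

lemma finite_stacks: "finite (stacks c K)"
  by (induction c arbitrary: K) auto

lemma stacks_self: "c # K \<in> stacks c K"
  by (cases c) auto

text \<open>A step pops the top command or replaces it by subcommands over the same continuation,
  and a loop body always runs on top of its own loop. Hence no stack outgrows the nesting of the
  program, and the finite set \<open>stacks\<close> can serve as a state space that is left only
  through \<open>K\<close>.\<close>

lemma stacks_step: "S \<in> stacks c K ==> fst (sstep (S, v)) \<in> insert K (stacks c K)"
proof (induction c arbitrary: K)
  case (SSeq a b)
  show ?case using SSeq.prems SSeq.IH(1)[of "b # K"] SSeq.IH(2)[of K]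
      stacks_self[of a "b # K"] stacks_self[of b K] by auto
next
  case (SIf k P a b)
  show ?case using SIf.prems SIf.IH(1)[of K] SIf.IH(2)[of K] stacks_self[of a K] stacks_self[of b K]
    by auto
next
  case (SWhile k P a)
  show ?case using SWhile.prems SWhile.IH[of "SWhile k P a # K"] stacks_self[of a "SWhile k P a # K"]
    by (auto split: if_splits)
qed auto

fun wf_scom :: "nat => nat => scom => bool" where
  "wf_scom w S (Act k g) \<longleftrightarrow> k < w \<and> (\<forall>a<S. fst (g a) < S)"
| "wf_scom w S (SSeq a b) \<longleftrightarrow> wf_scom w S a \<and> wf_scom w S b"
| "wf_scom w S (SIf k P a b) \<longleftrightarrow> k < w \<and> wf_scom w S a \<and> wf_scom w S b"
| "wf_scom w S (SWhile k P a) \<longleftrightarrow> k < w \<and> wf_scom w S a"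

lemma wf_stacks:
  "wf_scom w S c ==> (\<forall>a\<in>set K. wf_scom w S a) ==> T \<in> stacks c K ==> a \<in> set T ==> wf_scom w S a"
proof (induction c arbitrary: K)
  case (SSeq b d)
  thus ?case using SSeq.IH(1)[of "d # K"] SSeq.IH(2)[of K] by auto
next
  case (SIf k P b d)
  thus ?case using SIf.IH(1)[of K] SIf.IH(2)[of K] by auto
next
  case (SWhile k P b)
  thus ?case using SWhile.IH[of "SWhile k P b # K"] by auto
qed auto

section \<open>From tape programs to Turing machines\<close>

definition stay :: "nat list => (nat \<times> dir) list" where
  "stay ss = map (\<lambda>a. (a, Stay)) ss"

declare tape_act.simps [simp del] tape_read.simps [simp del]

lemma tape_act_Stay [simp]: "tape_act (tape_read tp, Stay) tp = tp"
  by (cases tp) (simp add: tape_act.simps tape_read.simps)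


lemma map2_stay: "map2 tape_act (stay (map tape_read ts)) ts = ts"
  by (rule nth_equalityI) (auto simp: stay_def)

text \<open>The empty stack is the end of the program: there the machine accepts or rejects
  according to the symbol scanned on tape \<open>q\<close>.\<close>

fun delta_of :: "(scom list => nat) => nat => nat set => scom list => nat list => nat \<times> (nat \<times> dir) list" where
  "delta_of enc q F [] ss = (if ss ! q \<in> F then 1 else 2, stay ss)"
| "delta_of enc q F (Act k g # K) ss = (enc K, (stay ss)[k := g (ss ! k)])"
| "delta_of enc q F (SSeq a b # K) ss = (enc (a # b # K), stay ss)"
| "delta_of enc q F (SIf k P a b # K) ss = (enc ((if ss ! k \<in> P then a else b) # K), stay ss)"
| "delta_of enc q F (SWhile k P a # K) ss =
    (enc (if ss ! k \<in> P then a # SWhile k P a # K else K), stay ss)"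

text \<open>The initial stack must get state 0, and 1 and 2 are kept free for the halting
  states.\<close>

lemma ex_state_numbering:
  assumes "finite (T :: 'a set)" "c \<in> T"
  obtains e N where "inj_on e T" "e c = (0::nat)" "\<And>x. x \<in> T ==> e x \<noteq> 1 \<and> e x \<noteq> 2 \<and> e x < N" "3 \<le> N"
proof -
  obtain h :: "'a => nat" where h: "bij_betw h T {0..<card T}"
    using ex_bij_betw_finite_nat[OF assms(1)] by blast
  define e where "e x = (if x = c then 0 else h x + 3)" for x
  have "inj_on e T" using h by (auto simp: e_def inj_on_def bij_betw_def)
  moreover have "e x < card T + 3" if "x \<in> T" for x
    using h that by (auto simp: e_def bij_betw_def)
  moreover have "e x \<noteq> 1 \<and> e x \<noteq> 2" for x by (simp add: e_def)
  ultimately show ?thesis using that[of e "card T + 3"] by (auto simp: e_def)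
qed

lemma map_tape_update:
  "k < w ==> map (v(k := x)) [0..<w] = (map v [0..<w])[k := x]"
  by (rule nth_equalityI) (auto simp: nth_list_update)

theorem scom_to_tm:
  assumes wf: "wf_scom w S c" and "2 \<le> w" "3 \<le> S" "q < w"
  obtains M where "wf_tm M" "tm_tapes M = w"
    "\<And>v n v'. exec c v n v' ==>
       (tm_step M ^^ (n + 1)) (0, map v [0..<w]) =
       (if tape_read (v' q) \<in> F then 1 else 2, map v' [0..<w])"
proof -
  define T where "T = insert [] (stacks c [])"
  have fT: "finite T" by (simp add: T_def finite_stacks)
  have cT: "[c] \<in> T" by (simp add: T_def stacks_self)
  obtain e N where e: "inj_on e T" "e [c] = (0::nat)"
      "\<And>x. x \<in> T ==> e x \<noteq> 1 \<and> e x \<noteq> 2 \<and> e x < N" "3 \<le> N"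
    using ex_state_numbering[OF fT cT] by metis
  \<comment> \<open>Numbers that code no stack are decoded to the empty stack, for which
    \<open>delta_of\<close> still returns a legal action; well-formedness of \<open>M\<close>
    quantifies over all states.\<close>
  define dec where "dec s = (if s \<in> e ` T then inv_into T e s else [])" for s
  have dec_T: "dec s \<in> T" for s
    by (simp add: dec_def inv_into_into) (simp add: T_def)
  have dec_e: "dec (e x) = x" if "x \<in> T" for x
    using e(1) that by (simp add: dec_def inv_into_f_f)
  define M where "M = \<lparr>tm_tapes = w, tm_symbols = S, tm_states = N,
     tm_delta = (\<lambda>s. delta_of e q F (dec s))\<rparr>"
  have stepT: "fst (sstep (x, v)) \<in> T" if "x \<in> T" for x v
    using that stacks_step[of x c "[]" v] by (auto simp: T_def)
  have wfT: "wf_scom w S a" if "x \<in> T" "a \<in> set x" for x a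
    using that wf_stacks[OF wf, of "[]" x a] by (auto simp: T_def)
  have sim: "tm_step M (e x, map v [0..<w]) =
      (e (fst (sstep (x, v))), map (snd (sstep (x, v))) [0..<w])" if x: "x \<in> T" "x \<noteq> []" for x v
  proof -
    have nh: "\<not> halted (e x, map v [0..<w])" using e(3)[OF x(1)] by simp
    obtain a K where aK: "x = a # K" using x(2) by (cases x) auto
    have wfa: "wf_scom w S a" using wfT[OF x(1)] aK by auto
    have rd: "map tape_read (map v [0..<w]) ! k = tape_read (v k)" if "k < w" for k
      using that by simp
    have "tm_step M (e x, map v [0..<w]) =
        (case delta_of e q F x (map tape_read (map v [0..<w])) of
           (q', acts) => (q', map2 tape_act acts (map v [0..<w])))"
      using nh by (simp add: M_def dec_e[OF x(1)])
    also have "\<dots> = (e (fst (sstep (x, v))), map (snd (sstep (x, v))) [0..<w])"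
    proof (cases a)
      case (Act k g)
      hence k: "k < w" using wfa by simp
      have "map2 tape_act ((stay (map tape_read (map v [0..<w])))[k := g (tape_read (v k))]) (map v [0..<w])
          = (map v [0..<w])[k := tape_act (g (tape_read (v k))) (v k)]"
        by (rule nth_equalityI) (use k in \<open>auto simp: stay_def nth_list_update o_def\<close>)
      thus ?thesis using k by (simp add: aK Act rd[OF k] map_tape_update del: map_map)
    next
      case (SSeq a1 a2)
      thus ?thesis by (simp add: aK map2_stay del: map_map)
    next
      case (SIf k P a1 a2)
      hence k: "k < w" using wfa by simp
      thus ?thesis by (simp add: aK SIf map2_stay rd[OF k] del: map_map)
    next
      case (SWhile k P a1)
      hence k: "k < w" using wfa by simp
      thus ?thesis by (simp add: aK SWhile map2_stay rd[OF k] del: map_map)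
    qed
    finally show ?thesis .
  qed
  have run: "(tm_step M ^^ n) (e x, map v [0..<w]) =
      (e (fst ((sstep ^^ n) (x, v))), map (snd ((sstep ^^ n) (x, v))) [0..<w]) \<and>
      fst ((sstep ^^ n) (x, v)) \<in> T"
    if "x \<in> T" "\<And>i. i < n ==> fst ((sstep ^^ i) (x, v)) \<noteq> []" for n x v
    using that
  proof (induction n)
    case (Suc n)
    define y where "y = (sstep ^^ n) (x, v)"
    have y: "fst y \<in> T" "fst y \<noteq> []" using Suc by (auto simp: y_def)
    have "(tm_step M ^^ Suc n) (e x, map v [0..<w]) = tm_step M (e (fst y), map (snd y) [0..<w])"
      using Suc by (simp add: y_def)
    also have "\<dots> = (e (fst (sstep y)), map (snd (sstep y)) [0..<w])"
      using sim[OF y, of "snd y"] by simp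
    finally show ?case using stepT[OF y(1), of "snd y"] by (simp add: y_def)
  qed (simp add: that)
  have stuck: "(sstep ^^ j) ([], v) = ([], v)" for j v by (induction j) simp_all
  have exec_run: "(tm_step M ^^ (n + 1)) (0, map v [0..<w]) =
      (if tape_read (v' q) \<in> F then 1 else 2, map v' [0..<w])" (is "_ = ?res") if ex: "exec c v n v'" for v n v'
  proof -
    have fin: "(sstep ^^ n) ([c], v) = ([], v')" using exec_sstep[OF ex] .
    \<comment> \<open>The machine halts one step after the stack has become empty for the first
      time, which may be before round \<open>n + 1\<close>; from then on neither
      \<open>sstep\<close> nor the machine changes anything.\<close>
    define i where "i = (LEAST i. fst ((sstep ^^ i) ([c], v)) = [])"
    have i: "fst ((sstep ^^ i) ([c], v)) = []" and "i \<le> n"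
      using fin LeastI[of "\<lambda>i. fst ((sstep ^^ i) ([c], v)) = []" n]
        Least_le[of "\<lambda>i. fst ((sstep ^^ i) ([c], v)) = []" n] by (auto simp: i_def)
    have min: "fst ((sstep ^^ j) ([c], v)) \<noteq> []" if "j < i" for j
      using not_less_Least[OF that[unfolded i_def]] .
    obtain t where t: "(sstep ^^ i) ([c], v) = ([], t)" using i by (metis prod.collapse)
    have "(sstep ^^ n) ([c], v) = (sstep ^^ (n - i)) ((sstep ^^ i) ([c], v))"
      using \<open>i \<le> n\<close> funpow_add[of "n - i" i sstep] by simp
    hence t': "t = v'" using fin t stuck by simp
    have "(tm_step M ^^ i) (0, map v [0..<w]) = (e [], map v' [0..<w])"
      using run[OF cT, of i v] min t t' e(2) by simp
    moreover have "tm_step M (e [], map v' [0..<w]) = ?res"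
      using e(3)[of "[]"] \<open>q < w\<close> map2_stay[of "map v' [0..<w]"] dec_e[of "[]"]
      by (simp add: T_def M_def del: map_map)
    ultimately have "(tm_step M ^^ (Suc i)) (0, map v [0..<w]) = ?res" by simp
    moreover have "(tm_step M ^^ j) ?res = ?res" for j by (induction j) auto
    moreover have eq: "n + 1 = (n - i) + Suc i" using \<open>i \<le> n\<close> by simp
    ultimately show ?thesis unfolding eq by (simp only: funpow_add o_apply)
  qed
  have wfd: "fst (delta_of e q F x ss) < N \<and> length (snd (delta_of e q F x ss)) = w \<and>
      (\<forall>(a, d) \<in> set (snd (delta_of e q F x ss)). a < S)"
    if x: "x \<in> T" and ss: "length ss = w" "\<forall>a\<in>set ss. a < S" for x ss
  proof -
    have st: "length (stay ss) = w" "\<forall>(a, d) \<in> set (stay ss). a < S" using ss by (auto simp: stay_def)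
    \<comment> \<open>Tapes that scan exactly \<open>ss\<close>, so that the successor state chosen
      by \<open>delta_of\<close> is recognised as a result of \<open>sstep\<close> and hence as an
      element of \<open>T\<close>.\<close>
    obtain v where v: "\<And>k. k < w ==> tape_read (v k) = ss ! k"
      using that[of "\<lambda>k. (\<lambda>_. ss ! k, 0)"] by (simp add: tape_read.simps)
    have eN: "e (fst (sstep (x, v))) < N" using e(3) stepT[OF x] by blast
    show ?thesis
    proof (cases x)
      case Nil
      thus ?thesis using st e(4) by simp
    next
      case (Cons a K)
      have wfa: "wf_scom w S a" using wfT[OF x] Cons by auto
      show ?thesis
      proof (cases a)
        case (Act k g)
        have "fst (g (ss ! k)) < S" using wfa Act ss by simp
        moreover have "set ((stay ss)[k := g (ss ! k)]) \<subseteq> insert (g (ss ! k)) (set (stay ss))"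
          by (rule set_update_subset_insert)
        ultimately have "\<forall>(a, d) \<in> set ((stay ss)[k := g (ss ! k)]). a < S"
          using st(2) unfolding split_beta by blast
        thus ?thesis using Cons Act st(1) eN by simp
      next
        case (SSeq b d)
        thus ?thesis using st eN unfolding Cons SSeq by simp
      next
        case (SIf k P b d)
        hence "tape_read (v k) = ss ! k" using v wfa by simp
        thus ?thesis using st eN unfolding Cons SIf by simp
      next
        case (SWhile k P b)
        hence "tape_read (v k) = ss ! k" using v wfa by simp
        thus ?thesis using st eN unfolding Cons SWhile by simp
      qed
    qed
  qed
  have "wf_tm M"
    unfolding wf_tm_def split_beta
  proof (intro conjI allI impI)
    fix s ss assume "length ss = tm_tapes M \<and> (\<forall>a\<in>set ss. a < tm_symbols M)"
    hence "length ss = w" "\<forall>a\<in>set ss. a < S" by (simp_all add: M_def)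
    from wfd[OF dec_T this] show "fst (tm_delta M s ss) < tm_states M"
      "length (snd (tm_delta M s ss)) = tm_tapes M"
      "\<forall>p\<in>set (snd (tm_delta M s ss)). fst p < tm_symbols M"
      by (simp_all add: M_def split_beta)
  qed (simp_all add: M_def \<open>2 \<le> w\<close> \<open>3 \<le> S\<close> e(4))
  moreover have "tm_tapes M = w" by (simp add: M_def)
  ultimately show ?thesis using that exec_run by blast
qed

section \<open>A loop language\<close>

text \<open>There is no assignment: variables change only through the binders \<open>Sum\<close> and
  \<open>CFor\<close>, whose ranges are values of expressions. All values are built by sums and
  products from the input length and constants, so every program is polynomial by
  construction.\<close>

datatype exp =
    V nat
  | N nat
  | Len
  | Plus exp exp
  | Times exp exp
  | Less exp exp
  | Bit exp
  | Sum nat exp exp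

fun val :: "bool list => (nat => nat) => exp => nat" where
  "val w s (V v) = s v"
| "val w s (N n) = n"
| "val w s Len = length w"
| "val w s (Plus a b) = val w s a + val w s b"
| "val w s (Times a b) = val w s a * val w s b"
| "val w s (Less a b) = of_bool (val w s a < val w s b)"
| "val w s (Bit a) = of_bool (val w s a < length w \<and> w ! val w s a)"
| "val w s (Sum v a b) = (\<Sum>i<val w s a. val w (s(v := i)) b)"

datatype com =
    CEmit nat
  | CNop
  | CSeq com com
  | CIf exp com com
  | CFor nat exp com

fun out :: "bool list => (nat => nat) => com => nat list" where
  "out w s (CEmit a) = [a]"
| "out w s CNop = []"
| "out w s (CSeq c d) = out w s c @ out w s d"
| "out w s (CIf e c d) = (if val w s e = 0 then out w s d else out w s c)"
| "out w s (CFor v e c) = concat (map (\<lambda>i. out w (s(v := i)) c) [0..<val w s e])"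

section \<open>Registers on tapes\<close>

text \<open>
  A register is a tape whose cell 0 is marked; its value is the position of the head. Register
  \<open>r\<close> is tape \<open>r + 2\<close>; one of the tapes 0, 1 holds the input, the other one receives the output.
\<close>

definition ctape :: "nat => tape" where
  "ctape n = (\<lambda>i. if i = 0 then 1 else 0, int n)"

definition st :: "nat => bool list => (nat => nat) => tape => nat => tapes" where
  "st io w s ot h = (\<lambda>k. if k = io then (fst (input_tape w), int h)
     else if k < 2 then ot else ctape (s (k - 2)))"

definition runs :: "scom => tapes => nat => tapes => bool" where
  "runs c tp t tp' \<longleftrightarrow> (\<exists>n\<le>t. exec c tp n tp')"

lemma runs_mono: "runs c tp t tp' ==> t \<le> t' ==> runs c tp t' tp'"
  by (auto simp: runs_def intro: order_trans)

lemma runs_seq: "runs a tp t tp' ==> runs b tp' t' tp'' ==> runs (SSeq a b) tp (t + t' + 1) tp''"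
  unfolding runs_def by (metis add_le_mono exec.Seq le_refl)

definition inc :: "nat => scom" where "inc r = Act (r + 2) (\<lambda>a. (a, MoveR))"
definition dec :: "nat => scom" where "dec r = Act (r + 2) (\<lambda>a. (a, MoveL))"
definition fwd :: "nat => scom" where "fwd io = Act io (\<lambda>a. (a, MoveR))"
definition bwd :: "nat => scom" where "bwd io = Act io (\<lambda>a. (a, MoveL))"
definition if_zero :: "nat => scom => scom => scom" where "if_zero r = SIf (r + 2) {1}"
definition while_pos :: "nat => scom => scom" where "while_pos r = SWhile (r + 2) (- {1})"
definition skip :: scom where "skip = Act 0 (\<lambda>a. (a, Stay))"

lemma act_move:
  "tape_act (tape_read (f, h), MoveR) (f, h) = (f, h + 1)"
  "tape_act (tape_read (f, h), MoveL) (f, h) = (f, h - 1)"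
  by (simp_all add: tape_act.simps tape_read.simps)

lemma runs_act:
  "tp' = tp(k := tape_act (g (tape_read (tp k))) (tp k)) ==> runs (Act k g) tp 1 tp'"
  unfolding runs_def using exec.Act by fastforce

context
  fixes io :: nat
  assumes io: "io < 2"
begin

lemma runs_inc: "runs (inc r) (st io w s ot h) 1 (st io w (s(r := s r + 1)) ot h)"
  unfolding inc_def using io by (intro runs_act) (auto simp: st_def ctape_def act_move fun_eq_iff)

lemma runs_dec: "0 < s r ==> runs (dec r) (st io w s ot h) 1 (st io w (s(r := s r - 1)) ot h)"
  unfolding dec_def using io by (intro runs_act) (auto simp: st_def ctape_def act_move fun_eq_iff)

lemma runs_fwd: "runs (fwd io) (st io w s ot h) 1 (st io w s ot (h + 1))"
  unfolding fwd_def by (intro runs_act) (auto simp: st_def act_move)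

lemma runs_bwd: "0 < h ==> runs (bwd io) (st io w s ot h) 1 (st io w s ot (h - 1))"
  unfolding bwd_def by (intro runs_act) (auto simp: st_def act_move)

lemma runs_skip: "runs skip tp 1 tp"
  unfolding skip_def by (intro runs_act) auto

lemma st_read: "tape_read (st io w s ot h (r + 2)) = 1 \<longleftrightarrow> s r = 0"
  "tape_read (st io w s ot h (Suc (Suc r))) = 1 \<longleftrightarrow> s r = 0"
  using io by (auto simp: st_def ctape_def tape_read.simps)

lemma st_read_input:
  "tape_read (st io w s ot h io) = (if h < length w then bit_symbol (w ! h) else 0)"
  by (auto simp: st_def tape_read.simps input_tape_def)

lemma runs_if_zero:
  "(s r = 0 ==> runs a (st io w s ot h) t tp) ==> (s r \<noteq> 0 ==> runs b (st io w s ot h) t tp) ==>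
   runs (if_zero r a b) (st io w s ot h) (t + 1) tp"
  using st_read(1)[of w s ot h r] unfolding runs_def if_zero_def
  by (metis IfF IfT add_le_mono1 singleton_iff)

lemma runs_while_gen:
  assumes "\<And>i. i < n ==> tape_read (S i k) \<in> P \<and> runs c (S i) t (S (Suc i))"
    and "tape_read (S n k) \<notin> P"
  shows "runs (SWhile k P c) (S 0) (n * (t + 1) + 1) (S n)"
  using assms
proof (induction n arbitrary: S)
  case 0
  hence "exec (SWhile k P c) (S 0) 1 (S 0)" by (intro exec.WhileF) simp
  thus ?case unfolding runs_def by (intro exI[of _ 1]) simp
next
  case (Suc n)
  obtain m where m: "m \<le> t" "exec c (S 0) m (S 1)" using Suc.prems(1)[of 0] by (auto simp: runs_def)
  obtain m' where m': "m' \<le> n * (t + 1) + 1" "exec (SWhile k P c) (S 1) m' (S (Suc n))"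
    using Suc.IH[of "\<lambda>i. S (Suc i)"] Suc.prems by (auto simp: runs_def)
  have "exec (SWhile k P c) (S 0) (m + m' + 1) (S (Suc n))"
    using Suc.prems(1)[of 0] exec.WhileT[OF _ m(2) m'(2)] by blast
  thus ?case using m(1) m'(1) unfolding runs_def by (intro exI[of _ "m + m' + 1"]) auto
qed

lemma runs_while:
  assumes "\<And>i. i < n ==> runs c (st io w (s i) (ot i) (h i)) t (st io w (s (Suc i)) (ot (Suc i)) (h (Suc i)))"
    and "\<And>i. i < n ==> s i r \<noteq> 0" "s n r = 0"
    and "tp = st io w (s 0) (ot 0) (h 0)" "tp' = st io w (s n) (ot n) (h n)"
  shows "runs (while_pos r c) tp (n * (t + 1) + 1) tp'"
  unfolding while_pos_def assms(4,5)
  by (rule runs_while_gen[of n "\<lambda>i. st io w (s i) (ot i) (h i)"])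
    (use assms(1-3) st_read in auto)


lemma runs_inc':
  "s' = s(r := s r + 1) ==> 1 \<le> t ==> runs (inc r) (st io w s ot h) t (st io w s' ot h)"
  using runs_mono[OF runs_inc] by simp

lemma runs_dec':
  "0 < s r ==> s' = s(r := s r - 1) ==> 1 \<le> t ==>
   runs (dec r) (st io w s ot h) t (st io w s' ot h)"
  using runs_mono[OF runs_dec] by simp

lemma runs_clear:
  "runs (while_pos r (dec r)) (st io w s ot h) (s r * 2 + 1) (st io w (s(r := 0)) ot h)"
proof -
  have "runs (while_pos r (dec r)) (st io w s ot h) (s r * (1 + 1) + 1) (st io w (s(r := 0)) ot h)"
    by (rule runs_while[where s = "\<lambda>i. s(r := s r - i)" and ot = "\<lambda>_. ot" and h = "\<lambda>_. h"])
      (auto intro!: runs_dec' simp: fun_eq_iff)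
  thus ?thesis by (rule runs_mono) simp
qed

lemma runs_move:
  assumes "r \<noteq> q"
  shows "runs (while_pos r (SSeq (dec r) (inc q))) (st io w s ot h) (s r * 4 + 1)
    (st io w (s(r := 0, q := s q + s r)) ot h)"
proof -
  let ?s = "\<lambda>i. s(r := s r - i, q := s q + i)"
  have "runs (SSeq (dec r) (inc q)) (st io w (?s i) ot h) (1 + 1 + 1) (st io w (?s (Suc i)) ot h)"
    if "i < s r" for i
    by (rule runs_seq[OF runs_dec runs_inc']) (use assms that in \<open>auto simp: fun_eq_iff\<close>)
  hence "runs (while_pos r (SSeq (dec r) (inc q))) (st io w s ot h) (s r * ((1 + 1 + 1) + 1) + 1)
    (st io w (s(r := 0, q := s q + s r)) ot h)"
    by (intro runs_while[where s = ?s and ot = "\<lambda>_. ot" and h = "\<lambda>_. h"]) (use assms in auto)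
  thus ?thesis by (rule runs_mono) simp
qed

text \<open>Reading a unary register destroys it. A variable is therefore moved into two registers
  at once, and the second copy is moved back afterwards.\<close>

lemma runs_move2:
  assumes "r \<noteq> q" "r \<noteq> q'" "q \<noteq> q'"
  shows "runs (while_pos r (SSeq (dec r) (SSeq (inc q) (inc q')))) (st io w s ot h) (s r * 6 + 1)
    (st io w (s(r := 0, q := s q + s r, q' := s q' + s r)) ot h)"
proof -
  let ?s = "\<lambda>i. s(r := s r - i, q := s q + i, q' := s q' + i)"
  have "runs (SSeq (dec r) (SSeq (inc q) (inc q'))) (st io w (?s i) ot h) (1 + (1 + 1 + 1) + 1)
      (st io w (?s (Suc i)) ot h)" if "i < s r" for i
    by (rule runs_seq[OF runs_dec runs_seq[OF runs_inc runs_inc']])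
      (use assms that in \<open>auto simp: fun_eq_iff\<close>)
  hence "runs (while_pos r (SSeq (dec r) (SSeq (inc q) (inc q')))) (st io w s ot h)
      (s r * ((1 + (1 + 1 + 1) + 1) + 1) + 1)
      (st io w (s(r := 0, q := s q + s r, q' := s q' + s r)) ot h)"
    by (intro runs_while[where s = ?s and ot = "\<lambda>_. ot" and h = "\<lambda>_. h"]) (use assms in auto)
  thus ?thesis by (rule runs_mono) simp
qed

lemma runs_rewind:
  "runs (while_pos r (SSeq (dec r) (bwd io))) (st io w s ot (s r)) (s r * 4 + 1)
    (st io w (s(r := 0)) ot 0)"
proof -
  let ?s = "\<lambda>i. s(r := s r - i)" and ?h = "\<lambda>i. s r - i"
  have "runs (SSeq (dec r) (bwd io)) (st io w (?s i) ot (?h i)) (1 + 1 + 1)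
      (st io w (?s (Suc i)) ot (?h (Suc i)))" if "i < s r" for i
    using runs_seq[OF runs_dec[of "?s i" r w ot "?h i"] runs_bwd[of "?h i" w]] that by simp
  hence "runs (while_pos r (SSeq (dec r) (bwd io))) (st io w s ot (s r)) (s r * ((1 + 1 + 1) + 1) + 1)
    (st io w (s(r := 0)) ot 0)"
    by (intro runs_while[where s = ?s and ot = "\<lambda>_. ot" and h = ?h]) auto
  thus ?thesis by (rule runs_mono) simp
qed

lemma runs_seek:
  assumes "r \<noteq> q"
  shows "runs (while_pos r (SSeq (dec r) (SSeq (inc q) (fwd io)))) (st io w s ot 0) (s r * 6 + 1)
    (st io w (s(r := 0, q := s q + s r)) ot (s r))"
proof -
  let ?s = "\<lambda>i. s(r := s r - i, q := s q + i)"
  have "runs (SSeq (dec r) (SSeq (inc q) (fwd io))) (st io w (?s i) ot i) (1 + (1 + 1 + 1) + 1)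
      (st io w (?s (Suc i)) ot (Suc i))" if "i < s r" for i
  proof -
    have "runs (SSeq (inc q) (fwd io)) (st io w ((?s i)(r := ?s i r - 1)) ot i) (1 + 1 + 1)
        (st io w (?s (Suc i)) ot (i + 1))"
      by (rule runs_seq[OF runs_inc' runs_fwd]) (use assms that in \<open>auto simp: fun_eq_iff\<close>)
    thus ?thesis using runs_seq[OF runs_dec] assms that by simp
  qed
  hence "runs (while_pos r (SSeq (dec r) (SSeq (inc q) (fwd io)))) (st io w s ot 0)
      (s r * ((1 + (1 + 1 + 1) + 1) + 1) + 1) (st io w (s(r := 0, q := s q + s r)) ot (s r))"
    by (intro runs_while[where s = ?s and ot = "\<lambda>_. ot" and h = "\<lambda>i. i"]) (use assms in auto)
  thus ?thesis by (rule runs_mono) simp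
qed

text \<open>The input has no blanks inside, so its length is found by walking to the first blank;
  the second counter remembers the way back.\<close>

lemma runs_scan:
  assumes "r \<noteq> q"
  shows "runs (SWhile io {1, 2} (SSeq (fwd io) (SSeq (inc r) (inc q)))) (st io w s ot 0) (length w * 6 + 1)
    (st io w (s(r := s r + length w, q := s q + length w)) ot (length w))"
proof -
  let ?s = "\<lambda>i. s(r := s r + i, q := s q + i)"
  have "runs (SSeq (fwd io) (SSeq (inc r) (inc q))) (st io w (?s i) ot i) (1 + (1 + 1 + 1) + 1)
      (st io w (?s (Suc i)) ot (Suc i))" for i
    using runs_seq[OF runs_fwd runs_seq[OF runs_inc runs_inc'], of "?s (Suc i)"] assms by (auto simp: fun_eq_iff)
  hence "runs (SWhile io {1, 2} (SSeq (fwd io) (SSeq (inc r) (inc q)))) (st io w (?s 0) ot 0)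
      (length w * ((1 + (1 + 1 + 1) + 1) + 1) + 1) (st io w (?s (length w)) ot (length w))"
    by (intro runs_while_gen[where S = "\<lambda>i. st io w (?s i) ot i"])
      (auto simp: st_read_input bit_symbol_def)
  hence "runs (SWhile io {1, 2} (SSeq (fwd io) (SSeq (inc r) (inc q)))) (st io w s ot 0)
      (length w * ((1 + (1 + 1 + 1) + 1) + 1) + 1) (st io w (?s (length w)) ot (length w))"
    by (simp only: add_0_right fun_upd_triv)
  thus ?thesis by (rule runs_mono) simp
qed

text \<open>The truncated difference is positive exactly if the value of \<open>r\<close> is less
  than that of \<open>q\<close>, which is how \<open>Less\<close> is decided.\<close>

lemma runs_monus:
  assumes "r \<noteq> q"
  shows "runs (while_pos r (SSeq (dec r) (if_zero q skip (dec q)))) (st io w s ot h) (s r * 5 + 1)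
    (st io w (s(r := 0, q := s q - s r)) ot h)"
proof -
  let ?s = "\<lambda>i. s(r := s r - i, q := s q - i)"
  have "runs (SSeq (dec r) (if_zero q skip (dec q))) (st io w (?s i) ot h) (1 + (1 + 1) + 1)
      (st io w (?s (Suc i)) ot h)" if "i < s r" for i
  proof (rule runs_seq[OF runs_dec runs_if_zero])
    show "runs skip (st io w ((?s i)(r := ?s i r - 1)) ot h) 1 (st io w (?s (Suc i)) ot h)"
      if "((?s i)(r := ?s i r - 1)) q = 0"
    proof -
      have "(?s i)(r := ?s i r - 1) = ?s (Suc i)" using that assms by auto
      thus ?thesis using runs_skip by simp
    qed
  qed (use assms that in \<open>auto intro!: runs_dec' simp: fun_eq_iff\<close>)
  hence "runs (while_pos r (SSeq (dec r) (if_zero q skip (dec q)))) (st io w s ot h)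
      (s r * ((1 + (1 + 1) + 1) + 1) + 1) (st io w (s(r := 0, q := s q - s r)) ot h)"
    by (intro runs_while[where s = ?s and ot = "\<lambda>_. ot" and h = "\<lambda>_. h"]) (use assms in auto)
  thus ?thesis by (rule runs_mono) simp
qed

end

section \<open>Polynomial bounds\<close>

text \<open>Requiring a pure power only from 2 on lets the exponent absorb all coefficients and
  constants. Monotonicity is what makes the class closed under composition.\<close>

definition PB :: "(nat => nat) => bool" where
  "PB p \<longleftrightarrow> mono p \<and> (\<exists>k. \<forall>B\<ge>2. p B \<le> B ^ k)"

lemma le_self_power: "2 \<le> B ==> n \<le> B ^ n" for B n :: nat
proof (induction n)
  case (Suc n)
  assume "2 \<le> B"
  have "1 \<le> B ^ n" using \<open>2 \<le> B\<close> by simp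
  hence "Suc n \<le> 2 * B ^ n" using Suc by linarith
  also have "\<dots> \<le> B ^ Suc n" using \<open>2 \<le> B\<close> by simp
  finally show ?case .
qed simp

lemma PB_const [intro]: "PB (\<lambda>_. n)"
  unfolding PB_def by (auto simp: mono_def intro!: exI[of _ n] le_self_power)

lemma PB_id [intro]: "PB (\<lambda>B. B)"
  unfolding PB_def by (auto simp: mono_def intro!: exI[of _ 1])

lemma PB_mult [intro]: assumes "PB p" "PB q" shows "PB (\<lambda>B. p B * q B)"
proof -
  obtain k l where "\<forall>B\<ge>2. p B \<le> B ^ k" "\<forall>B\<ge>2. q B \<le> B ^ l" "mono p" "mono q"
    using assms by (auto simp: PB_def)
  hence "\<forall>B\<ge>2. p B * q B \<le> B ^ (k + l)" "mono (\<lambda>B. p B * q B)"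
    by (auto simp: power_add mult_le_mono mono_def)
  thus ?thesis unfolding PB_def by blast
qed

lemma PB_add [intro]: assumes "PB p" "PB q" shows "PB (\<lambda>B. p B + q B)"
proof -
  obtain k l where *: "\<forall>B\<ge>2. p B \<le> B ^ k" "\<forall>B\<ge>2. q B \<le> B ^ l" "mono p" "mono q"
    using assms by (auto simp: PB_def)
  have "p B + q B \<le> B ^ (k + l + 1)" if "2 \<le> B" for B
  proof -
    have "B ^ k \<le> B ^ (k + l)" "B ^ l \<le> B ^ (k + l)" using that by (auto intro!: power_increasing)
    moreover have "p B \<le> B ^ k" "q B \<le> B ^ l" using *(1,2) that by auto
    ultimately have "p B + q B \<le> 2 * B ^ (k + l)" by linarith
    also have "\<dots> \<le> B ^ (k + l + 1)" using that by simp
    finally show ?thesis .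
  qed
  moreover have "mono (\<lambda>B. p B + q B)" using * by (auto simp: mono_def add_mono)
  ultimately show ?thesis unfolding PB_def by blast
qed

lemma PB_comp: assumes "PB p" "PB q" shows "PB (\<lambda>B. p (q B))"
proof -
  obtain k where k: "\<forall>B\<ge>2. p B \<le> B ^ k" "mono p" using assms by (auto simp: PB_def)
  have "PB (\<lambda>B. q B + 2)" using assms(2) by (intro PB_add PB_const)
  then obtain l where l: "\<forall>B\<ge>2. q B + 2 \<le> B ^ l" by (auto simp: PB_def)
  have "p (q B) \<le> B ^ (l * k)" if "2 \<le> B" for B
  proof -
    have "p (q B) \<le> p (q B + 2)" using k(2) by (auto simp: mono_def)
    also have "\<dots> \<le> (q B + 2) ^ k" using k(1) by auto
    also have "\<dots> \<le> (B ^ l) ^ k" using l that by (auto intro: power_mono)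
    finally show ?thesis by (simp add: power_mult)
  qed
  moreover have "mono (\<lambda>B. p (q B))" using assms by (auto simp: PB_def mono_def)
  ultimately show ?thesis unfolding PB_def by blast
qed

lemma PB_mono: "PB p ==> a \<le> b ==> p a \<le> p b"
  by (auto simp: PB_def mono_def)

section \<open>Compilation of the loop language\<close>

text \<open>Register \<open>r\<close> accumulates the sum, \<open>r + 1\<close> counts the remaining
  rounds, \<open>r + 2\<close> is the loop index, and \<open>r + 3\<close> receives the value of the
  body. A product is the special case of a body that ignores the index.\<close>

definition sum_code :: "nat => scom => scom => scom" where
  "sum_code r a b = SSeq a (SSeq
     (while_pos (r + 1) (SSeq b (SSeq (while_pos (r + 3) (SSeq (dec (r + 3)) (inc r)))
        (SSeq (dec (r + 1)) (inc (r + 2))))))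
     (while_pos (r + 2) (dec (r + 2))))"

text \<open>
  The code for \<open>e\<close> leaves the value of \<open>e\<close> in register \<open>r\<close>; the registers above \<open>r\<close> are
  scratch and hold 0 before and after. The variable \<open>v\<close> lives in register \<open>ren v\<close>.
\<close>

fun cexp :: "nat => (nat => nat) => nat => exp => scom" where
  "cexp io ren r (V v) = SSeq
     (while_pos (ren v) (SSeq (dec (ren v)) (SSeq (inc r) (inc (r + 1)))))
     (while_pos (r + 1) (SSeq (dec (r + 1)) (inc (ren v))))"
| "cexp io ren r (N n) = ((\<lambda>c. SSeq c (inc r)) ^^ n) skip"
| "cexp io ren r Len = SSeq
     (SWhile io {1, 2} (SSeq (fwd io) (SSeq (inc r) (inc (r + 1)))))
     (while_pos (r + 1) (SSeq (dec (r + 1)) (bwd io)))"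
| "cexp io ren r (Plus a b) = SSeq (cexp io ren r a) (SSeq (cexp io ren (r + 1) b)
     (while_pos (r + 1) (SSeq (dec (r + 1)) (inc r))))"
| "cexp io ren r (Times a b) = sum_code r (cexp io ren (r + 1) a) (cexp io ren (r + 3) b)"
| "cexp io ren r (Less a b) = SSeq (cexp io ren r a) (SSeq (cexp io ren (r + 1) b) (SSeq
     (while_pos r (SSeq (dec r) (if_zero (r + 1) skip (dec (r + 1)))))
     (if_zero (r + 1) skip (SSeq (inc r) (while_pos (r + 1) (dec (r + 1)))))))"
| "cexp io ren r (Bit a) = SSeq (cexp io ren r a) (SSeq
     (while_pos r (SSeq (dec r) (SSeq (inc (r + 1)) (fwd io)))) (SSeq
     (SIf io {2} (inc r) skip)
     (while_pos (r + 1) (SSeq (dec (r + 1)) (bwd io)))))"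
| "cexp io ren r (Sum v a b) = sum_code r (cexp io ren (r + 1) a) (cexp io (ren(v := r + 2)) (r + 3) b)"

text \<open>Value and time share one bound because registers are unary: the time of later code
  depends on the values produced by earlier code. The polynomial may depend on the expression only,
  hence the quantification over all renamings and scratch areas.\<close>

definition computes :: "exp => (nat => nat) => bool" where
  "computes e p \<longleftrightarrow> (\<forall>io w s ot r ren B. io < 2 --> length w \<le> B --> (\<forall>v. s (ren v) \<le> B) -->
     (\<forall>v. ren v < r) --> (\<forall>i\<ge>r. s i = 0) -->
     val w (s \<circ> ren) e \<le> p B \<and>
     runs (cexp io ren r e) (st io w s ot 0) (p B) (st io w (s(r := val w (s \<circ> ren) e)) ot 0))"

lemma computesD:
  assumes "computes e p" "io < 2" "length w \<le> B" "\<And>v. s (ren v) \<le> B" "\<And>v. ren v < r"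
    "\<And>i. r \<le> i ==> s i = 0"
  shows "val w (s \<circ> ren) e \<le> p B"
    "runs (cexp io ren r e) (st io w s ot 0) (p B) (st io w (s(r := val w (s \<circ> ren) e)) ot 0)"
  using assms unfolding computes_def by blast+

lemma upd_comp_ren:
  assumes "\<And>v. ren v < r" "r \<le> (i :: nat)"
  shows "(s(i := x)) \<circ> ren = s \<circ> ren"
proof
  fix v
  have "ren v \<noteq> i" using assms(1)[of v] assms(2) by linarith
  thus "((s(i := x)) \<circ> ren) v = (s \<circ> ren) v" by simp
qed

text \<open>\<open>ren'\<close> covers both uses of the code: it equals \<open>ren\<close> for
  products, and sends the bound variable to the index register \<open>r + 2\<close> for sums. The
  index may exceed \<open>B\<close> but stays below \<open>pa B\<close>, so the body is measured at
  \<open>B + pa B\<close>.\<close>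

lemma sum_code_runs:
  assumes io: "io < 2" and a: "computes a pa" and b: "computes b pb" and PB: "PB pb"
    and B: "length w \<le> B" "\<And>v. s (ren v) \<le> B" and ren: "\<And>v. ren v < r" and z: "\<And>i. r \<le> i ==> s i = 0"
    and ren': "\<And>v. ren' v = ren v \<or> ren' v = r + 2"
    and n: "n = val w (s \<circ> ren) a" and f: "\<And>i. f i = val w (s(r + 2 := i) \<circ> ren') b"
  shows "(\<Sum>i<n. f i) \<le> pa B * pb (B + pa B)"
    "runs (sum_code r (cexp io ren (r + 1) a) (cexp io ren' (r + 3) b)) (st io w s ot 0)
       (pa B + (pa B * (5 * pb (B + pa B) + 10) + pa B * 2 + 10)) (st io w (s(r := (\<Sum>i<n. f i))) ot 0)"
proof -
  have n_le: "n \<le> pa B" and ra: "runs (cexp io ren (r + 1) a) (st io w s ot 0) (pa B) (st io w (s(r + 1 := n)) ot 0)"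
    using computesD[OF a io B(1), of s ren "r + 1"] ren z B(2) unfolding n by (auto simp: less_SucI)
  define si where "si i = s(r := (\<Sum>j<i. f j), r + 1 := n - i, r + 2 := i)" for i
  let ?B = "B + pa B"
  have body: "f i \<le> pb ?B \<and> runs (SSeq (cexp io ren' (r + 3) b) (SSeq (while_pos (r + 3) (SSeq (dec (r + 3)) (inc r)))
      (SSeq (dec (r + 1)) (inc (r + 2))))) (st io w (si i) ot 0) (5 * pb ?B + 6) (st io w (si (Suc i)) ot 0)"
    if i: "i < n" for i
  proof -
    have comp: "si i \<circ> ren' = s(r + 2 := i) \<circ> ren'"
    proof
      fix v show "(si i \<circ> ren') v = (s(r + 2 := i) \<circ> ren') v"
        using ren'[of v] ren[of v] by (auto simp: si_def)
    qed
    have ren'_less: "ren' v < r + 3" for v using ren'[of v] ren[of v] by auto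
    have bound: "si i (ren' v) \<le> ?B" for v
      using ren'[of v] ren[of v] B(2)[of v] i n_le by (auto simp: si_def trans_le_add1)
    have zero: "si i j = 0" if "r + 3 \<le> j" for j using that z by (auto simp: si_def)
    have fi: "f i \<le> pb ?B"
      and rb: "runs (cexp io ren' (r + 3) b) (st io w (si i) ot 0) (pb ?B) (st io w ((si i)(r + 3 := f i)) ot 0)"
      using computesD[OF b io, of w ?B "si i" ren' "r + 3", OF _ bound ren'_less zero] B(1) unfolding f comp by auto
    define s1 where "s1 = (si i)(r + 3 := f i)"
    have m1: "runs (while_pos (r + 3) (SSeq (dec (r + 3)) (inc r))) (st io w s1 ot 0) (f i * 4 + 1)
        (st io w ((si i)(r := (\<Sum>j<Suc i. f j))) ot 0)"
    proof -
      have "s1(r + 3 := 0, r := s1 r + s1 (r + 3)) = (si i)(r := (\<Sum>j<Suc i. f j))"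
        using z by (auto simp: s1_def si_def fun_eq_iff)
      thus ?thesis using runs_move[OF io, of "r + 3" r w s1 ot 0] by (simp add: s1_def)
    qed
    have m2: "runs (SSeq (dec (r + 1)) (inc (r + 2))) (st io w ((si i)(r := (\<Sum>j<Suc i. f j))) ot 0) (1 + 1 + 1)
        (st io w (si (Suc i)) ot 0)"
      by (rule runs_seq[OF runs_dec runs_inc'])
        (use io i in \<open>auto simp: si_def fun_eq_iff\<close>)
    have "runs (SSeq (cexp io ren' (r + 3) b) (SSeq (while_pos (r + 3) (SSeq (dec (r + 3)) (inc r)))
      (SSeq (dec (r + 1)) (inc (r + 2))))) (st io w (si i) ot 0)
      (pb ?B + (f i * 4 + 1 + (1 + 1 + 1) + 1) + 1) (st io w (si (Suc i)) ot 0)"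
      by (rule runs_seq[OF rb[folded s1_def] runs_seq[OF m1 m2]])
    thus ?thesis using fi by (auto elim!: runs_mono)
  qed
  have "(\<Sum>i<n. f i) \<le> (\<Sum>i<n. pb ?B)" using body by (intro sum_mono) auto
  also have "\<dots> \<le> pa B * pb ?B" using n_le by simp
  finally show "(\<Sum>i<n. f i) \<le> pa B * pb ?B" .
  have loop: "runs (while_pos (r + 1) (SSeq (cexp io ren' (r + 3) b) (SSeq (while_pos (r + 3) (SSeq (dec (r + 3)) (inc r)))
      (SSeq (dec (r + 1)) (inc (r + 2)))))) (st io w (s(r + 1 := n)) ot 0) (n * (5 * pb ?B + 6 + 1) + 1)
      (st io w (si n) ot 0)"
  proof (rule runs_while[OF io, where s = si and ot = "\<lambda>_. ot" and h = "\<lambda>_. 0"])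
    show "st io w (s(r + 1 := n)) ot 0 = st io w (si 0) ot 0"
      using z by (intro arg_cong[of _ _ "\<lambda>s. st io w s ot 0"]) (auto simp: si_def fun_eq_iff)
  qed (use body in \<open>auto simp: si_def\<close>)
  have "s(r := (\<Sum>i<n. f i)) = (si n)(r + 2 := 0)"
    using z by (auto simp: si_def fun_eq_iff)
  moreover have "si n (r + 2) = n" by (simp add: si_def)
  ultimately have clear: "runs (while_pos (r + 2) (dec (r + 2))) (st io w (si n) ot 0) (n * 2 + 1) (st io w (s(r := (\<Sum>i<n. f i))) ot 0)"
    using runs_clear[OF io, of "r + 2" w "si n" ot 0] by simp
  have "runs (sum_code r (cexp io ren (r + 1) a) (cexp io ren' (r + 3) b)) (st io w s ot 0)
      (pa B + (n * (5 * pb ?B + 6 + 1) + 1 + (n * 2 + 1) + 1) + 1) (st io w (s(r := (\<Sum>i<n. f i))) ot 0)"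
    unfolding sum_code_def by (rule runs_seq[OF ra runs_seq[OF loop clear]])
  moreover have "n * (5 * pb ?B + 6 + 1) \<le> pa B * (5 * pb ?B + 10)" using n_le by (intro mult_le_mono) auto
  ultimately show "runs (sum_code r (cexp io ren (r + 1) a) (cexp io ren' (r + 3) b)) (st io w s ot 0)
       (pa B + (pa B * (5 * pb (B + pa B) + 10) + pa B * 2 + 10)) (st io w (s(r := (\<Sum>i<n. f i))) ot 0)"
    using n_le by (elim runs_mono) linarith
qed

lemma runs_const: "io < 2 ==> runs (((\<lambda>c. SSeq c (inc r)) ^^ n) skip) (st io w s ot 0) (n * 2 + 1) (st io w (s(r := s r + n)) ot 0)"
proof (induction n)
  case 0
  thus ?case using runs_skip by simp
next
  case (Suc n)
  have "runs (((\<lambda>c. SSeq c (inc r)) ^^ Suc n) skip) (st io w s ot 0) (n * 2 + 1 + 1 + 1) (st io w (s(r := s r + Suc n)) ot 0)"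
    unfolding funpow.simps o_apply
    by (rule runs_seq[OF Suc.IH[OF Suc.prems] runs_inc'[OF Suc.prems]]) (rule ext, simp_all)
  thus ?case by (rule runs_mono) simp
qed

lemma cexp_correct: "\<exists>p. PB p \<and> computes e p"
proof (induction e)
  case (V v)
  have "computes (V v) (\<lambda>B. 10 * B + 5)"
    unfolding computes_def
  proof (intro allI impI conjI)
    fix io w ot r B and s ren :: "nat => nat"
    assume as: "io < (2::nat)" "\<forall>v. s (ren v) \<le> B" "\<forall>v. ren v < r" "\<forall>i\<ge>r. s i = 0"
    let ?x = "ren v"
    have ne: "?x \<noteq> r" "?x \<noteq> Suc r" using as(3)[rule_format, of v] by auto
    define s1 where "s1 = s(?x := 0, r := s r + s ?x, r + 1 := s (r + 1) + s ?x)"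
    have "s(r := s ?x) = s1(r + 1 := 0, ?x := s1 ?x + s1 (r + 1))"
      using ne as(4) by (auto simp: s1_def fun_eq_iff)
    moreover have "s1 (r + 1) = s ?x" using as(4) ne by (simp add: s1_def)
    ultimately have 2: "runs (while_pos (r + 1) (SSeq (dec (r + 1)) (inc ?x))) (st io w s1 ot 0) (s ?x * 4 + 1) (st io w (s(r := s ?x)) ot 0)"
      using runs_move[OF as(1), of "r + 1" ?x w s1 ot 0] ne by simp
    have 1: "runs (while_pos ?x (SSeq (dec ?x) (SSeq (inc r) (inc (r + 1))))) (st io w s ot 0) (s ?x * 6 + 1) (st io w s1 ot 0)"
      using runs_move2[OF as(1), of ?x r "r + 1" w s ot 0] ne by (simp add: s1_def)
    have "runs (cexp io ren r (V v)) (st io w s ot 0) (s ?x * 6 + 1 + (s ?x * 4 + 1) + 1) (st io w (s(r := s ?x)) ot 0)"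
      unfolding cexp.simps by (rule runs_seq[OF 1 2])
    thus "runs (cexp io ren r (V v)) (st io w s ot 0) (10 * B + 5) (st io w (s(r := val w (s \<circ> ren) (V v))) ot 0)"
      using as(2)[rule_format, of v] by (auto elim!: runs_mono)
    show "val w (s \<circ> ren) (V v) \<le> 10 * B + 5"
      using as(2)[rule_format, of v] by simp
  qed
  thus ?case by (intro exI[of _ "\<lambda>B. 10 * B + 5"] conjI PB_add PB_mult PB_const PB_id)
next
  case (N n)
  have "computes (N n) (\<lambda>B. n * 2 + 1)"
    unfolding computes_def
  proof (intro allI impI conjI)
    fix io w ot r B and s ren :: "nat => nat"
    assume as: "io < (2::nat)" "\<forall>i\<ge>r. s i = 0"
    show "runs (cexp io ren r (N n)) (st io w s ot 0) (n * 2 + 1) (st io w (s(r := val w (s \<circ> ren) (N n))) ot 0)"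
      using runs_const[OF as(1), of n r w s ot] as(2) by simp
  qed simp
  thus ?case by (intro exI[of _ "\<lambda>B. n * 2 + 1"] conjI PB_const)
next
  case Len
  have "computes Len (\<lambda>B. 10 * B + 5)"
    unfolding computes_def
  proof (intro allI impI conjI)
    fix io ot r B and w :: "bool list" and s ren :: "nat => nat"
    assume as: "io < (2::nat)" "length w \<le> B" "\<forall>i\<ge>r. s i = (0::nat)"
    define s1 where "s1 = s(r := s r + length w, r + 1 := s (r + 1) + length w)"
    have l: "s1 (r + 1) = length w" using as(3) by (simp add: s1_def)
    have "s(r := length w) = s1(r + 1 := 0)" using as(3) by (auto simp: s1_def fun_eq_iff)
    hence 2: "runs (while_pos (r + 1) (SSeq (dec (r + 1)) (bwd io))) (st io w s1 ot (length w)) (length w * 4 + 1) (st io w (s(r := length w)) ot 0)"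
      using runs_rewind[OF as(1), of "r + 1" w s1 ot] by (simp add: l[simplified])
    have "runs (cexp io ren r Len) (st io w s ot 0) (length w * 6 + 1 + (length w * 4 + 1) + 1) (st io w (s(r := length w)) ot 0)"
      unfolding cexp.simps
      by (rule runs_seq[OF runs_scan[OF as(1)] 2[unfolded s1_def]]) simp
    thus "runs (cexp io ren r Len) (st io w s ot 0) (10 * B + 5) (st io w (s(r := val w (s \<circ> ren) Len)) ot 0)"
      using as(2) by (auto elim!: runs_mono)
    show "val w (s \<circ> ren) Len \<le> 10 * B + 5" using as(2) by simp
  qed
  thus ?case by (intro exI[of _ "\<lambda>B. 10 * B + 5"] conjI PB_add PB_mult PB_const PB_id)
next
  case (Plus a b)
  obtain pa pb where p: "PB pa" "computes a pa" "PB pb" "computes b pb" using Plus by blast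
  have "computes (Plus a b) (\<lambda>B. pa B + 5 * pb B + 3)"
    unfolding computes_def
  proof (intro allI impI conjI)
    fix io ot r B and w :: "bool list" and s ren :: "nat => nat"
    assume as: "io < (2::nat)" "length w \<le> B" "\<forall>v. s (ren v) \<le> B" "\<forall>v. ren v < r" "\<forall>i\<ge>r. s i = 0"
    let ?a = "val w (s \<circ> ren) a" and ?b = "val w (s \<circ> ren) b"
    have ne: "ren v \<noteq> r" "ren v < r + 1" for v using as(4)[rule_format, of v] by auto
    note A = computesD[OF p(2) as(1,2), of s ren r]
    let ?s = "s(r := ?a)"
    have comp: "?s \<circ> ren = s \<circ> ren" using as(4) by (intro upd_comp_ren[of ren r]) auto
    note Bb = computesD[OF p(4) as(1,2), of ?s ren "r + 1", unfolded comp]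
    let ?s2 = "?s(r + 1 := ?b)"
    have e: "?s2(r + 1 := 0, r := ?s2 r + ?s2 (r + 1)) = s(r := ?a + ?b)"
      using as(5) by (auto simp: fun_eq_iff)
    have 3: "runs (while_pos (r + 1) (SSeq (dec (r + 1)) (inc r))) (st io w ?s2 ot 0) (?b * 4 + 1) (st io w (s(r := ?a + ?b)) ot 0)"
      using runs_move[OF as(1), of "r + 1" r w ?s2 ot 0] unfolding e by simp
    have "runs (cexp io ren r (Plus a b)) (st io w s ot 0) (pa B + (pb B + (?b * 4 + 1) + 1) + 1) (st io w (s(r := ?a + ?b)) ot 0)"
      unfolding cexp.simps
      by (rule runs_seq[OF A(2) runs_seq[OF Bb(2) 3]]) (use as ne in auto)
    moreover have "?a \<le> pa B" "?b \<le> pb B" using A(1) Bb(1) as ne by auto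
    ultimately show "runs (cexp io ren r (Plus a b)) (st io w s ot 0) (pa B + 5 * pb B + 3)
        (st io w (s(r := val w (s \<circ> ren) (Plus a b))) ot 0)"
      "val w (s \<circ> ren) (Plus a b) \<le> pa B + 5 * pb B + 3" by (auto elim!: runs_mono)
  qed
  thus ?case
    using p by (intro exI[of _ "\<lambda>B. pa B + 5 * pb B + 3"] conjI PB_add PB_mult PB_const)
next
  case (Less a b)
  obtain pa pb where p: "PB pa" "computes a pa" "PB pb" "computes b pb" using Less by blast
  have "computes (Less a b) (\<lambda>B. 10 * pa B + 10 * pb B + 10)"
    unfolding computes_def
  proof (intro allI impI conjI)
    fix io ot r B and w :: "bool list" and s ren :: "nat => nat"
    assume as: "io < (2::nat)" "length w \<le> B" "\<forall>v. s (ren v) \<le> B" "\<forall>v. ren v < r" "\<forall>i\<ge>r. s i = 0"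
    let ?a = "val w (s \<circ> ren) a" and ?b = "val w (s \<circ> ren) b"
    have ne: "ren v \<noteq> r" "ren v < r + 1" for v using as(4)[rule_format, of v] by auto
    note A = computesD[OF p(2) as(1,2), of s ren r]
    let ?s = "s(r := ?a)"
    have comp: "?s \<circ> ren = s \<circ> ren" using as(4) by (intro upd_comp_ren[of ren r]) auto
    note Bb = computesD[OF p(4) as(1,2), of ?s ren "r + 1", unfolded comp]
    let ?s2 = "?s(r + 1 := ?b)"
    define s3 where "s3 = s(r + 1 := ?b - ?a)"
    have e: "?s2(r := 0, r + 1 := ?s2 (r + 1) - ?s2 r) = s3"
      using as(5) by (auto simp: fun_eq_iff s3_def)
    have 3: "runs (while_pos r (SSeq (dec r) (if_zero (r + 1) skip (dec (r + 1))))) (st io w ?s2 ot 0) (?a * 5 + 1) (st io w s3 ot 0)"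
      using runs_monus[OF as(1), of r "r + 1" w ?s2 ot 0] unfolding e by simp
    let ?r = "s(r := of_bool (?a < ?b))"
    have 4: "runs (if_zero (r + 1) skip (SSeq (inc r) (while_pos (r + 1) (dec (r + 1))))) (st io w s3 ot 0) (?b * 2 + 3 + 1) (st io w ?r ot 0)"
    proof (rule runs_if_zero[OF as(1)])
      assume "s3 (r + 1) = 0"
      hence "s3 = ?r" using as(5) by (auto simp: s3_def fun_eq_iff)
      thus "runs skip (st io w s3 ot 0) (?b * 2 + 3) (st io w ?r ot 0)"
        by (simp only:) (rule runs_mono[OF runs_skip[OF as(1)]], simp)
    next
      assume "s3 (r + 1) \<noteq> 0"
      hence e2: "(s3(r := s3 r + 1))(r + 1 := 0) = ?r" using as(5) by (auto simp: s3_def fun_eq_iff)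
      have r2: "runs (SSeq (inc r) (while_pos (r + 1) (dec (r + 1)))) (st io w s3 ot 0) (1 + ((s3(r := s3 r + 1)) (r + 1) * 2 + 1) + 1)
          (st io w ((s3(r := s3 r + 1))(r + 1 := 0)) ot 0)"
        by (rule runs_seq[OF runs_inc[OF as(1)] runs_clear[OF as(1)]])
      show "runs (SSeq (inc r) (while_pos (r + 1) (dec (r + 1)))) (st io w s3 ot 0) (?b * 2 + 3) (st io w ?r ot 0)"
        using r2 unfolding e2 by (rule runs_mono) (simp add: s3_def)
    qed
    have "runs (cexp io ren r (Less a b)) (st io w s ot 0) (pa B + (pb B + ((?a * 5 + 1) + (?b * 2 + 3 + 1) + 1) + 1) + 1) (st io w ?r ot 0)"
      unfolding cexp.simps
      by (rule runs_seq[OF A(2) runs_seq[OF Bb(2) runs_seq[OF 3 4]]]) (use as ne in auto)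
    moreover have "?a \<le> pa B" "?b \<le> pb B" using A(1) Bb(1) as ne by auto
    ultimately show "runs (cexp io ren r (Less a b)) (st io w s ot 0) (10 * pa B + 10 * pb B + 10)
        (st io w (s(r := val w (s \<circ> ren) (Less a b))) ot 0)"
      "val w (s \<circ> ren) (Less a b) \<le> 10 * pa B + 10 * pb B + 10" by (auto elim!: runs_mono)
  qed
  thus ?case
    using p by (intro exI[of _ "\<lambda>B. 10 * pa B + 10 * pb B + 10"] conjI PB_add PB_mult PB_const)
next
  case (Bit a)
  obtain pa where p: "PB pa" "computes a pa" using Bit by blast
  have "computes (Bit a) (\<lambda>B. 11 * pa B + 10)"
    unfolding computes_def
  proof (intro allI impI conjI)
    fix io ot r B and w :: "bool list" and s ren :: "nat => nat"
    assume as: "io < (2::nat)" "length w \<le> B" "\<forall>v. s (ren v) \<le> B" "\<forall>v. ren v < r" "\<forall>i\<ge>r. s i = 0"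
    let ?a = "val w (s \<circ> ren) a"
    note A = computesD[OF p(2) as(1,2), of s ren r]
    let ?s = "s(r := ?a)"
    let ?s1 = "s(r + 1 := ?a)"
    have e: "?s(r := 0, r + 1 := ?s (r + 1) + ?s r) = ?s1"
      using as(5) by (auto simp: fun_eq_iff)
    have 2: "runs (while_pos r (SSeq (dec r) (SSeq (inc (r + 1)) (fwd io)))) (st io w ?s ot 0) (?a * 6 + 1) (st io w ?s1 ot ?a)"
      using runs_seek[OF as(1), of r "r + 1" w ?s ot] unfolding e by simp
    let ?v = "of_bool (?a < length w \<and> w ! ?a)"
    define s2 where "s2 = s(r := ?v, r + 1 := ?a)"
    have 3: "runs (SIf io {2} (inc r) skip) (st io w ?s1 ot ?a) (1 + 1) (st io w s2 ot ?a)"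
    proof (cases "?a < length w \<and> w ! ?a")
      case True
      hence "tape_read (st io w ?s1 ot ?a io) \<in> {2}" by (simp add: st_read_input[OF as(1)] bit_symbol_def)
      moreover have "runs (inc r) (st io w ?s1 ot ?a) 1 (st io w s2 ot ?a)"
        using True as(5) by (intro runs_inc'[OF as(1)]) (auto simp: s2_def fun_eq_iff)
      ultimately show ?thesis unfolding runs_def by (metis IfT add_le_mono1)
    next
      case False
      hence "tape_read (st io w ?s1 ot ?a io) \<notin> {2}" by (auto simp add: st_read_input[OF as(1)] bit_symbol_def)
      moreover have "?s1 = s2" using False as(5) by (auto simp: s2_def fun_eq_iff)
      hence "runs skip (st io w ?s1 ot ?a) 1 (st io w s2 ot ?a)" using runs_skip[OF as(1)] by simp
      ultimately show ?thesis unfolding runs_def by (metis IfF add_le_mono1)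
    qed
    have "s2(r + 1 := 0) = s(r := ?v)" using as(5) by (auto simp: s2_def fun_eq_iff)
    hence 4: "runs (while_pos (r + 1) (SSeq (dec (r + 1)) (bwd io))) (st io w s2 ot ?a) (?a * 4 + 1) (st io w (s(r := ?v)) ot 0)"
      using runs_rewind[OF as(1), of "r + 1" w s2 ot] by (simp add: s2_def)
    have "runs (cexp io ren r (Bit a)) (st io w s ot 0) (pa B + ((?a * 6 + 1) + ((1 + 1) + (?a * 4 + 1) + 1) + 1) + 1) (st io w (s(r := ?v)) ot 0)"
      unfolding cexp.simps
      by (rule runs_seq[OF A(2) runs_seq[OF 2 runs_seq[OF 3 4]]]) (use as in auto)
    moreover have "?a \<le> pa B" using A(1) as by auto
    ultimately show "runs (cexp io ren r (Bit a)) (st io w s ot 0) (11 * pa B + 10)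
        (st io w (s(r := val w (s \<circ> ren) (Bit a))) ot 0)"
      "val w (s \<circ> ren) (Bit a) \<le> 11 * pa B + 10" by (auto elim!: runs_mono)
  qed
  thus ?case
    using p by (intro exI[of _ "\<lambda>B. 11 * pa B + 10"] conjI PB_add PB_mult PB_const)
next
  case (Times a b)
  obtain pa pb where p: "PB pa" "computes a pa" "PB pb" "computes b pb" using Times by blast
  let ?p = "\<lambda>B. pa B + (pa B * (5 * pb (B + pa B) + 10) + pa B * 2 + 10)"
  have "computes (Times a b) ?p"
    unfolding computes_def
  proof (intro allI impI)
    fix io ot r B and w :: "bool list" and s ren :: "nat => nat"
    assume as: "io < (2::nat)" "length w \<le> B" "\<forall>v. s (ren v) \<le> B" "\<forall>v. ren v < r" "\<forall>i\<ge>r. s i = 0"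
    have f: "val w (s \<circ> ren) b = val w (s(r + 2 := i) \<circ> ren) b" for i
      using upd_comp_ren[of ren r "r + 2" s i] as(4) by simp
    have "(\<Sum>i<val w (s \<circ> ren) a. val w (s \<circ> ren) b) \<le> pa B * pb (B + pa B)"
       "runs (sum_code r (cexp io ren (r + 1) a) (cexp io ren (r + 3) b)) (st io w s ot 0)
       (?p B) (st io w (s(r := (\<Sum>i<val w (s \<circ> ren) a. val w (s \<circ> ren) b))) ot 0)"
      by (rule sum_code_runs[OF as(1) p(2) p(4,3) as(2) _ _ _ _ refl f]; use as in auto)+
    thus "val w (s \<circ> ren) (Times a b) \<le> ?p B \<and>
        runs (cexp io ren r (Times a b)) (st io w s ot 0) (?p B) (st io w (s(r := val w (s \<circ> ren) (Times a b))) ot 0)"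
      by (auto simp: algebra_simps)
  qed
  moreover have "PB ?p" using p by (intro PB_add PB_mult PB_const PB_comp[of pb "\<lambda>B. B + pa B"] PB_id)
  ultimately show ?case by blast
next
  case (Sum v a b)
  obtain pa pb where p: "PB pa" "computes a pa" "PB pb" "computes b pb" using Sum by blast
  let ?p = "\<lambda>B. pa B + (pa B * (5 * pb (B + pa B) + 10) + pa B * 2 + 10)"
  have "computes (Sum v a b) ?p"
    unfolding computes_def
  proof (intro allI impI)
    fix io ot r B and w :: "bool list" and s ren :: "nat => nat"
    assume as: "io < (2::nat)" "length w \<le> B" "\<forall>v. s (ren v) \<le> B" "\<forall>v. ren v < r" "\<forall>i\<ge>r. s i = 0"
    have "(s \<circ> ren)(v := i) = s(r + 2 := i) \<circ> (ren(v := r + 2))" for i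
    proof
      fix u
      have "ren u \<noteq> r + 2" using as(4)[rule_format, of u] by linarith
      thus "((s \<circ> ren)(v := i)) u = (s(r + 2 := i) \<circ> (ren(v := r + 2))) u" by simp
    qed
    hence f: "val w ((s \<circ> ren)(v := i)) b = val w (s(r + 2 := i) \<circ> (ren(v := r + 2))) b" for i
      by simp
    have "(\<Sum>i<val w (s \<circ> ren) a. val w ((s \<circ> ren)(v := i)) b) \<le> pa B * pb (B + pa B)"
       "runs (sum_code r (cexp io ren (r + 1) a) (cexp io (ren(v := r + 2)) (r + 3) b)) (st io w s ot 0)
       (?p B) (st io w (s(r := (\<Sum>i<val w (s \<circ> ren) a. val w ((s \<circ> ren)(v := i)) b))) ot 0)"
      by (rule sum_code_runs[OF as(1) p(2) p(4,3) as(2) _ _ _ _ refl f]; use as in auto)+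
    thus "val w (s \<circ> ren) (Sum v a b) \<le> ?p B \<and>
        runs (cexp io ren r (Sum v a b)) (st io w s ot 0) (?p B) (st io w (s(r := val w (s \<circ> ren) (Sum v a b))) ot 0)"
      by (auto simp: algebra_simps)
  qed
  moreover have "PB ?p" using p by (intro PB_add PB_mult PB_const PB_comp[of pb "\<lambda>B. B + pa B"] PB_id)
  ultimately show ?case by blast
qed

fun ccom :: "(nat => scom) => nat => (nat => nat) => nat => com => scom" where
  "ccom E io ren r (CEmit a) = E a"
| "ccom E io ren r CNop = skip"
| "ccom E io ren r (CSeq c d) = SSeq (ccom E io ren r c) (ccom E io ren r d)"
| "ccom E io ren r (CIf e c d) = SSeq (cexp io ren r e)
     (if_zero r (ccom E io ren r d) (SSeq (while_pos r (dec r)) (ccom E io ren r c)))"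
| "ccom E io ren r (CFor v e c) = SSeq (cexp io ren r e) (SSeq
     (while_pos r (SSeq (ccom E io (ren(v := r + 1)) (r + 2) c) (SSeq (dec r) (inc (r + 1)))))
     (while_pos (r + 1) (dec (r + 1))))"

text \<open>Emission is a parameter: \<open>E a\<close> is any code that changes the tape other than
  the input tape as \<open>em a\<close> does, within three steps. The same compiler then yields
  machines that write their output and machines that compare it with a given string.\<close>

definition emits :: "com => (nat => nat) => bool" where
  "emits c p \<longleftrightarrow> (\<forall>E em io w s ot r ren B. io < 2 -->
     (\<forall>a s ot. runs (E a) (st io w s ot 0) 3 (st io w s (em a ot) 0)) -->
     length w \<le> B --> (\<forall>v. s (ren v) \<le> B) --> (\<forall>v. ren v < r) --> (\<forall>i\<ge>r. s i = 0) -->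
     runs (ccom E io ren r c) (st io w s ot 0) (p B) (st io w s (fold em (out w (s \<circ> ren) c) ot) 0))"

lemma emitsD:
  assumes "emits c p" "io < 2" "\<And>a s ot. runs (E a) (st io w s ot 0) 3 (st io w s (em a ot) 0)"
    "length w \<le> B" "\<And>v. s (ren v) \<le> B" "\<And>v. ren v < r" "\<And>i. r \<le> i ==> s i = 0"
  shows "runs (ccom E io ren r c) (st io w s ot 0) (p B) (st io w s (fold em (out w (s \<circ> ren) c) ot) 0)"
  using assms unfolding emits_def by blast

lemma emitsI:
  assumes "\<And>E em io w s ot r ren B. io < 2 ==>
     (\<And>a s ot. runs (E a) (st io w s ot 0) 3 (st io w s (em a ot) 0)) ==>
     length w \<le> B ==> (\<And>v. s (ren v) \<le> B) ==> (\<And>v. ren v < r) ==> (\<And>i. i \<ge> r ==> s i = 0) ==>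
     runs (ccom E io ren r c) (st io w s ot 0) (p B) (st io w s (fold em (out w (s \<circ> ren) c) ot) 0)"
  shows "emits c p"
  using assms unfolding emits_def by blast

lemma ccom_correct: "\<exists>p. PB p \<and> emits c p"
proof (induction c)
  case (CEmit a)
  have "emits (CEmit a) (\<lambda>_. 3)" by (rule emitsI) simp
  thus ?case by (intro exI[of _ "\<lambda>_. 3"] conjI PB_const)
next
  case CNop
  have "emits CNop (\<lambda>_. 1)" by (rule emitsI) (simp add: runs_skip[simplified])
  thus ?case by (intro exI[of _ "\<lambda>_. 1"] conjI PB_const)
next
  case (CSeq c d)
  obtain pc pd where p: "PB pc" "emits c pc" "PB pd" "emits d pd" using CSeq by blast
  have "emits (CSeq c d) (\<lambda>B. pc B + pd B + 1)"
  proof (rule emitsI)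
    fix E :: "nat => scom" and em io w ot r B and s ren :: "nat => nat"
    assume as: "io < 2" "\<And>a s ot. runs (E a) (st io w s ot 0) 3 (st io w s (em a ot) 0)"
     "length w \<le> B" "\<And>v. s (ren v) \<le> B" "\<And>v. ren v < r" "\<And>i. i \<ge> r ==> s i = 0"
    note sub = emitsD[where E = E and em = em and w = w and B = B and s = s and ren = ren and r = r, OF _ as]
    show "runs (ccom E io ren r (CSeq c d)) (st io w s ot 0) (pc B + pd B + 1)
        (st io w s (fold em (out w (s \<circ> ren) (CSeq c d)) ot) 0)"
      using runs_seq[OF sub[OF p(2)] sub[OF p(4)]] by simp
  qed
  thus ?case using p by (intro exI[of _ "\<lambda>B. pc B + pd B + 1"] conjI PB_add PB_const)
next
  case (CIf e c d)
  obtain pe pc pd where p: "PB pc" "emits c pc" "PB pd" "emits d pd" "PB pe" "computes e pe"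
    using CIf cexp_correct[of e] by blast
  let ?p = "\<lambda>B. pe B + (pe B * 2 + 1 + pc B + 1 + pd B + 1) + 1"
  have "emits (CIf e c d) ?p"
  proof (rule emitsI)
    fix E :: "nat => scom" and em io w ot r B and s ren :: "nat => nat"
    assume as: "io < 2" "\<And>a s ot. runs (E a) (st io w s ot 0) 3 (st io w s (em a ot) 0)"
     "length w \<le> B" "\<And>v. s (ren v) \<le> B" "\<And>v. ren v < r" "\<And>i. i \<ge> r ==> s i = 0"
    note sub = emitsD[where E = E and em = em and w = w and B = B and s = s and ren = ren and r = r, OF _ as]
    let ?e = "val w (s \<circ> ren) e"
    note e = computesD[OF p(6) as(1,3), of s ren r, OF as(4-6)]
    let ?o = "st io w s (fold em (out w (s \<circ> ren) (CIf e c d)) ot) 0"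
    have "runs (if_zero r (ccom E io ren r d) (SSeq (while_pos r (dec r)) (ccom E io ren r c)))
        (st io w (s(r := ?e)) ot 0) (pe B * 2 + 1 + pc B + 1 + pd B + 1) ?o"
    proof (rule runs_if_zero[OF as(1)])
      assume "(s(r := ?e)) r = 0"
      hence e0: "?e = 0" by simp
      hence u: "s(r := ?e) = s" using as(6) by auto
      have o: "?o = st io w s (fold em (out w (s \<circ> ren) d) ot) 0" using e0 by simp
      show "runs (ccom E io ren r d) (st io w (s(r := ?e)) ot 0) (pe B * 2 + 1 + pc B + 1 + pd B) ?o"
        unfolding o u by (rule runs_mono[OF sub[OF p(4)]]) (assumption, rule le_add2)
    next
      assume "(s(r := ?e)) r \<noteq> 0"
      hence e0: "?e \<noteq> 0" by simp
      have u: "(s(r := ?e))(r := 0) = s" using as(6) by auto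
      have "runs (while_pos r (dec r)) (st io w (s(r := ?e)) ot 0) (?e * 2 + 1) (st io w s ot 0)"
        using runs_clear[OF as(1), of r w "s(r := ?e)" ot 0] unfolding u by simp
      hence "runs (SSeq (while_pos r (dec r)) (ccom E io ren r c)) (st io w (s(r := ?e)) ot 0)
          (?e * 2 + 1 + pc B + 1) (st io w s (fold em (out w (s \<circ> ren) c) ot) 0)"
        by (rule runs_seq) (rule sub[OF p(2)])
      thus "runs (SSeq (while_pos r (dec r)) (ccom E io ren r c)) (st io w (s(r := ?e)) ot 0)
          (pe B * 2 + 1 + pc B + 1 + pd B) ?o"
        using e0 e(1) by (auto elim!: runs_mono)
    qed
    note main = this
    show "runs (ccom E io ren r (CIf e c d)) (st io w s ot 0) (?p B) ?o"
      unfolding ccom.simps by (rule runs_seq[OF e(2) main])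
  qed
  thus ?case
    using p by (intro exI[of _ ?p] conjI PB_add PB_mult PB_const)
next
  case (CFor v e c)
  obtain pe pc where p: "PB pc" "emits c pc" "PB pe" "computes e pe"
    using CFor cexp_correct[of e] by blast
  let ?p = "\<lambda>B. pe B + (pe B * (pc (B + pe B) + 5) + 1 + (pe B * 2 + 1) + 1) + 1"
  have "emits (CFor v e c) ?p"
  proof (rule emitsI)
    fix E :: "nat => scom" and em io w ot r B and s ren :: "nat => nat"
    assume as: "io < 2" "\<And>a s ot. runs (E a) (st io w s ot 0) 3 (st io w s (em a ot) 0)"
     "length w \<le> B" "\<And>v. s (ren v) \<le> B" "\<And>v. ren v < r" "\<And>i. i \<ge> r ==> s i = 0"
    define n where "n = val w (s \<circ> ren) e"
    note e = computesD[OF p(4) as(1,3), of s ren r, OF as(4-6), folded n_def]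
    define si where "si i = s(r := n - i, r + 1 := i)" for i
    define outs where "outs i = concat (map (\<lambda>i. out w ((s \<circ> ren)(v := i)) c) [0..<i])" for i
    let ?B = "B + pe B"
    have body: "runs (SSeq (ccom E io (ren(v := r + 1)) (r + 2) c) (SSeq (dec r) (inc (r + 1))))
        (st io w (si i) (fold em (outs i) ot) 0) (pc ?B + (1 + 1 + 1) + 1) (st io w (si (Suc i)) (fold em (outs (Suc i)) ot) 0)"
      if i: "i < n" for i
    proof (rule runs_seq[OF emitsD[where E = E and em = em, OF p(2) as(1,2)]])
      have c: "si i \<circ> (ren(v := r + 1)) = (s \<circ> ren)(v := i)"
      proof
        fix u
        have "ren u \<noteq> r" "ren u \<noteq> r + 1" using as(5)[of u] by auto
        thus "(si i \<circ> (ren(v := r + 1))) u = ((s \<circ> ren)(v := i)) u" by (simp add: si_def)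
      qed
      have "fold em (out w (si i \<circ> (ren(v := r + 1))) c) (fold em (outs i) ot) = fold em (outs (Suc i)) ot"
        unfolding c by (simp add: outs_def)
      thus "runs (SSeq (dec r) (inc (r + 1))) (st io w (si i) (fold em (out w (si i \<circ> (ren(v := r + 1))) c)
           (fold em (outs i) ot)) 0) (1 + 1 + 1) (st io w (si (Suc i)) (fold em (outs (Suc i)) ot) 0)"
        by (simp only:) (rule runs_seq[OF runs_dec[OF as(1)] runs_inc'[OF as(1)]],
            use i in \<open>auto simp: si_def fun_eq_iff\<close>)
      show "length w \<le> ?B" using as(3) by simp
      show "si i ((ren(v := r + 1)) u) \<le> ?B" for u
      proof -
        have "ren u \<noteq> r" "ren u \<noteq> r + 1" using as(5)[of u] by auto
        thus ?thesis using as(4)[of u] i e(1) by (simp add: si_def)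
      qed
      show "(ren(v := r + 1)) u < r + 2" for u using as(5)[of u] by simp
      show "si i j = 0" if "r + 2 \<le> j" for j using as(6)[of j] that by (simp add: si_def)
    qed
    have loop: "runs (while_pos r (SSeq (ccom E io (ren(v := r + 1)) (r + 2) c) (SSeq (dec r) (inc (r + 1)))))
        (st io w (s(r := n)) ot 0) (n * (pc ?B + (1 + 1 + 1) + 1 + 1) + 1) (st io w (si n) (fold em (outs n) ot) 0)"
    proof (rule runs_while[OF as(1), where s = si and ot = "\<lambda>i. fold em (outs i) ot" and h = "\<lambda>_. 0"])
      have "s(r := n) = si 0" using as(6)[of "r + 1"] by (auto simp: si_def)
      thus "st io w (s(r := n)) ot 0 = st io w (si 0) (fold em (outs 0) ot) 0" by (simp add: outs_def)
    qed (use body in \<open>auto simp: si_def\<close>)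
    have u: "(si n)(r + 1 := 0) = s" using as(6) by (auto simp: si_def)
    have u': "si n (r + 1) = n" by (simp add: si_def)
    have clear: "runs (while_pos (r + 1) (dec (r + 1))) (st io w (si n) (fold em (outs n) ot) 0) (n * 2 + 1) (st io w s (fold em (outs n) ot) 0)"
      using runs_clear[OF as(1), of "r + 1" w "si n" "fold em (outs n) ot" 0] unfolding u u' .
    have r1: "runs (ccom E io ren r (CFor v e c)) (st io w s ot 0)
        (pe B + (n * (pc ?B + (1 + 1 + 1) + 1 + 1) + 1 + (n * 2 + 1) + 1) + 1) (st io w s (fold em (outs n) ot) 0)"
      unfolding ccom.simps by (rule runs_seq[OF e(2) runs_seq[OF loop clear]])
    have oeq: "fold em (outs n) ot = fold em (out w (s \<circ> ren) (CFor v e c)) ot"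
      by (simp add: outs_def n_def)
    have npe: "n \<le> pe B" by (rule e(1))
    hence le: "n * (pc ?B + (1 + 1 + 1) + 1 + 1) \<le> pe B * (pc ?B + 5)"
      by (intro mult_le_mono) auto
    show "runs (ccom E io ren r (CFor v e c)) (st io w s ot 0) (?p B)
        (st io w s (fold em (out w (s \<circ> ren) (CFor v e c)) ot) 0)"
      by (rule runs_mono[OF r1[unfolded oeq]]) (use npe le in linarith)
  qed
  thus ?case
    using p by (intro exI[of _ ?p] conjI PB_add PB_mult PB_const PB_comp[of pc "\<lambda>B. B + pe B"] PB_id)
qed

subsection \<open>The tapes a compiled program uses\<close>

lemma wf_basic:
  "wf_scom W S (inc r) \<longleftrightarrow> r + 2 < W" "wf_scom W S (dec r) \<longleftrightarrow> r + 2 < W"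
  "wf_scom W S (fwd io) \<longleftrightarrow> io < W" "wf_scom W S (bwd io) \<longleftrightarrow> io < W"
  "wf_scom W S skip \<longleftrightarrow> 0 < W"
  "wf_scom W S (if_zero r a b) \<longleftrightarrow> r + 2 < W \<and> wf_scom W S a \<and> wf_scom W S b"
  "wf_scom W S (while_pos r a) \<longleftrightarrow> r + 2 < W \<and> wf_scom W S a"
  "wf_scom W S (sum_code r a b) \<longleftrightarrow> r + 5 < W \<and> wf_scom W S a \<and> wf_scom W S b"
  by (auto simp: inc_def dec_def fwd_def bwd_def skip_def if_zero_def while_pos_def sum_code_def)

text \<open>The number of tapes has to be fixed for the whole machine; \<open>k\<close> registers
  above \<open>r\<close> suffice wherever the scratch area and the variables are placed.\<close>

definition exp_fits :: "exp => nat => bool" where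
  "exp_fits e k \<longleftrightarrow> (\<forall>io<2. \<forall>ren r W S. (\<forall>v. ren v < r) --> r + k \<le> W --> wf_scom W S (cexp io ren r e))"

lemma wf_cexp: "\<exists>k. exp_fits e k"
proof (induction e)
  case (V v)
  show ?case
    by (rule exI[of _ 10]) (auto simp: exp_fits_def wf_basic dest!: spec[of _ v])
next
  case (N n)
  have "0 < W ==> r + 2 < W ==> wf_scom W S (((\<lambda>c. SSeq c (inc r)) ^^ n) skip)" for r W S
    by (induction n) (auto simp: wf_basic)
  thus ?case by (intro exI[of _ 10]) (auto simp: exp_fits_def)
next
  case Len
  show ?case by (rule exI[of _ 10]) (auto simp: exp_fits_def wf_basic)
next
  case (Plus a b)
  then obtain k l where "exp_fits a k" "exp_fits b l" by blast
  thus ?case by (intro exI[of _ "k + l + 10"]) (auto simp: exp_fits_def wf_basic less_SucI)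
next
  case (Times a b)
  then obtain k l where "exp_fits a k" "exp_fits b l" by blast
  thus ?case by (intro exI[of _ "k + l + 10"]) (auto simp: exp_fits_def wf_basic less_SucI trans_less_add1)
next
  case (Less a b)
  then obtain k l where "exp_fits a k" "exp_fits b l" by blast
  thus ?case by (intro exI[of _ "k + l + 10"]) (auto simp: exp_fits_def wf_basic less_SucI)
next
  case (Bit a)
  then obtain k where "exp_fits a k" by blast
  thus ?case by (intro exI[of _ "k + 10"]) (auto simp: exp_fits_def wf_basic)
next
  case (Sum v a b)
  then obtain k l where "exp_fits a k" "exp_fits b l" by blast
  thus ?case by (intro exI[of _ "k + l + 10"]) (auto simp: exp_fits_def wf_basic less_SucI trans_less_add1)
qed

fun syms :: "com => nat set" where
  "syms (CEmit a) = {a}"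
| "syms CNop = {}"
| "syms (CSeq c d) = syms c \<union> syms d"
| "syms (CIf e c d) = syms c \<union> syms d"
| "syms (CFor v e c) = syms c"

lemma set_out: "set (out w s c) \<subseteq> syms c"
  by (induction c arbitrary: s) auto

definition com_fits :: "com => nat => bool" where
  "com_fits c k \<longleftrightarrow> (\<forall>E io ren r W S. io < 2 --> (\<forall>a\<in>syms c. wf_scom W S (E a)) --> (\<forall>v. ren v < r) --> r + k \<le> W -->
     wf_scom W S (ccom E io ren r c))"

lemma wf_ccom: "\<exists>k. com_fits c k"
proof (induction c)
  case (CSeq c d)
  then obtain k l where "com_fits c k" "com_fits d l" by blast
  thus ?case by (intro exI[of _ "k + l"]) (auto simp: com_fits_def)
next
  case (CIf e c d)
  then obtain k l where "com_fits c k" "com_fits d l" by blast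
  moreover obtain m where "exp_fits e m" using wf_cexp by blast
  ultimately show ?case by (intro exI[of _ "k + l + m + 10"]) (auto simp: com_fits_def exp_fits_def wf_basic)
next
  case (CFor v e c)
  then obtain k where "com_fits c k" by blast
  moreover obtain m where "exp_fits e m" using wf_cexp by blast
  ultimately show ?case by (intro exI[of _ "k + m + 10"]) (auto simp: com_fits_def exp_fits_def wf_basic less_SucI)
next
  case CNop
  show ?case by (intro exI[of _ 1]) (auto simp: com_fits_def exp_fits_def wf_basic)
qed (auto simp: com_fits_def intro!: exI[of _ 0])

section \<open>Machines for loop programs\<close>

lemma runs_SIf:
  "(tape_read (tp k) \<in> P ==> runs a tp t tp') ==> (tape_read (tp k) \<notin> P ==> runs b tp t tp') ==>
   runs (SIf k P a b) tp (t + 1) tp'"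
  unfolding runs_def by (metis IfF IfT add_le_mono1)

text \<open>Register tapes start blank, whereas \<open>ctape\<close> needs a mark in cell 0 to be
  able to test for zero.\<close>

definition init_code :: "nat => scom" where
  "init_code W = fold (\<lambda>k c. SSeq c (Act k (\<lambda>_. (1, Stay)))) [2..<W] skip"

lemma runs_init:
  assumes "n \<ge> 2" "\<And>k. tp' k = (if 2 \<le> k \<and> k < n then tape_act (1, Stay) (tp k) else tp k)"
  shows "runs (init_code n) tp (2 * n) tp'"
  using assms
proof (induction n arbitrary: tp' rule: dec_induct)
  case base
  have "tp' k = tp k" for k using base[of k] by (cases "2 \<le> k \<and> k < 2") auto
  hence "tp' = tp" by blast
  thus ?case using runs_mono[OF runs_skip[of 0]] by (simp add: init_code_def)
next
  case (step n)
  let ?tp = "\<lambda>k. if 2 \<le> k \<and> k < n then tape_act (1, Stay) (tp k) else tp k"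
  have "runs (init_code n) tp (2 * n) ?tp" using step.IH by auto
  moreover have "runs (Act n (\<lambda>_. (1, Stay))) ?tp 1 tp'"
    using step by (intro runs_act) (auto simp: fun_eq_iff)
  ultimately have "runs (SSeq (init_code n) (Act n (\<lambda>_. (1, Stay)))) tp (2 * n + 1 + 1) tp'" by (rule runs_seq)
  thus ?case using step.hyps by (simp add: init_code_def upt_rec[of 2])
qed

text \<open>The power bound is available from 2 on only, so it is used at \<open>n + 2\<close>,
  which is at most \<open>3 * n\<close> for positive \<open>n\<close>.\<close>

lemma PB_poly: "PB p ==> \<exists>c d. \<forall>n. p n \<le> c * n ^ d + c"
proof -
  assume "PB p"
  then obtain k where k: "mono p" "\<And>B. 2 \<le> B ==> p B \<le> B ^ k" by (auto simp: PB_def)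
  have "p n \<le> 3 ^ k * n ^ k + 3 ^ k" for n
  proof -
    have "p n \<le> p (n + 2)" using k(1) by (auto simp: mono_def)
    also have "\<dots> \<le> (n + 2) ^ k" using k(2)[of "n + 2"] by simp
    also have "\<dots> \<le> 3 ^ k * n ^ k + 3 ^ k"
    proof (cases "n = 0")
      case True
      have "(2::nat) ^ k \<le> 3 ^ k" by (rule power_mono) auto
      thus ?thesis using True by (simp add: numeral_2_eq_2)
    next
      case False
      hence "(n + 2) ^ k \<le> (3 * n) ^ k" by (intro power_mono) auto
      thus ?thesis by (simp add: power_mult_distrib)
    qed
    finally show ?thesis .
  qed
  thus ?thesis by blast
qed

text \<open>Tape \<open>io\<close> holds the string that the program reads, and
  \<open>1 - io\<close> is the tape on which emission acts. The final symbol scanned there decides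
  acceptance; this matters for verifiers, while for functions only the content of the tape is
  used.\<close>

lemma com_to_tm:
  assumes "io < 2" and E: "\<And>w a s ot. runs (E a) (st io w s ot 0) 3 (st io w s (em a ot) 0)"
    and wfE: "\<And>a W. a \<in> syms c ==> 2 \<le> W ==> wf_scom W 4 (E a)"
  obtains M p where "wf_tm M" "3 \<le> tm_tapes M" "PB p"
    "\<And>w ot. \<exists>n\<le>p (length w). \<exists>ts'. (tm_step M ^^ n)
        (0, (if io = 0 then [input_tape w, ot] else [ot, input_tape w]) @ replicate (tm_tapes M - 2) (input_tape [])) =
        (if tape_read (fold em (out w (\<lambda>_. 0) c) ot) = 0 then 1 else 2, ts') \<and>
        ts' ! (1 - io) = fold em (out w (\<lambda>_. 0) c) ot"
proof -
  obtain k where k: "com_fits c k" using wf_ccom by blast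
  define W where "W = k + 10"
  obtain p where p: "PB p" "emits c p" using ccom_correct by blast
  define prog where "prog = SSeq (init_code W) (ccom E io (\<lambda>_. 0) 1 c)"
  have "wf_scom W 4 (fold (\<lambda>k c. SSeq c (Act k (\<lambda>_. (1, Stay)))) xs s)"
    if "wf_scom W 4 s" "\<forall>x\<in>set xs. x < W" for xs s
    using that by (induction xs arbitrary: s) auto
  hence "wf_scom W 4 (init_code W)" by (auto simp: init_code_def wf_basic W_def)
  moreover have "wf_scom W 4 (ccom E io (\<lambda>_. 0) 1 c)"
    using k assms(1) wfE by (auto simp: com_fits_def W_def)
  ultimately have wf: "wf_scom W 4 prog" by (simp add: prog_def)
  have W: "2 \<le> W" "3 \<le> (4::nat)" "1 - io < W" by (auto simp: W_def)
  obtain M where M: "wf_tm M" "tm_tapes M = W"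
    "\<And>tp n tp'. exec prog tp n tp' ==> (tm_step M ^^ (n + 1)) (0, map tp [0..<W]) =
       (if tape_read (tp' (1 - io)) \<in> {0} then 1 else 2, map tp' [0..<W])"
    using scom_to_tm[OF wf W, of "{0}"] by blast
  have main: "\<exists>n\<le>2 * W + p (length w) + 2. \<exists>ts'. (tm_step M ^^ n) (0, ts @ replicate (tm_tapes M - 2) (input_tape [])) =
        (if tape_read (fold em (out w (\<lambda>_. 0) c) ot) = 0 then 1 else 2, ts') \<and>
        ts' ! (1 - io) = fold em (out w (\<lambda>_. 0) c) ot"
    if ts: "ts = (if io = 0 then [input_tape w, ot] else [ot, input_tape w])" for w ts ot
  proof -
    let ?o = "fold em (out w (\<lambda>_. 0) c) ot"
    define tp where "tp j = (if j < 2 then ts ! j else if j < W then input_tape [] else ctape 0)" for j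
    have "W \<ge> 2" by (simp add: W_def)
    have s1: "runs (init_code W) tp (2 * W) (st io w (\<lambda>_. 0) ot 0)"
      using assms(1) by (intro runs_init \<open>W \<ge> 2\<close>)
        (auto simp: st_def tp_def ts tape_act.simps ctape_def input_tape_def less_Suc_eq numeral_2_eq_2 nth_Cons')
    have s2: "runs (ccom E io (\<lambda>_. 0) 1 c) (st io w (\<lambda>_. 0) ot 0) (p (length w)) (st io w (\<lambda>_. 0) ?o 0)"
      using emitsD[where E = E and em = em and s = "\<lambda>_. 0" and ren = "\<lambda>_. 0" and r = 1 and ot = ot,
          OF p(2) assms(1) E order_refl] by (simp add: o_def)
    obtain n where n: "n \<le> 2 * W + p (length w) + 1" "exec prog tp n (st io w (\<lambda>_. 0) ?o 0)"
      using runs_seq[OF s1 s2] unfolding prog_def[symmetric] runs_def by blast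
    have "1 - io \<noteq> io" using assms(1) by (cases "io = 0") auto
    hence o: "st io w (\<lambda>_. 0) ?o 0 (1 - io) = ?o"
      using assms(1) by (cases "io = 0") (simp_all add: st_def)
    have "map tp [0..<W] = ts @ replicate (W - 2) (input_tape [])"
      by (rule nth_equalityI) (auto simp: tp_def ts nth_append W_def)
    thus ?thesis
      using M(3)[OF n(2)] n(1) o assms(1)
      by (intro exI[of _ "n + 1"]) (auto simp: M(2) W_def)
  qed
  show ?thesis
  proof (rule that[of M "\<lambda>n. 2 * W + p n + 2"])
    show "PB (\<lambda>n. 2 * W + p n + 2)" using p by (intro PB_add PB_const)
  qed (use M main W_def in auto)
qed

subsection \<open>Computing functions\<close>

definition write_out :: "nat => tape => tape" where
  "write_out a = tape_act (a, MoveR)"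

lemma fold_write_out:
  "fold write_out xs (f, int n) = (\<lambda>i. if int n \<le> i \<and> i < int (n + length xs) then xs ! nat (i - int n) else f i, int (n + length xs))"
proof (induction xs arbitrary: f n)
  case (Cons a xs)
  have "write_out a (f, int n) = (f(int n := a), int (Suc n))"
    by (simp add: write_out_def tape_act.simps)
  hence "fold write_out (a # xs) (f, int n) = fold write_out xs (f(int n := a), int (Suc n))"
    by (simp del: of_nat_Suc)
  also have "\<dots> = (\<lambda>i. if int (Suc n) \<le> i \<and> i < int (Suc n + length xs) then xs ! nat (i - int (Suc n))
      else (f(int n := a)) i, int (Suc n + length xs))"
    by (rule Cons.IH)
  also have "\<dots> = (\<lambda>i. if int n \<le> i \<and> i < int (n + length (a # xs)) then (a # xs) ! nat (i - int n)
      else f i, int (n + length (a # xs)))"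
  proof -
    have "nat (i - int n) = Suc (nat (i - int (Suc n)))" if "int (Suc n) \<le> i" for i using that by simp
    thus ?thesis by (auto simp: fun_eq_iff)
  qed
  finally show ?case .
qed auto

theorem polytime_com:
  assumes "syms c \<subseteq> {1, 2}"
  shows "polytime_computable (\<lambda>x. map (\<lambda>a. a = 2) (out x (\<lambda>_. 0) c))"
proof -
  let ?E = "\<lambda>a. Act 1 (\<lambda>_. (a, MoveR))"
  have E: "runs (?E a) (st 0 w s ot 0) 3 (st 0 w s (write_out a ot) 0)" for w a s ot
    by (rule runs_mono[OF runs_act]) (auto simp: st_def fun_eq_iff write_out_def)
  have wfE: "wf_scom W 4 (?E a)" if "a \<in> syms c" "2 \<le> W" for a W using assms that by auto
  obtain M p where M: "wf_tm M" "3 \<le> tm_tapes M" "PB p"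
    "\<And>w ot. \<exists>n\<le>p (length w). \<exists>ts'. (tm_step M ^^ n)
        (0, (if 0 = (0::nat) then [input_tape w, ot] else [ot, input_tape w]) @ replicate (tm_tapes M - 2) (input_tape [])) =
        (if tape_read (fold write_out (out w (\<lambda>_. 0) c) ot) = 0 then 1 else 2, ts') \<and>
        ts' ! (1 - 0) = fold write_out (out w (\<lambda>_. 0) c) ot"
    by (rule com_to_tm[of 0 ?E write_out c]) (simp, rule E, erule wfE, assumption, rule that)
  obtain C d where Cd: "\<And>n. p n \<le> C * n ^ d + C" using PB_poly[OF M(3)] by blast
  have "\<exists>n \<le> C * length x ^ d + C. halted (tm_run M [x] n) \<and>
      tape_holds (snd (tm_run M [x] n) ! 1) (map (\<lambda>a. a = 2) (out x (\<lambda>_. 0) c))" for x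
  proof -
    let ?o = "out x (\<lambda>_. 0) c"
    have init: "tm_init M [x] = (0, [input_tape x, input_tape []] @ replicate (tm_tapes M - 2) (input_tape []))"
      using M(2) by (auto simp: tm_init_def intro!: nth_equalityI simp: nth_Cons')
    obtain n ts' where n: "n \<le> p (length x)" "tm_run M [x] n = (if tape_read (fold write_out ?o (input_tape [])) = 0 then 1 else 2, ts')"
        "ts' ! 1 = fold write_out ?o (input_tape [])"
      using M(4)[of x "input_tape []"] unfolding tm_run_def init by auto
    have "set ?o \<subseteq> {1, 2}" using set_out assms by blast
    hence "?o ! i = 1 \<or> ?o ! i = 2" if "i < length ?o" for i using that nth_mem by blast
    moreover have it: "input_tape [] = (\<lambda>_. 0, int 0)" by (auto simp: input_tape_def)
    ultimately have "tape_holds (fold write_out ?o (input_tape [])) (map (\<lambda>a. a = 2) ?o)"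
      unfolding it fold_write_out by (auto simp: tape_holds_def bit_symbol_def)
    thus ?thesis using n Cd[of "length x"] by (intro exI[of _ n]) auto
  qed
  thus ?thesis unfolding polytime_computable_def using M(1) by blast
qed

lemma tm_run_Suc: "tm_run M xs (Suc t) = tm_step M (tm_run M xs t)"
  by (simp add: tm_run_def)

lemma tm_run_halted: "halted (tm_run M xs n) ==> n \<le> t ==> tm_run M xs t = tm_run M xs n"
proof (induction t)
  case (Suc t)
  show ?case
  proof (cases "n = Suc t")
    case False
    hence "tm_run M xs t = tm_run M xs n" using Suc by simp
    thus ?thesis using Suc.prems(1) unfolding tm_run_Suc by (cases "tm_run M xs n") simp
  qed simp
qed simp

subsection \<open>Verifiers\<close>

text \<open>
  The verifier runs the program on the certificate and compares the symbols it emits with the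
  input. The symbol 3 marks a mismatch; since the head stays there, the mark is final.
\<close>

definition compare :: "nat => tape => tape" where
  "compare a tp = (if (a = 1 \<or> a = 2) \<and> tape_read tp = a then tape_act (tape_read tp, MoveR) tp else tape_act (3, Stay) tp)"

lemma compare_mismatch: "tape_read tp = 3 ==> tape_read (fold compare xs tp) = 3"
proof (induction xs arbitrary: tp)
  case (Cons a xs)
  have "tape_read (compare a tp) = 3"
    using Cons.prems by (cases tp) (auto simp: compare_def tape_act.simps tape_read.simps)
  thus ?case using Cons.IH by simp
qed simp

lemma fold_compare:
  "p \<le> length x ==> tape_read (fold compare xs (fst (input_tape x), int p)) = 0 \<longleftrightarrow> xs = map bit_symbol (drop p x)"
proof (induction xs arbitrary: p)
  case Nil
  thus ?case by (auto simp: tape_read.simps input_tape_def bit_symbol_def)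
next
  case (Cons a xs)
  let ?tp = "(fst (input_tape x), int p)"
  have r: "tape_read ?tp = (if p < length x then bit_symbol (x ! p) else 0)"
    by (simp add: tape_read.simps input_tape_def)
  show ?case
  proof (cases "p < length x \<and> bit_symbol (x ! p) = a")
    case True
    hence "compare a ?tp = (fst (input_tape x), int (Suc p))"
      using r by (auto simp: compare_def tape_act.simps tape_read.simps bit_symbol_def split: if_splits)
    moreover have "drop p x = x ! p # drop (Suc p) x" using True by (simp add: Cons_nth_drop_Suc)
    ultimately show ?thesis using Cons.IH[of "Suc p"] True by simp
  next
    case False
    hence "tape_read (compare a ?tp) = 3"
      using r by (auto simp: compare_def tape_act.simps tape_read.simps)
    moreover have "a # xs \<noteq> map bit_symbol (drop p x)"
      using False by (cases "p < length x") (auto simp: Cons_nth_drop_Suc[symmetric])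
    ultimately show ?thesis using compare_mismatch[of "compare a ?tp" xs] by simp
  qed
qed

text \<open>The program reads the certificate only and reconstructs the whole input from it. Thus no
  parser for encodings has to be programmed: membership of \<open>x\<close> follows from the fact
  that \<open>x\<close> has been printed without a mismatch.\<close>

theorem in_NP_com:
  assumes sound: "\<And>x u. out u (\<lambda>_. 0) c = map bit_symbol x ==> x \<in> L"
    and complete: "\<And>x. x \<in> L ==> \<exists>u. length u \<le> q (length x) \<and> out u (\<lambda>_. 0) c = map bit_symbol x"
    and "PB q"
  shows "in_NP L"
proof -
  let ?E = "\<lambda>a. if a = 1 \<or> a = 2 then SIf 0 {a} (fwd 0) (Act 0 (\<lambda>_. (3, Stay))) else Act 0 (\<lambda>_. (3, Stay))"
  have E: "runs (?E a) (st 1 w s ot 0) 3 (st 1 w s (compare a ot) 0)" for w a s ot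
  proof -
    have e: "runs (Act 0 (\<lambda>_. (3, Stay))) (st 1 w s ot 0) 1 (st 1 w s (tape_act (3, Stay) ot) 0)"
      by (rule runs_act) (auto simp: st_def fun_eq_iff)
    have m: "runs (fwd 0) (st 1 w s ot 0) 1 (st 1 w s (tape_act (tape_read ot, MoveR) ot) 0)"
      unfolding fwd_def by (rule runs_act) (auto simp: st_def fun_eq_iff)
    have rd: "tape_read (st 1 w s ot 0 0) = tape_read ot" by (simp add: st_def)
    show ?thesis
    proof (cases "a = 1 \<or> a = 2")
      case True
      have "runs (SIf 0 {a} (fwd 0) (Act 0 (\<lambda>_. (3, Stay)))) (st 1 w s ot 0) (1 + 1) (st 1 w s (compare a ot) 0)"
        by (rule runs_SIf) (use m e rd True in \<open>auto simp: compare_def\<close>)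
      thus ?thesis using True by (auto elim: runs_mono)
    next
      case False
      thus ?thesis using e by (auto simp: compare_def elim: runs_mono)
    qed
  qed
  have wfE: "wf_scom W 4 (?E a)" if "a \<in> syms c" "2 \<le> W" for a W using that by (auto simp: wf_basic)
  obtain M p where M: "wf_tm M" "3 \<le> tm_tapes M" "PB p"
    "\<And>w ot. \<exists>n\<le>p (length w). \<exists>ts'. (tm_step M ^^ n)
        (0, (if 1 = (0::nat) then [input_tape w, ot] else [ot, input_tape w]) @ replicate (tm_tapes M - 2) (input_tape [])) =
        (if tape_read (fold compare (out w (\<lambda>_. 0) c) ot) = 0 then 1 else 2, ts') \<and>
        ts' ! (1 - 1) = fold compare (out w (\<lambda>_. 0) c) ot"
    by (rule com_to_tm[of 1 ?E compare c]) (simp, rule E, erule wfE, assumption, rule that)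
  obtain C d where Cd: "\<And>n. p n \<le> C * n ^ d + C" using PB_poly[OF M(3)] by blast
  obtain C' d' where Cd': "\<And>n. q n \<le> C' * n ^ d' + C'" using PB_poly[OF \<open>PB q\<close>] by blast
  have run: "\<exists>n \<le> C * (length x + length u) ^ d + C. \<exists>ts. tm_run M [x, u] n = (if out u (\<lambda>_. 0) c = map bit_symbol x then 1 else 2, ts)" for x u
  proof -
    have init: "tm_init M [x, u] = (0, [input_tape x, input_tape u] @ replicate (tm_tapes M - 2) (input_tape []))"
      using M(2) by (auto simp: tm_init_def)
    have tape: "input_tape x = (fst (input_tape x), int 0)" by (simp add: input_tape_def)
    have "p (length u) \<le> C * (length x + length u) ^ d + C"
      using PB_mono[OF M(3), of "length u" "length x + length u"] Cd[of "length x + length u"] by simp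
    moreover obtain n ts' where "n \<le> p (length u)" "tm_run M [x, u] n =
        (if tape_read (fold compare (out u (\<lambda>_. 0) c) (input_tape x)) = 0 then 1 else 2, ts')"
      using M(4)[of u "input_tape x"] unfolding tm_run_def init by auto
    moreover have "tape_read (fold compare (out u (\<lambda>_. 0) c) (input_tape x)) = 0 \<longleftrightarrow>
        out u (\<lambda>_. 0) c = map bit_symbol x"
      using fold_compare[of 0 x "out u (\<lambda>_. 0) c", folded tape] by simp
    ultimately show ?thesis by (intro exI[of _ n] exI[of _ ts'] conjI) auto
  qed
  have acc: "tm_accepts M [x, u] \<longleftrightarrow> out u (\<lambda>_. 0) c = map bit_symbol x" for x u
  proof -
    obtain n ts where n: "tm_run M [x, u] n = (if out u (\<lambda>_. 0) c = map bit_symbol x then 1 else 2, ts)"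
      using run[of x u] by blast
    show ?thesis
    proof
      assume "tm_accepts M [x, u]"
      then obtain m where m: "fst (tm_run M [x, u] m) = 1" by (auto simp: tm_accepts_def)
      have fn: "halted (tm_run M [x, u] n)" using n by simp
      have fm: "halted (tm_run M [x, u] m)" using m by (cases "tm_run M [x, u] m") simp
      have "fst (tm_run M [x, u] n) = 1"
      proof (cases "n \<le> m")
        case True
        thus ?thesis using tm_run_halted[OF fn True] m by simp
      next
        case False
        thus ?thesis using tm_run_halted[OF fm, of n] m by simp
      qed
      hence "(if out u (\<lambda>_. 0) c = map bit_symbol x then 1 else 2) = (1::nat)" unfolding n by simp
      thus "out u (\<lambda>_. 0) c = map bit_symbol x" by presburger
    next
      assume "out u (\<lambda>_. 0) c = map bit_symbol x"
      hence "fst (tm_run M [x, u] n) = 1" unfolding n by simp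
      thus "tm_accepts M [x, u]" unfolding tm_accepts_def by blast
    qed
  qed
  have "\<exists>n \<le> C * (length x + length u) ^ d + C. halted (tm_run M [x, u] n)" for x u
  proof -
    obtain n ts where "n \<le> C * (length x + length u) ^ d + C"
      "tm_run M [x, u] n = (if out u (\<lambda>_. 0) c = map bit_symbol x then 1 else 2, ts)"
      using run[of x u] by blast
    thus ?thesis by (intro exI[of _ n]) auto
  qed
  moreover have "x \<in> L \<longleftrightarrow> (\<exists>u. length u \<le> C' * length x ^ d' + C' \<and> tm_accepts M [x, u])" for x
  proof
    assume "x \<in> L"
    then obtain u where "length u \<le> q (length x)" "out u (\<lambda>_. 0) c = map bit_symbol x"
      using complete by blast
    thus "\<exists>u. length u \<le> C' * length x ^ d' + C' \<and> tm_accepts M [x, u]"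
      using Cd'[of "length x"] acc le_trans by blast
  qed (use sound acc in blast)
  ultimately show ?thesis unfolding in_NP_def using M(1) by blast
qed

section \<open>Routing instances that simulate formulas\<close>

section \<open>Valid plans\<close>

abbreviation adj_opt :: "('a, 'v) routing => 'v option => 'v option => bool" where
  "adj_opt I x y \<equiv> \<exists>u v. x = Some u \<and> y = Some v \<and> {u, v} \<in> edges I"

definition dies :: "('a, 'v) routing => ('a, 'v) plan => 'v => 'a set" where
  "dies I p r = {a \<in> assets I. \<exists>j. p a j = Some r \<and> active I p r j}"

text \<open>Passes are counted with their times, so an asset that visits an open trap repeatedly
  uses up its reload time repeatedly.\<close>

definition passes :: "('a, 'v) routing => ('a, 'v) plan => 'v => ('a \<times> nat) set" where
  "passes I p r = {(a, j). a \<in> assets I \<and> p a j = Some r \<and> \<not> active I p r j}"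

lemma activeD: "active I p r j ==> i < j ==> active I p r i ==> a \<in> assets I ==> p a i = Some r ==> i + reload I r < j"
  by (subst (asm) active.simps) blast

lemma not_activeE:
  assumes "\<not> active I p r j"
  obtains i a where "i < j" "active I p r i" "a \<in> assets I" "p a i = Some r" "j \<le> i + reload I r"
  using assms by (subst (asm) active.simps) (auto simp: not_less)

context
  fixes I :: "('a, 'v) routing" and p :: "('a, 'v) plan"
  assumes wf: "wf_routing I" and v: "valid_plan I p"
begin

lemma plan_verts: "a \<in> assets I ==> p a j = Some u ==> u \<in> verts I"
  using v unfolding valid_plan_def by (metis imageE insertE option.distinct(1) option.inject)

lemma plan_start: "a \<in> assets I ==> p a 0 = Some (source I)"
  using v unfolding valid_plan_def by blast

lemma plan_source: "a \<in> assets I ==> p a (Suc j) = Some (source I) ==> p a j = Some (source I)"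
  using v unfolding valid_plan_def by (metis diff_Suc_1 zero_less_Suc)

lemma plan_source_le: "a \<in> assets I ==> p a j = Some (source I) ==> i \<le> j ==> p a i = Some (source I)"
  by (induction j) (auto simp: le_Suc_eq dest: plan_source)

lemma plan_finished: "a \<in> assets I ==> finished I (p a j) ==> j \<le> i ==> p a i = p a j"
proof (induction i)
  case (Suc i)
  have "\<forall>a\<in>assets I. \<forall>j. finished I (p a j) --> p a (j + 1) = p a j"
    using v unfolding valid_plan_def by blast
  thus ?case using Suc by (metis Suc_eq_plus1 le_SucE)
qed simp

lemma plan_step:
  assumes "a \<in> assets I" "p a (Suc j) = Some w"
  obtains u where "p a j = Some u" "u = w \<or> {u, w} \<in> edges I"
proof -
  have "\<forall>a\<in>assets I. \<forall>j\<ge>1. p a j \<noteq> None --> p a j = p a (j - 1) \<or>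
      adj_opt I (p a (j - 1)) (p a j)"
    using v unfolding valid_plan_def by blast
  from this[rule_format, of a "Suc j"] consider "p a j = Some w" | u where "p a j = Some u" "{u, w} \<in> edges I"
    using assms by auto
  thus ?thesis using that by cases auto
qed

lemma plan_distinct:
  "a \<in> assets I ==> a' \<in> assets I ==> p a j = Some u ==> p a' j = Some u ==>
   u \<noteq> source I ==> u \<noteq> target I ==> a = a'"
  using v unfolding valid_plan_def by (metis insertE option.distinct(1) option.inject singletonD)

lemma plan_kill: "a \<in> assets I ==> r \<in> traps I ==> p a j = Some r ==> active I p r j ==> p a (Suc j) = None"
  using v unfolding valid_plan_def by (metis Suc_eq_plus1)

lemma plan_killed:
  assumes "a \<in> assets I" "p a j = Some u" "p a (Suc j) = None"
  shows "u \<in> traps I" "active I p u j"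
proof -
  have "\<forall>a\<in>assets I. \<forall>j. p a j \<noteq> None \<and> p a (j + 1) = None --> (\<exists>r\<in>traps I. p a j = Some r \<and> active I p r j)"
    using v unfolding valid_plan_def by blast
  from this[rule_format, of a j] show "u \<in> traps I" "active I p u j" using assms by auto
qed

text \<open>Finished assets stay where they are, so the length is the first round in which all of
  them are finished; this makes it unique and the description operator in \<open>plan_length\<close>
  meaningful.\<close>

lemma plan_length_exists:
  obtains n where "1 \<le> n" "\<And>a j. a \<in> assets I ==> n \<le> j ==> finished I (p a j)"
    "\<And>a. a \<in> assets I ==> survives I p a \<longleftrightarrow> p a n = Some (target I)"
proof -
  have "\<exists>n. has_length I p n" using v unfolding valid_plan_def by (elim conjE)
  then obtain n where n: "has_length I p n" by blast
  have fin: "finished I (p a j)" if "has_length I p n" "a \<in> assets I" "n \<le> j" for a j n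
    using that plan_finished[of a n j] unfolding has_length_def by auto
  have "m = n" if "has_length I p m" for m
  proof (rule ccontr)
    assume "m \<noteq> n"
    then consider "m \<le> n - 1" | "n \<le> m - 1" by linarith
    thus False
    proof cases
      case 1
      thus False using fin[OF that] n unfolding has_length_def by blast
    next
      case 2
      thus False using fin[OF n] that unfolding has_length_def by blast
    qed
  qed
  hence "plan_length I p = n" unfolding plan_length_def using n by (rule the_equality[rotated])
  moreover have "1 \<le> n" using n by (simp add: has_length_def)
  ultimately show ?thesis using that[of n] fin[OF n] by (simp add: survives_def)
qed

lemma plan_None: "a \<in> assets I ==> p a j = None ==> j \<le> i ==> p a i = None"
  using plan_finished[of a j i] by (simp add: finished_def)

lemma plan_target: "a \<in> assets I ==> p a j = Some (target I) ==> j \<le> i ==> p a i = Some (target I)"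
  using plan_finished[of a j i] by (simp add: finished_def)

lemma survives_iff: "a \<in> assets I ==> survives I p a \<longleftrightarrow> (\<exists>j. p a j = Some (target I))"
proof -
  assume a: "a \<in> assets I"
  obtain n where n: "\<And>a j. a \<in> assets I ==> n \<le> j ==> finished I (p a j)"
    "\<And>a. a \<in> assets I ==> survives I p a \<longleftrightarrow> p a n = Some (target I)" using plan_length_exists by metis
  show ?thesis
  proof
    assume "\<exists>j. p a j = Some (target I)"
    then obtain j where j: "p a j = Some (target I)" by blast
    show "survives I p a"
    proof (cases "j \<le> n")
      case True
      thus ?thesis using plan_target[OF a j True] n(2)[OF a] by simp
    next
      case False
      thus ?thesis using plan_finished[OF a n(1)[OF a, of n], of j] j n(2)[OF a] by simp
    qed
  qed (use n(2)[OF a] in blast)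
qed

lemma trap_wf: "r \<in> traps I ==> r \<noteq> source I \<and> r \<noteq> target I"
  using wf unfolding wf_routing_def by blast

lemma alive_inactive:
  "a \<in> assets I ==> r \<in> traps I ==> p a j = Some r ==> p a i \<noteq> None ==> j < i ==> (a, j) \<in> passes I p r"
  using plan_kill[of a r j] plan_None[of a "Suc j" i] by (auto simp: passes_def)

lemma kill_time_unique:
  assumes "a \<in> assets I" "r \<in> traps I" "r' \<in> traps I" "p a i = Some r" "active I p r i" "p a j = Some r'" "active I p r' j"
  shows "i = j"
proof (rule ccontr)
  assume "i \<noteq> j"
  then consider "Suc i \<le> j" | "Suc j \<le> i" by linarith
  thus False
    using plan_kill[OF assms(1,2,4,5)] plan_kill[OF assms(1,3,6,7)] plan_None[OF assms(1), of "Suc i" j]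
      plan_None[OF assms(1), of "Suc j" i] assms(4,6) by cases auto
qed

lemma passes_time_bound: "\<exists>n. \<forall>r\<in>traps I. passes I p r \<subseteq> assets I \<times> {..<n}"
proof -
  obtain n where n: "\<And>a j. a \<in> assets I ==> n \<le> j ==> finished I (p a j)" using plan_length_exists by metis
  have "passes I p r \<subseteq> assets I \<times> {..<n}" if "r \<in> traps I" for r
    using n trap_wf[OF that] unfolding passes_def finished_def by (force simp: not_less[symmetric])
  thus ?thesis by blast
qed

lemma finite_passes: "r \<in> traps I ==> finite (passes I p r)"
  using passes_time_bound wf unfolding wf_routing_def by (meson finite_SigmaI finite_lessThan finite_subset)

lemma finite_dies: "finite (dies I p r)"
  using wf unfolding wf_routing_def dies_def by auto

text \<open>The basic counting bound. Each trigger opens the trap for \<open>reload I r\<close>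
  rounds and kills an asset of its own, and in each round at most one asset stands on a
  trap.\<close>

lemma card_passes:
  assumes r: "r \<in> traps I"
  shows "card (passes I p r) \<le> reload I r * card (dies I p r)"
proof -
  \<comment> \<open>\<open>T\<close> is the set of trigger times; \<open>f\<close> picks a victim
    for each of them, and is injective because nobody is killed twice.\<close>
  define T where "T = {i. active I p r i \<and> (\<exists>a\<in>assets I. p a i = Some r)}"
  define f where "f i = (SOME a. a \<in> assets I \<and> p a i = Some r)" for i
  have f: "f i \<in> assets I \<and> p (f i) i = Some r" if "i \<in> T" for i
    using that someI_ex[of "\<lambda>a. a \<in> assets I \<and> p a i = Some r"] unfolding f_def T_def by blast
  have inj: "inj_on f T"
  proof
    fix i j assume "i \<in> T" "j \<in> T" "f i = f j"
    thus "i = j" using kill_time_unique[of "f i" r r i j] f[of i] f[of j] r unfolding T_def by auto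
  qed
  have fT: "f ` T \<subseteq> dies I p r" using f unfolding T_def dies_def by blast
  hence cT: "card T \<le> card (dies I p r)" and finT: "finite T"
    using inj finite_dies card_inj_on_le[OF inj fT] finite_imageD[OF finite_subset[OF fT]] by auto
  have "inj_on snd (passes I p r)"
    using plan_distinct trap_wf[OF r] unfolding passes_def inj_on_def by auto
  hence "card (passes I p r) = card (snd ` passes I p r)" by (simp add: card_image)
  also have "\<dots> \<le> card (\<Union>i\<in>T. {i<..i + reload I r})"
  proof (rule card_mono)
    show "snd ` passes I p r \<subseteq> (\<Union>i\<in>T. {i<..i + reload I r})"
    proof
      fix j assume "j \<in> snd ` passes I p r"
      hence "\<not> active I p r j" by (auto simp: passes_def)
      thus "j \<in> (\<Union>i\<in>T. {i<..i + reload I r})" by (rule not_activeE) (auto simp: T_def)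
    qed
  qed (use finT in auto)
  also have "\<dots> \<le> (\<Sum>i\<in>T. card {i<..i + reload I r})" by (rule card_UN_le[OF finT])
  also have "\<dots> = card T * reload I r" by simp
  also have "\<dots> \<le> reload I r * card (dies I p r)" using cT by simp
  finally show ?thesis .
qed

lemma dies_disjoint:
  assumes "r \<in> traps I" "r' \<in> traps I" "r \<noteq> r'"
  shows "dies I p r \<inter> dies I p r' = {}"
proof (rule equals0I)
  fix a assume a: "a \<in> dies I p r \<inter> dies I p r'"
  then obtain i j where "a \<in> assets I" "p a i = Some r" "active I p r i" "p a j = Some r'" "active I p r' j"
    by (auto simp: dies_def)
  thus False using kill_time_unique[of a r r' i j] assms by auto
qed

lemma dies_not_survives:
  assumes "r \<in> traps I"
  shows "dies I p r \<inter> {a \<in> assets I. survives I p a} = {}"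
proof (rule equals0I)
  fix a assume a: "a \<in> dies I p r \<inter> {a \<in> assets I. survives I p a}"
  then obtain i j where *: "a \<in> assets I" "p a i = Some r" "active I p r i" "p a j = Some (target I)"
    using survives_iff by (auto simp: dies_def)
  hence "p a (Suc i) = None" using plan_kill assms by blast
  thus False
    using plan_None[of a "Suc i" j] plan_target[of a j "Suc i"] *(1,4) by (cases "Suc i \<le> j") auto
qed

lemma card_dies_Un:
  assumes "finite T" "T \<subseteq> traps I"
  shows "card ((\<Union>r\<in>T. dies I p r) \<union> {a \<in> assets I. survives I p a}) =
    (\<Sum>r\<in>T. card (dies I p r)) + card {a \<in> assets I. survives I p a}"
proof -
  have fA: "finite (assets I)" using wf unfolding wf_routing_def by blast
  have "(\<Sum>r\<in>T. card (dies I p r)) = card (\<Union>r\<in>T. dies I p r)"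
    by (rule card_UN_disjoint[symmetric]) (use assms finite_dies dies_disjoint in blast)+
  moreover have "(\<Union>r\<in>T. dies I p r) \<inter> {a \<in> assets I. survives I p a} = {}"
    using dies_not_survives assms(2) by blast
  ultimately show ?thesis using fA finite_dies assms(1) by (subst card_Un_disjoint) auto
qed

text \<open>The budget: the goal bounds the survivors from below and thereby all deaths together
  from above.\<close>

lemma card_dies_survivors:
  assumes "finite T" "T \<subseteq> traps I"
  shows "(\<Sum>r\<in>T. card (dies I p r)) + card {a \<in> assets I. survives I p a} \<le> card (assets I)"
proof -
  have "finite (assets I)" using wf unfolding wf_routing_def by blast
  thus ?thesis unfolding card_dies_Un[OF assms, symmetric] by (rule card_mono) (auto simp: dies_def)
qed

end

section \<open>The routing instance of a formula\<close>

text \<open>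
  A formula with variables \<open>i < K\<close> and clauses \<open>j < C\<close>; literal \<open>2 * i\<close> is the variable \<open>i\<close>,
  literal \<open>2 * i + 1\<close> its negation, and \<open>occ l j\<close> says that clause \<open>j\<close> contains the literal \<open>l\<close>.
  The vertices are 0 (source), 1 (target), the entrance 2, the trap 3 at the start of the corridor,
  the exits 4 and 5, a trap for every literal, \<open>NS\<close> slots (\<open>K\<close> for the variables, \<open>C\<close> for the
  clauses, and fillers), and the corridor.
\<close>

locale gadget =
  fixes K C :: nat and occ :: "nat => nat => bool"
  assumes K: "1 \<le> K" and C: "4 \<le> C"
begin

text \<open>With \<open>q = C + 1\<close>, one opened literal can serve its variable slot and one
  slot per clause; the \<open>NS = K + K * C\<close> slots give every clause \<open>K\<close> slots,
  one genuine and the others fillers. \<open>m\<close> counts \<open>q + 1\<close> assets per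
  variable plus the three that die at the entrance, at trap 3 and at exit 5. \<open>La\<close>
  exceeds the reload time \<open>m\<close> of the entrance plus that of an exit, so the exits cannot
  be open while assets still enter.\<close>

definition q :: nat where "q = C + 1"
definition NS :: nat where "NS = K * q"
definition m :: nat where "m = NS + K + 3"
definition La :: nat where "La = m + NS + 10"
definition lit :: "nat => nat" where "lit l = 6 + l"
definition slot :: "nat => nat" where "slot i = 6 + 2 * K + i"
definition cor :: "nat => nat" where "cor i = 6 + 2 * K + NS + i"

text \<open>A variable slot is accessible from both literals of its variable, so filling it forces
  one of the two traps to be opened. Fillers are accessible from every literal and only absorb the
  surplus of passes.\<close>

definition adj :: "nat => nat => bool" where
  "adj l i \<longleftrightarrow> (if i < K then i = l div 2 else if i < K + C then occ l (i - K) else True)"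

definition es :: "(nat \<times> nat) list" where
  "es = [(0, 2), (2, 3), (3, cor 0), (5, cor (La - 1)), (4, 5), (1, 5)] @
     map (\<lambda>l. (2, lit l)) [0..<2 * K] @
     concat (map (\<lambda>l. concat (map (\<lambda>i. if adj l i then [(lit l, slot i)] else []) [0..<NS])) [0..<2 * K]) @
     map (\<lambda>i. (4, slot i)) [0..<NS] @
     map (\<lambda>i. (cor i, cor (i + 1))) [0..<La - 1]"

definition rs :: "(nat \<times> nat) list" where
  "rs = [(2, m), (3, 1), (4, NS - 1), (5, NS - 1)] @ map (\<lambda>l. (lit l, q)) [0..<2 * K]"

definition listing :: listing where
  "listing = ([0..<m], [0..<cor La], es, 0, 1, rs, NS - 1)"

abbreviation I :: "(nat, nat) routing" where "I \<equiv> routing_of listing"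

lemma q_ge: "5 \<le> q" using C by (simp add: q_def)
lemma NS_ge: "K + C \<le> NS" "5 * K \<le> NS" "5 \<le> NS"
proof -
  have "K * 5 \<le> K * q" using q_ge by (rule mult_le_mono2)
  thus "5 * K \<le> NS" by (simp add: NS_def)
  thus "5 \<le> NS" using K by simp
  have "1 * C \<le> K * C" using K by (rule mult_le_mono1)
  thus "K + C \<le> NS" by (simp add: NS_def q_def)
qed

lemma set_es: "(u, v) \<in> set es \<longleftrightarrow>
   (u = 0 \<and> v = 2) \<or> (u = 2 \<and> v = 3) \<or> (u = 3 \<and> v = cor 0) \<or> (u = 5 \<and> v = cor (La - 1)) \<or>
   (u = 4 \<and> v = 5) \<or> (u = 1 \<and> v = 5) \<or> (u = 2 \<and> (\<exists>l<2 * K. v = lit l)) \<or>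
   (\<exists>l<2 * K. \<exists>i<NS. adj l i \<and> u = lit l \<and> v = slot i) \<or>
   (u = 4 \<and> (\<exists>i<NS. v = slot i)) \<or> (\<exists>i<La - 1. u = cor i \<and> v = cor (i + 1))"
proof -
  have 1: "(u, v) \<in> set (map (\<lambda>l. (2, lit l)) [0..<2 * K]) \<longleftrightarrow> u = 2 \<and> (\<exists>l<2 * K. v = lit l)"
    by auto
  have 2: "(u, v) \<in> set (concat (map (\<lambda>l. concat (map (\<lambda>i. if adj l i then [(lit l, slot i)] else []) [0..<NS])) [0..<2 * K]))
      \<longleftrightarrow> (\<exists>l<2 * K. \<exists>i<NS. adj l i \<and> u = lit l \<and> v = slot i)"
    by (auto split: if_splits intro!: bexI) blast
  have 3: "(u, v) \<in> set (map (\<lambda>i. (4, slot i)) [0..<NS]) \<longleftrightarrow> u = 4 \<and> (\<exists>i<NS. v = slot i)"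
    by auto
  have 4: "(u, v) \<in> set (map (\<lambda>i. (cor i, cor (i + 1))) [0..<La - 1]) \<longleftrightarrow> (\<exists>i<La - 1. u = cor i \<and> v = cor (i + 1))"
    by auto
  show ?thesis unfolding es_def set_append Un_iff 1 2 3 4 by simp
qed

lemma edge_iff: "{u, v} \<in> edges I \<longleftrightarrow> (u, v) \<in> set es \<or> (v, u) \<in> set es"
  by (force simp: listing_def doubleton_eq_iff)

lemmas vdefs = lit_def slot_def cor_def

lemma La_pos: "0 < La" by (simp add: La_def)

lemma N_s: "{u, 0} \<in> edges I ==> u = 2"
  unfolding edge_iff set_es using La_pos by (auto simp: vdefs)
lemma N_t: "{u, 1} \<in> edges I ==> u = 5"
  unfolding edge_iff set_es using La_pos by (auto simp: vdefs)
lemma N_Y: "{u, 2} \<in> edges I ==> u = 0 \<or> u = 3 \<or> (\<exists>l<2 * K. u = lit l)"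
  unfolding edge_iff set_es using La_pos by (auto simp: vdefs)
lemma N_B: "{u, 3} \<in> edges I ==> u = 2 \<or> u = cor 0"
  unfolding edge_iff set_es using La_pos by (auto simp: vdefs)
lemma N_Z: "{u, 4} \<in> edges I ==> u = 5 \<or> (\<exists>i<NS. u = slot i)"
  unfolding edge_iff set_es using La_pos by (auto simp: vdefs)
lemma N_X: "{u, 5} \<in> edges I ==> u = 4 \<or> u = 1 \<or> u = cor (La - 1)"
  unfolding edge_iff set_es using La_pos by (auto simp: vdefs)
lemma N_lit: "{u, lit l} \<in> edges I ==> l < 2 * K ==> u = 2 \<or> (\<exists>i<NS. u = slot i)"
  unfolding edge_iff set_es using La_pos by (auto simp: vdefs)
lemma N_slot: "{u, slot i} \<in> edges I ==> i < NS ==> u = 4 \<or> (\<exists>l<2 * K. adj l i \<and> u = lit l)"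
  unfolding edge_iff set_es using La_pos by (auto simp: vdefs)
lemma N_cor: "{u, cor i} \<in> edges I ==> i < La ==> u = 3 \<and> i = 0 \<or> u = 5 \<and> i = La - 1 \<or>
    (\<exists>i'<La. u = cor i' \<and> (i = i' + 1 \<or> i' = i + 1))"
  unfolding edge_iff set_es using La_pos by (auto simp: vdefs)

lemma I_simps [simp]:
  "assets I = {0..<m}" "verts I = {0..<cor La}" "source I = 0" "target I = 1" "goal I = NS - 1"
  by (auto simp: listing_def)

lemma traps_I: "traps I = {2, 3, 4, 5} \<union> lit ` {..<2 * K}"
  by (auto simp: listing_def rs_def image_image)

lemma map_of_lits: "map_of (map (\<lambda>l. (lit l, q)) [0..<n]) (lit l) = (if l < n then Some q else None)"
  by (induction n) (auto simp: map_add_Some_iff vdefs)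

lemma reload_I: "reload I 2 = m" "reload I 3 = 1" "reload I 4 = NS - 1" "reload I 5 = NS - 1"
  "l < 2 * K ==> reload I (lit l) = q"
  by (auto simp: listing_def rs_def map_of_lits) (auto simp: vdefs)

lemma verts_cases:
  assumes "u < cor La"
  obtains "u = 0" | "u = 1" | "u = 2" | "u = 3" | "u = 4" | "u = 5" | l where "l < 2 * K" "u = lit l" |
    i where "i < NS" "u = slot i" | i where "i < La" "u = cor i"
proof -
  consider "u < 6" | "6 \<le> u" "u < 6 + 2 * K" | "6 + 2 * K \<le> u" "u < 6 + 2 * K + NS" | "6 + 2 * K + NS \<le> u"
    by linarith
  thus ?thesis
  proof cases
    case 1
    hence "u = 0 \<or> u = 1 \<or> u = 2 \<or> u = 3 \<or> u = 4 \<or> u = 5" by linarith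
    thus ?thesis using that by blast
  next
    case 2
    thus ?thesis using that(7)[of "u - 6"] by (simp add: lit_def)
  next
    case 3
    thus ?thesis using that(8)[of "u - (6 + 2 * K)"] by (simp add: slot_def)
  next
    case 4
    thus ?thesis using that(9)[of "u - (6 + 2 * K + NS)"] assms by (simp add: cor_def)
  qed
qed

lemma distinct_concat_map:
  assumes "distinct xs" "\<And>x. x \<in> set xs ==> distinct (f x)"
    "\<And>x y. x \<in> set xs ==> y \<in> set xs ==> x \<noteq> y ==> set (f x) \<inter> set (f y) = {}"
  shows "distinct (concat (map f xs))"
  using assms
proof (induction xs)
  case (Cons a xs)
  have "set (f a) \<inter> set (f y) = {}" if "y \<in> set xs" for y
    using Cons.prems(1) Cons.prems(3)[of a y] that by auto
  moreover have "distinct (concat (map f xs))" using Cons by auto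
  ultimately show ?case using Cons.prems(2)[of a] by auto
qed simp

lemma distinct_es: "distinct es"
proof -
  define A where "A = concat (map (\<lambda>l. concat (map (\<lambda>i. if adj l i then [(lit l, slot i)] else []) [0..<NS])) [0..<2 * K])"
  have "distinct (concat (map (\<lambda>i. if adj l i then [(lit l, slot i)] else []) [0..<NS]))" for l
    by (rule distinct_concat_map) (auto simp: vdefs split: if_splits)
  hence "distinct A"
    unfolding A_def by (intro distinct_concat_map) (auto simp: vdefs split: if_splits)
  moreover have A: "6 \<le> u \<and> u < v \<and> u < 6 + 2 * K" if "(u, v) \<in> set A" for u v
    using that by (auto simp: A_def vdefs split: if_splits)
  moreover have "distinct (map (\<lambda>l. (2::nat, lit l)) [0..<2 * K])" "distinct (map (\<lambda>i. (4::nat, slot i)) [0..<NS])"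
    "distinct (map (\<lambda>i. (cor i, cor (i + 1))) [0..<La - 1])"
    by (auto simp: distinct_map inj_on_def vdefs)
  ultimately show ?thesis
    unfolding es_def A_def[symmetric] distinct_append using La_pos by (auto simp: vdefs dest!: A)
qed

lemma wf_listing_gadget: "wf_listing listing"
proof -
  \<comment> \<open>Every edge is listed with its smaller end first, hence different pairs are
    different edges.\<close>
  have ord: "u < v \<and> v < cor La" if "(u, v) \<in> set es" for u v
    using that NS_ge La_pos unfolding set_es by (auto simp: vdefs)
  have "inj_on (\<lambda>(u, v). {u, v}) (set es)"
  proof (rule inj_onI, clarify)
    fix u v u' v' assume "(u, v) \<in> set es" "(u', v') \<in> set es" "{u, v} = {u', v'}"
    thus "u = u' \<and> v = v'" using ord[of u v] ord[of u' v'] by (auto simp: doubleton_eq_iff)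
  qed
  hence d: "distinct (map (\<lambda>(u, v). {u, v}) es)" using distinct_es by (simp add: distinct_map)
  have "distinct (map fst rs)" by (auto simp: rs_def distinct_map inj_on_def o_def vdefs)
  moreover have "wf_routing I"
    unfolding wf_routing_def
  proof (intro conjI ballI)
    fix e assume "e \<in> edges I"
    then obtain u v where uv: "(u, v) \<in> set es" "e = {u, v}" by (auto simp: listing_def)
    thus "e \<subseteq> verts I" "card e = 2" using ord[of u v] by (auto simp: card_2_iff)
  next
    show "traps I \<subseteq> verts I - {source I, target I}"
      unfolding traps_I by (auto simp: vdefs)
    show "0 < reload I r" if "r \<in> traps I" for r
      using that NS_ge q_ge unfolding traps_I by (auto simp: reload_I m_def)
    show "goal I \<le> card (assets I)" "1 \<le> goal I" using NS_ge by (simp_all add: m_def)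
  qed (auto simp: vdefs)
  ultimately show ?thesis using d unfolding listing_def wf_listing.simps by simp
qed

end

section \<open>A plan yields a satisfying assignment\<close>

locale gadget_plan = gadget +
  fixes p :: "(nat, nat) plan"
  assumes sol: "solution I p"
begin

lemma wf: "wf_routing I"
  using wf_listing_gadget unfolding listing_def wf_listing.simps by simp

lemma v: "valid_plan I p" using sol by (simp add: solution_def)

abbreviation D :: "nat => nat set" where "D \<equiv> dies I p"
abbreviation P :: "nat => (nat \<times> nat) set" where "P \<equiv> passes I p"
abbreviation S :: "nat set" where "S \<equiv> {a \<in> assets I. survives I p a}"
definition sg :: nat where "sg = (\<Sum>l<2 * K. card (D (lit l)))"

lemmas step = plan_step[OF wf v] and pass = alive_inactive[OF wf v]

lemma a_less: "(a, i) \<in> P r ==> a \<in> assets I" by (auto simp: passes_def)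

lemma pred_cases:
  assumes "a \<in> assets I" "p a (Suc j) = Some w"
  obtains u where "p a j = Some u" "u = w \<or> {u, w} \<in> edges I" "u \<in> traps I ==> (a, j) \<in> P u"
    "u < cor La"
proof -
  obtain u where "p a j = Some u" "u = w \<or> {u, w} \<in> edges I" using step[OF assms] by blast
  moreover from this have "u < cor La" using plan_verts[OF wf v assms(1), of j u] by simp
  ultimately show ?thesis using that pass[OF assms(1), of u j "Suc j"] assms(2) by auto
qed

lemma neighbours:
  "{0, w} \<in> edges I ==> w = 2"
  "{1, w} \<in> edges I ==> w = 5"
  "{2, w} \<in> edges I ==> w = 0 \<or> w = 3 \<or> (\<exists>l<2 * K. w = lit l)"
  "{3, w} \<in> edges I ==> w = 2 \<or> w = cor 0"
  "{4, w} \<in> edges I ==> w = 5 \<or> (\<exists>i<NS. w = slot i)"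
  "{5, w} \<in> edges I ==> w = 4 \<or> w = 1 \<or> w = cor (La - 1)"
  "{lit l, w} \<in> edges I ==> l < 2 * K ==> w = 2 \<or> (\<exists>i<NS. w = slot i)"
  "{slot i, w} \<in> edges I ==> i < NS ==> w = 4 \<or> (\<exists>l<2 * K. adj l i \<and> w = lit l)"
  "{cor i, w} \<in> edges I ==> i < La ==> w = 3 \<and> i = 0 \<or> w = 5 \<and> i = La - 1 \<or>
    (\<exists>i'<La. w = cor i' \<and> (i = i' + 1 \<or> i' = i + 1))"
  using N_s[of w] N_t[of w] N_Y[of w] N_B[of w] N_Z[of w] N_X[of w] N_lit[of w l] N_slot[of w i] N_cor[of w i]
  by (simp_all only: insert_commute)

lemma trapsI: "2 \<in> traps I" "3 \<in> traps I" "4 \<in> traps I" "5 \<in> traps I" "l < 2 * K ==> lit l \<in> traps I"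
  by (auto simp: traps_I)

text \<open>Trap 3 and the literal traps separate the entrance area from the rest. Whoever is alive
  after leaving such a trap must have found it inactive, so the crossing is recorded as a
  pass.\<close>

lemma reach_beyond:
  assumes "a \<in> assets I" "p a j = Some u"
  shows "u \<in> {0, 2, 3} \<or> (\<exists>l<2 * K. u = lit l) \<or> (\<exists>i<j. (a, i) \<in> P 3) \<or> (\<exists>i<j. \<exists>l<2 * K. (a, i) \<in> P (lit l))"
  using assms(2)
proof (induction j arbitrary: u)
  case 0
  thus ?case using plan_start[OF wf v assms(1)] by simp
next
  case (Suc j)
  obtain u' where u': "p a j = Some u'" "u' = u \<or> {u', u} \<in> edges I" "u' \<in> traps I ==> (a, j) \<in> P u'"
    using pred_cases[OF assms(1) Suc.prems] by metis
  from Suc.IH[OF u'(1)] consider "u' = 0" | "u' = 2" | "u' = 3" | l where "l < 2 * K" "u' = lit l" |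
    "\<exists>i<j. (a, i) \<in> P 3" | "\<exists>i<j. \<exists>l<2 * K. (a, i) \<in> P (lit l)" by blast
  thus ?case
  proof cases
    case 1
    thus ?thesis using u'(2) neighbours(1)[of u] by blast
  next
    case 2
    thus ?thesis using u'(2) neighbours(3)[of u] by blast
  next
    case 3
    thus ?thesis using u'(3) trapsI(2) by blast
  next
    case 4
    thus ?thesis using u'(3) trapsI(5)[of l] by blast
  qed (use less_SucI in blast)+
qed

text \<open>Once the corridor is excluded, exit 4 is the only link from the slots to exit 5, and the
  step that leaves the region goes from 4 directly to 5.\<close>

lemma reach_exit:
  assumes "a \<in> assets I" "p a j = Some u" "\<And>i. (a, i) \<notin> P 3"
  shows "u \<in> {0, 2, 3, 4} \<or> (\<exists>l<2 * K. u = lit l) \<or> (\<exists>i<NS. u = slot i) \<or>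
    (\<exists>i<j. (a, i) \<in> P 4 \<and> p a (Suc i) = Some 5)"
  using assms(2)
proof (induction j arbitrary: u)
  case 0
  thus ?case using plan_start[OF wf v assms(1)] by simp
next
  case (Suc j)
  obtain u' where u': "p a j = Some u'" "u' = u \<or> {u', u} \<in> edges I" "u' \<in> traps I ==> (a, j) \<in> P u'"
    using pred_cases[OF assms(1) Suc.prems] by metis
  from Suc.IH[OF u'(1)] consider "u' = 0" | "u' = 2" | "u' = 3" | "u' = 4" | l where "l < 2 * K" "u' = lit l" |
    i where "i < NS" "u' = slot i" | "\<exists>i<j. (a, i) \<in> P 4 \<and> p a (Suc i) = Some 5" by blast
  thus ?case
  proof cases
    case 1
    thus ?thesis using u'(2) neighbours(1)[of u] by blast
  next
    case 2
    thus ?thesis using u'(2) neighbours(3)[of u] by blast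
  next
    case 3
    thus ?thesis using u'(3) trapsI(2) assms(3) by blast
  next
    case 4
    thus ?thesis using u'(2,3) trapsI(3) neighbours(5)[of u] Suc.prems by blast
  next
    case 5
    thus ?thesis using u'(2) neighbours(7)[of l u] by blast
  next
    case 6
    thus ?thesis using u'(2) neighbours(8)[of i u] by blast
  qed (use less_SucI in blast)
qed

lemma reach_target:
  assumes "a \<in> assets I" "p a j = Some 1"
  shows "\<exists>i<j. (a, i) \<in> P 5"
  using assms(2)
proof (induction j)
  case 0
  thus ?case using plan_start[OF wf v assms(1)] by simp
next
  case (Suc j)
  obtain u' where u': "p a j = Some u'" "u' = 1 \<or> {u', 1} \<in> edges I" "u' \<in> traps I ==> (a, j) \<in> P u'"
    using pred_cases[OF assms(1) Suc.prems] by metis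
  show ?case
  proof (cases "u' = 1")
    case True
    thus ?thesis using Suc.IH u'(1) less_SucI by blast
  next
    case False
    hence "u' = 5" using u'(2) N_t by blast
    thus ?thesis using u'(3) trapsI(4) by blast
  qed
qed

lemma reach_entrance:
  assumes "a \<in> assets I" "p a j = Some u" "u \<noteq> 0" "u \<noteq> 2"
  shows "\<exists>i<j. (a, i) \<in> P 2"
  using assms(2-)
proof (induction j arbitrary: u)
  case 0
  thus ?case using plan_start[OF wf v assms(1)] by simp
next
  case (Suc j)
  obtain u' where u': "p a j = Some u'" "u' = u \<or> {u', u} \<in> edges I" "u' \<in> traps I ==> (a, j) \<in> P u'"
    using pred_cases[OF assms(1) Suc.prems(1)] by metis
  consider "u' = 0" | "u' = 2" | "u' \<noteq> 0" "u' \<noteq> 2" by blast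
  thus ?case
  proof cases
    case 1
    thus ?thesis using u'(2) neighbours(1)[of u] Suc.prems by blast
  next
    case 2
    thus ?thesis using u'(3) trapsI(1) by blast
  next
    case 3
    thus ?thesis using Suc.IH[OF u'(1)] less_SucI by blast
  qed
qed

lemma pass_trigger:
  assumes "(a, j) \<in> P r"
  obtains i b where "i < j" "j \<le> i + reload I r" "active I p r i" "b \<in> assets I" "p b i = Some r"
proof -
  have "\<not> active I p r j" using assms by (auto simp: passes_def)
  thus ?thesis by (rule not_activeE) (use that in blast)
qed

lemma pass_dies: "(a, j) \<in> P r ==> D r \<noteq> {}"
  by (rule pass_trigger) (auto simp: dies_def)

lemma survivorD: "a \<in> S ==> a \<in> assets I \<and> (\<exists>j. p a j = Some 1)"
  using survives_iff[OF wf v] by auto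

definition Es :: "nat set" where "Es = {a. \<exists>i. \<exists>l<2 * K. (a, i) \<in> P (lit l)}"
definition Ls :: "nat set" where "Ls = {a. \<exists>i. (a, i) \<in> P 3}"
definition PE :: "(nat \<times> nat) set" where "PE = (\<Union>l<2 * K. P (lit l))"

lemma card_PE: "card PE \<le> q * sg" and finite_PE: "finite PE"
proof -
  have "card PE \<le> (\<Sum>l<2 * K. card (P (lit l)))" unfolding PE_def by (rule card_UN_le) simp
  also have "\<dots> \<le> (\<Sum>l<2 * K. q * card (D (lit l)))"
    by (rule sum_mono) (use card_passes[OF wf v] trapsI(5) reload_I(5) in fastforce)
  finally show "card PE \<le> q * sg" by (simp add: sg_def sum_distrib_left)
  show "finite PE" unfolding PE_def using finite_passes[OF wf v] trapsI(5) by auto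
qed

lemma Es_PE: "Es = fst ` PE" by (force simp: Es_def PE_def)

lemma card_Es: "card Es \<le> q * sg" and finite_Es: "finite Es"
  using card_PE finite_PE card_image_le[OF finite_PE, of fst] by (auto simp: Es_PE)

lemma card_Ls: "card Ls \<le> card (D 3)" and finite_Ls: "finite Ls"
proof -
  have "Ls = fst ` P 3" by (force simp: Ls_def)
  moreover have "finite (P 3)" using finite_passes[OF wf v] trapsI by blast
  ultimately show "finite Ls" "card Ls \<le> card (D 3)"
    using card_image_le[of "P 3" fst] card_passes[OF wf v trapsI(2)] reload_I by auto
qed

lemma beyond_Es_Ls: "a \<in> assets I ==> p a j = Some u ==> u \<in> {1, 4, 5} ==> a \<in> Es \<union> Ls"
  using reach_beyond[of a j u] unfolding Es_def Ls_def by (auto simp: lit_def)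

text \<open>The exits and the target lie behind the separating traps, so the deaths at the exits and
  the survivors together are bounded by the passes of literal traps and of trap 3.\<close>

lemma U_subset: "D 4 \<union> D 5 \<union> S \<subseteq> Es \<union> Ls"
proof
  fix a assume "a \<in> D 4 \<union> D 5 \<union> S"
  then obtain j u where "a \<in> assets I" "p a j = Some u" "u \<in> {1, 4, 5}"
    using survivorD by (fastforce simp: dies_def)
  thus "a \<in> Es \<union> Ls" by (rule beyond_Es_Ls)
qed

lemma card_D45S: "card (D 4 \<union> D 5 \<union> S) = card (D 4) + card (D 5) + card S"
  using card_dies_Un[OF wf v, of "{4, 5}"] trapsI by (simp add: Un_assoc)

lemma card_D5S: "card (D 5 \<union> S) = card (D 5) + card S"
  using card_dies_Un[OF wf v, of "{5}"] trapsI by simp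

lemma total: "card (D 2) + card (D 3) + card (D 4) + card (D 5) + sg + card S \<le> m"
proof -
  have "(\<Sum>r\<in>traps I. card (D r)) + card S \<le> card (assets I)"
    by (rule card_dies_survivors[OF wf v]) (auto simp: traps_I)
  moreover have "(\<Sum>r\<in>traps I. card (D r)) = card (D 2) + card (D 3) + card (D 4) + card (D 5) + sg"
  proof -
    have "(\<Sum>r\<in>lit ` {..<2 * K}. card (D r)) = sg"
      unfolding sg_def by (subst sum.reindex) (auto simp: inj_on_def lit_def)
    thus ?thesis unfolding traps_I by (subst sum.union_disjoint) (auto simp: lit_def)
  qed
  ultimately show ?thesis by simp
qed

lemma card_S: "NS - 1 \<le> card S" using sol by (simp add: solution_def)

lemma pass_exit:
  assumes "a \<in> D 5 \<union> S" "a \<notin> Ls"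
  obtains i where "(a, i) \<in> P 4" "p a (Suc i) = Some 5"
proof -
  obtain j u where *: "a \<in> assets I" "p a j = Some u" "u \<in> {1, 5}"
    using assms(1) survivorD by (fastforce simp: dies_def)
  moreover have "\<And>i. (a, i) \<notin> P 3" using assms(2) by (auto simp: Ls_def)
  ultimately show ?thesis using reach_exit[of a j u] that by (auto simp: lit_def slot_def)
qed

lemma card_exit: "card (D 5 \<union> S) - card Ls \<le> card (P 4)"
proof -
  have "D 5 \<union> S - Ls \<subseteq> fst ` P 4"
  proof
    fix a assume "a \<in> D 5 \<union> S - Ls"
    then obtain i where "(a, i) \<in> P 4" using pass_exit[of a] by blast
    thus "a \<in> fst ` P 4" by force
  qed
  moreover have "finite (P 4)" using finite_passes[OF wf v] trapsI by blast
  ultimately have "card (D 5 \<union> S - Ls) \<le> card (P 4)"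
    by (intro surj_card_le[of "P 4" _ fst])
  thus ?thesis using diff_card_le_card_Diff[OF finite_Ls, of "D 5 \<union> S"] by linarith
qed

text \<open>
  The budget of \<open>K + 4\<close> deaths suffices only if the entrance, the corridor and both exits cost one
  death each; every other way to open an exit costs an additional pass of a literal trap.
\<close>

lemma counts: "card (D 2) = 1" "card (D 3) = 1" "card (D 4) = 1" "card (D 5) = 1" "sg = K"
  and cards: "card Es = NS" "card PE = NS" "card Ls = 1" "Es \<inter> Ls = {}" "D 4 \<union> D 5 \<union> S = Es \<union> Ls" "card S = NS - 1"
proof -
  define y where "y = card (D 2)"
  define b where "b = card (D 3)"
  define z where "z = card (D 4)"
  define x where "x = card (D 5)"
  define w where "w = card S"
  have w: "NS - 1 \<le> w" using card_S by (simp add: w_def)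
  have tot: "y + b + z + x + sg + w \<le> NS + K + 3" using total unfolding m_def y_def b_def z_def x_def w_def .
  hence tot': "y + b + z + x + sg \<le> K + 4" using w NS_ge by linarith
  have "0 < w" using w NS_ge by linarith
  then obtain a where a: "a \<in> S" unfolding w_def by (auto simp: card_gt_0_iff)
  then obtain j where j: "a \<in> assets I" "p a j = Some 1" using survivorD by blast
  have "D 5 \<noteq> {}" "D 2 \<noteq> {}"
    using reach_target[OF j] reach_entrance[OF j] pass_dies by auto
  hence x: "1 \<le> x" and y: "1 \<le> y"
    using finite_dies[OF wf v] unfolding x_def y_def
    by (auto simp: Suc_le_eq card_gt_0_iff)
  have EL: "z + x + w \<le> card Es + card Ls"
    using card_mono[OF _ U_subset] finite_Es finite_Ls card_Un_le[of Es Ls] card_D45S unfolding z_def x_def w_def by simp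
  have Lb: "card Ls \<le> b" using card_Ls by (simp add: b_def)
  have E: "card Es \<le> q * sg" using card_Es .
  have P4: "x + w - card Ls \<le> (NS - 1) * z"
    using card_exit card_passes[OF wf v trapsI(3)] reload_I(3) unfolding card_D5S x_def w_def z_def by simp
  have NSq: "NS = q * K" by (simp add: NS_def)
  \<comment> \<open>With no death at trap 3 nobody uses the corridor, and the at least
    \<open>NS\<close> assets that reach exit 5 all pass exit 4. One trigger of 4 allows only
    \<open>NS - 1\<close> passes; with a second one, \<open>NS + 2\<close> assets have to come
    through literal traps, which takes \<open>K + 1\<close> deaths there and exceeds the
    budget.\<close>
  have "b \<noteq> 0"
  proof
    assume b0: "b = 0"
    have "NS \<le> (NS - 1) * z" using P4 Lb b0 x w NS_ge by linarith
    hence "2 \<le> z" using NS_ge by (cases z; cases "z - 1") auto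
    hence "q * K < q * sg" using EL E Lb b0 x w NSq NS_ge by linarith
    hence "K < sg" by simp
    thus False using tot' x y \<open>2 \<le> z\<close> by linarith
  qed
  \<comment> \<open>If exit 4 is never triggered, everybody beyond it used the corridor, at the
    price of one death per asset.\<close>
  have "z \<noteq> 0"
  proof
    assume "z = 0"
    hence "x + w \<le> card Ls" using P4 by simp
    thus False using Lb tot' w x y NS_ge K by linarith
  qed
  \<comment> \<open>Saving \<open>d\<close> deaths at literal traps loses at least
    \<open>5 * d\<close> passes, which only the corridor can replace, at one death each. This is
    where \<open>5 \<le> q\<close>, that is \<open>4 \<le> C\<close>, is used.\<close>
  have sg: "K \<le> sg"
  proof (rule ccontr)
    assume "\<not> K \<le> sg"
    then obtain d where d: "K = sg + d" "1 \<le> d" using that[of "K - sg"] by linarith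
    have "q * K = q * (sg + d)" using d(1) by (rule arg_cong)
    hence "q * sg + q * d = NS" unfolding NSq by (simp only: add_mult_distrib2)
    hence "q * d + z + x \<le> b + 1" using EL E Lb w NS_ge by linarith
    moreover have "5 * d \<le> q * d" using q_ge by simp
    ultimately show False using tot' d x y \<open>z \<noteq> 0\<close> by linarith
  qed
  show c: "card (D 2) = 1" "card (D 3) = 1" "card (D 4) = 1" "card (D 5) = 1" "sg = K"
    using tot' x y sg \<open>b \<noteq> 0\<close> \<open>z \<noteq> 0\<close> unfolding y_def b_def z_def x_def by linarith+
  have w': "w = NS - 1" using tot w c NS_ge unfolding y_def b_def z_def x_def by linarith
  thus "card S = NS - 1" by (simp add: w_def)
  have PEN: "card Es \<le> card PE" "card PE \<le> NS"
    using card_image_le[OF finite_PE, of fst] card_PE c NSq by (auto simp: Es_PE)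
  have "NS + 1 \<le> card Es + card Ls" using EL c w NS_ge unfolding z_def x_def by linarith
  thus cE: "card Es = NS" and "card PE = NS" and cL: "card Ls = 1"
    using PEN Lb c unfolding b_def by linarith+
  have "card (D 4 \<union> D 5 \<union> S) = NS + 1" using card_D45S c w' NS_ge unfolding w_def by simp
  moreover have "card (D 4 \<union> D 5 \<union> S) \<le> card (Es \<union> Ls)" "card (Es \<union> Ls) + card (Es \<inter> Ls) = card Es + card Ls"
    using card_mono[OF _ U_subset] card_Un_Int[of Es Ls] finite_Es finite_Ls by auto
  ultimately have "card (Es \<inter> Ls) = 0" "card (D 4 \<union> D 5 \<union> S) = card (Es \<union> Ls)" using cE cL by linarith+
  thus "Es \<inter> Ls = {}" "D 4 \<union> D 5 \<union> S = Es \<union> Ls"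
    using card_subset_eq[OF _ U_subset] finite_Es finite_Ls by auto
qed

lemma trigger_unique:
  assumes "card (D r) = 1" "r \<in> traps I" "active I p r i" "a \<in> assets I" "p a i = Some r"
    "active I p r i'" "a' \<in> assets I" "p a' i' = Some r"
  shows "i = i'"
proof -
  have "a \<in> D r" "a' \<in> D r" using assms by (auto simp: dies_def)
  hence "a = a'" using assms(1) by (metis card_1_singletonE singletonD)
  thus ?thesis using kill_time_unique[OF wf v assms(4), of r r i i'] assms by blast
qed

text \<open>A single death means a single trigger, so all visits to the trap lie in the one window
  that starts with this trigger.\<close>

lemma trigger_time:
  assumes "card (D r) = 1" "r \<in> traps I"
  obtains t where "\<And>b j. b \<in> assets I ==> p b j = Some r ==> j = t \<and> b \<in> D r \<or> (b, j) \<in> P r \<and> t < j \<and> j \<le> t + reload I r"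
proof -
  obtain a where "a \<in> D r" using assms(1) by (metis card_1_singletonE insertI1)
  then obtain t where t: "active I p r t" "a \<in> assets I" "p a t = Some r" by (auto simp: dies_def)
  have "j = t \<and> b \<in> D r \<or> (b, j) \<in> P r \<and> t < j \<and> j \<le> t + reload I r"
    if "b \<in> assets I" "p b j = Some r" for b j
  proof (cases "active I p r j")
    case True
    thus ?thesis using trigger_unique[OF assms True that t] that by (auto simp: dies_def)
  next
    case False
    hence p: "(b, j) \<in> P r" using that by (simp add: passes_def)
    then obtain i c where "i < j" "j \<le> i + reload I r" "active I p r i" "c \<in> assets I" "p c i = Some r"
      by (rule pass_trigger)
    moreover from this have "i = t" using trigger_unique[OF assms _ _ _ t] by blast
    ultimately show ?thesis using p by blast
  qed
  thus ?thesis by (rule that)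
qed

text \<open>An asset without a literal pass can only get to the exits through the corridor, one cell
  per round; the bound on its arrival grows with the cell it stands on.\<close>

lemma reach_corridor:
  assumes "a \<in> assets I" "p a j = Some u" "a \<notin> Es" "\<And>i. (a, i) \<in> P 3 ==> t \<le> i"
  shows "u \<in> {0, 2, 3} \<or> (\<exists>l<2 * K. u = lit l) \<or> (\<exists>i<La. u = cor i \<and> t + i < j) \<or>
    (\<exists>j'\<le>j. p a j' = Some 5 \<and> t + La < j')"
  using assms(2)
proof (induction j arbitrary: u)
  case 0
  thus ?case using plan_start[OF wf v assms(1)] by simp
next
  case (Suc j)
  obtain u' where u': "p a j = Some u'" "u' = u \<or> {u', u} \<in> edges I" "u' \<in> traps I ==> (a, j) \<in> P u'"
    using pred_cases[OF assms(1) Suc.prems] by metis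
  from Suc.IH[OF u'(1)] consider "u' = 0" | "u' = 2" | "u' = 3" | l where "l < 2 * K" "u' = lit l" |
    i where "i < La" "u' = cor i" "t + i < j" | "\<exists>j'\<le>j. p a j' = Some 5 \<and> t + La < j'" by blast
  thus ?case
  proof cases
    case 1
    thus ?thesis using u'(2) neighbours(1)[of u] by blast
  next
    case 2
    thus ?thesis using u'(2) neighbours(3)[of u] by blast
  next
    case 3
    hence "t \<le> j" using u'(3) trapsI(2) assms(4) by blast
    hence "u = cor 0 ==> \<exists>i<La. u = cor i \<and> t + i < Suc j" using La_pos by (intro exI[of _ 0]) auto
    thus ?thesis using 3 u'(2) neighbours(4)[of u] by blast
  next
    case 4
    thus ?thesis using u'(3) trapsI(5)[of l] assms(3) unfolding Es_def by blast
  next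
    case 5
    from u'(2) consider "u = cor i" | "u = 3" | "u = 5" "i = La - 1" | i' where "i' < La" "u = cor i'" "i' \<le> i + 1"
      using neighbours(9)[of i u] 5 by fastforce
    thus ?thesis
    proof cases
      case 3
      thus ?thesis using Suc.prems 5 by (intro disjI2 exI[of _ "Suc j"]) auto
    qed (use 5 in auto)
  qed (use le_SucI in blast)
qed

theorem satisfying_assignment:
  "\<exists>\<alpha>. \<forall>j<C. \<exists>l<2 * K. occ l j \<and> (\<alpha> (l div 2) \<longleftrightarrow> even l)"
proof -
  obtain tY where Y': "\<And>b j. b \<in> assets I ==> p b j = Some 2 ==>
      j = tY \<and> b \<in> D 2 \<or> (b, j) \<in> P 2 \<and> tY < j \<and> j \<le> tY + m"
    by (rule trigger_time[OF counts(1) trapsI(1), unfolded reload_I], rule that, blast)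
  have Y: "tY \<le> j \<and> j \<le> tY + m" if "b \<in> assets I" "p b j = Some 2" for b j
    using Y'[OF that] by auto
  obtain tX where X: "\<And>b j. b \<in> assets I ==> p b j = Some 5 ==>
      j = tX \<and> b \<in> D 5 \<or> (b, j) \<in> P 5 \<and> tX < j \<and> j \<le> tX + (NS - 1)"
    by (rule trigger_time[OF counts(4) trapsI(4), unfolded reload_I], rule that, blast)
  obtain tZ where Z: "\<And>b j. b \<in> assets I ==> p b j = Some 4 ==>
      j = tZ \<and> b \<in> D 4 \<or> (b, j) \<in> P 4 \<and> tZ < j \<and> j \<le> tZ + (NS - 1)"
    by (rule trigger_time[OF counts(3) trapsI(3), unfolded reload_I], rule that, blast)
  obtain \<l> where l: "\<l> \<in> Ls" using cards(3) by (metis card_1_singletonE insertI1)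
  \<comment> \<open>The asset \<open>\<l>\<close> passes no literal trap, so it reaches exit 5
    through the corridor, after entering not before \<open>tY\<close> and more than
    \<open>La\<close> rounds in total. As all visits to 5 lie in the window of length
    \<open>NS - 1\<close> after \<open>tX\<close>, the exit cannot have been triggered much
    earlier.\<close>
  have tX: "tY + m + 12 \<le> tX"
  proof -
    have "\<l> \<notin> Es" and "\<l> \<in> D 4 \<union> D 5 \<union> S" using l cards(4,5) by blast+
    then obtain j u where j: "\<l> \<in> assets I" "p \<l> j = Some u" "u \<in> {1, 4, 5}"
      using survivorD by (fastforce simp: dies_def)
    have "tY \<le> i" if "(\<l>, i) \<in> P 3" for i
    proof -
      have "p \<l> i = Some 3" using that by (simp add: passes_def)
      then obtain i' where "i' < i" "(\<l>, i') \<in> P 2" using reach_entrance[OF j(1), of i 3] by auto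
      thus ?thesis using Y[OF j(1), of i'] by (auto simp: passes_def)
    qed
    from reach_corridor[OF j(1,2) \<open>\<l> \<notin> Es\<close> this] j(3)
    obtain j' where "p \<l> j' = Some 5" "tY + La < j'" using NS_ge by (auto simp: lit_def cor_def)
    thus ?thesis using X[OF j(1), of j'] NS_ge by (auto simp: La_def)
  qed
  have noX: "tX \<le> j" if "b \<in> assets I" "p b j = Some 5" for b j using X[OF that] by auto
  \<comment> \<open>There are at most \<open>NS - 1\<close> passes of exit 4, and
    \<open>NS - 1\<close> different assets need one that is followed by a step to 5. So these are
    all the passes, and nobody may step on 4 and turn back.\<close>
  have tight: "p b (Suc i) = Some 5" if "(b, i) \<in> P 4" for b i
  proof -
    have "NS - 1 \<le> card (D 5 \<union> S - Ls)"
      using diff_card_le_card_Diff[OF finite_Ls, of "D 5 \<union> S"] card_D5S counts(4) cards(3,6) NS_ge by linarith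
    define f where "f a = (a, SOME i. (a, i) \<in> P 4 \<and> p a (Suc i) = Some 5)" for a
    have f: "f a \<in> P 4 \<and> p (fst (f a)) (Suc (snd (f a))) = Some 5" if "a \<in> D 5 \<union> S - Ls" for a
    proof -
      obtain i where "(a, i) \<in> P 4 \<and> p a (Suc i) = Some 5" using pass_exit[of a] \<open>a \<in> _\<close> by blast
      thus ?thesis unfolding f_def fst_conv snd_conv
        by (rule someI[of "\<lambda>i. (a, i) \<in> P 4 \<and> p a (Suc i) = Some 5"])
    qed
    have "inj f" by (auto simp: inj_def f_def)
    hence "card (f ` (D 5 \<union> S - Ls)) = card (D 5 \<union> S - Ls)" by (intro card_image inj_on_subset[OF \<open>inj f\<close>]) simp
    moreover have "card (P 4) \<le> NS - 1" using card_passes[OF wf v trapsI(3)] counts(3) reload_I(3) by simp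
    moreover have "finite (P 4)" using finite_passes[OF wf v] trapsI by blast
    ultimately have "f ` (D 5 \<union> S - Ls) = P 4"
      using f \<open>NS - 1 \<le> card (D 5 \<union> S - Ls)\<close> by (intro card_seteq) auto
    hence "(b, i) \<in> f ` (D 5 \<union> S - Ls)" using that by simp
    then obtain a where "a \<in> D 5 \<union> S - Ls" "f a = (b, i)" by (elim imageE) simp
    thus ?thesis using f[of a] by simp
  qed
  \<comment> \<open>The \<open>NS - 1\<close> passes fill the window of exit 4 completely, so one of
    them takes place right after the trigger. It is followed by a step to 5, which is not possible
    before \<open>tX\<close>; hence exit 4 is not triggered before \<open>tX - 2\<close>
    either.\<close>
  have noZ: "tX \<le> j + 2" if "b \<in> assets I" "p b j = Some 4" for b j
  proof -
    have P4: "tX \<le> Suc i" if "(c, i) \<in> P 4" for c i using noX[OF a_less[OF that] tight[OF that]] .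
    have "tX \<le> tZ + 2"
    proof -
      have fin: "finite (P 4)" using finite_passes[OF wf v] trapsI by blast
      have "inj_on snd (P 4)" using plan_distinct[OF wf v] unfolding passes_def inj_on_def by auto
      hence "card (snd ` P 4) = card (P 4)" by (rule card_image)
      moreover have "NS - 1 \<le> card (P 4)" using card_exit card_D5S counts(4) cards(3,6) NS_ge by linarith
      moreover have "snd ` P 4 \<subseteq> {tZ<..tZ + (NS - 1)}"
      proof
        fix i assume "i \<in> snd ` P 4"
        then obtain c where c: "(c, i) \<in> P 4" by auto
        hence na: "\<not> active I p 4 i" "p c i = Some 4" by (auto simp: passes_def)
        show "i \<in> {tZ<..tZ + (NS - 1)}"
        proof (cases "i = tZ \<and> c \<in> D 4")
          case True
          then obtain i' where "active I p 4 i'" "p c i' = Some 4" by (auto simp: dies_def)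
          thus ?thesis using Z[OF a_less[OF c], of i'] na True by (auto simp: passes_def)
        next
          case False
          thus ?thesis using Z[OF a_less[OF c] na(2)] by auto
        qed
      qed
      ultimately have "snd ` P 4 = {tZ<..tZ + (NS - 1)}" by (intro card_seteq) auto
      moreover have "Suc tZ \<in> {tZ<..tZ + (NS - 1)}" using NS_ge by auto
      ultimately obtain c where "(c, Suc tZ) \<in> P 4" by force
      thus ?thesis using P4 by fastforce
    qed
    thus ?thesis using Z[OF that] P4[of b j] by auto
  qed
  \<comment> \<open>The entrance can be crossed until \<open>tY + m\<close>; one more round leads to
    a literal trap and another one to a slot.\<close>
  define T where "T = tY + m + 2"
  have T: "T + 10 \<le> tX" using tX by (simp add: T_def)
  \<comment> \<open>Both \<open>Es\<close> and \<open>PE\<close> have \<open>NS\<close> elements, so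
    no asset can afford a second pass of a literal trap.\<close>
  have uniq: "i = i'" if "(a, i) \<in> P (lit l)" "l < 2 * K" "(a, i') \<in> P (lit l')" "l' < 2 * K" for a i i' l l'
  proof -
    have "inj_on fst PE" using cards(1,2) finite_PE unfolding Es_PE by (intro eq_card_imp_inj_on) auto
    moreover have "(a, i) \<in> PE" "(a, i') \<in> PE" using that by (auto simp: PE_def)
    ultimately have "(a, i) = (a, i')" by (intro inj_onD[of fst PE]) simp_all
    thus ?thesis by simp
  qed
  have slot_lit: "\<exists>l<2 * K. adj l i \<and> (\<exists>j'<j. (a, j') \<in> P (lit l))"
    if aA: "a \<in> assets I" and jT: "p a j = Some (slot i)" "j \<le> T" and iN: "i < NS" for a i j
    using jT
  proof (induction j)
    case 0
    thus ?case using plan_start[OF wf v aA] by (simp add: slot_def)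
  next
    case (Suc j)
    obtain u' where u': "p a j = Some u'" "u' = slot i \<or> {u', slot i} \<in> edges I" "u' \<in> traps I ==> (a, j) \<in> P u'"
      using pred_cases[OF aA Suc.prems(1)] by metis
    have "u' \<noteq> 4" using noZ[OF aA, of j] u'(1) T Suc.prems(2) by auto
    then consider "u' = slot i" | l where "l < 2 * K" "adj l i" "u' = lit l" using u'(2) N_slot[OF _ iN] by blast
    thus ?case
    proof cases
      case 1
      then obtain l j' where "l < 2 * K" "adj l i" "j' < j" "(a, j') \<in> P (lit l)" using Suc u'(1) by auto
      thus ?thesis using less_SucI by blast
    next
      case 2
      thus ?thesis using u'(3) trapsI(5) by blast
    qed
  qed
  \<comment> \<open>All other places are excluded at time \<open>T\<close>: the source and the
    entrance because the entrance is closed by then, trap 3 because passing it would put the asset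
    into \<open>Ls\<close>, exit 4 by \<open>noZ\<close>, and a literal trap because the asset would
    then need a second pass or a later visit to the entrance.\<close>
  have parked: "\<exists>i<NS. p a T = Some (slot i)" if a: "a \<in> Es" for a
  proof -
    obtain i0 l0 where i0: "(a, i0) \<in> P (lit l0)" "l0 < 2 * K" using a by (auto simp: Es_def)
    have aI: "a \<in> assets I" using a_less[OF i0(1)] .
    have nL: "\<And>i. (a, i) \<notin> P 3" using a cards(4) by (auto simp: Ls_def)
    have "p a i0 = Some (lit l0)" using i0 by (simp add: passes_def)
    then obtain i2 where "(a, i2) \<in> P 2" using reach_entrance[OF aI, of i0 "lit l0"] by (auto simp: lit_def)
    hence i2: "p a i2 = Some 2" by (simp add: passes_def)
    have alive: "p a j \<noteq> None" if "j < T + 8" for j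
    proof
      assume None: "p a j = None"
      have "a \<in> D 4 \<union> D 5 \<union> S" using a cards(5) by blast
      then obtain i u where i: "p a i = Some u" "u \<in> {1, 4, 5}" using survivorD by (fastforce simp: dies_def)
      have "i < j" using plan_None[OF wf v aI None, of i] i(1) by (cases "j \<le> i") simp_all
      moreover have "tX \<le> i + 2"
      proof -
        consider "u = 1" | "u = 4" | "u = 5" using i(2) by blast
        thus ?thesis
        proof cases
          case 1
          then obtain i' where "i' < i" "p a i' = Some 5" using reach_target[OF aI, of i] i(1) by (auto simp: passes_def)
          thus ?thesis using noX[OF aI, of i'] by simp
        next
          case 2
          thus ?thesis using noZ[OF aI, of i] i(1) by simp
        next
          case 3
          thus ?thesis using noX[OF aI, of i] i(1) by simp
        qed
      qed
      ultimately show False using that T by linarith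
    qed
    obtain u where u: "p a T = Some u" using alive[of T] by auto
    have early: False if "(a, i) \<in> P 4" "i < T" for i
      using noZ[OF aI, of i] that T by (auto simp: passes_def)
    from reach_exit[OF aI u nL] early consider "u = 0" | "u = 2" | "u = 3" | "u = 4" |
      l where "l < 2 * K" "u = lit l" | i where "i < NS" "u = slot i" by blast
    thus ?thesis
    proof cases
      case 1
      have "i2 \<le> T" using Y[OF aI i2] by (simp add: T_def)
      thus ?thesis using plan_source_le[OF wf v aI, of T i2] u 1 i2 by simp
    next
      case 2
      thus ?thesis using Y[OF aI, of T] u by (simp add: T_def)
    next
      case 3
      thus ?thesis using pass[OF aI trapsI(2), of T "Suc T"] u alive[of "Suc T"] nL by auto
    next
      case 4
      thus ?thesis using noZ[OF aI, of T] u T by auto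
    next
      case 5
      have p: "(a, T) \<in> P (lit l)" using pass[OF aI trapsI(5)[OF 5(1)], of T "Suc T"] u alive[of "Suc T"] 5 by auto
      have sT: "T = Suc (tY + m + 1)" by (simp add: T_def)
      obtain u' where u': "p a (tY + m + 1) = Some u'" "u' = lit l \<or> {u', lit l} \<in> edges I"
          "u' \<in> traps I ==> (a, tY + m + 1) \<in> P u'"
        using pred_cases[OF aI, of "tY + m + 1" "lit l"] u 5 sT by metis
      from u'(2) N_lit[OF _ 5(1)] consider "u' = lit l" | "u' = 2" | i where "i < NS" "u' = slot i" by blast
      hence False
      proof cases
        case 1
        thus ?thesis using uniq[OF p 5(1), of "tY + m + 1" l] u'(3) trapsI(5) 5(1) by (simp add: T_def)
      next
        case 2
        thus ?thesis using Y[OF aI, of "tY + m + 1"] u'(1) by simp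
      next
        case 3
        then obtain l' j' where "l' < 2 * K" "j' < tY + m + 1" "(a, j') \<in> P (lit l')"
          using slot_lit[OF aI, of "tY + m + 1" i] u'(1) by (auto simp: T_def)
        thus ?thesis using uniq[OF p 5(1), of j' l'] by (simp add: T_def)
      qed
      thus ?thesis ..
    qed (use u in blast)
  qed
  define R where "R = {l. l < 2 * K \<and> D (lit l) \<noteq> {}}"
  have R: "\<exists>l\<in>R. adj l i" if "i < NS" for i
  proof -
    \<comment> \<open>Different parked assets occupy different slots, and there are as many of them
      as slots. Hence every slot is filled and has an opened literal next to it.\<close>
    define g where "g a = (SOME i. i < NS \<and> p a T = Some (slot i))" for a
    have g: "g a < NS \<and> p a T = Some (slot (g a))" if "a \<in> Es" for a
      using someI_ex[OF parked[OF that]] by (simp add: g_def)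
    have EsI: "Es \<subseteq> assets I" unfolding Es_def using a_less by blast
    have "inj_on g Es"
    proof
      fix a b assume "a \<in> Es" "b \<in> Es" "g a = g b"
      moreover from this have "a \<in> assets I" "b \<in> assets I" using EsI by blast+
      ultimately show "a = b" using g[of a] g[of b] plan_distinct[OF wf v, of a b T "slot (g a)"] by (auto simp: slot_def)
    qed
    hence "g ` Es = {..<NS}"
      using g cards(1) by (intro card_seteq) (auto simp: card_image)
    hence "i \<in> g ` Es" using \<open>i < NS\<close> by simp
    then obtain a where a: "a \<in> Es" "i = g a" by blast
    then obtain l j where "l < 2 * K" "adj l i" "(a, j) \<in> P (lit l)"
      using slot_lit[of a T i] g[of a] EsI by blast
    thus ?thesis unfolding R_def using pass_dies by blast
  qed
  have finR: "finite R" by (simp add: R_def)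
  have "card R \<le> K"
  proof -
    have "card R = (\<Sum>l\<in>R. 1)" by simp
    also have "\<dots> \<le> (\<Sum>l\<in>R. card (D (lit l)))"
      using finite_dies[OF wf v] by (intro sum_mono) (auto simp: R_def card_gt_0_iff Suc_le_eq)
    also have "\<dots> \<le> sg" unfolding sg_def by (rule sum_mono2) (auto simp: R_def)
    finally show ?thesis using counts(5) by simp
  qed
  \<comment> \<open>The variable slots require an opened literal for every variable; as at most
    \<open>K\<close> literals are opened, there is exactly one per variable.\<close>
  moreover have "{..<K} \<subseteq> (\<lambda>l. l div 2) ` R"
  proof
    fix i assume "i \<in> {..<K}"
    hence "i < K" "i < NS" using NS_ge by auto
    thus "i \<in> (\<lambda>l. l div 2) ` R" using R[of i] by (auto simp: adj_def)
  qed
  ultimately have "card ((\<lambda>l. l div 2) ` R) = card R"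
    using card_mono[of "(\<lambda>l. l div 2) ` R" "{..<K}"] card_image_le[OF finR, of "\<lambda>l. l div 2"] finR by auto
  hence injR: "inj_on (\<lambda>l. l div 2) R" using finR by (intro eq_card_imp_inj_on) auto
  define \<alpha> where "\<alpha> i = (2 * i \<in> R)" for i
  have "\<exists>l<2 * K. occ l j \<and> (\<alpha> (l div 2) \<longleftrightarrow> even l)" if "j < C" for j
  proof -
    obtain l where l: "l \<in> R" "adj l (K + j)" using R[of "K + j"] \<open>j < C\<close> NS_ge by auto
    have "\<alpha> (l div 2) \<longleftrightarrow> even l"
    proof
      assume "\<alpha> (l div 2)"
      hence "2 * (l div 2) = l" using inj_onD[OF injR, of "2 * (l div 2)" l] l(1) by (simp add: \<alpha>_def)
      thus "even l" by (metis dvd_triv_left)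
    qed (use l(1) in \<open>auto simp: \<alpha>_def\<close>)
    thus ?thesis using l that by (auto simp: adj_def R_def)
  qed
  thus ?thesis by blast
qed

end

section \<open>A satisfying assignment yields a plan\<close>

lemma ex_length:
  assumes "\<And>a. a \<in> assets I ==> finished I (p a n)" "a \<in> assets I" "\<not> finished I (p a 0)"
  shows "\<exists>n. has_length I p n"
proof -
  define k where "k = (LEAST k. \<forall>a\<in>assets I. finished I (p a k))"
  have k: "\<forall>a\<in>assets I. finished I (p a k)" unfolding k_def by (rule LeastI[of _ n]) (use assms(1) in blast)
  have "k \<noteq> 0"
  proof
    assume "k = 0"
    thus False using k assms(2,3) by blast
  qed
  moreover have "\<not> (\<forall>a\<in>assets I. finished I (p a (k - 1)))"
    using not_less_Least[of "k - 1" "\<lambda>k. \<forall>a\<in>assets I. finished I (p a k)"] \<open>k \<noteq> 0\<close> unfolding k_def by simp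
  ultimately show ?thesis using k unfolding has_length_def by (intro exI[of _ k]) auto
qed

text \<open>For an explicit plan this replaces the recursion of \<open>active\<close>: if all visits
  to a trap fit into the window opened at time \<open>i\<close>, the only visits that find it active
  are those at time \<open>i\<close>.\<close>

lemma active_window:
  assumes "\<And>a j. a \<in> assets I ==> p a j = Some r ==> i \<le> j \<and> j \<le> i + reload I r"
    and "a \<in> assets I" "p a i = Some r" "b \<in> assets I" "p b j = Some r"
  shows "active I p r j \<longleftrightarrow> j = i"
proof -
  have i: "active I p r i"
    using assms(1) by (subst active.simps) fastforce
  show ?thesis
  proof
    assume "active I p r j"
    thus "j = i" using assms(1)[OF assms(4,5)] activeD[of I p r j i a] i assms(2,3) by (cases "i < j") auto
  qed (use i in simp)
qed

locale gadget_sat = gadget +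
  fixes al :: "nat => bool"
  assumes sat: "\<And>j. j < C ==> \<exists>l<2 * K. occ l j \<and> (al (l div 2) \<longleftrightarrow> even l)"
begin

definition lam :: "nat => nat" where "lam i = (if al i then 2 * i else 2 * i + 1)"

definition wit :: "nat => nat" where "wit j = (SOME i. i < K \<and> occ (lam i) j)"

lemma wit: "j < C ==> wit j < K \<and> occ (lam (wit j)) j"
proof -
  assume "j < C"
  then obtain l where l: "l < 2 * K" "occ l j" "al (l div 2) \<longleftrightarrow> even l" using sat by blast
  hence "lam (l div 2) = l" by (auto simp: lam_def)
  hence "\<exists>i. i < K \<and> occ (lam i) j" using l by (intro exI[of _ "l div 2"]) auto
  thus ?thesis unfolding wit_def by (rule someI_ex)
qed

lemma lam_div: "lam i div 2 = i" by (simp add: lam_def)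
lemma lam_less: "i < K ==> lam i < 2 * K" by (simp add: lam_def)

text \<open>
  Token \<open>e\<close> belongs to the variable \<open>e div q\<close>. The first token of a group fills the slot of the
  variable; of the \<open>K\<close> slots provided for clause \<open>j\<close>, the one that stands for the clause itself
  goes to the group of the literal that makes the clause true.
\<close>

definition swap0 :: "nat => nat => nat" where
  "swap0 i g = (if g = i then 0 else if g = 0 then i else g)"

definition si :: "nat => nat" where
  "si e = (if e mod q = 0 then e div q
     else K + swap0 (wit (e mod q - 1)) (e div q) * C + (e mod q - 1))"

lemma block_divmod: "y < n ==> (x * n + y) div n = x \<and> (x * n + y) mod n = (y :: nat)"
  by simp

lemma NS_eq: "NS = K + K * C" by (simp add: NS_def q_def)

lemma e_split: "e < NS ==> e div q < K \<and> e mod q \<le> C"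
  using q_ge by (auto simp: NS_def q_def less_mult_imp_div_less mod_Suc_le_divisor)

lemma block_less: "h < K ==> j < C ==> h * C + j < K * C"
proof -
  assume "h < K" "j < C"
  hence "h * C + j < (h + 1) * C" by simp
  also have "\<dots> \<le> K * C" using \<open>h < K\<close> by (intro mult_le_mono1) simp
  finally show ?thesis .
qed

lemma si_bounds: assumes "e < NS" shows "si e < NS" "adj (lam (e div q)) (si e)"
proof -
  let ?g = "e div q" and ?j = "e mod q - 1"
  have g: "?g < K" "e mod q \<le> C" using e_split[OF assms] by auto
  have "si e < NS \<and> adj (lam ?g) (si e)"
  proof (cases "e mod q = 0")
    case True
    thus ?thesis using g NS_ge by (auto simp: si_def adj_def lam_div)
  next
    case False
    define h where "h = swap0 (wit ?j) ?g"
    have j: "?j < C" using False g by linarith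
    hence hK: "h < K" using g wit[of ?j] by (auto simp: h_def swap0_def)
    have s: "si e = K + h * C + ?j" using False by (simp add: si_def h_def)
    have "h = 0 \<longleftrightarrow> ?g = wit ?j" by (auto simp: h_def swap0_def)
    moreover have "h * C + ?j < C ==> h = 0" by (cases h) auto
    ultimately have "adj (lam ?g) (si e)" using wit[OF j] j unfolding s adj_def by auto
    thus ?thesis using block_less[OF hK j] by (simp add: s NS_eq)
  qed
  thus "si e < NS" "adj (lam (e div q)) (si e)" by auto
qed

lemma block_inj: "h * C + j = h' * C + j' ==> j < C ==> j' < C ==> h = h' \<and> j = j'"
proof -
  assume *: "h * C + j = h' * C + j'" "j < C" "j' < C"
  thus ?thesis using block_divmod[OF *(2), of h] block_divmod[OF *(3), of h'] by metis
qed

lemma si_inj: assumes "e < NS" "e' < NS" "si e = si e'" shows "e = e'"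
proof -
  have g: "e div q < K" "e mod q \<le> C" "e' div q < K" "e' mod q \<le> C" using e_split assms by auto
  have "e div q = e' div q \<and> e mod q = e' mod q"
  proof (cases "e mod q = 0 \<or> e' mod q = 0")
    case True
    thus ?thesis using assms(3) g by (auto simp: si_def split: if_splits)
  next
    case False
    hence j: "e mod q - 1 < C" "e' mod q - 1 < C" using g by linarith+
    have "swap0 (wit (e mod q - 1)) (e div q) * C + (e mod q - 1) =
        swap0 (wit (e' mod q - 1)) (e' div q) * C + (e' mod q - 1)"
    proof -
      have "si e = K + (swap0 (wit (e mod q - 1)) (e div q) * C + (e mod q - 1))"
        "si e' = K + (swap0 (wit (e' mod q - 1)) (e' div q) * C + (e' mod q - 1))"
        using False by (simp_all add: si_def)
      thus ?thesis using assms(3) by linarith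
    qed
    from block_inj[OF this j] have *: "e mod q - 1 = e' mod q - 1"
      "swap0 (wit (e mod q - 1)) (e div q) = swap0 (wit (e' mod q - 1)) (e' div q)" by auto
    from *(1) have "e mod q = e' mod q" using False by linarith
    thus ?thesis using *(2) by (auto simp: swap0_def split: if_splits)
  qed
  thus ?thesis by (metis div_mult_mod_eq)
qed

text \<open>
  Asset \<open>a\<close> enters at time \<open>a + 1\<close>. Every group of \<open>q + 1\<close> assets opens a literal trap and sends
  \<open>q\<close> tokens to their slots; the last asset opens the exit 5 at time \<open>T\<close> through the corridor.
\<close>

definition grp :: "nat => nat" where "grp a = (a - 1) div (q + 1)"
definition off :: "nat => nat" where "off a = (a - 1) mod (q + 1)"
definition tok :: "nat => nat" where "tok a = grp a * q + (off a - 1)"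
definition istok :: "nat => bool" where "istok a \<longleftrightarrow> 1 \<le> a \<and> a + 2 < m \<and> off a \<noteq> 0"
definition T :: nat where "T = m + 2 + La"

text \<open>The timetable: asset 0 dies at the entrance, asset \<open>m - 2\<close> at trap 3, and
  asset \<open>m - 1\<close> takes the corridor and dies on exit 5 at time \<open>T\<close>. Token
  \<open>e\<close> stands on exit 4 at time \<open>T + e - 1\<close> and, if it is not token 0, on
  exit 5 at time \<open>T + e\<close>. Token 0 dies on exit 4 one round before exit 5 is opened, so
  the others follow in an unbroken column.\<close>

definition pos :: "nat => nat => nat option" where
  "pos a j =
    (if j \<le> a then Some 0 else if j = a + 1 then Some 2 else if a = 0 then None
     else if j = a + 2 then Some (if a + 2 < m then lit (lam (grp a)) else 3)
     else if istok a then
       (if j + 1 < T + tok a then Some (slot (si (tok a))) else if j + 1 = T + tok a then Some 4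
        else if tok a = 0 then None else if j = T + tok a then Some 5 else Some 1)
     else if a + 1 = m then (if j < T then Some (cor (j - (m + 2))) else if j = T then Some 5 else None)
     else None)"

lemma m_eq: "m = K * (q + 1) + 3" by (simp_all add: m_def NS_def)

lemma grp_off: assumes "1 \<le> a" "a + 2 < m"
  shows "grp a < K" "off a \<le> q" "a = grp a * (q + 1) + off a + 1"
proof -
  have "a - 1 < K * (q + 1)" using assms unfolding m_eq by linarith
  thus "grp a < K" unfolding grp_def by (rule less_mult_imp_div_less)
  show "off a \<le> q" unfolding off_def by (metis Suc_eq_plus1 less_Suc_eq_le mod_less_divisor zero_less_Suc)
  show "a = grp a * (q + 1) + off a + 1"
    using div_mult_mod_eq[of "a - 1" "q + 1"] assms unfolding grp_def off_def by linarith
qed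

lemma tok_props: assumes "istok a" shows "tok a div q = grp a" "tok a mod q = off a - 1" "tok a < NS"
proof -
  have *: "off a - 1 < q" "grp a < K" using grp_off[of a] assms q_ge unfolding istok_def by linarith+
  thus "tok a div q = grp a" "tok a mod q = off a - 1" by (simp_all add: tok_def)
  have "tok a < (grp a + 1) * q" using * by (simp add: tok_def)
  also have "\<dots> \<le> K * q" using * by (intro mult_le_mono1) simp
  finally show "tok a < NS" by (simp add: NS_def)
qed

lemma tok_inj: assumes "istok a" "istok b" "tok a = tok b" shows "a = b"
proof -
  have "grp a = grp b" "off a - 1 = off b - 1" using tok_props[OF assms(1)] tok_props[OF assms(2)] assms(3) by auto
  moreover have "off a \<noteq> 0" "off b \<noteq> 0" using assms by (auto simp: istok_def)
  ultimately have "grp a = grp b" "off a = off b" by linarith+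
  thus ?thesis using grp_off(3)[of a] grp_off(3)[of b] assms unfolding istok_def by metis
qed

text \<open>The inverse of \<open>tok\<close>. The offset 2 accounts for asset 0 and for the victim
  that leads the group.\<close>

definition ast :: "nat => nat" where "ast e = (e div q) * (q + 1) + e mod q + 2"

lemma ast: assumes "e < NS" shows "istok (ast e)" "tok (ast e) = e" "ast e < m"
proof -
  have e: "e div q < K" "e mod q < q" using e_split[OF assms] q_ge by auto
  have a1: "ast e - 1 = (e div q) * (q + 1) + (e mod q + 1)" by (simp add: ast_def)
  have g: "grp (ast e) = e div q" "off (ast e) = e mod q + 1"
    unfolding grp_def off_def a1 using block_divmod[of "e mod q + 1" "q + 1" "e div q"] e(2) by simp_all
  have "(e div q + 1) * (q + 1) = (e div q) * (q + 1) + (q + 1)" by simp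
  hence "ast e - 1 < (e div q + 1) * (q + 1)" unfolding a1 using e(2) by linarith
  also have "\<dots> \<le> K * (q + 1)" using e by (intro mult_le_mono1) simp
  finally have "ast e + 2 < m" unfolding m_eq by linarith
  thus "istok (ast e)" "ast e < m" using g by (auto simp: istok_def ast_def)
  show "tok (ast e) = e" unfolding tok_def g by simp
qed

lemma vertex_neq [simp]:
  "lit l \<noteq> 0" "lit l \<noteq> Suc 0" "lit l \<noteq> 2" "lit l \<noteq> 3" "lit l \<noteq> 4" "lit l \<noteq> 5"
  "slot i \<noteq> 0" "slot i \<noteq> Suc 0" "slot i \<noteq> 2" "slot i \<noteq> 3" "slot i \<noteq> 4" "slot i \<noteq> 5"
  "cor c \<noteq> 0" "cor c \<noteq> Suc 0" "cor c \<noteq> 2" "cor c \<noteq> 3" "cor c \<noteq> 4" "cor c \<noteq> 5"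
  "lit l = lit l' \<longleftrightarrow> l = l'" "slot i = slot i' \<longleftrightarrow> i = i'" "cor c = cor c' \<longleftrightarrow> c = c'"
  "l < 2 * K ==> lit l \<noteq> slot i" "l < 2 * K ==> lit l \<noteq> cor c" "i < NS ==> slot i \<noteq> cor c"
  "0 < lit l" "0 < slot i" "0 < cor c" "Suc 0 \<noteq> lit l" "Suc 0 \<noteq> slot i" "Suc 0 \<noteq> cor c"
  "2 \<noteq> lit l" "3 \<noteq> lit l" "4 \<noteq> lit l" "5 \<noteq> lit l" "2 \<noteq> slot i" "3 \<noteq> slot i" "4 \<noteq> slot i" "5 \<noteq> slot i"
  "2 \<noteq> cor c" "3 \<noteq> cor c" "4 \<noteq> cor c" "5 \<noteq> cor c"
  "l < 2 * K ==> slot i \<noteq> lit l" "l < 2 * K ==> cor c \<noteq> lit l" "i < NS ==> cor c \<noteq> slot i"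
  by (simp_all add: vdefs)

lemma T_gt: "m + NS + 10 < T" by (simp add: T_def La_def)
lemma m_ge: "8 \<le> m" using NS_ge K by (simp add: m_def)
lemma istok_less: "istok a ==> 1 \<le> a \<and> a + 2 < m" by (simp add: istok_def)

lemma slot_ge: "6 \<le> slot i" by (simp add: slot_def)
text \<open>The timetable is read vertex by vertex here and below. Validity of the plan can then be
  checked by cases on the vertex, with the times of its visitors at hand.\<close>

lemma at_0: "a < m ==> pos a j = Some 0 \<longleftrightarrow> j \<le> a"
  using m_ge by (auto simp: pos_def)
lemma at_1: "a < m ==> pos a j = Some 1 \<longleftrightarrow> istok a \<and> tok a \<noteq> 0 \<and> T + tok a < j"
  using m_ge T_gt istok_less[of a] slot_ge[of "si (tok a)"] by (auto simp: pos_def)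
lemma at_2: "a < m ==> pos a j = Some 2 \<longleftrightarrow> j = a + 1"
  using m_ge by (auto simp: pos_def)
lemma at_3: "a < m ==> pos a j = Some 3 \<longleftrightarrow> m \<le> a + 2 \<and> j = a + 2"
  using m_ge istok_less[of a] by (auto simp: pos_def)
lemma at_4: "a < m ==> pos a j = Some 4 \<longleftrightarrow> istok a \<and> j + 1 = T + tok a"
  using m_ge T_gt istok_less[of a] by (auto simp: pos_def)
lemma at_5: "a < m ==> pos a j = Some 5 \<longleftrightarrow> istok a \<and> tok a \<noteq> 0 \<and> j = T + tok a \<or> a + 1 = m \<and> j = T"
  using m_ge T_gt istok_less[of a] by (auto simp: pos_def)
lemma at_lit: "a < m ==> l < 2 * K ==> pos a j = Some (lit l) \<longleftrightarrow> 1 \<le> a \<and> a + 2 < m \<and> j = a + 2 \<and> l = lam (grp a)"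
  using m_ge istok_less[of a] by (auto simp: pos_def)
lemma at_slot: "a < m ==> i < NS ==> pos a j = Some (slot i) \<longleftrightarrow> istok a \<and> i = si (tok a) \<and> a + 3 \<le> j \<and> j + 1 < T + tok a"
  using m_ge istok_less[of a] lam_less[of "grp a"] grp_off[of a] T_gt by (auto simp: pos_def)
lemma at_cor: "a < m ==> i < La ==> pos a j = Some (cor i) \<longleftrightarrow> a + 1 = m \<and> j = m + 2 + i"
  using m_ge istok_less[of a] lam_less[of "grp a"] grp_off[of a] T_gt si_bounds[of "tok a"] tok_props[of a]
  by (auto simp: pos_def T_def)
lemma at_None: "a < m ==> pos a j = None \<longleftrightarrow> a + 2 \<le> j \<and> (a = 0 \<or> a + 3 \<le> j \<and>
    (if istok a then tok a = 0 \<and> T \<le> j else a + 1 = m --> T < j))"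
  using m_ge T_gt istok_less[of a] by (auto simp: pos_def)

lemma pos_cases:
  assumes "a < m"
  obtains "pos a j = None" | u where "pos a j = Some u" "u < cor La"
proof (cases "pos a j")
  case (Some u)
  have "istok a ==> slot (si (tok a)) < cor La" using si_bounds[of "tok a"] tok_props[of a] by (simp add: vdefs)
  moreover have "lit (lam (grp a)) < cor La" if "1 \<le> a" "a + 2 < m" using lam_less[OF grp_off(1)[OF that]] by (simp add: vdefs)
  ultimately have "u < cor La" using Some m_ge La_pos assms by (auto simp: pos_def vdefs T_def split: if_splits)
  thus ?thesis using that(2) Some by blast
qed (use that in blast)

lemma active_2: "a < m ==> pos a j = Some 2 ==> active I pos 2 j \<longleftrightarrow> j = 1"
  by (rule active_window[where a = 0]) (use m_ge in \<open>auto simp: at_2 reload_I\<close>)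
lemma active_3: "a < m ==> pos a j = Some 3 ==> active I pos 3 j \<longleftrightarrow> j = m"
  by (rule active_window[where a = "m - 2"]) (use m_ge in \<open>auto simp: at_3 reload_I\<close>)
lemma active_4: "a < m ==> pos a j = Some 4 ==> active I pos 4 j \<longleftrightarrow> j = T - 1"
proof (rule active_window[where a = "ast 0" and b = a])
  have z: "0 < NS" using NS_ge by simp
  show "ast 0 \<in> assets I" "pos (ast 0) (T - 1) = Some 4"
    using ast[OF z] at_4[of "ast 0" "T - 1"] T_gt by auto
  show "T - 1 \<le> j \<and> j \<le> T - 1 + reload I 4" if "a \<in> assets I" "pos a j = Some 4" for a j
    using that at_4[of a j] tok_props(3)[of a] T_gt by (auto simp: reload_I)
qed auto
lemma active_5: "a < m ==> pos a j = Some 5 ==> active I pos 5 j \<longleftrightarrow> j = T"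
proof (rule active_window[where a = "m - 1" and b = a])
  show "m - 1 \<in> assets I" "pos (m - 1) T = Some 5"
    using at_5[of "m - 1" T] m_ge by auto
  show "T \<le> j \<and> j \<le> T + reload I 5" if "a \<in> assets I" "pos a j = Some 5" for a j
    using that at_5[of a j] tok_props(3)[of a] NS_ge by (auto simp: reload_I)
qed auto
text \<open>Different groups use different literals because \<open>lam\<close> keeps the variable.
  Within a group the leader comes first, and the following \<open>q\<close> assets arrive in the
  next \<open>q\<close> rounds, which is the reload time.\<close>

lemma active_lit:
  assumes "a < m" "l < 2 * K" "pos a j = Some (lit l)"
  shows "active I pos (lit l) j \<longleftrightarrow> off a = 0"
proof -
  have a: "1 \<le> a" "a + 2 < m" "j = a + 2" "l = lam (grp a)" using at_lit[OF assms(1,2)] assms(3) by auto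
  define b where "b = grp a * (q + 1) + 1"
  have b: "b \<le> a" "a \<le> b + q" "a = b \<longleftrightarrow> off a = 0" using grp_off[OF a(1,2)] unfolding b_def by linarith+
  have "active I pos (lit l) j \<longleftrightarrow> j = b + 2"
  proof (rule active_window[where a = b and b = a])
    show "b + 2 \<le> j' \<and> j' \<le> b + 2 + reload I (lit l)" if "a' \<in> assets I" "pos a' j' = Some (lit l)" for a' j'
    proof -
      have a': "1 \<le> a'" "a' + 2 < m" "j' = a' + 2" "lam (grp a') = lam (grp a)"
        using at_lit[OF _ assms(2)] that a(4) by auto
      hence "grp a' = grp a" using lam_div by metis
      thus ?thesis using grp_off[OF a'(1,2)] a'(3) reload_I(5)[OF assms(2)] unfolding b_def by auto
    qed
    have "grp b = grp a" using block_divmod[of 0 "q + 1" "grp a"] unfolding b_def grp_def[of "_ + 1"] by simp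
    thus "pos b (b + 2) = Some (lit l)" using at_lit[OF _ assms(2), of b "b + 2"] a b assms(1) by (auto simp: b_def)
  qed (use b assms in auto)
  thus ?thesis using b a by auto
qed

lemma edgeI: "(u, v) \<in> set es \<or> (v, u) \<in> set es ==> {u, v} \<in> edges I"
  by (simp only: edge_iff)

lemma pos_move:
  assumes a: "a < m" and p: "pos a (Suc j) = Some w"
  shows "pos a j = Some w \<or> (\<exists>u. pos a j = Some u \<and> {u, w} \<in> edges I)"
proof -
  have "w < cor La" using pos_cases[OF a, of "Suc j"] p by auto
  thus ?thesis
  proof (cases rule: verts_cases)
    case 1
    thus ?thesis using p at_0[OF a] by auto
  next
    case 2
    hence t: "istok a" "tok a \<noteq> 0" "T + tok a \<le> j" using p at_1[OF a] by auto
    show ?thesis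
    proof (cases "j = T + tok a")
      case True
      hence "pos a j = Some 5" using at_5[OF a] t by auto
      thus ?thesis using 2 by (auto intro!: edgeI simp: set_es)
    next
      case False
      thus ?thesis using 2 t at_1[OF a] by auto
    qed
  next
    case 3
    hence "j = a" using p at_2[OF a] by auto
    hence "pos a j = Some 0" using at_0[OF a] by auto
    thus ?thesis using 3 by (auto intro!: edgeI simp: set_es)
  next
    case 4
    hence "j = a + 1" using p at_3[OF a] by auto
    hence "pos a j = Some 2" using at_2[OF a] by auto
    thus ?thesis using 4 by (auto intro!: edgeI simp: set_es)
  next
    case 5
    hence t: "istok a" "Suc j + 1 = T + tok a" using p at_4[OF a] by auto
    have s: "si (tok a) < NS" using si_bounds tok_props(3)[OF t(1)] by blast
    have "pos a j = Some (slot (si (tok a)))" using at_slot[OF a s] t T_gt a by auto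
    thus ?thesis using 5 s by (auto intro!: edgeI simp: set_es)
  next
    case 6
    then consider "istok a" "tok a \<noteq> 0" "Suc j = T + tok a" | "a + 1 = m" "Suc j = T" using p at_5[OF a] by auto
    thus ?thesis
    proof cases
      case 1
      hence "pos a j = Some 4" using at_4[OF a] by auto
      thus ?thesis using 6 by (auto intro!: edgeI simp: set_es)
    next
      case 2
      hence "pos a j = Some (cor (La - 1))" using at_cor[OF a, of "La - 1" j] La_pos by (auto simp: T_def)
      thus ?thesis using 6 by (auto intro!: edgeI simp: set_es)
    qed
  next
    case (7 l)
    hence "j = a + 1" using p at_lit[OF a] by auto
    hence "pos a j = Some 2" using at_2[OF a] by auto
    thus ?thesis using 7 by (auto intro!: edgeI simp: set_es)
  next
    case (8 i)
    hence t: "istok a" "i = si (tok a)" "a + 3 \<le> Suc j" "Suc j + 1 < T + tok a" using p at_slot[OF a] by auto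
    show ?thesis
    proof (cases "j = a + 2")
      case True
      have g: "1 \<le> a" "a + 2 < m" using istok_less[OF t(1)] by auto
      have l: "lam (grp a) < 2 * K" using lam_less grp_off(1)[OF g] by blast
      have "pos a j = Some (lit (lam (grp a)))" using at_lit[OF a l] g True by auto
      moreover have "adj (lam (grp a)) i" using si_bounds(2)[OF tok_props(3)[OF t(1)]] tok_props(1)[OF t(1)] t(2) by simp
      ultimately show ?thesis using 8 l by (auto intro!: edgeI simp: set_es)
    next
      case False
      thus ?thesis using at_slot[OF a 8(1), of j] t 8 by auto
    qed
  next
    case (9 i)
    hence t: "a + 1 = m" "Suc j = m + 2 + i" using p at_cor[OF a] by auto
    show ?thesis
    proof (cases i)
      case 0
      hence "pos a j = Some 3" using at_3[OF a] t m_ge by auto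
      thus ?thesis using 9 0 by (auto intro!: edgeI simp: set_es)
    next
      case (Suc i')
      hence "pos a j = Some (cor i')" using at_cor[OF a, of i' j] 9 t by auto
      thus ?thesis using 9 Suc by (auto intro!: edgeI simp: set_es)
    qed
  qed
qed

lemma pos_distinct:
  assumes "a < m" "b < m" "pos a j = Some u" "pos b j = Some u" "u \<noteq> 0" "u \<noteq> 1"
  shows "a = b"
proof -
  have "u < cor La" using pos_cases[OF assms(1), of j] assms(3) by auto
  thus ?thesis
  proof (cases rule: verts_cases)
    case 3
    thus ?thesis using at_2 assms by auto
  next
    case 4
    thus ?thesis using at_3 assms by auto
  next
    case 5
    thus ?thesis using at_4[OF assms(1), of j] at_4[OF assms(2), of j] assms tok_inj by auto
  next
    case 6
    thus ?thesis using at_5[OF assms(1), of j] at_5[OF assms(2), of j] assms tok_inj by auto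
  next
    case (7 l)
    thus ?thesis using at_lit assms by auto
  next
    case (8 i)
    thus ?thesis using at_slot[OF assms(1) 8(1), of j] at_slot[OF assms(2) 8(1), of j] assms tok_inj tok_props(3) si_inj by metis
  next
    case (9 i)
    thus ?thesis using at_cor assms by auto
  qed (use assms in auto)
qed

lemma pos_kill:
  assumes a: "a < m" and r: "r \<in> traps I" "pos a j = Some r"
  shows "active I pos r j \<longleftrightarrow> pos a (Suc j) = None"
proof -
  consider "r = 2" | "r = 3" | "r = 4" | "r = 5" | l where "l < 2 * K" "r = lit l" using r(1) by (auto simp: traps_I)
  thus ?thesis
  proof cases
    case 1
    hence j: "j = a + 1" using r at_2[OF a] by simp
    have "active I pos r j \<longleftrightarrow> j = 1" using active_2[OF a] r(2) 1 by simp
    thus ?thesis unfolding at_None[OF a] j by auto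
  next
    case 2
    hence j: "j = a + 2" "m \<le> a + 2" using r at_3[OF a] by auto
    have "\<not> istok a" using istok_less[of a] j by auto
    moreover have "active I pos r j \<longleftrightarrow> j = m" using active_3[OF a] r(2) 2 by simp
    ultimately show ?thesis unfolding at_None[OF a] using j a m_ge T_gt by auto
  next
    case 3
    hence j: "istok a" "j + 1 = T + tok a" using r at_4[OF a] by auto
    have "active I pos r j \<longleftrightarrow> j = T - 1" using active_4[OF a] r(2) 3 by simp
    thus ?thesis unfolding at_None[OF a] using j istok_less[OF j(1)] T_gt by auto
  next
    case 4
    hence j: "istok a \<and> tok a \<noteq> 0 \<and> j = T + tok a \<or> a + 1 = m \<and> j = T" using r at_5[OF a] by auto
    have "active I pos r j \<longleftrightarrow> j = T" using active_5[OF a] r(2) 4 by simp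
    thus ?thesis unfolding at_None[OF a] using j istok_less[of a] T_gt m_ge by auto
  next
    case (5 l)
    hence j: "1 \<le> a" "a + 2 < m" "j = a + 2" using r at_lit[OF a 5(1)] by auto
    hence "istok a \<longleftrightarrow> off a \<noteq> 0" by (simp add: istok_def)
    moreover have "active I pos r j \<longleftrightarrow> off a = 0" using active_lit[OF a 5(1)] r(2) 5(2) by simp
    ultimately show ?thesis unfolding at_None[OF a] using j T_gt by auto
  qed
qed

lemma pos_killed:
  assumes a: "a < m" and "pos a j \<noteq> None" "pos a (Suc j) = None"
  shows "\<exists>r\<in>traps I. pos a j = Some r"
proof -
  let ?N = "\<lambda>j. a + 2 \<le> j \<and> (a = 0 \<or> a + 3 \<le> j \<and> (if istok a then tok a = 0 \<and> T \<le> j else a + 1 = m --> T < j))"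
  have N: "\<not> ?N j" "?N (Suc j)" using assms(2,3) unfolding at_None[OF a] .
  consider "a = 0" "j = 1" | "1 \<le> a" "j = a + 2" | "istok a" "tok a = 0" "Suc j = T" | "a + 1 = m" "j = T"
  proof (cases "a = 0 \<or> j = a + 2")
    case True
    thus ?thesis using N that(1,2) by (cases "a = 0") auto
  next
    case False
    hence "a + 3 \<le> j" using N(2) by auto
    thus ?thesis using N False that(3,4) by (cases "istok a") auto
  qed
  thus ?thesis
  proof cases
    case 1
    hence "pos a j = Some 2" using at_2[OF a] by auto
    thus ?thesis by (auto simp: traps_I)
  next
    case 2
    show ?thesis
    proof (cases "a + 2 < m")
      case True
      have "lam (grp a) < 2 * K" using lam_less grp_off(1)[OF 2(1) True] by blast
      thus ?thesis using at_lit[OF a] 2 True by (intro bexI[of _ "lit (lam (grp a))"]) (auto simp: traps_I)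
    next
      case False
      thus ?thesis using at_3[OF a] 2 by (intro bexI[of _ 3]) (auto simp: traps_I)
    qed
  next
    case 3
    thus ?thesis using at_4[OF a] by (intro bexI[of _ 4]) (auto simp: traps_I)
  next
    case 4
    thus ?thesis using at_5[OF a] by (intro bexI[of _ 5]) (auto simp: traps_I)
  qed
qed

lemma pos_finished: "a < m ==> finished I (pos a j) ==> pos a (j + 1) = pos a j"
  unfolding finished_def I_simps
  using at_None[of a j] at_None[of a "j + 1"] at_1[of a j] at_1[of a "j + 1"] by (auto split: if_splits)

lemma pos_end: "a < m ==> T + NS \<le> j ==> finished I (pos a j)"
  unfolding finished_def I_simps
  using at_None[of a j] at_1[of a j] tok_props(3)[of a] T_gt NS_ge by (auto split: if_splits)

text \<open>Someone moves in each of three phases: the assets enter one per round, then the last one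
  walks through the corridor, and then one token per round steps from exit 5 to the target.\<close>

lemma pos_progress:
  assumes "1 \<le> j" "j < T + NS"
  shows "\<exists>a<m. pos a j \<noteq> pos a (j + 1)"
proof -
  consider "j < m" | "m \<le> j" "j \<le> T" | "T < j" by linarith
  thus ?thesis
  proof cases
    case 1
    thus ?thesis using at_0[of j j] at_2[of j "j + 1"] by (intro exI[of _ j]) auto
  next
    case 2
    have a: "m - 1 < m" using m_ge by simp
    consider "j = m" | "j = m + 1" | i where "i < La" "j = m + 2 + i" | "j = T"
      using 2 that(3)[of "j - (m + 2)"] unfolding T_def by linarith
    hence "pos (m - 1) j \<noteq> pos (m - 1) (j + 1)"
    proof cases
      case 1
      thus ?thesis using at_2[OF a, of j] at_2[OF a, of "j + 1"] m_ge by auto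
    next
      case 2
      thus ?thesis using at_3[OF a, of j] at_3[OF a, of "j + 1"] m_ge by auto
    next
      case (3 i)
      have "m - 1 + 1 = m" using m_ge by simp
      hence "pos (m - 1) j = Some (cor i)" "pos (m - 1) (j + 1) \<noteq> Some (cor i)"
        using at_cor[OF a 3(1), of j] at_cor[OF a 3(1), of "j + 1"] 3(2) by simp_all
      thus ?thesis by metis
    next
      case 4
      have "\<not> istok (m - 1)" "m - 1 + 1 = m" "m - 1 \<noteq> 0" using istok_less[of "m - 1"] m_ge by auto
      hence "pos (m - 1) j = Some 5" "pos (m - 1) (j + 1) = None"
        using 4 T_gt unfolding at_5[OF a] at_None[OF a] by auto
      thus ?thesis by simp
    qed
    thus ?thesis using a by blast
  next
    case 3
    define e where "e = j - T"
    have e: "e < NS" "e \<noteq> 0" "j = T + e" using 3 assms(2) by (auto simp: e_def)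
    have "pos (ast e) j = Some 5" "pos (ast e) (j + 1) = Some 1"
      using at_5[OF ast(3)[OF e(1)], of j] at_1[OF ast(3)[OF e(1)], of "j + 1"] ast[OF e(1)] e by auto
    thus ?thesis using ast(3)[OF e(1)] by (intro exI[of _ "ast e"]) auto
  qed
qed

lemma valid_pos: "valid_plan I pos"
  unfolding valid_plan_def
proof (intro conjI ballI allI impI)
  fix a j assume "a \<in> assets I"
  hence a: "a < m" by simp
  show "pos a j \<in> insert None (Some ` verts I)" using pos_cases[OF a, of j] by fastforce
  show "pos a 0 = Some (source I)" using at_0[OF a] by simp
  show "pos a (j - 1) = Some (source I)" if "0 < j" "pos a j = Some (source I)" using that at_0[OF a] by simp
  show "pos a (j + 1) = pos a j" if "finished I (pos a j)" using pos_finished[OF a that] .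
  show "pos a j = pos a (j - 1) \<or> adj_opt I (pos a (j - 1)) (pos a j)" if j: "1 \<le> j" "pos a j \<noteq> None"
  proof -
    obtain w where w: "pos a (Suc (j - 1)) = Some w" using j by auto
    from pos_move[OF a w] show ?thesis using w j(1) by (auto simp del: I_simps)
  qed
  show "pos a (j + 1) = None" if "r \<in> traps I" "pos a j = Some r \<and> active I pos r j" for r
    using that pos_kill[OF a, of r j] by simp
  show "\<exists>r\<in>traps I. pos a j = Some r \<and> active I pos r j" if "pos a j \<noteq> None \<and> pos a (j + 1) = None"
    using that pos_killed[OF a, of j] pos_kill[OF a, of _ j] by auto
next
  fix a a' j assume "a \<in> assets I" "a' \<in> assets I" "a \<noteq> a' \<and> pos a j = pos a' j"
  thus "pos a j \<in> {Some (source I), Some (target I), None}"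
    using pos_distinct[of a a' j] by (cases "pos a j") auto
next
  fix j assume as: "1 \<le> j" "\<exists>a\<in>assets I. \<not> finished I (pos a j)"
  then obtain a where "a < m" "\<not> finished I (pos a j)" by auto
  hence "j < T + NS" using pos_end[of a j] by (cases "T + NS \<le> j") auto
  thus "\<exists>a'\<in>assets I. pos a' j \<noteq> pos a' (j + 1)" using pos_progress[OF as(1)] by auto
next
  show "\<exists>n. has_length I pos n"
    by (rule ex_length[of I pos "T + NS" 0]) (use pos_end m_ge at_0[of 0 0] in \<open>auto simp: finished_def\<close>)
qed

text \<open>Every asset sees only one literal trap besides the four fixed traps.\<close>

theorem plan_of_assignment:
  "solution I pos \<and> (\<forall>a\<in>assets I. card (crosses I pos a) \<le> 6)"
proof (intro conjI ballI)
  have wf: "wf_routing I" using wf_listing_gadget unfolding listing_def wf_listing.simps by simp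
  have "ast ` {1..<NS} \<subseteq> {a \<in> assets I. survives I pos a}"
  proof
    fix a assume "a \<in> ast ` {1..<NS}"
    then obtain e where e: "a = ast e" "1 \<le> e" "e < NS" by auto
    hence "pos a (T + e + 1) = Some 1" using at_1[of a "T + e + 1"] ast[OF e(3)] by auto
    thus "a \<in> {a \<in> assets I. survives I pos a}"
      using survives_iff[OF wf valid_pos, of a] ast(3)[OF e(3)] e(1) by auto
  qed
  moreover have "inj_on ast {1..<NS}" by (rule inj_on_inverseI[of _ tok]) (use ast in auto)
  ultimately have "card {1..<NS} \<le> card {a \<in> assets I. survives I pos a}"
    by (intro card_inj_on_le[of ast]) auto
  thus "solution I pos" unfolding solution_def using valid_pos by simp
  fix a assume "a \<in> assets I"
  hence a: "a < m" by simp
  have "crosses I pos a \<subseteq> {2, 3, 4, 5, lit (lam (grp a))}"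
    unfolding crosses_def traps_I using at_lit[OF a] by auto
  hence "card (crosses I pos a) \<le> card {2, 3, 4, 5, lit (lam (grp a))}" by (intro card_mono) auto
  also have "\<dots> \<le> 6" by (auto simp: card_insert_if)
  finally show "card (crosses I pos a) \<le> 6" .
qed

end

text \<open>The plan with few crossings is not obtained by improving a given solution: the solution
  yields an assignment, and the assignment yields the explicit plan.\<close>

theorem (in gadget) gadget_correct:
  defines "sat \<equiv> \<exists>al. \<forall>j<C. \<exists>l<2 * K. occ l j \<and> (al (l div 2) \<longleftrightarrow> even l)"
  shows "(\<exists>p. solution I p) \<longleftrightarrow> sat"
    "(\<exists>p. solution I p) ==> \<exists>p. solution I p \<and> (\<forall>a\<in>assets I. card (crosses I p a) \<le> 6)"
proof -
  have 1: "sat" if "solution I p" for p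
  proof -
    interpret gadget_plan K C occ p by unfold_locales (rule that)
    show ?thesis unfolding sat_def by (rule satisfying_assignment)
  qed
  have 2: "\<exists>p. solution I p \<and> (\<forall>a\<in>assets I. card (crosses I p a) \<le> 6)" if s: "sat"
  proof -
    obtain al where "\<And>j. j < C ==> \<exists>l<2 * K. occ l j \<and> (al (l div 2) \<longleftrightarrow> even l)" using s unfolding sat_def by blast
    then interpret gadget_sat K C occ al by unfold_locales
    show ?thesis using plan_of_assignment by blast
  qed
  show "(\<exists>p. solution I p) \<longleftrightarrow> sat"
    "(\<exists>p. solution I p) ==> \<exists>p. solution I p \<and> (\<forall>a\<in>assets I. card (crosses I p a) \<le> 6)"
    using 1 2 by blast+
qed

section \<open>Printing the instances, and computations as formulas\<close>

section \<open>Arithmetic and logic in the loop language\<close>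

text \<open>
  A formula is an expression that counts as true if its value is not 0, so that \<open>Plus\<close>, \<open>Times\<close> and
  \<open>Sum\<close> serve as disjunction, conjunction and bounded existential quantification.
\<close>

definition eNot :: "exp => exp" where "eNot a = Less a (N 1)"
definition eEq :: "exp => exp => exp" where "eEq a b = Times (eNot (Less a b)) (eNot (Less b a))"
definition eLe :: "exp => exp => exp" where "eLe a b = eNot (Less b a)"
definition eAll :: "nat => exp => exp => exp" where "eAll v n b = eNot (Sum v n (eNot b))"
definition eOrs :: "exp list => exp" where "eOrs es = foldr Plus es (N 0)"

definition tr :: "bool list => (nat => nat) => exp => bool" where "tr w s e \<longleftrightarrow> val w s e \<noteq> 0"

lemma tr_simps [simp]:
  "tr w s (eNot a) \<longleftrightarrow> \<not> tr w s a"
  "tr w s (Times a b) \<longleftrightarrow> tr w s a \<and> tr w s b"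
  "tr w s (Plus a b) \<longleftrightarrow> tr w s a \<or> tr w s b"
  "tr w s (Less a b) \<longleftrightarrow> val w s a < val w s b"
  "tr w s (eLe a b) \<longleftrightarrow> val w s a \<le> val w s b"
  "tr w s (eEq a b) \<longleftrightarrow> val w s a = val w s b"
  "tr w s (Bit a) \<longleftrightarrow> val w s a < length w \<and> w ! val w s a"
  "tr w s (Sum v n b) \<longleftrightarrow> (\<exists>i<val w s n. tr w (s(v := i)) b)"
  "tr w s (eAll v n b) \<longleftrightarrow> (\<forall>i<val w s n. tr w (s(v := i)) b)"
  "tr w s (N x) \<longleftrightarrow> x \<noteq> 0"
  by (auto simp: tr_def eNot_def eEq_def eLe_def eAll_def split: if_splits)

lemma tr_eOrs [simp]: "tr w s (eOrs es) \<longleftrightarrow> (\<exists>e\<in>set es. tr w s e)"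
  by (induction es) (auto simp: eOrs_def)

lemma out_CIf [simp]: "out w s (CIf e c d) = (if tr w s e then out w s c else out w s d)"
  by (simp add: tr_def)

declare out.simps(4) [simp del]

fun fv :: "exp => nat set" where
  "fv (V v) = {v}"
| "fv (N n) = {}"
| "fv Len = {}"
| "fv (Plus a b) = fv a \<union> fv b"
| "fv (Times a b) = fv a \<union> fv b"
| "fv (Less a b) = fv a \<union> fv b"
| "fv (Bit a) = fv a"
| "fv (Sum v a b) = fv a \<union> (fv b - {v})"

lemma val_cong: "(\<And>v. v \<in> fv e ==> s v = s' v) ==> val w s e = val w s' e"
proof (induction e arbitrary: s s')
  case (Sum v a b)
  have 1: "val w s a = val w s' a" by (rule Sum.IH(1)) (simp add: Sum.prems)
  have "val w (s(v := i)) b = val w (s'(v := i)) b" for i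
  proof (rule Sum.IH(2))
    fix x assume "x \<in> fv b"
    thus "(s(v := i)) x = (s'(v := i)) x" using Sum.prems[of x] by (cases "x = v") simp_all
  qed
  with 1 show ?case by simp
next
  case (Plus a b)
  have "val w s a = val w s' a" by (rule Plus.IH(1)) (simp add: Plus.prems)
  moreover have "val w s b = val w s' b" by (rule Plus.IH(2)) (simp add: Plus.prems)
  ultimately show ?case by simp
next
  case (Times a b)
  have "val w s a = val w s' a" by (rule Times.IH(1)) (simp add: Times.prems)
  moreover have "val w s b = val w s' b" by (rule Times.IH(2)) (simp add: Times.prems)
  ultimately show ?case by simp
next
  case (Less a b)
  have "val w s a = val w s' a" by (rule Less.IH(1)) (simp add: Less.prems)
  moreover have "val w s b = val w s' b" by (rule Less.IH(2)) (simp add: Less.prems)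
  ultimately show ?case by simp
next
  case (Bit a)
  have "val w s a = val w s' a" by (rule Bit.IH) (simp add: Bit.prems)
  thus ?case by simp
qed simp_all

lemma tr_cong: "(\<And>v. v \<in> fv e ==> s v = s' v) ==> tr w s e = tr w s' e"
  using val_cong[of e s s' w] by (simp add: tr_def)

lemma val_upd [simp]: "v \<notin> fv e ==> val w (s(v := x)) e = val w s e"
  by (rule val_cong) auto

lemma fv_simps [simp]: "fv (eNot a) = fv a" "fv (eEq a b) = fv a \<union> fv b" "fv (eLe a b) = fv a \<union> fv b"
  "fv (eAll v n b) = fv n \<union> (fv b - {v})" "fv (eOrs es) = (\<Union>e\<in>set es. fv e)"
  by (auto simp: eNot_def eEq_def eLe_def eAll_def) (induction es, auto simp: eOrs_def)+

fun cseqs :: "com list => com" where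
  "cseqs [] = CNop"
| "cseqs (c # cs) = CSeq c (cseqs cs)"

lemma out_cseqs [simp]: "out w s (cseqs cs) = concat (map (out w s) cs)"
  by (induction cs) auto

lemma syms_cseqs [simp]: "syms (cseqs cs) = (\<Union>c\<in>set cs. syms c)"
  by (induction cs) auto

section \<open>Emitting numbers in binary\<close>

definition pow2 :: "nat => bool" where "pow2 j \<longleftrightarrow> (\<exists>d. j = 2 ^ d)"

lemma pow2_double: "pow2 (2 * j) \<longleftrightarrow> pow2 j"
proof
  assume "pow2 (2 * j)"
  then obtain d where d: "2 * j = 2 ^ d" by (auto simp: pow2_def)
  thus "pow2 j" by (cases d) (auto simp: pow2_def)
next
  assume "pow2 j"
  then obtain d where "j = 2 ^ d" by (auto simp: pow2_def)
  hence "2 * j = 2 ^ Suc d" by simp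
  thus "pow2 (2 * j)" unfolding pow2_def by blast
qed

lemma pow2_odd: "odd j ==> pow2 j \<longleftrightarrow> j = 1"
proof
  assume "odd j" "pow2 j"
  then obtain d where "j = 2 ^ d" by (auto simp: pow2_def)
  thus "j = 1" using \<open>odd j\<close> by (cases d) auto
qed (auto simp: pow2_def intro: exI[of _ 0])

text \<open>Powers of two are the positive numbers without an odd divisor above 1. In this form the
  property is expressible with bounded quantifiers and products.\<close>

lemma pow2_iff: "pow2 j \<longleftrightarrow> 0 < j \<and> \<not> (\<exists>h<j. \<exists>b<j + 1. (2 * h + 3) * b = j)"
proof (induction j rule: less_induct)
  case (less j)
  consider "j = 0" | "odd j" | k where "j = 2 * k" "0 < k"
  proof (cases "odd j")
    case False
    then obtain k where "j = 2 * k" by (auto elim: evenE)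
    thus ?thesis using that(1) that(3)[of k] by (cases "k = 0") simp_all
  qed
  thus ?case
  proof cases
    case 1
    thus ?thesis by (simp add: pow2_def)
  next
    case 2
    show ?thesis
    proof
      assume "pow2 j"
      hence "j = 1" using 2 pow2_odd by blast
      thus "0 < j \<and> \<not> (\<exists>h<j. \<exists>b<j + 1. (2 * h + 3) * b = j)" by auto
    next
      assume *: "0 < j \<and> \<not> (\<exists>h<j. \<exists>b<j + 1. (2 * h + 3) * b = j)"
      show "pow2 j"
      proof (rule ccontr)
        assume "\<not> pow2 j"
        hence "j \<noteq> 1" using 2 pow2_odd by blast
        obtain h where "j = 2 * h + 3"
        proof -
          obtain i where "j = 2 * i + 1" using 2 by (rule oddE)
          thus ?thesis using \<open>j \<noteq> 1\<close> that[of "i - 1"] by (cases i) simp_all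
        qed
        hence "h < j \<and> 1 < j + 1 \<and> (2 * h + 3) * 1 = j" by auto
        thus False using * by blast
      qed
    qed
  next
    case (3 k)
    have "(\<exists>h<j. \<exists>b<j + 1. (2 * h + 3) * b = j) \<longleftrightarrow> (\<exists>h<k. \<exists>b<k + 1. (2 * h + 3) * b = k)"
    proof
      assume "\<exists>h<j. \<exists>b<j + 1. (2 * h + 3) * b = j"
      then obtain h b where hb: "(2 * h + 3) * b = 2 * k" using 3 by auto
      hence "even ((2 * h + 3) * b)" by simp
      hence "even b" by simp
      then obtain b' where b': "b = 2 * b'" by (rule evenE)
      hence *: "(2 * h + 3) * b' = k" using hb by auto
      hence "0 < b'" using 3 by (cases b') auto
      have "2 * h + 3 \<le> k" using mult_le_mono2[of 1 b' "2 * h + 3"] * \<open>0 < b'\<close> by simp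
      moreover have "b' \<le> k" using mult_le_mono1[of 1 "2 * h + 3" b'] * by simp
      ultimately have "h < k" "b' < k + 1" by simp_all
      thus "\<exists>h<k. \<exists>b<k + 1. (2 * h + 3) * b = k" using * by blast
    next
      assume "\<exists>h<k. \<exists>b<k + 1. (2 * h + 3) * b = k"
      then obtain h b where "h < k" "b < k + 1" "(2 * h + 3) * b = k" by blast
      hence "h < j \<and> 2 * b < j + 1 \<and> (2 * h + 3) * (2 * b) = j" using 3 by auto
      thus "\<exists>h<j. \<exists>b<j + 1. (2 * h + 3) * b = j" by blast
    qed
    thus ?thesis using less[of k] 3 pow2_double[of k] by auto
  qed
qed

text \<open>The digit of weight \<open>j\<close> in \<open>n\<close>, described without division so
  that it becomes a formula.\<close>

lemma odd_div_iff:
  fixes n j :: nat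
  shows "0 < j ==> odd (n div j) \<longleftrightarrow> (\<exists>a<n + 1. \<exists>r<j. n = (2 * a + 1) * j + r)"
proof
  assume "0 < j" "odd (n div j)"
  then obtain a where a: "n div j = 2 * a + 1" by (elim oddE)
  hence n: "n = (2 * a + 1) * j + n mod j" using div_mult_mod_eq[of n j] by simp
  have "a \<le> n div j" using a by simp
  also have "\<dots> \<le> n" by (rule div_le_dividend)
  finally show "\<exists>a<n + 1. \<exists>r<j. n = (2 * a + 1) * j + r" using n \<open>0 < j\<close>
    by (intro exI[of _ a] conjI exI[of _ "n mod j"]) auto
next
  assume "0 < j" "\<exists>a<n + 1. \<exists>r<j. n = (2 * a + 1) * j + r"
  then obtain a r where "r < j" "n = (2 * a + 1) * j + r" by blast
  hence "n div j = 2 * a + 1" using \<open>0 < j\<close> by (simp del: mult_Suc mult_Suc_right)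
  thus "odd (n div j)" by simp
qed

lemma filter_pow2:
  assumes "0 < n"
  shows "filter pow2 [0..<n + 1] = 1 # map ((*) 2) (filter pow2 [0..<n div 2 + 1])" (is "?L = 1 # map _ ?R")
proof (rule sorted_distinct_set_unique)
  have "sorted ?R" by (rule sorted_wrt_filter) (rule sorted_upt)
  hence "sorted (map ((*) 2) ?R)" unfolding sorted_map by (rule sorted_wrt_mono_rel[rotated]) simp
  moreover have "1 \<le> x" if "x \<in> set (map ((*) 2) ?R)" for x
    using that by (auto simp: pow2_def simp del: upt_Suc)
  ultimately show "sorted (1 # map ((*) 2) ?R)" by simp
  show "distinct (1 # map ((*) 2) ?R)" by (auto simp: distinct_map inj_on_def)
  show "set ?L = set (1 # map ((*) 2) ?R)"
  proof (rule set_eqI)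
    fix j
    show "j \<in> set ?L \<longleftrightarrow> j \<in> set (1 # map ((*) 2) ?R)"
    proof (cases "even j")
      case True
      then obtain k where "j = 2 * k" by (rule evenE)
      thus ?thesis using pow2_double[of k] by (auto simp del: upt_Suc)
    next
      case False
      thus ?thesis using assms pow2_odd[of j] by (auto simp del: upt_Suc)
    qed
  qed
  show "sorted ?L" by (rule sorted_wrt_filter) (rule sorted_upt)
qed (simp del: upt_Suc)

lemma binary_pow2: "binary n = map (\<lambda>j. odd (n div j)) (filter pow2 [0..<n + 1])"
proof (induction n rule: less_induct)
  case (less n)
  show ?case
  proof (cases "n = 0")
    case True
    thus ?thesis by (simp add: binary.simps pow2_def)
  next
    case False
    hence "binary n = odd n # map (\<lambda>j. odd (n div 2 div j)) (filter pow2 [0..<n div 2 + 1])"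
      using less[of "n div 2"] by (subst binary.simps) simp
    thus ?thesis using False by (subst filter_pow2) (simp_all add: div_mult2_eq o_def)
  qed
qed

text \<open>Values are polynomial, so the loop can afford to try all weights up to the value and to
  keep the powers of two. They come in increasing order, which is least significant digit first. The
  variables 100 to 102 are reserved for this.\<close>

definition emitN :: "exp => com" where
  "emitN e = CSeq
     (CFor 100 (Plus e (N 1))
        (CIf (Times (Less (N 0) (V 100)) (eNot (Sum 101 (V 100) (Sum 102 (Plus (V 100) (N 1))
               (eEq (Times (Plus (Times (N 2) (V 101)) (N 3)) (V 102)) (V 100))))))
          (CSeq (CEmit 1) (CIf (Sum 101 (Plus e (N 1)) (Sum 102 (V 100)
               (eEq e (Plus (Times (Plus (Times (N 2) (V 101)) (N 1)) (V 100)) (V 102)))))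
             (CEmit 2) (CEmit 1)))
          CNop))
     (CSeq (CEmit 2) (CEmit 1))"

lemma concat_filter: "concat (map (\<lambda>j. if P j then f j else []) xs) = concat (map f (filter P xs))"
  by (induction xs) auto

lemma out_emitN:
  assumes "fv e \<inter> {100, 101, 102} = {}"
  shows "out w s (emitN e) = map bit_symbol (encode_nat (val w s e))"
proof -
  let ?n = "val w s e"
  have "out w s (emitN e) = concat (map (\<lambda>j. if pow2 j then [1::nat, if odd (?n div j) then 2 else 1] else []) [0..<?n + 1]) @ [2, 1]"
  proof -
    let ?b = "CIf (Times (Less (N 0) (V 100)) (eNot (Sum 101 (V 100) (Sum 102 (Plus (V 100) (N 1))
               (eEq (Times (Plus (Times (N 2) (V 101)) (N 3)) (V 102)) (V 100))))))
          (CSeq (CEmit 1) (CIf (Sum 101 (Plus e (N 1)) (Sum 102 (V 100)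
               (eEq e (Plus (Times (Plus (Times (N 2) (V 101)) (N 1)) (V 100)) (V 102)))))
             (CEmit 2) (CEmit 1)))
          CNop"
    have v: "val w (s(100 := j, 101 := h, 102 := b)) e = ?n" "val w (s(100 := j, 101 := h)) e = ?n"
      "val w (s(100 := j)) e = ?n" for j h b
      by (rule val_cong; use assms in auto)+
    have "out w (s(100 := j)) ?b = (if pow2 j then [1::nat, if odd (?n div j) then 2 else 1] else [])" for j :: nat
    proof -
      have 1: "tr w (s(100 := j)) (Times (Less (N 0) (V 100)) (eNot (Sum 101 (V 100) (Sum 102 (Plus (V 100) (N 1))
               (eEq (Times (Plus (Times (N 2) (V 101)) (N 3)) (V 102)) (V 100)))))) \<longleftrightarrow> pow2 j"
        unfolding pow2_iff by (simp only: tr_simps val.simps fun_upd_apply) simp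
      have 2: "tr w (s(100 := j)) (Sum 101 (Plus e (N 1)) (Sum 102 (V 100)
               (eEq e (Plus (Times (Plus (Times (N 2) (V 101)) (N 1)) (V 100)) (V 102))))) \<longleftrightarrow> odd (?n div j)" if "pow2 j"
      proof -
        have "0 < j" using that pow2_iff by blast
        thus ?thesis unfolding odd_div_iff[OF \<open>0 < j\<close>] by (simp only: tr_simps val.simps fun_upd_apply v) simp
      qed
      show ?thesis using 2 by (simp only: out_CIf out.simps 1) simp
    qed
    thus ?thesis unfolding emitN_def by (simp del: upt_Suc out_CIf add: o_def)
  qed
  also have "\<dots> = map bit_symbol (encode_nat ?n)"
    unfolding concat_filter encode_nat_def binary_pow2[of ?n] by (simp add: map_concat o_def bit_symbol_def)
  finally show ?thesis .
qed

lemma syms_emitN [simp]: "syms (emitN e) = {1, 2}"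
  by (auto simp: emitN_def)

lemma map_bs_encode_list:
  "map bit_symbol (encode_list ns) = concat (map (\<lambda>n. map bit_symbol (encode_nat n)) ns) @ [2, 2]"
  by (simp add: encode_list_def map_concat o_def bit_symbol_def)

section \<open>Emitting the routing instance of a formula\<close>

definition emit_pair :: "exp => exp => com" where "emit_pair a b = CSeq (emitN a) (emitN b)"
definition emit_end :: com where "emit_end = CSeq (CEmit 2) (CEmit 2)"

definition exq :: "exp => exp" where "exq c = Plus c (N 1)"
definition exNS :: "exp => exp => exp" where "exNS k c = Times k (exq c)"
definition exm :: "exp => exp => exp" where "exm k c = Plus (Plus (exNS k c) k) (N 3)"
definition exLa1 :: "exp => exp => exp" where "exLa1 k c = Plus (Plus (exm k c) (exNS k c)) (N 9)"
definition exlit :: "exp => exp" where "exlit l = Plus (N 6) l"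
definition exslot :: "exp => exp => exp" where "exslot k i = Plus (Plus (N 6) (Times (N 2) k)) i"
definition excor :: "exp => exp => exp => exp" where
  "excor k c i = Plus (Plus (Plus (N 6) (Times (N 2) k)) (exNS k c)) i"
definition exNS1 :: "exp => exp => exp" where "exNS1 k c = Sum 3 (exNS k c) (Less (N 0) (V 3))"
text \<open>Variable 0 is the literal, 2 the slot, and 1 ranges over the clauses for
  \<open>oc\<close>. The relation \<open>i = l div 2\<close> is expressed by
  \<open>l = 2 * i\<close> or \<open>l = 2 * i + 1\<close>.\<close>

definition exadj :: "exp => exp => exp => exp" where
  "exadj k c oc = eOrs
     [Times (Less (V 2) k) (Plus (eEq (Plus (V 2) (V 2)) (V 0)) (eEq (Plus (Plus (V 2) (V 2)) (N 1)) (V 0))),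
      Times (eNot (Less (V 2) k)) (Sum 1 c (Times (eEq (V 2) (Plus k (V 1))) oc)),
      eLe (Plus k c) (V 2)]"

definition emit_gadget :: "exp => exp => exp => com" where
  "emit_gadget k c oc = cseqs
    [CFor 2 (exm k c) (emitN (V 2)), emit_end,
     CFor 2 (excor k c (Plus (exLa1 k c) (N 1))) (emitN (V 2)), emit_end,
     emit_pair (N 0) (N 2), emit_pair (N 2) (N 3), emit_pair (N 3) (excor k c (N 0)),
     emit_pair (N 5) (excor k c (exLa1 k c)), emit_pair (N 4) (N 5), emit_pair (N 1) (N 5),
     CFor 0 (Times (N 2) k) (emit_pair (N 2) (exlit (V 0))),
     CFor 0 (Times (N 2) k) (CFor 2 (exNS k c)
       (CIf (exadj k c oc) (emit_pair (exlit (V 0)) (exslot k (V 2))) CNop)),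
     CFor 2 (exNS k c) (emit_pair (N 4) (exslot k (V 2))),
     CFor 2 (exLa1 k c) (emit_pair (excor k c (V 2)) (excor k c (Plus (V 2) (N 1)))), emit_end,
     emit_pair (N 0) (N 1), emit_end,
     emit_pair (N 2) (exm k c), emit_pair (N 3) (N 1), emit_pair (N 4) (exNS1 k c), emit_pair (N 5) (exNS1 k c),
     CFor 0 (Times (N 2) k) (emit_pair (exlit (V 0)) (exq c)), emit_end,
     emitN (exNS1 k c), emit_end]"

lemma syms_emit_gadget: "syms (emit_gadget k c oc) \<subseteq> {1, 2}"
  by (simp add: emit_gadget_def emit_pair_def emit_end_def)

lemma concat_map_concat: "concat (map f (concat xss)) = concat (map (\<lambda>xs. concat (map f xs)) xss)"
  by (induction xss) auto

lemma sum_positive: "(\<Sum>i<n. of_bool (0 < i)) = n - (1::nat)"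
  by (induction n) auto

context gadget
begin

lemma out_emit_gadget:
  fixes k c oc :: exp
  assumes k: "fv k = {}" "val w (\<lambda>_. 0) k = K" and c: "fv c = {}" "val w (\<lambda>_. 0) c = C"
    and oc: "fv oc \<subseteq> {0, 1}" "\<And>l j. occ l j \<longleftrightarrow> tr w ((\<lambda>_. 0)(0 := l, 1 := j)) oc"
  shows "out w (\<lambda>_. 0) (emit_gadget k c oc) = map bit_symbol (encode listing)"
proof -
  let ?e = "\<lambda>n. map bit_symbol (encode_nat n)"
  let ?p = "\<lambda>(u, v). ?e u @ ?e v"
  have vk [simp]: "val w s k = K" for s using val_cong[of k s "\<lambda>_. 0" w] k by simp
  have vc [simp]: "val w s c = C" for s using val_cong[of c s "\<lambda>_. 0" w] c by simp
  have vals: "val w s (exq c) = q" "val w s (exNS k c) = NS" "val w s (exm k c) = m"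
    "val w s (exLa1 k c) = La - 1" "val w s (Plus (exLa1 k c) (N 1)) = La"
    "val w s (exlit e) = lit (val w s e)" "val w s (exslot k e) = slot (val w s e)"
    "val w s (excor k c e) = cor (val w s e)" "val w s (exNS1 k c) = NS - 1" for s e
    by (simp_all add: exq_def exNS_def exm_def exLa1_def exlit_def exslot_def excor_def exNS1_def q_def NS_def
        m_def La_def vdefs sum_positive)
  have fvs: "fv (exq c) = {}" "fv (exNS k c) = {}" "fv (exm k c) = {}" "fv (exLa1 k c) = {}"
    "fv (exlit e) = fv e" "fv (exslot k e) = fv e" "fv (excor k c e) = fv e" "fv (exNS1 k c) = {}" for e
    using k c by (auto simp: exq_def exNS_def exm_def exLa1_def exlit_def exslot_def excor_def exNS1_def)
  have ad: "tr w ((\<lambda>_. 0)(0 := l, 2 := i)) (exadj k c oc) \<longleftrightarrow> adj l i" if "l < 2 * K" for l i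
  proof -
    have o: "tr w ((\<lambda>_. 0)(0 := l, 2 := i, Suc 0 := j)) oc \<longleftrightarrow> occ l j" for j
      unfolding oc(2) by (rule tr_cong) (use oc(1) in auto)
    have h: "(i + i = l \<or> Suc (i + i) = l) = (i = l div 2)" by linarith
    show ?thesis
    proof -
      have "tr w ((\<lambda>_. 0)(0 := l, 2 := i)) (exadj k c oc) \<longleftrightarrow>
        i < K \<and> (i + i = l \<or> Suc (i + i) = l) \<or> \<not> i < K \<and> (\<exists>j<C. i = K + j \<and> occ l j) \<or> K + C \<le> i"
        unfolding exadj_def by (simp add: o)
      also have "\<dots> \<longleftrightarrow> adj l i" unfolding h
      proof -
        have "(\<exists>j<C. i = K + j \<and> occ l j) \<longleftrightarrow> occ l (i - K)" if "\<not> i < K" "i < K + C"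
        proof
          assume "\<exists>j<C. i = K + j \<and> occ l j"
          thus "occ l (i - K)" by auto
        next
          assume "occ l (i - K)"
          thus "\<exists>j<C. i = K + j \<and> occ l j" using that by (intro exI[of _ "i - K"]) auto
        qed
        moreover have "\<not> (\<exists>j<C. i = K + j \<and> occ l j)" if "K + C \<le> i" using that by auto
        ultimately show "i < K \<and> i = l div 2 \<or> \<not> i < K \<and> (\<exists>j<C. i = K + j \<and> occ l j) \<or> K + C \<le> i \<longleftrightarrow> adj l i" unfolding adj_def by (cases "i < K"; cases "i < K + C") auto
      qed
      finally show ?thesis .
    qed
  qed
  have pair: "out w s (emit_pair a b) = ?p (val w s a, val w s b)"
    if "fv a \<subseteq> {0..<10}" "fv b \<subseteq> {0..<10}" for s a b
  proof -
    have "fv a \<inter> {100, 101, 102} = {}" "fv b \<inter> {100, 101, 102} = {}" using that by force+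
    thus ?thesis by (simp add: emit_pair_def out_emitN)
  qed
  have num: "out w s (emitN a) = ?e (val w s a)" if "fv a \<subseteq> {0..<10}" for s a
    using that by (intro out_emitN) force
  have en: "out w s emit_end = [2, 2]" for s by (simp add: emit_end_def)
  have up: "concat (map (\<lambda>x. ?e x @ ?e (f x)) xs) = concat (map ?e (unpair (map (\<lambda>x. (x, f x)) xs)))" for xs f
    by (simp add: unpair_def concat_map_concat o_def)
  have un: "concat (map ?e (unpair ps)) = concat (map ?p ps)" for ps
    by (simp add: unpair_def concat_map_concat o_def split_beta case_prod_unfold)
  have es_out: "concat (map ?p es) =
      ?p (0, 2) @ ?p (2, 3) @ ?p (3, cor 0) @ ?p (5, cor (La - 1)) @ ?p (4, 5) @ ?p (1, 5) @
      concat (map (\<lambda>l. ?p (2, lit l)) [0..<2 * K]) @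
      concat (map (\<lambda>l. concat (map (\<lambda>i. if adj l i then ?p (lit l, slot i) else []) [0..<NS])) [0..<2 * K]) @
      concat (map (\<lambda>i. ?p (4, slot i)) [0..<NS]) @ concat (map (\<lambda>i. ?p (cor i, cor (i + 1))) [0..<La - 1])"
  proof -
    have "concat (map ?p (if b then [x] else [])) = (if b then ?p x else [])" for b x by simp
    thus ?thesis unfolding es_def by (simp add: concat_map_concat o_def del: upt_Suc)
  qed
  have rs_out: "concat (map ?p rs) = ?p (2, m) @ ?p (3, 1) @ ?p (4, NS - 1) @ ?p (5, NS - 1) @
      concat (map (\<lambda>l. ?p (lit l, q)) [0..<2 * K])"
    unfolding rs_def by (simp add: o_def)
  have adj_out: "map (\<lambda>l. concat (map (\<lambda>i. if tr w ((\<lambda>_. 0)(0 := l, 2 := i)) (exadj k c oc) then out w ((\<lambda>_. 0)(0 := l, 2 := i)) (emit_pair (exlit (V 0)) (exslot k (V 2)))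
      else out w ((\<lambda>_. 0)(0 := l, 2 := i)) CNop) [0..<NS])) [0..<2 * K] =
      map (\<lambda>l. concat (map (\<lambda>i. if adj l i then ?p (lit l, slot i) else []) [0..<NS])) [0..<2 * K]"
    by (intro map_cong refl arg_cong[where f = concat]) (simp add: ad pair fvs vals)
  have La: "Suc (La - Suc 0) = La" by (simp add: La_def)
  show ?thesis
    unfolding listing_def encode.simps map_append map_bs_encode_list un es_out rs_out
    unfolding emit_gadget_def
    by (simp add: pair num en fvs vals La o_def del: upt_Suc)
      (simp only: adj_out)
qed

end

section \<open>Unique decoding\<close>

lemma binary_eq_Nil: "binary k = [] \<longleftrightarrow> k = 0"
  by (subst binary.simps) simp
lemma binary_inject: "binary m = binary n ==> m = n"
proof (induction m arbitrary: n rule: less_induct)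
  case (less m)
  show ?case
  proof (cases "m = 0")
    case True
    have "binary n = []" unfolding less.prems[symmetric] binary_eq_Nil by (rule True)
    thus ?thesis using True binary_eq_Nil by simp
  next
    case False
    have n: "n \<noteq> 0" using False less.prems binary_eq_Nil[of m] binary_eq_Nil[of n] by auto
    have "binary m = odd m # binary (m div 2)" "binary n = odd n # binary (n div 2)"
      using False n by (subst binary.simps, simp)+
    hence "odd m = odd n" "binary (m div 2) = binary (n div 2)" using less.prems by simp_all
    moreover have "m div 2 = n div 2" by (rule less.IH) (use False calculation in simp_all)
    ultimately show ?thesis by presburger
  qed
qed

text \<open>Digits are coded by pairs that start with False and separators by pairs that start with
  True, so the end of a number is recognised without lookahead.\<close>

lemma digits_decode:
  "concat (map (\<lambda>b. [False, b]) bs) @ True # xs = concat (map (\<lambda>b. [False, b]) cs) @ True # ys ==> bs = cs \<and> xs = ys"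
proof (induction bs arbitrary: cs)
  case Nil
  thus ?case by (cases cs) auto
next
  case (Cons b bs)
  then obtain c cs' where cs: "cs = c # cs'" by (cases cs) auto
  thus ?case using Cons.IH[of cs'] Cons.prems by simp
qed

lemma encode_nat_decode: "encode_nat m @ xs = encode_nat n @ ys ==> m = n \<and> xs = ys"
  using digits_decode[of "binary m" "False # xs" "binary n" "False # ys"] binary_inject
  by (simp add: encode_nat_def)

lemma encode_nat_end: "encode_nat m @ xs \<noteq> True # True # ys"
  by (cases "binary m") (simp_all add: encode_nat_def)

lemma encode_list_decode: "encode_list ms @ xs = encode_list ns @ ys ==> ms = ns \<and> xs = ys"
proof (induction ms arbitrary: ns)
  case Nil
  show ?case
  proof (cases ns)
    case (Cons n ns')
    thus ?thesis using Nil encode_nat_end[of n "encode_list ns' @ ys" xs, THEN not_sym]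
      by (simp add: encode_list_def)
  qed (use Nil in \<open>simp add: encode_list_def\<close>)
next
  case (Cons m ms)
  then obtain n ns' where ns: "ns = n # ns'"
    using encode_nat_end[of m "encode_list ms @ xs" ys] by (cases ns) (simp_all add: encode_list_def)
  hence "encode_nat m @ (encode_list ms @ xs) = encode_nat n @ (encode_list ns' @ ys)"
    using Cons.prems by (simp add: encode_list_def)
  hence "m = n" "encode_list ms @ xs = encode_list ns' @ ys" using encode_nat_decode by blast+
  thus ?case using Cons.IH ns by simp
qed

lemma unpair_inject: "unpair ps = unpair qs ==> ps = qs"
proof (induction ps arbitrary: qs)
  case Nil
  thus ?case by (cases qs) (auto simp: unpair_def)
next
  case (Cons p ps)
  thus ?case by (cases p; cases qs) (auto simp: unpair_def)
qed

text \<open>\<open>ROUTING_PLAN\<close> is a set of strings, so a string produced by the reduction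
  could belong to it on account of another listing; unique decoding excludes this.\<close>

lemma encode_inject: assumes "encode I = encode I'" shows "I = I'"
proof -
  obtain as vs es s t rs k where I: "I = (as, vs, es, s, t, rs, k)" by (cases I)
  obtain as' vs' es' s' t' rs' k' where I': "I' = (as', vs', es', s', t', rs', k')" by (cases I')
  have 1: "as = as'" and 2: "encode_list vs @ encode_list (unpair es) @ encode_list [s, t] @ encode_list (unpair rs) @ encode_list [k] =
    encode_list vs' @ encode_list (unpair es') @ encode_list [s', t'] @ encode_list (unpair rs') @ encode_list [k']"
    using encode_list_decode[OF assms[unfolded I I' encode.simps]] by blast+
  note 3 = encode_list_decode[OF 2]
  note 4 = encode_list_decode[OF 3[THEN conjunct2]]
  note 5 = encode_list_decode[OF 4[THEN conjunct2]]
  note 6 = encode_list_decode[OF 5[THEN conjunct2]]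
  have 7: "[k] = [k']" using encode_list_decode[of "[k]" "[]" "[k']" "[]"] 6 by simp
  show ?thesis unfolding I I' using 1 3 4 5 6 7 unpair_inject by simp
qed

section \<open>Formulas given by clause families\<close>

text \<open>
  A family \<open>(g, ls)\<close> stands for one clause for every triple of values of the variables 10, 11, 12
  that satisfies the guard \<open>g\<close>. In a literal \<open>(sg, y, te, pe)\<close>, \<open>sg\<close> is the sign, \<open>y\<close> the kind of
  the atom, and the expressions \<open>te\<close>, \<open>pe\<close> are its two indices.
\<close>

type_synonym lit = "bool \<times> nat \<times> exp \<times> exp"
type_synonym fam = "exp \<times> lit list"

definition e3 :: "nat => nat => nat => nat => nat" where
  "e3 t p p' = (\<lambda>_. 0)(10 := t, 11 := p, 12 := p')"

lemma e3_simps [simp]: "e3 t p p' 10 = t" "e3 t p p' 11 = p" "e3 t p p' 12 = p'"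
  by (simp_all add: e3_def)

definition lit_holds :: "bool list => (nat => nat => nat => bool) => (nat => nat) => lit => bool" where
  "lit_holds w A s = (\<lambda>(sg, y, te, pe). A y (val w s te) (val w s pe) \<longleftrightarrow> sg)"

definition fam_holds :: "bool list => nat => (nat => nat => nat => bool) => fam => bool" where
  "fam_holds w P A = (\<lambda>(g, ls). \<forall>t<P. \<forall>p<P. \<forall>p'<P. tr w (e3 t p p') g --> (\<exists>x\<in>set ls. lit_holds w A (e3 t p p') x))"

definition fam_closed :: "nat => fam => bool" where
  "fam_closed Kc = (\<lambda>(g, ls). fv g \<subseteq> {10, 11, 12} \<and>
     (\<forall>(sg, y, te, pe)\<in>set ls. y < Kc \<and> fv te \<subseteq> {10, 11, 12} \<and> fv pe \<subseteq> {10, 11, 12}))"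

definition fam_bounded :: "bool list => nat => fam => bool" where
  "fam_bounded w P = (\<lambda>(g, ls). \<forall>t<P. \<forall>p<P. \<forall>p'<P. tr w (e3 t p p') g -->
     (\<forall>(sg, y, te, pe)\<in>set ls. val w (e3 t p p') te < P \<and> val w (e3 t p p') pe < P))"

definition lit_exp :: "exp => lit => exp" where
  "lit_exp pE = (\<lambda>(sg, y, te, pe). eEq (V 0)
     (Plus (Times (N 2) (Plus (Times (Plus (Times (N y) pE) te) pE) pe)) (N (if sg then 0 else 1))))"

text \<open>A clause whose guard fails is given all literals instead of being omitted. Thus the
  number of clauses depends on \<open>P\<close> and the number of families only.\<close>

definition fam_exp :: "exp => nat => fam => exp" where
  "fam_exp pE i = (\<lambda>(g, ls). Times
     (eEq (V 1) (Plus (Times (Plus (Times (Plus (Times (N i) pE) (V 10)) pE) (V 11)) pE) (V 12)))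
     (Plus (eNot g) (eOrs (map (lit_exp pE) ls))))"

definition occ_exp :: "exp => fam list => exp" where
  "occ_exp pE fams = Sum 10 pE (Sum 11 pE (Sum 12 pE
     (eOrs (map (\<lambda>i. fam_exp pE i (fams ! i)) [0..<length fams]))))"

lemma radix_eq:
  fixes a b a' b' P :: nat
  assumes "a * P + b = a' * P + b'" "b < P" "b' < P"
  shows "a = a' \<and> b = b'"
proof -
  have "(a * P + b) div P = a" "(a' * P + b') div P = a'" "(a * P + b) mod P = b" "(a' * P + b') mod P = b'"
    using assms(2,3) by simp_all
  thus ?thesis using assms(1) by simp
qed

lemma radix_less:
  fixes a b P m :: nat
  assumes "a < m" "b < P"
  shows "a * P + b < m * P"
proof -
  have "a * P + b < (a + 1) * P" using assms(2) by simp
  also have "\<dots> \<le> m * P" using assms(1) by (intro mult_le_mono1) simp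
  finally show ?thesis .
qed

text \<open>Mixed-radix numbers: the kind or the family is the leading digit, and the other digits
  are below \<open>P\<close>. Variables carry two indices, clauses three.\<close>

definition vcode :: "nat => nat => nat => nat => nat" where "vcode P y t p = (y * P + t) * P + p"
definition ccode :: "nat => nat => nat => nat => nat => nat" where
  "ccode P i t p p' = ((i * P + t) * P + p) * P + p'"

locale families =
  fixes pE :: exp and Kc :: nat and fams :: "fam list"
  assumes pE: "fv pE = {}" and Kc: "1 \<le> Kc" and fams: "fams \<noteq> []"
    and closed: "\<And>f. f \<in> set fams ==> fam_closed Kc f"
    and P2: "\<And>w. 2 \<le> val w (\<lambda>_. 0) pE"
    and bounded: "\<And>w f. f \<in> set fams ==> fam_bounded w (val w (\<lambda>_. 0) pE) f"
begin

definition Pof :: "bool list => nat" where "Pof w = val w (\<lambda>_. 0) pE"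

lemma val_pE [simp]: "val w s pE = Pof w"
  unfolding Pof_def by (rule val_cong) (simp add: pE)

definition occ_of :: "bool list => nat => nat => bool" where
  "occ_of w l j \<longleftrightarrow> tr w ((\<lambda>_. 0)(0 := l, 1 := j)) (occ_exp pE fams)"

lemma occ_of_iff:
  "occ_of w l j \<longleftrightarrow> (\<exists>t<Pof w. \<exists>p<Pof w. \<exists>p'<Pof w. \<exists>i<length fams. j = ccode (Pof w) i t p p' \<and>
     (\<not> tr w (e3 t p p') (fst (fams ! i)) \<or>
      (\<exists>(sg, y, te, pe)\<in>set (snd (fams ! i)).
         l = 2 * vcode (Pof w) y (val w (e3 t p p') te) (val w (e3 t p p') pe) + (if sg then 0 else 1))))"
proof -
  let ?r = "\<lambda>t p p'. (\<lambda>_. 0)(0 := l, Suc 0 := j, 10 := t, 11 := p, 12 := p')"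
  have fam: "tr w (?r t p p') (fam_exp pE i (fams ! i)) \<longleftrightarrow> j = ccode (Pof w) i t p p' \<and>
     (\<not> tr w (e3 t p p') (fst (fams ! i)) \<or>
      (\<exists>(sg, y, te, pe)\<in>set (snd (fams ! i)).
         l = 2 * vcode (Pof w) y (val w (e3 t p p') te) (val w (e3 t p p') pe) + (if sg then 0 else 1)))"
    (is "_ \<longleftrightarrow> ?R") if i: "i < length fams" for i t p p'
  proof -
    obtain g ls where f: "fams ! i = (g, ls)" by (cases "fams ! i")
    hence c: "fam_closed Kc (g, ls)" using closed[of "(g, ls)"] nth_mem[OF i] by simp
    have g: "tr w (?r t p p') g = tr w (e3 t p p') g"
      by (rule tr_cong) (use c in \<open>auto simp: fam_closed_def e3_def\<close>)
    have l: "tr w (?r t p p') (lit_exp pE (sg, y, te, pe)) \<longleftrightarrow>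
      l = 2 * vcode (Pof w) y (val w (e3 t p p') te) (val w (e3 t p p') pe) + (if sg then 0 else 1)"
      if m: "(sg, y, te, pe) \<in> set ls" for sg y te pe
    proof -
      have "fv te \<subseteq> {10, 11, 12}" "fv pe \<subseteq> {10, 11, 12}" using c m by (auto simp: fam_closed_def)
      hence "val w (?r t p p') te = val w (e3 t p p') te" "val w (?r t p p') pe = val w (e3 t p p') pe"
        by (auto intro!: val_cong simp: e3_def)
      thus ?thesis by (simp add: lit_exp_def vcode_def)
    qed
    have "(\<exists>x\<in>set ls. tr w (?r t p p') (lit_exp pE x)) \<longleftrightarrow> (\<exists>(sg, y, te, pe)\<in>set ls.
         l = 2 * vcode (Pof w) y (val w (e3 t p p') te) (val w (e3 t p p') pe) + (if sg then 0 else 1))"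
    proof (rule bex_cong[OF refl])
      fix x assume x: "x \<in> set ls"
      obtain sg y te pe where xx: "x = (sg, y, te, pe)" by (cases x)
      show "tr w (?r t p p') (lit_exp pE x) \<longleftrightarrow> (case x of (sg, y, te, pe) =>
         l = 2 * vcode (Pof w) y (val w (e3 t p p') te) (val w (e3 t p p') pe) + (if sg then 0 else 1))"
        unfolding xx prod.case by (rule l) (use x xx in simp)
    qed
    thus ?thesis unfolding f fam_exp_def by (simp add: g ccode_def)
  qed
  have "occ_of w l j \<longleftrightarrow> (\<exists>t<Pof w. \<exists>p<Pof w. \<exists>p'<Pof w. \<exists>i<length fams. tr w (?r t p p') (fam_exp pE i (fams ! i)))"
    unfolding occ_of_def occ_exp_def by (simp add: Bex_def)
  thus ?thesis by (simp add: fam cong: conj_cong)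
qed

lemma satisfiable_iff:
  "(\<exists>\<alpha>. \<forall>j<length fams * Pof w * Pof w * Pof w. \<exists>l<2 * (Kc * Pof w * Pof w). occ_of w l j \<and> (\<alpha> (l div 2) \<longleftrightarrow> even l)) \<longleftrightarrow>
   (\<exists>A. \<forall>f\<in>set fams. fam_holds w (Pof w) A f)"
proof
  let ?P = "Pof w"
  have ci: "i = i2 \<and> t = t2 \<and> p = p2 \<and> p' = p2'"
    if "ccode ?P i t p p' = ccode ?P i2 t2 p2 p2'" "t < ?P" "p < ?P" "p' < ?P" "t2 < ?P" "p2 < ?P" "p2' < ?P"
    for i t p p' i2 t2 p2 p2'
    using radix_eq[OF that(1)[unfolded ccode_def] that(4,7)] that
      radix_eq[of "i * ?P + t" ?P p "i2 * ?P + t2" p2] radix_eq[of i ?P t i2 t2] by simp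
  assume "\<exists>\<alpha>. \<forall>j<length fams * ?P * ?P * ?P. \<exists>l<2 * (Kc * ?P * ?P). occ_of w l j \<and> (\<alpha> (l div 2) \<longleftrightarrow> even l)"
  then obtain \<alpha> where \<alpha>: "\<And>j. j < length fams * ?P * ?P * ?P ==> \<exists>l. occ_of w l j \<and> (\<alpha> (l div 2) \<longleftrightarrow> even l)" by blast
  have "fam_holds w ?P (\<lambda>y t p. \<alpha> (vcode ?P y t p)) f" if f: "f \<in> set fams" for f
  proof -
    obtain i where i: "i < length fams" "fams ! i = f" using f by (auto simp: in_set_conv_nth)
    obtain g ls where gl: "f = (g, ls)" by (cases f)
    have "\<exists>x\<in>set ls. lit_holds w (\<lambda>y t p. \<alpha> (vcode ?P y t p)) (e3 t p p') x"
      if tp: "t < ?P" "p < ?P" "p' < ?P" and g: "tr w (e3 t p p') g" for t p p'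
    proof -
      have "ccode ?P i t p p' < length fams * ?P * ?P * ?P"
        unfolding ccode_def using i tp by (intro radix_less)
      then obtain l where l: "occ_of w l (ccode ?P i t p p')" "\<alpha> (l div 2) \<longleftrightarrow> even l" using \<alpha> by blast
      obtain t2 p2 p2' i2 where 2: "t2 < ?P" "p2 < ?P" "p2' < ?P" "ccode ?P i t p p' = ccode ?P i2 t2 p2 p2'"
        and o: "\<not> tr w (e3 t2 p2 p2') (fst (fams ! i2)) \<or>
          (\<exists>(sg, y, te, pe)\<in>set (snd (fams ! i2)).
         l = 2 * vcode ?P y (val w (e3 t2 p2 p2') te) (val w (e3 t2 p2 p2') pe) + (if sg then 0 else 1))"
        using l(1) unfolding occ_of_iff by blast
      have e: "i = i2 \<and> t = t2 \<and> p = p2 \<and> p' = p2'" using ci[OF 2(4) tp 2(1-3)] .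
      have "(\<exists>(sg, y, te, pe)\<in>set ls.
         l = 2 * vcode ?P y (val w (e3 t p p') te) (val w (e3 t p p') pe) + (if sg then 0 else 1))"
        using o g i(2) gl by (simp add: e[THEN conjunct1, symmetric] e[THEN conjunct2, THEN conjunct1, symmetric]
          e[THEN conjunct2, THEN conjunct2, THEN conjunct1, symmetric] e[THEN conjunct2, THEN conjunct2, THEN conjunct2, symmetric])
      then obtain sg y te pe where m: "(sg, y, te, pe) \<in> set ls"
        and le: "l = 2 * vcode ?P y (val w (e3 t p p') te) (val w (e3 t p p') pe) + (if sg then 0 else 1)" by blast
      have "lit_holds w (\<lambda>y t p. \<alpha> (vcode ?P y t p)) (e3 t p p') (sg, y, te, pe)"
        using l(2) unfolding lit_holds_def le by (cases sg) simp_all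
      thus ?thesis using m by blast
    qed
    thus ?thesis unfolding gl fam_holds_def by blast
  qed
  thus "\<exists>A. \<forall>f\<in>set fams. fam_holds w ?P A f" by blast
next
  let ?P = "Pof w"
  have P: "0 < ?P" using P2[of w] unfolding Pof_def by simp
  assume "\<exists>A. \<forall>f\<in>set fams. fam_holds w ?P A f"
  then obtain A where A: "\<And>f. f \<in> set fams ==> fam_holds w ?P A f" by blast
  let ?\<alpha> = "\<lambda>v. A (v div ?P div ?P) (v div ?P mod ?P) (v mod ?P)"
  have "\<exists>l<2 * (Kc * ?P * ?P). occ_of w l j \<and> (?\<alpha> (l div 2) \<longleftrightarrow> even l)" if j: "j < length fams * ?P * ?P * ?P" for j
  proof -
    define i t p p' where d: "i = j div ?P div ?P div ?P" "t = j div ?P div ?P mod ?P" "p = j div ?P mod ?P" "p' = j mod ?P"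
    have b: "t < ?P" "p < ?P" "p' < ?P" using P by (simp_all add: d)
    have i: "i < length fams" using j unfolding d by (simp add: less_mult_imp_div_less)
    have jc: "j = ccode ?P i t p p'" unfolding ccode_def d by (simp only: div_mult_mod_eq)
    obtain g ls where gl: "fams ! i = (g, ls)" by (cases "fams ! i")
    have m: "(g, ls) \<in> set fams" using nth_mem[OF i] gl by simp
    show ?thesis
    proof (cases "tr w (e3 t p p') g")
      case True
      then obtain x where x: "x \<in> set ls" "lit_holds w A (e3 t p p') x"
        using A[OF m] b unfolding fam_holds_def by blast
      obtain sg y te pe where xx: "x = (sg, y, te, pe)" by (cases x)
      have y: "y < Kc" using closed[OF m] x(1) unfolding xx fam_closed_def by blast
      have bd: "val w (e3 t p p') te < ?P" "val w (e3 t p p') pe < ?P"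
      proof -
        have "\<forall>(sg, y, te, pe)\<in>set ls. val w (e3 t p p') te < ?P \<and> val w (e3 t p p') pe < ?P"
          using bounded[OF m, of w] True b unfolding fam_bounded_def Pof_def prod.case by simp
        from bspec[OF this x(1)] show "val w (e3 t p p') te < ?P" "val w (e3 t p p') pe < ?P"
          by (simp_all add: xx)
      qed
      define v where "v = vcode ?P y (val w (e3 t p p') te) (val w (e3 t p p') pe)"
      define l where "l = 2 * v + (if sg then 0 else 1)"
      have "v < Kc * ?P * ?P" unfolding v_def vcode_def using y bd by (intro radix_less)
      hence "l < 2 * (Kc * ?P * ?P)" unfolding l_def by simp
      moreover have "occ_of w l j" unfolding occ_of_iff
      proof (intro exI conjI)
        show "j = ccode ?P i t p p'" by (rule jc)
        show "\<not> tr w (e3 t p p') (fst (fams ! i)) \<or> (\<exists>(sg, y, te, pe)\<in>set (snd (fams ! i)).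
         l = 2 * vcode ?P y (val w (e3 t p p') te) (val w (e3 t p p') pe) + (if sg then 0 else 1))"
          unfolding gl prod.sel l_def v_def by (rule disjI2, rule bexI[OF _ x(1)]) (simp add: xx)
      qed (use b i in simp_all)
      moreover have "?\<alpha> v \<longleftrightarrow> sg"
        using x(2) bd unfolding xx lit_holds_def v_def vcode_def by simp
      hence "?\<alpha> (l div 2) \<longleftrightarrow> even l" unfolding l_def by simp
      ultimately show ?thesis by blast
    next
      case False
      \<comment> \<open>The clause of a failing guard contains every literal, so whichever of the
        literals 0 and 1 is true satisfies it.\<close>
      have "occ_of w l j" for l unfolding occ_of_iff
      proof (intro exI conjI)
        show "j = ccode ?P i t p p'" by (rule jc)
        show "\<not> tr w (e3 t p p') (fst (fams ! i)) \<or> (\<exists>(sg, y, te, pe)\<in>set (snd (fams ! i)).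
         l = 2 * vcode ?P y (val w (e3 t p p') te) (val w (e3 t p p') pe) + (if sg then 0 else 1))"
          using False gl by simp
      qed (use b i in simp_all)
      moreover define l :: nat where "l = (if ?\<alpha> 0 then 0 else 1)"
      moreover have "?\<alpha> (l div 2) \<longleftrightarrow> even l" unfolding l_def by simp
      moreover have "1 \<le> Kc * ?P * ?P" using Kc P by simp
      hence "l < 2 * (Kc * ?P * ?P)" unfolding l_def by (simp only: split: if_split) linarith
      ultimately show ?thesis by blast
    qed
  qed
  thus "\<exists>\<alpha>. \<forall>j<length fams * ?P * ?P * ?P. \<exists>l<2 * (Kc * ?P * ?P). occ_of w l j \<and> (\<alpha> (l div 2) \<longleftrightarrow> even l)" by (intro exI[of _ ?\<alpha>] allI impI)
qed

definition gadget_com :: com where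
  "gadget_com = emit_gadget (Times (Times (N Kc) pE) pE)
     (Times (Times (Times (N (length fams)) pE) pE) pE) (occ_exp pE fams)"

lemma fv_occ_exp: "fv (occ_exp pE fams) \<subseteq> {0, 1}"
proof -
  have l: "fv (lit_exp pE x) \<subseteq> {0, 10, 11, 12}" if "fam_closed Kc (g, ls)" "x \<in> set ls" for g ls x
    using that pE by (cases x) (auto simp: lit_exp_def fam_closed_def)
  have "fv (fam_exp pE i f) \<subseteq> {0, 1, 10, 11, 12}" if f: "f \<in> set fams" for i f
  proof -
    obtain g ls where gl: "f = (g, ls)" by (cases f)
    have c: "fam_closed Kc (g, ls)" using closed[OF f] gl by simp
    hence "fv g \<subseteq> {10, 11, 12}" by (simp add: fam_closed_def)
    moreover have "fv (eOrs (map (lit_exp pE) ls)) \<subseteq> {0, 10, 11, 12}" using l[OF c] by (simp add: UN_subset_iff)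
    ultimately show ?thesis unfolding gl fam_exp_def prod.case by (simp add: pE) blast
  qed
  hence "fv (eOrs (map (\<lambda>i. fam_exp pE i (fams ! i)) [0..<length fams])) \<subseteq> {0, 1, 10, 11, 12}"
    by (simp add: UN_subset_iff)
  thus ?thesis unfolding occ_exp_def by (auto simp: pE)
qed

theorem reduction:
  "\<exists>f. polytime_computable f \<and> (\<forall>x. f x \<in> crossing_bounded 6) \<and>
     (\<forall>x. (\<exists>A. \<forall>f\<in>set fams. fam_holds x (Pof x) A f) \<longleftrightarrow> f x \<in> ROUTING_PLAN)"
proof -
  let ?f = "\<lambda>x. map (\<lambda>a. a = 2) (out x (\<lambda>_. 0) gadget_com)"
  let ?K = "\<lambda>x. Kc * Pof x * Pof x" and ?C = "\<lambda>x. length fams * Pof x * Pof x * Pof x"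
  have P: "2 \<le> Pof x" for x unfolding Pof_def by (rule P2)
  have g: "gadget (?K x) (?C x)" for x
  proof
    show "1 \<le> ?K x" using Kc P[of x] by simp
    \<comment> \<open>The lower bound 2 on \<open>P\<close> and the presence of a family provide the
      four clauses that the gadget requires.\<close>
    have "1 * 2 * 2 * 2 \<le> ?C x" using fams P[of x] by (intro mult_le_mono) (simp_all add: Suc_leI)
    thus "4 \<le> ?C x" by simp
  qed
  let ?I = "\<lambda>x. gadget.listing (?K x) (?C x) (occ_of x)"
  have f: "?f x = encode (?I x)" for x
  proof -
    have "out x (\<lambda>_. 0) gadget_com = map bit_symbol (encode (?I x))"
      unfolding gadget_com_def
      by (rule gadget.out_emit_gadget[OF g]) (use fv_occ_exp in \<open>simp_all add: pE occ_of_def\<close>)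
    thus ?thesis by (simp add: o_def bit_symbol_def)
  qed
  have wf: "wf_listing (?I x)" for x by (rule gadget.wf_listing_gadget[OF g])
  have sol: "(\<exists>s. solution (routing_of (?I x)) s) \<longleftrightarrow> (\<exists>A. \<forall>f\<in>set fams. fam_holds x (Pof x) A f)" for x
    unfolding satisfiable_iff[symmetric] by (rule gadget.gadget_correct(1)[OF g])
  show ?thesis
  proof (intro exI conjI allI)
    show "polytime_computable ?f"
      by (rule polytime_com) (unfold gadget_com_def, rule syms_emit_gadget)
    show "?f x \<in> crossing_bounded 6" for x
      unfolding crossing_bounded_def f using wf gadget.gadget_correct(2)[OF g] by blast
    show "(\<exists>A. \<forall>f\<in>set fams. fam_holds x (Pof x) A f) \<longleftrightarrow> ?f x \<in> ROUTING_PLAN" for x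
    proof
      assume "\<exists>A. \<forall>f\<in>set fams. fam_holds x (Pof x) A f"
      thus "?f x \<in> ROUTING_PLAN" unfolding f ROUTING_PLAN_def using wf sol by blast
    next
      assume "?f x \<in> ROUTING_PLAN"
      then obtain I where "encode (?I x) = encode I" "\<exists>s. solution (routing_of I) s"
        unfolding f ROUTING_PLAN_def by blast
      hence "\<exists>s. solution (routing_of (?I x)) s" using encode_inject by metis
      thus "\<exists>A. \<forall>f\<in>set fams. fam_holds x (Pof x) A f" unfolding sol .
    qed
  qed
qed

end

section \<open>Computations as formulas\<close>

fun ePow :: "exp => nat => exp" where
  "ePow e 0 = N 1"
| "ePow e (Suc n) = Times e (ePow e n)"

lemma ePow_simps [simp]: "val w s (ePow e n) = val w s e ^ n" "fv (ePow e n) \<subseteq> fv e"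
  by (induction n) auto

fun dir_int :: "dir => int" where "dir_int MoveL = -1" | "dir_int Stay = 0" | "dir_int MoveR = 1"

lemma tape_act_eq: "tape_act ad tp = ((fst tp)(snd tp := fst ad), snd tp + dir_int (snd ad))"
  by (cases ad; cases tp; cases "snd ad") (simp_all add: tape_act.simps)

lemma tape_read_eq: "tape_read tp = fst tp (snd tp)"
  by (cases tp) (simp add: tape_read.simps)

locale cook =
  fixes M :: tm and c d c' d' :: nat
  assumes wf: "wf_tm M"
begin

abbreviation "nt \<equiv> tm_tapes M"
abbreviation "S \<equiv> tm_symbols M"
abbreviation "Qn \<equiv> tm_states M"

text \<open>The transition function is extended to idle in the halting states. Every round then
  obeys the same rule, and acceptance can be read off at the time bound.\<close>

definition delta :: "nat => nat list => nat \<times> (nat \<times> dir) list" where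
  "delta q ss = (if q = 1 \<or> q = 2 then (q, map (\<lambda>a. (a, Stay)) ss) else tm_delta M q ss)"

lemma tm_step_delta:
  "tm_step M (q, ts) = (fst (delta q (map tape_read ts)), map2 tape_act (snd (delta q (map tape_read ts))) ts)"
proof (cases "q = 1 \<or> q = 2")
  case True
  have "map2 tape_act (map (\<lambda>a. (a, Stay)) (map tape_read ts)) ts = ts"
    by (rule nth_equalityI) (simp_all add: tape_act_eq tape_read_eq)
  thus ?thesis using True by (simp add: delta_def)
next
  case False
  thus ?thesis by (simp add: delta_def split: prod.split)
qed

lemma sizes: "2 \<le> nt" "3 \<le> S" "3 \<le> Qn"
  using wf by (auto simp: wf_tm_def)

lemma delta_wf:
  assumes "q < Qn" "length ss = nt" "\<And>a. a \<in> set ss ==> a < S"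
  shows "fst (delta q ss) < Qn" "length (snd (delta q ss)) = nt" "\<And>x. x \<in> set (snd (delta q ss)) ==> fst x < S"
proof -
  have h: "\<forall>q<Qn. \<forall>ss. length ss = nt \<and> (\<forall>a\<in>set ss. a < S) -->
      (case tm_delta M q ss of (q', acts) => q' < Qn \<and> length acts = nt \<and> (\<forall>(a, d)\<in>set acts. a < S))"
    using wf by (simp add: wf_tm_def)
  have "length ss = nt \<and> (\<forall>a\<in>set ss. a < S)" using assms(2,3) by blast
  hence t: "case tm_delta M q ss of (q', acts) => q' < Qn \<and> length acts = nt \<and> (\<forall>(a, d)\<in>set acts. a < S)"
    by (rule mp[OF spec[OF mp[OF spec[OF h] assms(1)]]])
  obtain q' acts where qa: "tm_delta M q ss = (q', acts)" by (cases "tm_delta M q ss")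
  have "\<forall>x\<in>set acts. fst x < S" using t unfolding qa by auto
  hence "fst (delta q ss) < Qn \<and> length (snd (delta q ss)) = nt \<and> (\<forall>x\<in>set (snd (delta q ss)). fst x < S)"
    using t assms by (simp add: delta_def qa)
  thus "fst (delta q ss) < Qn" "length (snd (delta q ss)) = nt" "\<And>x. x \<in> set (snd (delta q ss)) ==> fst x < S"
    by blast+
qed

text \<open>\<open>uE\<close> bounds the certificates and \<open>tE\<close> the running time; the
  lengths are added to \<open>tE\<close> so that input and certificate fit into the window of cells
  considered. After the shift by \<open>tE\<close>, positions between \<open>-tE\<close> and
  \<open>tE\<close> are below \<open>pE\<close>, and the summand 2 keeps \<open>pE\<close> at least
  2.\<close>

definition uE :: exp where "uE = Plus (Times (N c') (ePow Len d')) (N c')"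
definition tE :: exp where
  "tE = Plus (Plus (Plus (Times (N c) (ePow (Plus Len uE) d)) (N c)) Len) uE"
definition pE :: exp where "pE = Plus (Times (N 2) tE) (N 2)"

definition Ub :: "bool list => nat" where "Ub x = c' * length x ^ d' + c'"
definition Tb :: "bool list => nat" where "Tb x = c * (length x + Ub x) ^ d + c + length x + Ub x"

lemma fv_bounds [simp]: "fv uE = {}" "fv tE = {}" "fv pE = {}"
  using ePow_simps(2)[of Len d'] ePow_simps(2)[of "Plus Len uE" d] by (auto simp: uE_def tE_def pE_def)

lemma val_bounds [simp]: "val x s uE = Ub x" "val x s tE = Tb x" "val x s pE = 2 * Tb x + 2"
  by (simp_all add: uE_def tE_def pE_def Ub_def Tb_def)

text \<open>
  The kinds of atoms: the state is \<open>q\<close>; the head of tape \<open>k\<close> is at the given position; the cell of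
  tape \<open>k\<close> at the given position contains \<open>a\<close>; tape \<open>k\<close> scans \<open>a\<close>. Positions are shifted by the
  time bound, so that they are not negative.
\<close>

definition kQ :: "nat => nat" where "kQ q = 4 * q"
definition kH :: "nat => nat" where "kH k = 4 * k + 1"
definition kC :: "nat => nat => nat" where "kC k a = 4 * (k * S + a) + 2"
definition kR :: "nat => nat => nat" where "kR k a = 4 * (k * S + a) + 3"
definition Kc :: nat where "Kc = 4 * (Qn + nt + nt * S)"

lemma kinds_less:
  "q < Qn ==> kQ q < Kc" "k < nt ==> kH k < Kc"
  "k < nt ==> a < S ==> kC k a < Kc" "k < nt ==> a < S ==> kR k a < Kc"
  using radix_less[of k nt a S] by (simp_all add: kQ_def kH_def kC_def kR_def Kc_def)

abbreviation "vt \<equiv> V 10"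
abbreviation "vp \<equiv> V 11"
abbreviation "vp' \<equiv> V 12"

text \<open>All clauses of the transition relation push true atoms forward; none asserts that state,
  head position or symbol is unique. The conflict with a non-accepting run arises at the end, where
  \<open>f_acc\<close> forbids every other state.\<close>

definition f_state :: fam where "f_state = (N 1, [(True, kQ 0, N 0, N 0)])"
definition f_head :: "nat => fam" where "f_head k = (N 1, [(True, kH k, N 0, tE)])"
definition f_bit1 :: fam where
  "f_bit1 = (Times (eEq vp (Plus tE vp')) (Times (Less vp' Len) (Bit vp')), [(True, kC 0 2, N 0, vp)])"
definition f_bit0 :: fam where
  "f_bit0 = (Times (eEq vp (Plus tE vp')) (Times (Less vp' Len) (eNot (Bit vp'))), [(True, kC 0 1, N 0, vp)])"
definition f_pad0 :: fam where
  "f_pad0 = (Plus (Less vp tE) (eLe (Plus tE Len) vp), [(True, kC 0 0, N 0, vp)])"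
text \<open>The certificate is the only part of the initial configuration that is left open.\<close>

definition f_guess :: fam where
  "f_guess = (Times (eLe tE vp) (Less vp (Plus tE uE)), [(True, kC 1 0, N 0, vp), (True, kC 1 1, N 0, vp), (True, kC 1 2, N 0, vp)])"
text \<open>A blank inside the certificate area is followed by blanks only, so that the guessed
  content is a string.\<close>

definition f_end :: fam where
  "f_end = (Times (eLe tE vp) (Less (Plus vp (N 1)) (Plus tE uE)), [(False, kC 1 0, N 0, vp), (True, kC 1 0, N 0, Plus vp (N 1))])"
definition f_pad1 :: fam where
  "f_pad1 = (Plus (Less vp tE) (eLe (Plus tE uE) vp), [(True, kC 1 0, N 0, vp)])"
definition f_blank :: "nat => fam" where "f_blank k = (N 1, [(True, kC k 0, N 0, vp)])"
definition f_read :: "nat => nat => fam" where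
  "f_read k a = (N 1, [(False, kH k, vt, vp), (False, kC k a, vt, vp), (True, kR k a, vt, N 0)])"
definition f_frame :: "nat => nat => fam" where
  "f_frame k a = (Times (eNot (eEq vp vp')) (Less vt tE),
     [(False, kH k, vt, vp'), (False, kC k a, vt, vp), (True, kC k a, Plus vt (N 1), vp)])"
text \<open>Negated premises: the present state is \<open>q\<close> and the scanned symbols are
  \<open>ss\<close>. A scanned symbol is an atom of its own, since otherwise the position of every
  head would have to be an index of the clause, which has only three.\<close>

definition prem :: "nat => nat list => lit list" where
  "prem q ss = (False, kQ q, vt, N 0) # map (\<lambda>k. (False, kR k (ss ! k), vt, N 0)) [0..<nt]"
definition f_next :: "nat => nat list => fam" where
  "f_next q ss = (Less vt tE, prem q ss @ [(True, kQ (fst (delta q ss)), Plus vt (N 1), N 0)])"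
fun moved :: "dir => exp" where
  "moved MoveL = eEq vp (Plus vp' (N 1))" | "moved Stay = eEq vp vp'" | "moved MoveR = eEq vp' (Plus vp (N 1))"
definition f_move :: "nat => nat => nat list => fam" where
  "f_move k q ss = (Times (Less vt tE) (moved (snd (snd (delta q ss) ! k))),
     prem q ss @ [(False, kH k, vt, vp), (True, kH k, Plus vt (N 1), vp')])"
definition f_write :: "nat => nat => nat list => fam" where
  "f_write k q ss = (Less vt tE,
     prem q ss @ [(False, kH k, vt, vp), (True, kC k (fst (snd (delta q ss) ! k)), Plus vt (N 1), vp)])"
definition f_acc :: "nat => fam" where "f_acc q = (N 1, [(False, kQ q, tE, N 0)])"

text \<open>All tuples of scanned symbols. Their number depends on the machine only, so the list of
  families is fixed.\<close>

definition words :: "nat list list" where "words = List.n_lists nt [0..<S]"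

lemma words_iff: "ss \<in> set words \<longleftrightarrow> length ss = nt \<and> (\<forall>a\<in>set ss. a < S)"
  by (auto simp: words_def set_n_lists)

definition fams :: "fam list" where
  "fams = [f_state, f_bit1, f_bit0, f_pad0, f_guess, f_end, f_pad1] @ map f_head [0..<nt] @ map f_blank [2..<nt] @
     concat (map (\<lambda>k. concat (map (\<lambda>a. [f_read k a, f_frame k a]) [0..<S])) [0..<nt]) @
     concat (map (\<lambda>q. concat (map (\<lambda>ss. f_next q ss # concat (map (\<lambda>k. [f_move k q ss, f_write k q ss]) [0..<nt])) words)) [0..<Qn]) @
     map f_acc (filter (\<lambda>q. q \<noteq> 1) [0..<Qn])"

lemma fams_ball:
  "(\<forall>f\<in>set fams. R f) \<longleftrightarrow> R f_state \<and> R f_bit1 \<and> R f_bit0 \<and> R f_pad0 \<and> R f_guess \<and> R f_end \<and> R f_pad1 \<and>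
     (\<forall>k\<in>{..<nt}. R (f_head k)) \<and> (\<forall>k\<in>{2..<nt}. R (f_blank k)) \<and>
     (\<forall>k\<in>{..<nt}. \<forall>a\<in>{..<S}. R (f_read k a) \<and> R (f_frame k a)) \<and>
     (\<forall>q\<in>{..<Qn}. \<forall>ss\<in>set words. R (f_next q ss) \<and> (\<forall>k\<in>{..<nt}. R (f_move k q ss) \<and> R (f_write k q ss))) \<and>
     (\<forall>q\<in>{q. q < Qn \<and> q \<noteq> 1}. R (f_acc q))"
proof -
  have "set fams = {f_state, f_bit1, f_bit0, f_pad0, f_guess, f_end, f_pad1} \<union> f_head ` {..<nt} \<union> f_blank ` {2..<nt} \<union>
     (\<Union>k\<in>{..<nt}. \<Union>a\<in>{..<S}. {f_read k a, f_frame k a}) \<union>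
     (\<Union>q\<in>{..<Qn}. \<Union>ss\<in>set words. insert (f_next q ss) (\<Union>k\<in>{..<nt}. {f_move k q ss, f_write k q ss})) \<union>
     f_acc ` {q. q < Qn \<and> q \<noteq> 1}"
    unfolding fams_def by (simp add: atLeast0LessThan insert_commute Un_assoc)
  thus ?thesis by (simp only: ball_Un ball_UN ball_simps(5,7,9) conj_assoc empty_iff ball_empty ball_simps simp_thms)
qed

lemma word_nth: "ss \<in> set words ==> k < nt ==> ss ! k < S"
  using nth_mem[of k ss] by (simp add: words_iff)

lemma delta_words:
  assumes "q < Qn" "ss \<in> set words"
  shows "fst (delta q ss) < Qn" "k < nt ==> fst (snd (delta q ss) ! k) < S"
proof -
  have a: "length ss = nt" "\<And>a. a \<in> set ss ==> a < S" using assms(2) by (auto simp: words_iff)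
  show "fst (delta q ss) < Qn" by (rule delta_wf(1)[OF assms(1) a])
  show "fst (snd (delta q ss) ! k) < S" if "k < nt"
    by (rule delta_wf(3)[OF assms(1) a]) (use that delta_wf(2)[OF assms(1) a] in simp_all)
qed

lemma fams_closed: "\<forall>f\<in>set fams. fam_closed Kc f"
proof -
  have m: "fv (moved x) \<subseteq> {10, 11, 12}" for x by (cases x) simp_all
  show ?thesis
    unfolding fams_ball
    by (intro conjI ballI) (use sizes in \<open>simp_all add: kinds_less delta_words word_nth m fam_closed_def f_state_def f_bit1_def f_bit0_def f_pad0_def f_guess_def f_end_def f_pad1_def
      f_head_def f_blank_def f_read_def f_frame_def f_next_def f_move_def f_write_def f_acc_def prem_def\<close>)
qed

lemma fams_bounded: "\<forall>f\<in>set fams. fam_bounded w (2 * Tb w + 2) f"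
  unfolding fams_ball
  by (intro conjI ballI) (auto simp add: fam_bounded_def f_state_def f_bit1_def f_bit0_def f_pad0_def f_guess_def f_end_def f_pad1_def
      f_head_def f_blank_def f_read_def f_frame_def f_next_def f_move_def f_write_def f_acc_def prem_def Tb_def)

lemma families: "families pE Kc fams"
proof
  show "1 \<le> Kc" using sizes by (simp add: Kc_def)
  show "fams \<noteq> []" by (simp add: fams_def)
qed (use fams_closed fams_bounded in simp_all)

end

section \<open>Correspondence between satisfying assignments and accepting runs\<close>

context cook
begin

abbreviation headp :: "tm_config => nat => int" where
  "headp C k \<equiv> snd (snd C ! k)"
abbreviation cellf :: "tm_config => nat => int => nat" where
  "cellf C k \<equiv> fst (snd C ! k)"
abbreviation "hcol x C k \<equiv> nat (headp C k + int (Tb x))"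
abbreviation "ccol x C k p \<equiv> cellf C k (int p - int (Tb x))"

text \<open>In \<open>t\<close> rounds a head moves at most \<open>t\<close> cells, so up to the
  time bound no head leaves the window of cells covered by the formula.\<close>

definition good :: "nat => tm_config => bool" where
  "good t C \<longleftrightarrow> fst C < Qn \<and> length (snd C) = nt \<and>
     (\<forall>k<nt. (\<forall>i. cellf C k i < S) \<and> \<bar>headp C k\<bar> \<le> int t)"

lemma good_word: "good t C ==> map tape_read (snd C) \<in> set words"
  unfolding words_iff
proof (intro conjI ballI)
  assume g: "good t C"
  thus "length (map tape_read (snd C)) = nt" by (simp add: good_def)
  fix a assume "a \<in> set (map tape_read (snd C))"
  then obtain k where "k < length (snd C)" "a = tape_read (snd C ! k)" by (auto simp: in_set_conv_nth)
  thus "a < S" using g unfolding good_def by (simp add: tape_read_eq)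
qed

lemma fam_holdsD:
  "fam_holds w P A (g, ls) ==> t < P ==> p < P ==> p' < P ==> tr w (e3 t p p') g ==>
     \<exists>x\<in>set ls. lit_holds w A (e3 t p p') x"
  by (simp add: fam_holds_def)

lemma lit_holds_iff [simp]: "lit_holds w A s (sg, y, te, pe) \<longleftrightarrow> A y (val w s te) (val w s pe) = sg"
  by (simp add: lit_holds_def)

lemma tm_step_nth:
  assumes "good t C" "k < nt"
  defines "D \<equiv> delta (fst C) (map tape_read (snd C))"
  shows "fst (tm_step M C) = fst D"
    "cellf (tm_step M C) k = (cellf C k)(headp C k := fst (snd D ! k))"
    "headp (tm_step M C) k = headp C k + dir_int (snd (snd D ! k))"
proof -
  have l: "length (snd C) = nt" "fst C < Qn" using assms by (auto simp: good_def)
  have w: "map tape_read (snd C) \<in> set words" by (rule good_word[OF assms(1)])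
  have ld: "length (snd D) = nt" unfolding D_def
    by (rule delta_wf(2)[OF l(2)]) (use w in \<open>auto simp: words_iff\<close>)
  have s: "tm_step M C = (fst D, map2 tape_act (snd D) (snd C))"
    unfolding D_def using tm_step_delta[of "fst C" "snd C"] by simp
  show "fst (tm_step M C) = fst D" unfolding s by simp
  have n: "map2 tape_act (snd D) (snd C) ! k = tape_act (snd D ! k) (snd C ! k)"
    using ld l assms(2) by simp
  show "cellf (tm_step M C) k = (cellf C k)(headp C k := fst (snd D ! k))"
    "headp (tm_step M C) k = headp C k + dir_int (snd (snd D ! k))"
    unfolding s snd_conv n tape_act_eq by simp_all
qed

lemma good_step:
  assumes "good t C"
  shows "good (Suc t) (tm_step M C)"
proof -
  let ?D = "delta (fst C) (map tape_read (snd C))"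
  have q: "fst C < Qn" and l: "length (snd C) = nt" using assms by (auto simp: good_def)
  have w: "map tape_read (snd C) \<in> set words" by (rule good_word[OF assms])
  have "length (snd ?D) = nt" by (rule delta_wf(2)[OF q]) (use w in \<open>auto simp: words_iff\<close>)
  hence "length (snd (tm_step M C)) = nt" using tm_step_delta[of "fst C" "snd C"] l by simp
  moreover have "fst (tm_step M C) < Qn"
    unfolding tm_step_nth(1)[OF assms, of 0, OF order.strict_trans2[OF zero_less_numeral sizes(1)]]
    by (rule delta_words(1)[OF q w])
  moreover have "(\<forall>i. cellf (tm_step M C) k i < S) \<and> \<bar>headp (tm_step M C) k\<bar> \<le> int (Suc t)" if k: "k < nt" for k
  proof -
    have o: "\<And>i. cellf C k i < S" "\<bar>headp C k\<bar> \<le> int t" using assms k unfolding good_def by auto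
    have "\<bar>dir_int (snd (snd ?D ! k))\<bar> \<le> 1" by (cases "snd (snd ?D ! k)") auto
    hence "\<bar>headp C k + dir_int (snd (snd ?D ! k))\<bar> \<le> int (Suc t)" using o(2) by linarith
    thus ?thesis unfolding tm_step_nth(2,3)[OF assms k] using o(1) delta_words(2)[OF q w k] by simp
  qed
  ultimately show ?thesis by (simp add: good_def)
qed

lemma tm_init_nth: "length (snd (tm_init M [x, u])) = nt"
  "snd (tm_init M [x, u]) ! 0 = input_tape x" "snd (tm_init M [x, u]) ! 1 = input_tape u"
  "2 \<le> k ==> k < nt ==> snd (tm_init M [x, u]) ! k = input_tape []" "fst (tm_init M [x, u]) = 0"
  using sizes(1) by (auto simp: tm_init_def nth_append nth_Cons split: nat.split)

lemma good_init: "good 0 (tm_init M [x, u])"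
proof -
  have a: "fst (input_tape v) i < S" "snd (input_tape v) = 0" for v i
    using sizes(2) by (auto simp: input_tape_def bit_symbol_def)
  have "\<exists>v. snd (tm_init M [x, u]) ! k = input_tape v" if "k < nt" for k
  proof -
    consider "k = 0" | "k = 1" | "2 \<le> k" by linarith
    thus ?thesis using tm_init_nth that by cases blast+
  qed
  hence "(\<forall>i. cellf (tm_init M [x, u]) k i < S) \<and> \<bar>headp (tm_init M [x, u]) k\<bar> \<le> int 0" if "k < nt" for k
    using a that by (metis abs_zero of_nat_0 order_refl)
  thus ?thesis using sizes(3) unfolding good_def by (simp add: tm_init_nth)
qed

lemma good_run: "good t (tm_run M [x, u] t)"
proof (induction t)
  case 0
  show ?case using good_init by (simp add: tm_run_def)
next
  case (Suc t)
  thus ?case unfolding tm_run_Suc by (rule good_step)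
qed

text \<open>Only the atoms that are true of the configuration are demanded; the assignment may make
  others true as well.\<close>

definition facts :: "bool list => (nat => nat => nat => bool) => nat => tm_config => bool" where
  "facts x A t C \<longleftrightarrow> A (kQ (fst C)) t 0 \<and>
     (\<forall>k<nt. A (kH k) t (hcol x C k) \<and>
       (\<forall>p<2 * Tb x + 2. A (kC k (ccol x C k p)) t p))"

lemma facts_step:
  assumes A: "\<forall>f\<in>set fams. fam_holds x (2 * Tb x + 2) A f"
    and f: "facts x A t C" and g: "good t C" and t: "t < Tb x"
  shows "facts x A (Suc t) (tm_step M C)"
proof -
  let ?P = "2 * Tb x + 2"
  let ?ss = "map tape_read (snd C)"
  let ?D = "delta (fst C) ?ss"
  have q: "fst C < Qn" and l: "length (snd C) = nt" using g by (auto simp: good_def)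
  have w: "?ss \<in> set words" by (rule good_word[OF g])
  note AA = A[unfolded fams_ball]
  have tP: "t < ?P" using t by simp
  have hd: "hcol x C k < ?P" "int (hcol x C k) = headp C k + int (Tb x)"
    if "k < nt" for k
  proof -
    have "\<bar>headp C k\<bar> \<le> int t" using g that unfolding good_def by blast
    thus "hcol x C k < ?P" "int (hcol x C k) = headp C k + int (Tb x)"
      using t by linarith+
  qed
  have H: "A (kH k) t (hcol x C k)" if "k < nt" for k using f that unfolding facts_def by blast
  have Cl: "A (kC k (ccol x C k p)) t p" if "k < nt" "p < ?P" for k p
    using f that unfolding facts_def by blast
  have sym: "cellf C k i < S" if "k < nt" for k i using g that unfolding good_def by blast
  have rd: "A (kR k (?ss ! k)) t 0" if k: "k < nt" for k
  proof -
    let ?p = "hcol x C k"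
    let ?a = "cellf C k (headp C k)"
    have "fam_holds x ?P A (f_read k ?a)" using AA k sym by simp
    from fam_holdsD[OF this[unfolded f_read_def] tP hd(1)[OF k] tP]
    have "A (kR k ?a) t 0 \<or> \<not> A (kH k) t ?p \<or> \<not> A (kC k ?a) t ?p" by auto
    thus ?thesis using H[OF k] Cl[OF k hd(1)[OF k]] hd(2)[OF k] k l by (simp add: tape_read_eq)
  qed
  have pr: "\<not> lit_holds x A (e3 t p p') y" if "y \<in> set (prem (fst C) ?ss)" for y p p'
  proof -
    have "A (kQ (fst C)) t 0" using f unfolding facts_def by blast
    thus ?thesis using that rd unfolding prem_def by (auto simp del: map_map nth_map)
  qed
  have fires: "\<exists>y\<in>set ls. lit_holds x A (e3 t p p') y"
    if fh: "fam_holds x ?P A (gd, prem (fst C) ?ss @ ls)" "p < ?P" "p' < ?P" "tr x (e3 t p p') gd" for gd ls p p'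
  proof -
    obtain y where "y \<in> set (prem (fst C) ?ss @ ls)" "lit_holds x A (e3 t p p') y"
      using fam_holdsD[OF fh(1) tP fh(2-4)] by blast
    thus ?thesis using pr[of y p p'] by auto
  qed
  have nx: "fam_holds x ?P A (f_next (fst C) ?ss)"
    and mv: "\<And>k. k < nt ==> fam_holds x ?P A (f_move k (fst C) ?ss)"
    and wr: "\<And>k. k < nt ==> fam_holds x ?P A (f_write k (fst C) ?ss)"
    using AA q w by (simp_all del: map_map)
  have "A (kQ (fst ?D)) (Suc t) 0"
    using fires[OF nx[unfolded f_next_def], of 0 0] t by simp
  moreover have "A (kH k) (Suc t) (hcol x (tm_step M C) k)" if k: "k < nt" for k
  proof -
    let ?p = "hcol x C k"
    let ?d = "snd (snd ?D ! k)"
    let ?p' = "nat (headp C k + dir_int ?d + int (Tb x))"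
    have b: "\<bar>headp C k\<bar> \<le> int t" using g k unfolding good_def by blast
    have p': "?p' < ?P" using b t by (cases ?d) simp_all
    have "tr x (e3 t ?p ?p') (moved ?d)" using b t by (cases ?d) (simp_all; linarith)+
    thus ?thesis
      using fires[OF mv[OF k, unfolded f_move_def] hd(1)[OF k] p'] t H[OF k] unfolding tm_step_nth(3)[OF g k]
      by simp
  qed
  moreover have "A (kC k (ccol x (tm_step M C) k p)) (Suc t) p" if k: "k < nt" and p: "p < ?P" for k p
  proof (cases "int p - int (Tb x) = headp C k")
    case True
    hence "p = hcol x C k" by linarith
    hence "A (kH k) t p" using H[OF k] by simp
    hence "A (kC k (fst (snd ?D ! k))) (Suc t) p"
      using fires[OF wr[OF k, unfolded f_write_def] p p] t by simp
    thus ?thesis unfolding tm_step_nth(2)[OF g k] using True by simp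
  next
    case False
    let ?p' = "hcol x C k"
    let ?a = "ccol x C k p"
    have ne: "p \<noteq> ?p'" using False hd(2)[OF k] by linarith
    have "fam_holds x ?P A (f_frame k ?a)" using AA k sym by simp
    from fam_holdsD[OF this[unfolded f_frame_def] tP p hd(1)[OF k]]
    have "A (kC k ?a) (Suc t) p \<or> \<not> A (kH k) t ?p' \<or> \<not> A (kC k ?a) t p"
      using ne t by auto
    thus ?thesis unfolding tm_step_nth(2)[OF g k] using False H[OF k] Cl[OF k p] by simp
  qed
  ultimately show ?thesis unfolding facts_def using tm_step_nth(1)[OF g, of 0] sizes(1) by simp
qed

lemma facts_init:
  assumes A: "\<forall>f\<in>set fams. fam_holds x (2 * Tb x + 2) A f"
  shows "\<exists>u. length u \<le> Ub x \<and> facts x A 0 (tm_init M [x, u])"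
proof -
  let ?P = "2 * Tb x + 2"
  note AA = A[unfolded fams_ball]
  have T: "length x + Ub x \<le> Tb x" by (simp add: Tb_def)
  let ?C = "\<lambda>a i. A (kC 1 a) 0 (Tb x + i)"
  have guess: "?C 0 i \<or> ?C 1 i \<or> ?C 2 i" if "i < Ub x" for i
  proof -
    have "fam_holds x ?P A f_guess" using AA by blast
    from fam_holdsD[OF this[unfolded f_guess_def], of 0 "Tb x + i" 0] show ?thesis using that T by auto
  qed
  have close: "?C 0 (Suc i)" if "?C 0 i" "Suc i < Ub x" for i
  proof -
    have "fam_holds x ?P A f_end" using AA by blast
    from fam_holdsD[OF this[unfolded f_end_def], of 0 "Tb x + i" 0] show ?thesis using that T by auto
  qed
  \<comment> \<open>The certificate ends at the first blank. The assignment may assert several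
    symbols of a cell; before the blank, symbol 2 takes precedence and is read as True.\<close>
  define n where "n = (LEAST i. i = Ub x \<or> ?C 0 i)"
  have n: "n \<le> Ub x" "n = Ub x \<or> ?C 0 n" unfolding n_def by (rule Least_le; simp) (rule LeastI[of _ "Ub x"]; simp)
  have less: "\<not> ?C 0 i" if "i < n" for i using not_less_Least[OF that[unfolded n_def]] by simp
  have ge: "?C 0 i" if "n \<le> i" "i < Ub x" for i
    using that
  proof (induction i rule: dec_induct)
    case base
    thus ?case using n by simp
  next
    case (step i)
    thus ?case using close[of i] by simp
  qed
  define u where "u = map (\<lambda>i. ?C 2 i) [0..<n]"
  have lu: "length u = n" by (simp add: u_def)
  have st: "A (kQ 0) 0 0"
    using fam_holdsD[OF AA[THEN conjunct1, unfolded f_state_def], of 0 0 0] by simp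
  have hd: "A (kH k) 0 (Tb x)" if "k < nt" for k
  proof -
    have "fam_holds x ?P A (f_head k)" using AA that by simp
    from fam_holdsD[OF this[unfolded f_head_def], of 0 0 0] show ?thesis by simp
  qed
  have in0: "A (kC 0 (fst (input_tape x) (int p - int (Tb x)))) 0 p" if p: "p < ?P" for p
  proof -
    consider "p < Tb x \<or> Tb x + length x \<le> p" | "Tb x \<le> p" "p < Tb x + length x" by linarith
    thus ?thesis
    proof cases
      case 1
      have "fam_holds x ?P A f_pad0" using AA by blast
      from fam_holdsD[OF this[unfolded f_pad0_def], of 0 p 0] have "A (kC 0 0) 0 p" using 1 p by auto
      moreover have "fst (input_tape x) (int p - int (Tb x)) = 0" using 1 by (auto simp: input_tape_def)
      ultimately show ?thesis by simp
    next
      case 2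
      let ?i = "p - Tb x"
      have i: "?i < ?P" "p = Tb x + ?i" "?i < length x" "int p - int (Tb x) = int ?i" using 2 p by simp_all
      have "fam_holds x ?P A f_bit1" "fam_holds x ?P A f_bit0" using AA by blast+
      from fam_holdsD[OF this(1)[unfolded f_bit1_def], of 0 p ?i] fam_holdsD[OF this(2)[unfolded f_bit0_def], of 0 p ?i]
      have "if x ! ?i then A (kC 0 2) 0 p else A (kC 0 1) 0 p" using i p 2 by simp
      moreover have "fst (input_tape x) (int p - int (Tb x)) = bit_symbol (x ! ?i)"
        unfolding i(4) using i(3) by (simp add: input_tape_def)
      ultimately show ?thesis by (simp add: bit_symbol_def split: if_splits)
    qed
  qed
  have in1: "A (kC 1 (fst (input_tape u) (int p - int (Tb x)))) 0 p" if p: "p < ?P" for p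
  proof -
    consider "p < Tb x \<or> Tb x + Ub x \<le> p" | "Tb x \<le> p" "p < Tb x + Ub x" by linarith
    thus ?thesis
    proof cases
      case 1
      have "fam_holds x ?P A f_pad1" using AA by blast
      from fam_holdsD[OF this[unfolded f_pad1_def], of 0 p 0] have "A (kC 1 0) 0 p" using 1 p by auto
      moreover have "fst (input_tape u) (int p - int (Tb x)) = 0" using 1 lu n(1) by (auto simp: input_tape_def)
      ultimately show ?thesis by simp
    next
      case 2
      define i where "i = p - Tb x"
      have i: "p = Tb x + i" "i < Ub x" "int p - int (Tb x) = int i" using 2 by (simp_all add: i_def)
      show ?thesis
      proof (cases "i < n")
        case True
        have "fst (input_tape u) (int p - int (Tb x)) = bit_symbol (?C 2 i)"
          unfolding i(3) using True lu by (simp add: input_tape_def u_def)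
        thus ?thesis using guess[OF i(2)] less[OF True] i(1) by (auto simp: bit_symbol_def)
      next
        case False
        hence "fst (input_tape u) (int p - int (Tb x)) = 0" unfolding i(3) using lu by (simp add: input_tape_def)
        moreover have "A (kC 1 0) 0 p" unfolding i(1) using ge[of i] False i(2) by simp
        ultimately show ?thesis by simp
      qed
    qed
  qed
  have in2: "A (kC k 0) 0 p" if "k < nt" "2 \<le> k" "p < ?P" for k p
  proof -
    have "fam_holds x ?P A (f_blank k)" using AA that by simp
    from fam_holdsD[OF this[unfolded f_blank_def], of 0 p 0] show ?thesis using that(3) by simp
  qed
  have e: "fst (input_tape []) i = 0" "snd (input_tape v) = 0" for i v by (simp_all add: input_tape_def)
  have "A (kH k) 0 (hcol x (tm_init M [x, u]) k) \<and>
       (\<forall>p<2 * Tb x + 2. A (kC k (ccol x (tm_init M [x, u]) k p)) 0 p)" if k: "k < nt" for k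
  proof -
    consider "k = 0" | "k = 1" | "2 \<le> k" by linarith
    thus ?thesis
    proof cases
      case 1
      thus ?thesis using hd[OF k] in0 by (simp only: tm_init_nth e) simp
    next
      case 2
      thus ?thesis using hd[OF k] in1 by (simp only: tm_init_nth e) simp
    next
      case 3
      thus ?thesis using hd[OF k] in2[OF k 3] by (simp add: tm_init_nth(4)[OF 3 k] e)
    qed
  qed
  hence "facts x A 0 (tm_init M [x, u])" unfolding facts_def tm_init_nth(5) using st by blast
  thus ?thesis using lu n(1) by blast
qed

text \<open>The state reached by the actual run is derived as a true atom at the time bound, and
  \<open>f_acc\<close> leaves only the accepting state.\<close>

lemma sound:
  assumes A: "\<forall>f\<in>set fams. fam_holds x (2 * Tb x + 2) A f"
  shows "\<exists>u. length u \<le> Ub x \<and> fst (tm_run M [x, u] (Tb x)) = 1"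
proof -
  obtain u where u: "length u \<le> Ub x" "facts x A 0 (tm_init M [x, u])" using facts_init[OF A] by blast
  have "t \<le> Tb x ==> facts x A t (tm_run M [x, u] t)" for t
  proof (induction t)
    case 0
    show ?case using u(2) by (simp add: tm_run_def)
  next
    case (Suc t)
    thus ?case unfolding tm_run_Suc by (intro facts_step[OF A _ good_run]) simp_all
  qed
  hence "A (kQ (fst (tm_run M [x, u] (Tb x)))) (Tb x) 0" unfolding facts_def by blast
  moreover have "fst (tm_run M [x, u] (Tb x)) < Qn" using good_run unfolding good_def by blast
  moreover have "\<not> A (kQ q) (Tb x) 0" if "q < Qn" "q \<noteq> 1" for q
  proof -
    have "fam_holds x (2 * Tb x + 2) A (f_acc q)" using A[unfolded fams_ball] that by simp
    from fam_holdsD[OF this[unfolded f_acc_def], of 0 0 0] show ?thesis by simp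
  qed
  ultimately show ?thesis using u(1) by blast
qed

text \<open>The assignment that describes a run; the residue of \<open>y\<close> modulo 4 recovers
  the kind of the atom from its code.\<close>

definition history :: "bool list => (nat => tm_config) => nat => nat => nat => bool" where
  "history x C y t p \<longleftrightarrow>
     (if y mod 4 = 0 then fst (C t) = y div 4
      else if y mod 4 = 1 then headp (C t) (y div 4) = int p - int (Tb x)
      else if y mod 4 = 2 then ccol x (C t) (y div 4 div S) p = y div 4 mod S
      else tape_read (snd (C t) ! (y div 4 div S)) = y div 4 mod S)"

lemma history_simps:
  "history x C (kQ q) t p \<longleftrightarrow> fst (C t) = q"
  "history x C (kH k) t p \<longleftrightarrow> headp (C t) k = int p - int (Tb x)"
  "a < S ==> history x C (kC k a) t p \<longleftrightarrow> ccol x (C t) k p = a"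
  "a < S ==> history x C (kR k a) t p \<longleftrightarrow> tape_read (snd (C t) ! k) = a"
proof -
  have m: "(4 * y + r) mod 4 = r" "(4 * y + r) div 4 = y" if "r < 4" for y r :: nat using that by simp_all
  show "history x C (kQ q) t p \<longleftrightarrow> fst (C t) = q" by (simp add: history_def kQ_def)
  show "history x C (kH k) t p \<longleftrightarrow> headp (C t) k = int p - int (Tb x)"
  proof -
    have "(4 * k + 1) mod 4 = 1" "(4 * k + 1) div 4 = k" by simp_all
    thus ?thesis unfolding history_def kH_def by simp
  qed
  assume "a < S"
  have m2: "(4 * (k * S + a) + 2) mod 4 = 2" "(4 * (k * S + a) + 2) div 4 = k * S + a" by (rule m; simp)+
  have m3: "(4 * (k * S + a) + 3) mod 4 = 3" "(4 * (k * S + a) + 3) div 4 = k * S + a" by (rule m; simp)+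
  from \<open>a < S\<close> have "(k * S + a) div S = k" "(k * S + a) mod S = a" by simp_all
  thus "history x C (kC k a) t p \<longleftrightarrow> ccol x (C t) k p = a"
    "history x C (kR k a) t p \<longleftrightarrow> tape_read (snd (C t) ! k) = a"
    unfolding history_def kC_def kR_def m2 m3 by simp_all
qed

lemma complete:
  assumes u: "length u \<le> Ub x" "fst (tm_run M [x, u] (Tb x)) = 1"
  shows "\<exists>A. \<forall>f\<in>set fams. fam_holds x (2 * Tb x + 2) A f"
proof -
  let ?P = "2 * Tb x + 2"
  let ?C = "tm_run M [x, u]"
  let ?A = "history x ?C"
  note hs = history_simps
  have S: "0 < S" "1 < S" "2 < S" using sizes by simp_all
  have C0: "?C 0 = tm_init M [x, u]" by (simp add: tm_run_def)
  have T: "length x + Ub x \<le> Tb x" by (simp add: Tb_def)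
  have e: "fst (input_tape []) i = 0" "snd (input_tape v) = 0" for i v by (simp_all add: input_tape_def)
  have hd: "headp (?C 0) k = 0" if "k < nt" for k
  proof -
    have "good 0 (?C 0)" by (rule good_run)
    thus ?thesis using that unfolding good_def by auto
  qed
  have step: "fst (?C (Suc t)) = fst (delta q ss)"
    "\<And>k. k < nt ==> cellf (?C (Suc t)) k = (cellf (?C t) k)(headp (?C t) k := fst (snd (delta q ss) ! k))"
    "\<And>k. k < nt ==> headp (?C (Suc t)) k = headp (?C t) k + dir_int (snd (snd (delta q ss) ! k))"
    if pr: "ss \<in> set words" "\<And>y. y \<in> set (prem q ss) ==> \<not> lit_holds x ?A (e3 t p p') y" for q ss t p p'
  proof -
    have q: "q = fst (?C t)" using pr(2)[of "(False, kQ q, vt, N 0)"] by (simp add: prem_def hs)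
    have g: "good t (?C t)" by (rule good_run)
    have "ss = map tape_read (snd (?C t))"
    proof (rule nth_equalityI)
      show l: "length ss = length (map tape_read (snd (?C t)))" using pr(1) g by (simp add: words_iff good_def)
      fix k assume "k < length ss"
      hence k: "k < nt" using pr(1) by (simp add: words_iff)
      have "(False, kR k (ss ! k), vt, N 0) \<in> set (prem q ss)" using k by (simp add: prem_def)
      from pr(2)[OF this] show "ss ! k = map tape_read (snd (?C t)) ! k"
        using word_nth[OF pr(1) k] l k g by (simp add: hs good_def)
    qed
    thus "fst (?C (Suc t)) = fst (delta q ss)"
      "\<And>k. k < nt ==> cellf (?C (Suc t)) k = (cellf (?C t) k)(headp (?C t) k := fst (snd (delta q ss) ! k))"
      "\<And>k. k < nt ==> headp (?C (Suc t)) k = headp (?C t) k + dir_int (snd (snd (delta q ss) ! k))"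
      unfolding q tm_run_Suc by (simp_all only: tm_step_nth(1)[OF g, of 0, OF order.strict_trans2[OF zero_less_numeral sizes(1)]] tm_step_nth(2,3)[OF g])
  qed
  \<comment> \<open>A false premise satisfies the clause, so only the case remains in which
    \<open>q\<close> and \<open>ss\<close> are the actual state and the actual symbols.\<close>
  have prem_case: "fam_holds x ?P ?A (gd, prem q ss @ ls)"
    if "\<And>t p p'. t < ?P ==> tr x (e3 t p p') gd ==> (\<And>y. y \<in> set (prem q ss) ==> \<not> lit_holds x ?A (e3 t p p') y) ==>
      \<exists>y\<in>set ls. lit_holds x ?A (e3 t p p') y" for gd q ss ls
    unfolding fam_holds_def prod.case
  proof (intro allI impI)
    fix t p p' assume a: "t < ?P" "tr x (e3 t p p') gd"
    show "\<exists>y\<in>set (prem q ss @ ls). lit_holds x ?A (e3 t p p') y"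
    proof (cases "\<exists>y\<in>set (prem q ss). lit_holds x ?A (e3 t p p') y")
      case False
      thus ?thesis using that[OF a] by auto
    qed auto
  qed
  have "\<forall>f\<in>set fams. fam_holds x ?P ?A f"
    unfolding fams_ball
  proof (intro conjI ballI)
    show "fam_holds x ?P ?A f_state" by (simp add: f_state_def fam_holds_def hs C0 tm_init_nth)
    show "fam_holds x ?P ?A f_bit1" "fam_holds x ?P ?A f_bit0" "fam_holds x ?P ?A f_pad0"
      using S by (auto simp: f_bit1_def f_bit0_def f_pad0_def fam_holds_def hs C0 tm_init_nth input_tape_def bit_symbol_def)
    show "fam_holds x ?P ?A f_guess"
      using S by (auto simp: f_guess_def fam_holds_def hs C0 tm_init_nth[unfolded One_nat_def] input_tape_def bit_symbol_def)
    show "fam_holds x ?P ?A f_end"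
      using S by (auto simp: f_end_def fam_holds_def hs C0 tm_init_nth[unfolded One_nat_def] input_tape_def bit_symbol_def)
    show "fam_holds x ?P ?A f_pad1"
      using S u(1) by (auto simp: f_pad1_def fam_holds_def hs C0 tm_init_nth[unfolded One_nat_def] input_tape_def bit_symbol_def)
    show "fam_holds x ?P ?A (f_head k)" if "k \<in> {..<nt}" for k
      using that hd by (simp add: f_head_def fam_holds_def hs)
    show "fam_holds x ?P ?A (f_blank k)" if "k \<in> {2..<nt}" for k
      using that S by (simp add: f_blank_def fam_holds_def hs C0 tm_init_nth e)
    show "fam_holds x ?P ?A (f_read k a)" "fam_holds x ?P ?A (f_frame k a)" if "k \<in> {..<nt}" "a \<in> {..<S}" for k a
    proof -
      show "fam_holds x ?P ?A (f_read k a)"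
        using that by (auto simp: f_read_def fam_holds_def hs tape_read_eq)
      have "cellf (?C (Suc t)) k i = cellf (?C t) k i" if "i \<noteq> headp (?C t) k" for t i
        unfolding tm_run_Suc using tm_step_nth(2)[OF good_run, of k] \<open>k \<in> {..<nt}\<close> that by simp
      thus "fam_holds x ?P ?A (f_frame k a)"
        using that by (auto simp: f_frame_def fam_holds_def hs)
    qed
    show "fam_holds x ?P ?A (f_next q ss)" if "q \<in> {..<Qn}" "ss \<in> set words" for q ss
      unfolding f_next_def
    proof (rule prem_case)
      fix t p p' assume pr: "\<And>y. y \<in> set (prem q ss) ==> \<not> lit_holds x ?A (e3 t p p') y"
      show "\<exists>y\<in>set [(True, kQ (fst (delta q ss)), Plus vt (N 1), N 0)]. lit_holds x ?A (e3 t p p') y"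
        using step(1)[OF that(2) pr] by (simp add: hs)
    qed
    show "fam_holds x ?P ?A (f_move k q ss)" if "q \<in> {..<Qn}" "ss \<in> set words" "k \<in> {..<nt}" for q ss k
      unfolding f_move_def
    proof (rule prem_case)
      fix t p p' assume pr: "\<And>y. y \<in> set (prem q ss) ==> \<not> lit_holds x ?A (e3 t p p') y"
        and gd: "tr x (e3 t p p') (Times (Less vt tE) (moved (snd (snd (delta q ss) ! k))))"
      have pp: "int p' = int p + dir_int (snd (snd (delta q ss) ! k))"
        using gd by (cases "snd (snd (delta q ss) ! k)") auto
      show "\<exists>y\<in>set [(False, kH k, vt, vp), (True, kH k, Plus vt (N 1), vp')]. lit_holds x ?A (e3 t p p') y"
      proof -
        have "headp (?C (Suc t)) k = headp (?C t) k + dir_int (snd (snd (delta q ss) ! k))"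
          by (rule step(3)[OF that(2) pr]) (use that(3) in simp_all)
        thus ?thesis using pp by (auto simp: hs)
      qed
    qed
    show "fam_holds x ?P ?A (f_write k q ss)" if "q \<in> {..<Qn}" "ss \<in> set words" "k \<in> {..<nt}" for q ss k
      unfolding f_write_def
    proof (rule prem_case)
      fix t p p' assume pr: "\<And>y. y \<in> set (prem q ss) ==> \<not> lit_holds x ?A (e3 t p p') y"
      have "fst (snd (delta q ss) ! k) < S" using delta_words(2) that by simp
      show "\<exists>y\<in>set [(False, kH k, vt, vp), (True, kC k (fst (snd (delta q ss) ! k)), Plus vt (N 1), vp)]. lit_holds x ?A (e3 t p p') y"
      proof -
        have "cellf (?C (Suc t)) k = (cellf (?C t) k)(headp (?C t) k := fst (snd (delta q ss) ! k))"
          by (rule step(2)[OF that(2) pr]) (use that(3) in simp_all)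
        thus ?thesis using \<open>fst (snd (delta q ss) ! k) < S\<close> by (auto simp: hs)
      qed
    qed
    show "fam_holds x ?P ?A (f_acc q)" if "q \<in> {q. q < Qn \<and> q \<noteq> 1}" for q
      using that u(2) by (auto simp: f_acc_def fam_holds_def hs)
  qed
  thus ?thesis by blast
qed

end

text \<open>One reduction serves both claims of the theorem, since its instances lie in
  \<open>crossing_bounded 6\<close> and hence in every larger class.\<close>

theorem NP_hard_ROUTING_PLAN:
  assumes "crossing_bounded 6 \<subseteq> B"
  shows "NP_hard_on B ROUTING_PLAN"
  unfolding NP_hard_on_def
proof (intro allI impI)
  fix L' assume "in_NP L'"
  then obtain M c d c' d' where wf: "wf_tm M"
    and time: "\<And>x u. \<exists>n \<le> c * (length x + length u) ^ d + c. halted (tm_run M [x, u] n)"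
    and L': "\<And>x. x \<in> L' \<longleftrightarrow> (\<exists>u. length u \<le> c' * length x ^ d' + c' \<and> tm_accepts M [x, u])"
    unfolding in_NP_def by blast
  interpret cook M c d c' d' by unfold_locales (rule wf)
  interpret families pE Kc fams by (rule families)
  have P: "Pof x = 2 * Tb x + 2" for x by (simp add: Pof_def)
  have acc: "tm_accepts M [x, u] \<longleftrightarrow> fst (tm_run M [x, u] (Tb x)) = 1" if u: "length u \<le> Ub x" for x u
  proof -
    obtain n where n: "n \<le> c * (length x + length u) ^ d + c" "halted (tm_run M [x, u] n)" using time by blast
    have "c * (length x + length u) ^ d \<le> c * (length x + Ub x) ^ d" using u by (intro mult_le_mono2 power_mono) simp_all
    hence nT: "n \<le> Tb x" using n(1) unfolding Tb_def by linarith
    have T: "tm_run M [x, u] (Tb x) = tm_run M [x, u] n" by (rule tm_run_halted[OF n(2) nT])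
    show ?thesis
    proof
      assume "tm_accepts M [x, u]"
      then obtain k where k: "fst (tm_run M [x, u] k) = 1" unfolding tm_accepts_def by blast
      hence hk: "halted (tm_run M [x, u] k)" by (cases "tm_run M [x, u] k") simp
      have "tm_run M [x, u] k = tm_run M [x, u] n"
        using tm_run_halted[OF hk, of n] tm_run_halted[OF n(2), of k] by (cases "k \<le> n") simp_all
      thus "fst (tm_run M [x, u] (Tb x)) = 1" using T k by simp
    qed (auto simp: tm_accepts_def)
  qed
  have sat: "x \<in> L' \<longleftrightarrow> (\<exists>A. \<forall>f\<in>set fams. fam_holds x (Pof x) A f)" for x
  proof
    assume "x \<in> L'"
    then obtain u where "length u \<le> Ub x" "tm_accepts M [x, u]" unfolding L' Ub_def by blast
    thus "\<exists>A. \<forall>f\<in>set fams. fam_holds x (Pof x) A f" unfolding P using complete acc by blast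
  next
    assume "\<exists>A. \<forall>f\<in>set fams. fam_holds x (Pof x) A f"
    then obtain u where "length u \<le> Ub x" "fst (tm_run M [x, u] (Tb x)) = 1" unfolding P using sound by blast
    thus "x \<in> L'" unfolding L' using acc Ub_def by auto
  qed
  obtain f where "polytime_computable f" "\<And>x. f x \<in> crossing_bounded 6"
    "\<And>x. (\<exists>A. \<forall>f\<in>set fams. fam_holds x (Pof x) A f) \<longleftrightarrow> f x \<in> ROUTING_PLAN"
    using reduction by blast
  thus "\<exists>f. polytime_computable f \<and> (\<forall>x. f x \<in> B) \<and> (\<forall>x. x \<in> L' \<longleftrightarrow> f x \<in> ROUTING_PLAN)"
    unfolding sat using assms by blast
qed

section \<open>Membership: short descriptions of long plans\<close>

section \<open>Compressed plans\<close>

text \<open>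
  Plans can be exponentially long. A compressed plan lists configurations \<open>X h\<close> with times
  \<open>t h\<close>; two consecutive configurations whose times are more than one round apart are alternated
  in between, which is why the distance has to be odd and the step reversible.
\<close>

abbreviation "inner_adj I x y \<equiv> \<exists>u v. x = Some u \<and> y = Some v \<and> {u, v} \<in> edges I \<and>
  u \<noteq> source I \<and> v \<noteq> source I \<and> u \<noteq> target I \<and> v \<noteq> target I"

definition act :: "('a, 'v) routing => (nat => nat) => (nat => 'a => 'v option) => nat => 'v => bool" where
  "act I t X h r \<longleftrightarrow> \<not> (\<exists>g<h. (\<exists>a\<in>assets I. X g a = Some r \<and> X (Suc g) a = None) \<and> t h \<le> t g + reload I r)"

text \<open>A single round of a plan. In round 0 plans are allowed to pause, which is the
  alternative \<open>h = 0\<close>.\<close>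

definition unit_step :: "('a, 'v) routing => (nat => nat) => (nat => 'a => 'v option) => nat => bool" where
  "unit_step I t X h \<longleftrightarrow> t (Suc h) = Suc (t h) \<and>
     (\<forall>a\<in>assets I. (finished I (X h a) --> X (Suc h) a = X h a) \<and>
       (X h a \<noteq> None --> (X (Suc h) a = None \<longleftrightarrow> (\<exists>r\<in>traps I. X h a = Some r \<and> act I t X h r))) \<and>
       (X (Suc h) a \<noteq> None --> X (Suc h) a = X h a \<or>
          adj_opt I (X h a) (X (Suc h) a)) \<and>
       (X (Suc h) a = Some (source I) --> X h a = Some (source I))) \<and>
     (h = 0 \<or> (\<exists>a\<in>assets I. X (Suc h) a \<noteq> X h a) \<or> (\<forall>a\<in>assets I. finished I (X h a)))"

text \<open>The source and the target are excluded because they cannot be left and entered back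
  again. Inactivity is required at the end of the interval: nothing is triggered within it, so a
  trap that is inactive at its end is inactive throughout.\<close>

definition rev_step :: "('a, 'v) routing => (nat => nat) => (nat => 'a => 'v option) => nat => bool" where
  "rev_step I t X h \<longleftrightarrow>
     (\<forall>a\<in>assets I. X (Suc h) a = X h a \<or> inner_adj I (X h a) (X (Suc h) a)) \<and>
     (\<exists>a\<in>assets I. X (Suc h) a \<noteq> X h a) \<and>
     (\<forall>a\<in>assets I. \<forall>r\<in>traps I. X h a = Some r \<or> X (Suc h) a = Some r --> \<not> act I t X (Suc h) r)"

definition compressed :: "('a, 'v) routing => (nat => nat) => (nat => 'a => 'v option) => nat => bool" where
  "compressed I t X H \<longleftrightarrow> t 0 = 0 \<and> (\<forall>a\<in>assets I. X 0 a = Some (source I)) \<and>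
     (\<forall>h\<le>H. \<forall>a\<in>assets I. \<forall>a'\<in>assets I. a \<noteq> a' \<and> X h a = X h a' --> X h a \<in> {Some (source I), Some (target I), None}) \<and>
     (\<forall>h<H. t h < t (Suc h) \<and> odd (t (Suc h) - t h) \<and> (unit_step I t X h \<or> rev_step I t X h)) \<and>
     (\<forall>a\<in>assets I. finished I (X H a)) \<and> goal I \<le> card {a \<in> assets I. X H a = Some (target I)}"

locale compressed_plan =
  fixes I :: "('a, 'v) routing" and t :: "nat => nat" and X :: "nat => 'a => 'v option" and H :: nat
  assumes wf: "wf_routing I" and cp: "compressed I t X H"
begin

lemma cp_step: "h < H ==> t h < t (Suc h) \<and> odd (t (Suc h) - t h) \<and> (unit_step I t X h \<or> rev_step I t X h)"
  using cp by (simp add: compressed_def)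

lemma tau_less: "g < h ==> h \<le> H ==> t g < t h"
proof (induction h)
  case (Suc h)
  have "t h < t (Suc h)" using cp_step Suc.prems by simp
  thus ?case using Suc by (cases "g = h") auto
qed simp

lemma tau_0: "t 0 = 0" using cp by (simp add: compressed_def)

definition idx :: "nat => nat" where "idx j = (GREATEST h. h \<le> H \<and> t h \<le> j)"

text \<open>Expansion of the compressed plan. As intervals have odd length, the last round of an
  interval has even offset and shows \<open>X h\<close>, so the next step leads to
  \<open>X (Suc h)\<close> as it should.\<close>

definition pl :: "'a => nat => 'v option" where
  "pl a j = (if idx j = H \<or> even (j - t (idx j)) then X (idx j) a else X (Suc (idx j)) a)"

lemma idx_eq:
  assumes "h \<le> H" "t h \<le> j" "h < H ==> j < t (Suc h)"
  shows "idx j = h"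
  unfolding idx_def
proof (rule Greatest_equality)
  fix k assume k: "k \<le> H \<and> t k \<le> j"
  show "k \<le> h"
  proof (rule ccontr)
    assume "\<not> k \<le> h"
    hence "Suc h \<le> k" "h < H" using k by simp_all
    hence "t (Suc h) \<le> t k" using tau_less[of "Suc h" k] k by (cases "Suc h = k") auto
    thus False using assms(3)[OF \<open>h < H\<close>] k by simp
  qed
qed (use assms in simp)

lemma idx_exists: "\<exists>h\<le>H. t h \<le> j \<and> (h < H --> j < t (Suc h))"
proof (rule ccontr)
  assume n: "\<not> ?thesis"
  have "h \<le> H ==> t h \<le> j" for h
  proof (induction h)
    case 0
    thus ?case by (simp add: tau_0)
  next
    case (Suc h)
    have h: "h \<le> H" "t h \<le> j" using Suc by simp_all
    show ?case
    proof (rule ccontr)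
      assume "\<not> t (Suc h) \<le> j"
      thus False using n h Suc.prems by (meson not_le)
    qed
  qed
  hence "t H \<le> j" by simp
  thus False using n by blast
qed

lemma round_cases:
  obtains (final) "t H \<le> j" "\<And>a. pl a j = X H a" "\<And>a. pl a (Suc j) = X H a"
  | (unit) h where "h < H" "j = t h" "unit_step I t X h" "\<And>a. pl a j = X h a" "\<And>a. pl a (Suc j) = X (Suc h) a"
  | (rev) h where "h < H" "t h \<le> j" "j < t (Suc h)" "rev_step I t X h"
      "(\<forall>a. pl a j = X h a) \<and> (\<forall>a. pl a (Suc j) = X (Suc h) a) \<or> (\<forall>a. pl a j = X (Suc h) a) \<and> (\<forall>a. pl a (Suc j) = X h a)"
proof -
  obtain h where h: "h \<le> H" "t h \<le> j" "h < H ==> j < t (Suc h)" using idx_exists by blast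
  have i: "idx j = h" by (rule idx_eq[OF h])
  show thesis
  proof (cases "h = H")
    case True
    have i': "idx (Suc j) = H" by (rule idx_eq) (use h True in simp_all)
    show thesis using final h True i i' by (simp add: pl_def)
  next
    case False
    hence hH: "h < H" using h by simp
    hence s: "odd (t (Suc h) - t h)" "unit_step I t X h \<or> rev_step I t X h" and jl: "j < t (Suc h)"
      using cp_step h(3) by blast+
    have nx: "idx (Suc j) = Suc h" if "Suc j = t (Suc h)"
    proof (rule idx_eq)
      assume "Suc h < H"
      thus "Suc j < t (Suc (Suc h))" using tau_less[of "Suc h" "Suc (Suc h)"] that by simp
    qed (use hH that in simp_all)
    have st: "idx (Suc j) = h" if "Suc j < t (Suc h)" by (rule idx_eq) (use h that in simp_all)
    have p: "(\<forall>a. pl a j = X h a) \<and> (\<forall>a. pl a (Suc j) = X (Suc h) a) \<or> (\<forall>a. pl a j = X (Suc h) a) \<and> (\<forall>a. pl a (Suc j) = X h a)"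
    proof (cases "even (j - t h)")
      case True
      have "pl a (Suc j) = X (Suc h) a" for a
      proof (cases "Suc j = t (Suc h)")
        case True
        thus ?thesis using nx by (simp add: pl_def)
      next
        case False
        hence "Suc j < t (Suc h)" using jl by simp
        moreover have "odd (Suc j - t h)" using \<open>even (j - t h)\<close> h(2) by (simp add: Suc_diff_le)
        ultimately show ?thesis using st hH by (simp add: pl_def)
      qed
      thus ?thesis using True i by (simp add: pl_def)
    next
      case False
      hence "Suc j \<noteq> t (Suc h)" using s(1) h(2) by (metis Suc_diff_le even_Suc)
      hence "idx (Suc j) = h" using jl st by simp
      moreover have "even (Suc j - t h)" using False h(2) by (simp add: Suc_diff_le)
      ultimately show ?thesis using False i hH by (simp add: pl_def)
    qed
    show thesis
    proof (cases "rev_step I t X h")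
      case True
      thus thesis using rev hH h(2) jl p by blast
    next
      case False
      hence u: "unit_step I t X h" using s by blast
      hence "t (Suc h) = Suc (t h)" by (simp add: unit_step_def)
      hence j: "j = t h" "Suc j = t (Suc h)" using h(2) jl by simp_all
      thus thesis using unit[OF hH j(1) u] i nx by (simp add: pl_def)
    qed
  qed
qed

definition trigger :: "nat => 'v => bool" where
  "trigger g r \<longleftrightarrow> (\<exists>a\<in>assets I. X g a = Some r \<and> X (Suc g) a = None)"

lemma rev_no_trigger: "rev_step I t X g ==> \<not> trigger g r"
  unfolding rev_step_def trigger_def by fastforce

lemma act_iff:
  assumes "h \<le> H"
  shows "act I t X h r \<longleftrightarrow> \<not> (\<exists>g<H. trigger g r \<and> t g < t h \<and> t h \<le> t g + reload I r)"
proof -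
  have "g < h \<longleftrightarrow> t g < t h" if "g < H" for g
    using tau_less[of g h] tau_less[of h g] assms that by (cases g h rule: linorder_cases) auto
  moreover have "g < h ==> g < H" for g using assms by simp
  ultimately show ?thesis unfolding act_def trigger_def by blast
qed

text \<open>The trigger responsible for the inactivity at the end of the interval cannot lie inside
  it, because no asset dies in a reversible step; hence its window covers the whole
  interval.\<close>

lemma rev_inactive:
  assumes "h < H" "rev_step I t X h" "a \<in> assets I" "r \<in> traps I" "X h a = Some r \<or> X (Suc h) a = Some r"
    "t h \<le> j" "j < t (Suc h)"
  shows "\<exists>g<H. trigger g r \<and> t g < j \<and> j \<le> t g + reload I r"
proof -
  have "\<not> act I t X (Suc h) r" using assms unfolding rev_step_def by blast
  then obtain g where g: "g < Suc h" "trigger g r" "t (Suc h) \<le> t g + reload I r"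
    unfolding act_def trigger_def by blast
  hence "g \<noteq> h" using rev_no_trigger[OF assms(2)] by blast
  hence "g < h" using g by simp
  hence "t g < t h" using tau_less assms(1) by simp
  thus ?thesis using g \<open>g < h\<close> assms by (intro exI[of _ g]) simp
qed

lemma trap_facts: "r \<in> traps I ==> r \<noteq> source I \<and> r \<noteq> target I"
  using wf unfolding wf_routing_def by blast

lemma final_finished: "a \<in> assets I ==> finished I (X H a)"
  using cp by (simp add: compressed_def)

text \<open>Activity refers to earlier activity, hence the induction on time: up to round
  \<open>j\<close> the triggers of the expanded plan are exactly the deaths between consecutive
  entries.\<close>

lemma active_iff:
  assumes r: "r \<in> traps I"
  shows "active I pl r j \<longleftrightarrow> \<not> (\<exists>g<H. trigger g r \<and> t g < j \<and> j \<le> t g + reload I r)"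
proof (induction j rule: less_induct)
  case (less j)
  have key: "active I pl r i \<and> (\<exists>a\<in>assets I. pl a i = Some r) \<longleftrightarrow> (\<exists>g<H. trigger g r \<and> t g = i)" if i: "i < j" for i
  proof (cases rule: round_cases[of i])
    case final
    have "pl a i \<noteq> Some r" if "a \<in> assets I" for a
      using final_finished[OF that] final(2) trap_facts[OF r] by (auto simp: finished_def)
    moreover have "t g \<noteq> i" if "g < H" for g using tau_less[of g H] that final(1) by simp
    ultimately show ?thesis by blast
  next
    case (unit h)
    have g: "g = h" if "g < H" "t g = i" for g
      using tau_less[of g h] tau_less[of h g] that unit(1,2) by (cases g h rule: linorder_cases) auto
    have a: "act I t X h r \<longleftrightarrow> active I pl r i"
      unfolding less.IH[OF i] unfolding unit(2) using unit(1) by (intro act_iff) simp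
    have st: "X h b = Some r ==> (X (Suc h) b = None \<longleftrightarrow> act I t X h r)" if "b \<in> assets I" for b
      using unit(3) that r unfolding unit_step_def by auto
    show ?thesis
    proof
      assume "active I pl r i \<and> (\<exists>a\<in>assets I. pl a i = Some r)"
      then obtain b where b: "b \<in> assets I" "X h b = Some r" "act I t X h r" using a unit(4) by auto
      hence "trigger h r" unfolding trigger_def using st by blast
      thus "\<exists>g<H. trigger g r \<and> t g = i" using unit(1,2) by blast
    next
      assume "\<exists>g<H. trigger g r \<and> t g = i"
      hence "trigger h r" using g by blast
      then obtain b where "b \<in> assets I" "X h b = Some r" "X (Suc h) b = None" unfolding trigger_def by blast
      thus "active I pl r i \<and> (\<exists>a\<in>assets I. pl a i = Some r)" using st a unit(4) by auto
    qed
  next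
    case (rev h)
    have g: "g = h" if "g < H" "t g = i" for g
    proof (rule linorder_cases[of g h])
      assume "g < h"
      thus ?thesis using tau_less[of g h] that rev(1,2) by simp
    next
      assume "h < g"
      hence "t (Suc h) \<le> t g" using tau_less[of "Suc h" g] that(1) by (cases "Suc h = g") auto
      thus ?thesis using that(2) rev(3) by simp
    qed
    have "\<not> (\<exists>g<H. trigger g r \<and> t g = i)" using g rev_no_trigger[OF rev(4)] by blast
    moreover have "\<not> active I pl r i" if "b \<in> assets I" "pl b i = Some r" for b
    proof -
      have "X h b = Some r \<or> X (Suc h) b = Some r" using rev(5) that(2) by auto
      from rev_inactive[OF rev(1,4) that(1) r this rev(2,3)] show ?thesis unfolding less.IH[OF i] by blast
    qed
    ultimately show ?thesis by blast
  qed
  have "active I pl r j \<longleftrightarrow> (\<forall>i<j. active I pl r i \<and> (\<exists>a\<in>assets I. pl a i = Some r) --> i + reload I r < j)"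
    by (subst active.simps) auto
  also have "\<dots> \<longleftrightarrow> (\<forall>i<j. (\<exists>g<H. trigger g r \<and> t g = i) --> i + reload I r < j)" using key by auto
  also have "\<dots> \<longleftrightarrow> \<not> (\<exists>g<H. trigger g r \<and> t g < j \<and> j \<le> t g + reload I r)" by (auto simp: not_le)
  finally show ?case .
qed

lemma pl_step:
  assumes a: "a \<in> assets I"
  shows "finished I (pl a j) ==> pl a (Suc j) = pl a j" (is "PROP ?A")
    "pl a (Suc j) \<noteq> None ==> pl a (Suc j) = pl a j \<or> adj_opt I (pl a j) (pl a (Suc j))" (is "PROP ?B")
    "pl a (Suc j) = Some (source I) ==> pl a j = Some (source I)" (is "PROP ?C")
    "pl a j \<noteq> None ==> pl a (Suc j) = None \<longleftrightarrow> (\<exists>r\<in>traps I. pl a j = Some r \<and> active I pl r j)" (is "PROP ?D")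
proof -
  have "(finished I (pl a j) --> pl a (Suc j) = pl a j) \<and>
    (pl a (Suc j) \<noteq> None --> pl a (Suc j) = pl a j \<or> adj_opt I (pl a j) (pl a (Suc j))) \<and>
    (pl a (Suc j) = Some (source I) --> pl a j = Some (source I)) \<and>
    (pl a j \<noteq> None --> (pl a (Suc j) = None \<longleftrightarrow> (\<exists>r\<in>traps I. pl a j = Some r \<and> active I pl r j)))"
  proof (cases rule: round_cases[of j])
    case final
    thus ?thesis using final_finished[OF a] by (auto simp: finished_def dest: trap_facts)
  next
    case (unit h)
    have ac: "active I pl r j \<longleftrightarrow> act I t X h r" if "r \<in> traps I" for r
      unfolding active_iff[OF that] unfolding unit(2) using unit(1) by (intro act_iff[symmetric]) simp
    have e: "(\<exists>r\<in>traps I. X h a = Some r \<and> act I t X h r) \<longleftrightarrow> (\<exists>r\<in>traps I. X h a = Some r \<and> active I pl r j)"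
      by (rule bex_cong[OF refl]) (simp add: ac)
    have "\<forall>a\<in>assets I. (finished I (X h a) --> X (Suc h) a = X h a) \<and>
       (X h a \<noteq> None --> (X (Suc h) a = None \<longleftrightarrow> (\<exists>r\<in>traps I. X h a = Some r \<and> act I t X h r))) \<and>
       (X (Suc h) a \<noteq> None --> X (Suc h) a = X h a \<or>
          adj_opt I (X h a) (X (Suc h) a)) \<and>
       (X (Suc h) a = Some (source I) --> X h a = Some (source I))"
      using unit(3) unfolding unit_step_def by (elim conjE)
    from bspec[OF this a] show ?thesis unfolding unit(4,5) e by (elim conjE) (intro conjI; assumption)
  next
    case (rev h)
    have "\<not> active I pl r j" if "r \<in> traps I" "pl a j = Some r" for r
    proof -
      have "X h a = Some r \<or> X (Suc h) a = Some r" using rev(5) that(2) by auto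
      from rev_inactive[OF rev(1,4) a that(1) this rev(2,3)] show ?thesis unfolding active_iff[OF that(1)] by blast
    qed
    moreover have "X (Suc h) a = X h a \<or> inner_adj I (X h a) (X (Suc h) a)"
      using rev(4) a unfolding rev_step_def by blast
    hence "pl a (Suc j) = pl a j \<or> inner_adj I (pl a j) (pl a (Suc j))"
      using rev(5)
    proof (elim disjE)
      assume "(\<forall>a. pl a j = X (Suc h) a) \<and> (\<forall>a. pl a (Suc j) = X h a)" "inner_adj I (X h a) (X (Suc h) a)"
      thus ?thesis by (auto simp: insert_commute)
    qed auto
    ultimately show ?thesis by (auto simp: finished_def dest: trap_facts)
  qed
  thus "PROP ?A" "PROP ?B" "PROP ?C" "PROP ?D" by blast+
qed

lemma pl_config: "\<exists>h\<le>H. \<forall>a. pl a j = X h a"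
proof (cases rule: round_cases[of j])
  case (unit h)
  thus ?thesis by (intro exI[of _ h]) simp
next
  case (rev h)
  hence "h \<le> H" "Suc h \<le> H" by simp_all
  thus ?thesis using rev(5) by blast
qed blast

lemma pl_start: "a \<in> assets I ==> pl a 0 = Some (source I)"
proof -
  assume a: "a \<in> assets I"
  have "idx 0 = 0" by (rule idx_eq) (use tau_0 tau_less[of 0 1] in auto)
  thus ?thesis using cp a by (simp add: pl_def compressed_def tau_0)
qed

lemma compressed_solution: "solution I pl"
proof -
  have src: "source I \<in> verts I" and st: "source I \<noteq> target I" and ev: "\<forall>e\<in>edges I. e \<subseteq> verts I"
    and fA: "finite (assets I)" and gl: "1 \<le> goal I" "goal I \<le> card (assets I)"
    using wf unfolding wf_routing_def by blast+
  have in_verts: "pl a j \<in> insert None (Some ` verts I)" if a: "a \<in> assets I" for a j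
  proof (induction j)
    case 0
    thus ?case using pl_start[OF a] src by simp
  next
    case (Suc j)
    show ?case
    proof (cases "pl a (Suc j) = None")
      case False
      then consider "pl a (Suc j) = pl a j" | u v where "pl a (Suc j) = Some v" "{u, v} \<in> edges I" using pl_step(2)[OF a] by blast
      thus ?thesis using Suc ev by cases auto
    qed simp
  qed
  have fin: "finished I (pl a (t H))" if "a \<in> assets I" for a
  proof -
    have "idx (t H) = H" by (rule idx_eq) simp_all
    thus ?thesis using final_finished[OF that] by (simp add: pl_def)
  qed
  have ne: "assets I \<noteq> {}" using gl by auto
  have hl: "\<exists>n. has_length I pl n"
    using ex_length[of I pl "t H"] fin ne pl_start st by (force simp: finished_def)
  have distinct: "pl a j \<in> {Some (source I), Some (target I), None}"
    if "a \<in> assets I" "a' \<in> assets I" "a \<noteq> a'" "pl a j = pl a' j" for a a' j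
  proof -
    obtain h where "h \<le> H" "\<forall>a. pl a j = X h a" using pl_config by blast
    thus ?thesis using cp that unfolding compressed_def by metis
  qed
  have mover: "\<exists>a'\<in>assets I. pl a' j \<noteq> pl a' (Suc j)" if "1 \<le> j" "b \<in> assets I" "\<not> finished I (pl b j)" for j b
  proof (cases rule: round_cases[of j])
    case final
    thus ?thesis using that final_finished by simp
  next
    case (unit h)
    have "h \<noteq> 0" using unit(2) tau_0 that(1) by (cases h) auto
    thus ?thesis using unit(3) that(2,3) unfolding unit_step_def unit(4,5) by metis
  next
    case (rev h)
    then obtain b where "b \<in> assets I" "X (Suc h) b \<noteq> X h b" unfolding rev_step_def by blast
    thus ?thesis using rev(5) by metis
  qed
  have valid: "valid_plan I pl"
    unfolding valid_plan_def
  proof (intro conjI ballI allI impI)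
    fix a j assume a: "a \<in> assets I"
    show "pl a j \<in> insert None (Some ` verts I)" by (rule in_verts[OF a])
    show "pl a 0 = Some (source I)" by (rule pl_start[OF a])
    show "pl a (j - 1) = Some (source I)" if "0 < j" "pl a j = Some (source I)"
      using that pl_step(3)[OF a, of "j - 1"] by simp
    show "pl a (j + 1) = pl a j" if "finished I (pl a j)" using pl_step(1)[OF a that] by simp
    show "pl a j = pl a (j - 1) \<or> adj_opt I (pl a (j - 1)) (pl a j)"
      if "1 \<le> j" "pl a j \<noteq> None"
      using that pl_step(2)[OF a, of "j - 1"] by simp
    show "pl a (j + 1) = None" if "r \<in> traps I" "pl a j = Some r \<and> active I pl r j" for r
      using that pl_step(4)[OF a, of j] by auto
    show "\<exists>r\<in>traps I. pl a j = Some r \<and> active I pl r j" if "pl a j \<noteq> None \<and> pl a (j + 1) = None"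
      using that pl_step(4)[OF a, of j] by simp
  next
    fix a a' j assume "a \<in> assets I" "a' \<in> assets I" "a \<noteq> a' \<and> pl a j = pl a' j"
    thus "pl a j \<in> {Some (source I), Some (target I), None}" using distinct by blast
  next
    fix j assume "1 \<le> j" "\<exists>a\<in>assets I. \<not> finished I (pl a j)"
    thus "\<exists>a'\<in>assets I. pl a' j \<noteq> pl a' (j + 1)" using mover by auto
  qed (rule hl)
  have "survives I pl a" if "a \<in> assets I" "X H a = Some (target I)" for a
  proof -
    have "idx (t H) = H" by (rule idx_eq) simp_all
    hence "pl a (t H) = Some (target I)" using that by (simp add: pl_def)
    thus ?thesis unfolding survives_iff[OF wf valid that(1)] by blast
  qed
  hence "card {a \<in> assets I. X H a = Some (target I)} \<le> card {a \<in> assets I. survives I pl a}"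
    using fA by (intro card_mono) auto
  moreover have "goal I \<le> card {a \<in> assets I. X H a = Some (target I)}" using cp unfolding compressed_def by blast
  ultimately show ?thesis unfolding solution_def using valid by simp
qed

end

section \<open>Walks of prescribed parity\<close>

definition near :: "('b => 'b => bool) => nat => 'b => 'b => bool" where
  "near R k x y \<longleftrightarrow> (\<exists>i\<le>k. (R ^^ i) x y)"

lemma near_0: "near R 0 x x" by (auto simp: near_def)

lemma near_trans: "near R k x y ==> near R l y z ==> near R (k + l) x z"
  unfolding near_def by (meson add_mono relpowp_trans)

lemma near_mono: "near R k x y ==> k \<le> l ==> near R l x y"
  unfolding near_def using order_trans by blast

lemma relpowp_sym: "symp R ==> (R ^^ i) x y ==> (R ^^ i) y x"
proof (induction i arbitrary: y)
  case (Suc i)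
  then obtain z where "(R ^^ i) x z" "R z y" by auto
  hence "R y z" "(R ^^ i) z x" using Suc by (auto dest: sympD)
  thus ?case by (rule relpowp_Suc_I2)
qed simp

text \<open>A short walk of the wrong parity can be closed to a short odd walk from \<open>x\<close> to \<open>x\<close>.\<close>

lemma walk_parity:
  assumes s: "symp R" and D: "\<And>y. R\<^sup>*\<^sup>* x y ==> near R D x y" and w: "(R ^^ L) x y"
  shows "\<exists>l\<le>3 * D + 1. (R ^^ l) x y \<and> even l = even L"
proof -
  have "(R ^^ L) x y ==> (\<exists>k\<le>2 * D + 1. odd k \<and> (R ^^ k) x x) \<or> (\<exists>d\<le>D. (R ^^ d) x y \<and> even d = even L)" for L y
  proof (induction L arbitrary: y)
    case 0
    thus ?case by auto
  next
    case (Suc L)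
    then obtain z where z: "(R ^^ L) x z" "R z y" by auto
    obtain e where e: "e \<le> D" "(R ^^ e) x y" using D[OF relpowp_imp_rtranclp[OF Suc.prems]] unfolding near_def by blast
    consider "\<exists>k\<le>2 * D + 1. odd k \<and> (R ^^ k) x x" | d where "d \<le> D" "(R ^^ d) x z" "even d = even L"
      using Suc.IH[OF z(1)] by blast
    thus ?case
    proof cases
      case (2 d)
      show ?thesis
      proof (cases "even e = even (Suc L)")
        case False
        have "(R ^^ Suc d) x y" using relpowp_Suc_I[OF 2(2) z(2)] .
        hence "(R ^^ (Suc d + e)) x x" using relpowp_sym[OF s e(2)] by (rule relpowp_trans)
        moreover have "odd (Suc d + e)" using False 2(3) by simp
        moreover have "Suc d + e \<le> 2 * D + 1" using 2(1) e(1) by simp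
        ultimately show ?thesis by blast
      qed (use e in blast)
    qed blast
  qed
  from this[OF w] show ?thesis
  proof
    assume "\<exists>k\<le>2 * D + 1. odd k \<and> (R ^^ k) x x"
    then obtain k where k: "k \<le> 2 * D + 1" "odd k" "(R ^^ k) x x" by blast
    obtain e where e: "e \<le> D" "(R ^^ e) x y" using D[OF relpowp_imp_rtranclp[OF w]] unfolding near_def by blast
    show ?thesis
    proof (cases "even e = even L")
      case True
      thus ?thesis using e by (intro exI[of _ e]) simp
    next
      case False
      have "(R ^^ (k + e)) x y" using k(3) e(2) by (rule relpowp_trans)
      thus ?thesis using False k e by (intro exI[of _ "k + e"]) simp
    qed
  next
    assume "\<exists>d\<le>D. (R ^^ d) x y \<and> even d = even L"
    then obtain d where "d \<le> D" "(R ^^ d) x y" "even d = even L" by blast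
    thus ?thesis by (intro exI[of _ d]) simp
  qed
qed

section \<open>Moving the assets while the traps do not change\<close>

text \<open>The value \<open>None\<close> outside the assets makes two configurations equal as soon
  as they agree on the assets. Assets at the source or the target are part of a configuration,
  although only those on \<open>W\<close> will move.\<close>

definition conf :: "('a, 'v) routing => 'v set => ('a => 'v option) => bool" where
  "conf I W X \<longleftrightarrow> (\<forall>a. a \<notin> assets I --> X a = None) \<and>
     (\<forall>a v. X a = Some v --> v \<in> W \<or> v = source I \<or> v = target I) \<and>
     (\<forall>a a' v. X a = Some v --> X a' = Some v --> v \<in> W --> a = a')"

definition gadj :: "('a, 'v) routing => 'v set => 'v => 'v => bool" where
  "gadj I W u v \<longleftrightarrow> u \<in> W \<and> v \<in> W \<and> {u, v} \<in> edges I"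

definition shift_step :: "('a, 'v) routing => 'v set => ('a => 'v option) => ('a => 'v option) => bool" where
  "shift_step I W X Y \<longleftrightarrow> conf I W X \<and> conf I W Y \<and> X \<noteq> Y \<and>
     (\<forall>a. Y a = X a \<or> (\<exists>u v. X a = Some u \<and> Y a = Some v \<and> gadj I W u v))"

lemma symp_gadj: "symp (gadj I W)"
  by (auto simp: symp_def gadj_def insert_commute)

lemma symp_shift_step: "symp (shift_step I W)"
proof (rule sympI)
  fix X Y assume s: "shift_step I W X Y"
  have "X a = Y a \<or> (\<exists>u v. Y a = Some u \<and> X a = Some v \<and> gadj I W u v)" for a
  proof -
    have "Y a = X a \<or> (\<exists>u v. X a = Some u \<and> Y a = Some v \<and> gadj I W u v)" using s unfolding shift_step_def by blast
    thus ?thesis using sympD[OF symp_gadj] by fastforce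
  qed
  thus "shift_step I W Y X" using s unfolding shift_step_def by (elim conjE) (intro conjI allI; (assumption | rule not_sym | blast))
qed

lemma shift_step_conf: "(shift_step I W)\<^sup>*\<^sup>* X Y ==> conf I W X ==> conf I W Y"
  by (induction rule: rtranclp_induct) (auto simp: shift_step_def)

text \<open>
  Two assets may cross the same edge in opposite directions in one round. Hence the contents of any
  two connected places can be exchanged, and few exchanges produce every reachable configuration.
\<close>

definition exch :: "'v => 'v => ('a => 'v option) => 'a => 'v option" where
  "exch u v X = (\<lambda>a. map_option (transpose u v) (X a))"

lemma exch_same [simp]: "exch u u X = X"
  by (simp add: exch_def fun_eq_iff option.map_id)

lemma conf_exch:
  assumes "conf I W X" "u \<in> W" "v \<in> W" "source I \<notin> W" "target I \<notin> W"
  shows "conf I W (exch u v X)"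
proof -
  have ne: "source I \<noteq> u" "source I \<noteq> v" "target I \<noteq> u" "target I \<noteq> v" using assms by blast+
  have W: "transpose u v x \<in> W \<longleftrightarrow> x \<in> W" for x using assms(2,3) by (auto simp: transpose_def)
  show ?thesis
    unfolding conf_def
  proof (intro conjI allI impI)
    fix a assume "a \<notin> assets I"
    thus "exch u v X a = None" using assms(1) by (simp add: conf_def exch_def)
  next
    fix a w assume "exch u v X a = Some w"
    then obtain x where x: "X a = Some x" "w = transpose u v x" by (auto simp: exch_def)
    hence "x \<in> W \<or> x = source I \<or> x = target I" using assms(1) unfolding conf_def by blast
    thus "w \<in> W \<or> w = source I \<or> w = target I" using W[of x] ne x(2) by (auto simp: transpose_def)
  next
    fix a a' w assume *: "exch u v X a = Some w" "exch u v X a' = Some w" "w \<in> W"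
    then obtain x x' where x: "X a = Some x" "X a' = Some x'" "w = transpose u v x" "w = transpose u v x'"
      by (auto simp: exch_def)
    hence "x = x'" by (metis transpose_involutory)
    moreover have "x \<in> W" using W[of x] x(3) *(3) by simp
    ultimately show "a = a'" using assms(1) x(1,2) unfolding conf_def by blast
  qed
qed

context
  fixes I :: "('a, 'v) routing" and W :: "'v set"
  assumes wf: "wf_routing I" and W: "W \<subseteq> verts I" "source I \<notin> W" "target I \<notin> W"
begin

text \<open>Exchanging the contents of adjacent places is one round, whether both, one or none of
  them is occupied; in the last case nothing changes and no round is spent.\<close>

lemma exch_edge:
  assumes X: "conf I W X" and g: "gadj I W u v"
  shows "near (shift_step I W) 1 X (exch u v X)"
proof (cases "exch u v X = X")
  case True
  thus ?thesis using near_mono[OF near_0] by simp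
next
  case False
  have uv: "u \<in> W" "v \<in> W" "{u, v} \<in> edges I" using g by (auto simp: gadj_def)
  have "exch u v X a = X a \<or> (\<exists>u' v'. X a = Some u' \<and> exch u v X a = Some v' \<and> gadj I W u' v')" for a
  proof (cases "X a")
    case (Some x)
    consider "x = u" | "x = v" | "x \<noteq> u" "x \<noteq> v" by blast
    thus ?thesis
      by cases (use Some g sympD[OF symp_gadj g] in \<open>simp_all add: exch_def transpose_def\<close>)
  qed (simp add: exch_def)
  hence "shift_step I W X (exch u v X)"
    using X conf_exch[OF X uv(1,2) W(2,3)] False unfolding shift_step_def by metis
  hence "(shift_step I W ^^ 1) X (exch u v X)" by (simp only: relpowp_1)
  thus ?thesis unfolding near_def by blast
qed

text \<open>The transposition of \<open>u\<close> and \<open>v\<close> is that of \<open>y\<close>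
  and \<open>v\<close> conjugated by that of \<open>u\<close> and \<open>y\<close>. Each further
  edge of the path thus costs two more exchanges.\<close>

lemma exch_path:
  "(gadj I W ^^ k) u v ==> conf I W X ==> near (shift_step I W) (2 * k) X (exch u v X)"
proof (induction k arbitrary: u X)
  case 0
  thus ?case by (simp add: near_0)
next
  case (Suc k)
  obtain y where y: "gadj I W u y" "(gadj I W ^^ k) y v" using relpowp_Suc_D2[OF Suc.prems(1)] by blast
  have uy: "u \<in> W" "y \<in> W" using y(1) by (auto simp: gadj_def)
  consider "u = v" | "u = y" | "y = v" | "u \<noteq> v" "u \<noteq> y" "y \<noteq> v" by blast
  thus ?case
  proof cases
    case 1
    thus ?thesis using near_mono[OF near_0] by simp
  next
    case 2
    thus ?thesis using near_mono[OF Suc.IH[OF y(2) Suc.prems(2)]] by simp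
  next
    case 3
    thus ?thesis using near_mono[OF exch_edge[OF Suc.prems(2) y(1)]] by simp
  next
    case 4
    have 1: "near (shift_step I W) 1 X (exch u y X)" by (rule exch_edge[OF Suc.prems(2) y(1)])
    have c1: "conf I W (exch u y X)" by (rule conf_exch[OF Suc.prems(2) uy W(2,3)])
    have 2: "near (shift_step I W) (2 * k) (exch u y X) (exch y v (exch u y X))" by (rule Suc.IH[OF y(2) c1])
    hence "(shift_step I W)\<^sup>*\<^sup>* (exch u y X) (exch y v (exch u y X))"
      unfolding near_def by (blast intro: relpowp_imp_rtranclp)
    hence c2: "conf I W (exch y v (exch u y X))" using c1 by (rule shift_step_conf)
    have 3: "near (shift_step I W) 1 (exch y v (exch u y X)) (exch u y (exch y v (exch u y X)))"
      by (rule exch_edge[OF c2 y(1)])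
    have "transpose u y (transpose y v (transpose u y x)) = transpose u v x" for x
      using 4 by (auto simp: transpose_def)
    hence "exch u y (exch y v (exch u y X)) = exch u v X"
      by (simp add: exch_def fun_eq_iff option.map_comp o_def)
    thus ?thesis using near_trans[OF near_trans[OF 1 2] 3] by (simp add: numeral_2_eq_2)
  qed
qed

lemma exch_connected:
  assumes "(gadj I W)\<^sup>*\<^sup>* u v" "conf I W X"
  shows "near (shift_step I W) (2 * (card (verts I) * card (verts I))) X (exch u v X)"
proof -
  let ?R = "{(u, v). gadj I W u v}"
  have sub: "?R \<subseteq> verts I \<times> verts I" using W(1) by (auto simp: gadj_def)
  have fin: "finite (verts I)" using wf by (simp add: wf_routing_def)
  hence fR: "finite ?R" using sub by (meson finite_SigmaI finite_subset)
  have "(u, v) \<in> ?R\<^sup>*" using assms(1) by (simp add: rtranclp_rtrancl_eq)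
  then obtain k where k: "k \<le> card ?R" "(u, v) \<in> ?R ^^ k" unfolding rtrancl_finite_eq_relpow[OF fR] by blast
  have "card ?R \<le> card (verts I) * card (verts I)"
    using card_mono[OF finite_SigmaI[OF fin fin] sub] by (simp add: card_cartesian_product)
  hence k2: "k \<le> card (verts I) * card (verts I)" using k(1) by simp
  have "((\<lambda>x y. (x, y) \<in> ?R) ^^ k) u v" unfolding relpowp_relpow_eq by (rule k(2))
  hence "(gadj I W ^^ k) u v" by simp
  from exch_path[OF this assms(2)] show ?thesis by (rule near_mono) (use k2 in simp)
qed

text \<open>Invariant while assets are brought to their goals one after another: an asset is at its
  goal or in the same component of \<open>W\<close>.\<close>

definition compat :: "('a => 'v option) => ('a => 'v option) => bool" where
  "compat Z Y \<longleftrightarrow> (\<forall>a. Z a = Y a \<or> (\<exists>x\<in>W. \<exists>y\<in>W. Z a = Some x \<and> Y a = Some y \<and> (gadj I W)\<^sup>*\<^sup>* x y))"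

lemma shift_step_compat: "(shift_step I W)\<^sup>*\<^sup>* X Y ==> compat X Y"
proof (induction rule: rtranclp_induct)
  case base
  thus ?case by (simp add: compat_def)
next
  case (step Y Z)
  show ?case
    unfolding compat_def
  proof
    fix a
    have 1: "X a = Y a \<or> (\<exists>x\<in>W. \<exists>y\<in>W. X a = Some x \<and> Y a = Some y \<and> (gadj I W)\<^sup>*\<^sup>* x y)"
      using step.IH unfolding compat_def by blast
    have 2: "Z a = Y a \<or> (\<exists>u v. Y a = Some u \<and> Z a = Some v \<and> gadj I W u v)"
      using step.hyps(2) unfolding shift_step_def by blast
    from 2 show "X a = Z a \<or> (\<exists>x\<in>W. \<exists>y\<in>W. X a = Some x \<and> Z a = Some y \<and> (gadj I W)\<^sup>*\<^sup>* x y)"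
    proof
      assume "\<exists>u v. Y a = Some u \<and> Z a = Some v \<and> gadj I W u v"
      then obtain u v where uv: "Y a = Some u" "Z a = Some v" "gadj I W u v" by blast
      hence W: "u \<in> W" "v \<in> W" by (auto simp: gadj_def)
      from 1 show ?thesis
      proof
        assume "X a = Y a"
        thus ?thesis using uv W by auto
      next
        assume "\<exists>x\<in>W. \<exists>y\<in>W. X a = Some x \<and> Y a = Some y \<and> (gadj I W)\<^sup>*\<^sup>* x y"
        then obtain x where x: "x \<in> W" "X a = Some x" "(gadj I W)\<^sup>*\<^sup>* x u" using uv(1) by auto
        have "(gadj I W)\<^sup>*\<^sup>* x v" using x(3) uv(3) by (rule rtranclp.rtrancl_into_rtrancl)
        thus ?thesis using uv(2) W x(1,2) by blast
      qed
    qed (use 1 in simp)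
  qed
qed

text \<open>Assets are placed one by one, each by a single exchange of its present place with its
  goal. Hence the distance is polynomial although the number of configurations is
  exponential.\<close>

lemma shift_step_near:
  assumes X: "conf I W X" and r: "(shift_step I W)\<^sup>*\<^sup>* X Y"
  shows "near (shift_step I W) (card (assets I) * (2 * (card (verts I) * card (verts I)))) X Y"
proof -
  let ?b = "2 * (card (verts I) * card (verts I))"
  have Y: "conf I W Y" by (rule shift_step_conf[OF r X])
  have fA: "finite (assets I)" using wf by (simp add: wf_routing_def)
  have "finite B ==> B \<subseteq> assets I ==> \<exists>Z. near (shift_step I W) (card B * ?b) X Z \<and> conf I W Z \<and> compat Z Y \<and> (\<forall>a\<in>B. Z a = Y a)" for B
  proof (induction B rule: finite_induct)
    case empty
    thus ?case using X shift_step_compat[OF r] near_0 by (intro exI[of _ X]) simp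
  next
    case (insert a B)
    then obtain Z where Z: "near (shift_step I W) (card B * ?b) X Z" "conf I W Z" "compat Z Y" "\<forall>a\<in>B. Z a = Y a" by blast
    have n: "card (insert a B) * ?b = card B * ?b + ?b" using insert.hyps by simp
    show ?case
    proof (cases "Z a = Y a")
      case True
      thus ?thesis using Z near_mono[OF Z(1), of "card (insert a B) * ?b"] unfolding n by (intro exI[of _ Z]) simp
    next
      case False
      then obtain x y where xy: "x \<in> W" "y \<in> W" "Z a = Some x" "Y a = Some y" "(gadj I W)\<^sup>*\<^sup>* x y"
        using Z(3) unfolding compat_def by blast
      let ?Z = "exch x y Z"
      have "near (shift_step I W) (card (insert a B) * ?b) X ?Z"
        unfolding n by (rule near_trans[OF Z(1) exch_connected[OF xy(5) Z(2)]])
      moreover have "conf I W ?Z" by (rule conf_exch[OF Z(2) xy(1,2) W(2,3)])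
      moreover have yx: "(gadj I W)\<^sup>*\<^sup>* y x"
        using xy(5) symp_gadj by (metis symp_rtranclp sympD)
      have "compat ?Z Y"
        unfolding compat_def
      proof
        fix c
        have cc: "Z c = Y c \<or> (\<exists>x\<in>W. \<exists>y\<in>W. Z c = Some x \<and> Y c = Some y \<and> (gadj I W)\<^sup>*\<^sup>* x y)"
          using Z(3) unfolding compat_def by blast
        show "?Z c = Y c \<or> (\<exists>x\<in>W. \<exists>y\<in>W. ?Z c = Some x \<and> Y c = Some y \<and> (gadj I W)\<^sup>*\<^sup>* x y)"
        proof (cases "Z c = Some x \<or> Z c = Some y")
          case True
          then obtain w w' where w: "Z c = Some w" "?Z c = Some w'" "(gadj I W)\<^sup>*\<^sup>* w' w" "w \<in> W" "w' \<in> W"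
            using xy yx by (auto simp: exch_def)
          then obtain v where v: "v \<in> W" "Y c = Some v" "(gadj I W)\<^sup>*\<^sup>* w v" using cc by auto
          have "(gadj I W)\<^sup>*\<^sup>* w' v" using w(3) v(3) by (rule rtranclp_trans)
          thus ?thesis using w v by blast
        next
          case False
          hence "?Z c = Z c" by (cases "Z c") (auto simp: exch_def transpose_def)
          thus ?thesis using cc by simp
        qed
      qed
      moreover have "\<forall>c\<in>insert a B. ?Z c = Y c"
      proof
        fix c assume c: "c \<in> insert a B"
        show "?Z c = Y c"
        proof (cases "c = a")
          case True
          thus ?thesis using xy by (simp add: exch_def)
        next
          case False
          hence zc: "Z c = Y c" using c Z(4) by simp
          \<comment> \<open>The exchange does not disturb assets that are already placed:
            \<open>x\<close> is occupied by \<open>a\<close>, and \<open>y\<close> is the goal of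
            \<open>a\<close> alone.\<close>
          have "Z c \<noteq> Some x" using Z(2) xy(1,3) False unfolding conf_def by blast
          moreover have "Y c \<noteq> Some y" using Y xy(2,4) False unfolding conf_def by blast
          hence "Z c \<noteq> Some y" using zc by simp
          ultimately have "?Z c = Z c" by (cases "Z c") (auto simp: exch_def transpose_def)
          thus ?thesis using zc by simp
        qed
      qed
      ultimately show ?thesis by blast
    qed
  qed
  from this[OF fA order_refl] obtain Z where Z: "near (shift_step I W) (card (assets I) * ?b) X Z" "conf I W Z" "\<forall>a\<in>assets I. Z a = Y a"
    by blast
  have "Z = Y"
  proof
    fix a show "Z a = Y a" using Z(2,3) Y by (cases "a \<in> assets I") (simp_all add: conf_def)
  qed
  thus ?thesis using Z(1) by simp
qed

end

section \<open>Cutting a plan into few events and static stretches\<close>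

lemma card_unique_index:
  fixes P :: "'a => nat => bool"
  assumes "finite A" "\<And>a i j. a \<in> A ==> P a i ==> P a j ==> i = j"
  shows "finite {j. \<exists>a\<in>A. P a j}" "card {j. \<exists>a\<in>A. P a j} \<le> card A"
proof -
  have "{j. \<exists>a\<in>A. P a j} \<subseteq> (\<lambda>a. THE j. P a j) ` A"
  proof
    fix j assume "j \<in> {j. \<exists>a\<in>A. P a j}"
    then obtain a where a: "a \<in> A" "P a j" by blast
    hence "(THE j. P a j) = j" using assms(2) by (intro the_equality) blast+
    thus "j \<in> (\<lambda>a. THE j. P a j) ` A" using a by (intro image_eqI[of _ _ a]) simp_all
  qed
  note sub = this
  show "finite {j. \<exists>a\<in>A. P a j}" by (rule finite_subset[OF sub finite_imageI[OF assms(1)]])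
  show "card {j. \<exists>a\<in>A. P a j} \<le> card A" by (rule surj_card_le[OF assms(1) sub])
qed

locale solved =
  fixes I :: "('a, 'v) routing" and p :: "('a, 'v) plan"
  assumes wf: "wf_routing I" and sol: "solution I p"
begin

lemma v: "valid_plan I p" using sol by (simp add: solution_def)

definition C :: "nat => 'a => 'v option" where "C j a = (if a \<in> assets I then p a j else None)"

lemma C_asset [simp]: "a \<in> assets I ==> C j a = p a j" by (simp add: C_def)

text \<open>The ordinary vertices together with the traps that are inactive at time
  \<open>j\<close>: the places on which assets can be permuted freely.\<close>

definition fr :: "nat => 'v set" where
  "fr j = {v \<in> verts I. v \<noteq> source I \<and> v \<noteq> target I \<and> (v \<in> traps I --> \<not> active I p v j)}"

definition static :: "nat => bool" where
  "static j \<longleftrightarrow> (\<forall>r\<in>traps I. active I p r j \<longleftrightarrow> active I p r (Suc j)) \<and> shift_step I (fr j) (C j) (C (Suc j))"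

definition len :: nat where "len = (SOME n. has_length I p n)"

lemma len: "1 \<le> len" "a \<in> assets I ==> finished I (p a len)" "\<exists>a\<in>assets I. \<not> finished I (p a (len - 1))"
proof -
  have "has_length I p len" unfolding len_def using v by (auto simp: valid_plan_def intro: someI)
  thus "1 \<le> len" "a \<in> assets I ==> finished I (p a len)" "\<exists>a\<in>assets I. \<not> finished I (p a (len - 1))"
    by (auto simp: has_length_def)
qed

lemma unfinished: "j < len ==> \<exists>a\<in>assets I. \<not> finished I (p a j)"
proof -
  assume j: "j < len"
  obtain a where a: "a \<in> assets I" "\<not> finished I (p a (len - 1))" using len(3) by blast
  have "\<not> finished I (p a j)" using plan_finished[OF wf v a(1), of j "len - 1"] j a(2) by auto
  thus ?thesis using a(1) by blast
qed

definition leaves :: "'a => nat => bool" where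
  "leaves a j \<longleftrightarrow> p a j = Some (source I) \<and> p a (Suc j) \<noteq> Some (source I)"
definition ends :: "'a => nat => bool" where
  "ends a j \<longleftrightarrow> \<not> finished I (p a j) \<and> finished I (p a (Suc j))"
definition expires :: "'a => nat => bool" where
  "expires a j \<longleftrightarrow> (\<exists>i r. r \<in> traps I \<and> p a i = Some r \<and> active I p r i \<and> j = i + reload I r)"

lemma leaves_unique: "a \<in> assets I ==> leaves a i ==> leaves a j ==> i = j"
proof -
  have *: "\<not> (i < j)" if "a \<in> assets I" "leaves a i" "leaves a j" for i j
    using plan_source_le[OF wf v that(1), of j "Suc i"] that(2,3) by (auto simp: leaves_def)
  assume "a \<in> assets I" "leaves a i" "leaves a j"
  thus "i = j" using *[of i j] *[of j i] by simp
qed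

lemma ends_unique: "a \<in> assets I ==> ends a i ==> ends a j ==> i = j"
proof -
  have *: "\<not> (i < j)" if "a \<in> assets I" "ends a i" "ends a j" for i j
    using plan_finished[OF wf v that(1), of "Suc i" j] that(2,3) by (auto simp: ends_def)
  assume "a \<in> assets I" "ends a i" "ends a j"
  thus "i = j" using *[of i j] *[of j i] by simp
qed

lemma trap_unfinished: "r \<in> traps I ==> \<not> finished I (Some r)"
  using trap_wf[OF wf v] by (auto simp: finished_def)

lemma active_ends: "a \<in> assets I ==> r \<in> traps I ==> p a j = Some r ==> active I p r j ==> ends a j"
  using plan_kill[OF wf v] trap_unfinished by (simp add: ends_def finished_def)

lemma expires_unique: "a \<in> assets I ==> expires a i ==> expires a j ==> i = j"
proof -
  assume a: "a \<in> assets I" and e: "expires a i" "expires a j"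
  obtain k r where 1: "r \<in> traps I" "p a k = Some r" "active I p r k" "i = k + reload I r" using e(1) by (auto simp: expires_def)
  obtain l s where 2: "s \<in> traps I" "p a l = Some s" "active I p s l" "j = l + reload I s" using e(2) by (auto simp: expires_def)
  have "k = l" using ends_unique[OF a active_ends[OF a 1(1-3)] active_ends[OF a 2(1-3)]] .
  thus "i = j" using 1 2 by simp
qed

text \<open>Each asset contributes at most four rounds: it leaves the source once, it is finished
  once, and the trap it triggers expires once; the round before finishing is included because it may
  be the step onto an active trap. Round 0 is added since nobody is required to move in it.\<close>

definition events :: "nat set" where
  "events = {0} \<union> {j. \<exists>a\<in>assets I. leaves a j} \<union> {j. \<exists>a\<in>assets I. ends a j} \<union>
     {j. \<exists>a\<in>assets I. ends a (Suc j)} \<union> {j. \<exists>a\<in>assets I. expires a j}"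

lemma card_events: "finite events" "card events \<le> 4 * card (assets I) + 1"
proof -
  have fA: "finite (assets I)" using wf by (simp add: wf_routing_def)
  have e: "i = j" if "a \<in> assets I" "ends a (Suc i)" "ends a (Suc j)" for a i j using ends_unique[OF that] by simp
  let ?S1 = "{j. \<exists>a\<in>assets I. leaves a j}" and ?S2 = "{j. \<exists>a\<in>assets I. ends a j}"
    and ?S3 = "{j. \<exists>a\<in>assets I. ends a (Suc j)}" and ?S4 = "{j. \<exists>a\<in>assets I. expires a j}"
  have 1: "finite ?S1" "card ?S1 \<le> card (assets I)" by (rule card_unique_index[OF fA], erule leaves_unique; assumption)+
  have 2: "finite ?S2" "card ?S2 \<le> card (assets I)" by (rule card_unique_index[OF fA], erule ends_unique; assumption)+
  have 3: "finite ?S3" "card ?S3 \<le> card (assets I)" by (rule card_unique_index[OF fA], erule e; assumption)+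
  have 4: "finite ?S4" "card ?S4 \<le> card (assets I)" by (rule card_unique_index[OF fA], erule expires_unique; assumption)+
  show "finite events" unfolding events_def using 1(1) 2(1) 3(1) 4(1) by simp
  have "card events \<le> card ({0} \<union> ?S1 \<union> ?S2 \<union> ?S3) + card ?S4" unfolding events_def by (rule card_Un_le)
  also have "card ({0} \<union> ?S1 \<union> ?S2 \<union> ?S3) \<le> card ({0} \<union> ?S1 \<union> ?S2) + card ?S3" by (rule card_Un_le)
  also have "card ({0} \<union> ?S1 \<union> ?S2) \<le> card ({0} \<union> ?S1) + card ?S2" by (rule card_Un_le)
  also have "card ({0} \<union> ?S1) \<le> card {0::nat} + card ?S1" by (rule card_Un_le)
  finally show "card events \<le> 4 * card (assets I) + 1" using 1(2) 2(2) 3(2) 4(2) by simp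
qed

text \<open>A trap is switched off only by a death on it and switched on only when the reload time
  started by a death expires.\<close>

lemma activity_change:
  assumes r: "r \<in> traps I" and "active I p r j \<noteq> active I p r (Suc j)"
  shows "j \<in> events"
proof (cases "active I p r j")
  case True
  hence "\<not> active I p r (Suc j)" using assms by simp
  then obtain i a where i: "i < Suc j" "active I p r i" "a \<in> assets I" "p a i = Some r" "Suc j \<le> i + reload I r"
    by (rule not_activeE)
  have "\<not> i < j" using activeD[OF True _ i(2-4)] i(5) by auto
  hence "i = j" using i(1) by simp
  hence "ends a j" using active_ends[OF i(3) r] i by simp
  thus ?thesis using i(3) by (auto simp: events_def)
next
  case False
  hence T: "active I p r (Suc j)" using assms by simp
  obtain i a where i: "i < j" "active I p r i" "a \<in> assets I" "p a i = Some r" "j \<le> i + reload I r"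
    using False by (rule not_activeE)
  have "i + reload I r < Suc j" using activeD[OF T _ i(2-4)] i(1) by simp
  hence "expires a j" using i r unfolding expires_def by (intro exI[of _ i] exI[of _ r]) simp
  thus ?thesis using i(3) by (auto simp: events_def)
qed

lemma conf_C: "\<forall>a\<in>assets I. \<forall>v. p a j = Some v --> v \<noteq> source I --> v \<noteq> target I --> v \<in> fr j' ==> conf I (fr j') (C j)"
  unfolding conf_def
proof (intro conjI allI impI)
  fix a v assume "\<forall>a\<in>assets I. \<forall>v. p a j = Some v --> v \<noteq> source I --> v \<noteq> target I --> v \<in> fr j'" "C j a = Some v"
  thus "v \<in> fr j' \<or> v = source I \<or> v = target I" by (auto simp: C_def split: if_splits)
next
  fix a a' v assume *: "C j a = Some v" "C j a' = Some v" "v \<in> fr j'"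
  hence "a \<in> assets I" "a' \<in> assets I" "p a j = Some v" "p a' j = Some v" "v \<noteq> source I" "v \<noteq> target I"
    by (auto simp: C_def fr_def split: if_splits)
  thus "a = a'" by (rule plan_distinct[OF wf v])
qed (simp add: C_def)

text \<open>Outside the events nobody leaves the source, finishes or is about to die, so every mover
  goes between places of \<open>fr j\<close>.\<close>

lemma static_step:
  assumes j: "j < len" "j \<notin> events"
  shows "static j"
proof -
  have same: "active I p r j \<longleftrightarrow> active I p r (Suc j)" if "r \<in> traps I" for r using activity_change[OF that] j(2) by blast
  have ne: "\<not> leaves a j" "\<not> ends a j" "\<not> ends a (Suc j)" if "a \<in> assets I" for a using j(2) that unfolding events_def by blast+
  have j1: "1 \<le> j" using j(2) unfolding events_def by (cases j) auto
  have inact: "\<not> active I p r j" if "a \<in> assets I" "r \<in> traps I" "p a j = Some r \<or> p a (Suc j) = Some r" for a r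
    using active_ends[OF that(1,2), of j] active_ends[OF that(1,2), of "Suc j"] same[OF that(2)] ne[OF that(1)] that(3) by blast
  have infr: "v \<in> fr j" if "a \<in> assets I" "p a j = Some v \<or> p a (Suc j) = Some v" "v \<noteq> source I" "v \<noteq> target I" for a v
    using that plan_verts[OF wf v that(1)] inact[OF that(1)] unfolding fr_def by blast
  have c: "conf I (fr j) (C j)" "conf I (fr j) (C (Suc j))" using infr by (intro conf_C; blast)+
  have st: "C (Suc j) a = C j a \<or> (\<exists>u v. C j a = Some u \<and> C (Suc j) a = Some v \<and> gadj I (fr j) u v)" for a
  proof (cases "a \<in> assets I \<and> p a (Suc j) \<noteq> p a j")
    case True
    hence a: "a \<in> assets I" and d: "p a (Suc j) \<noteq> p a j" by simp_all
    have nf: "\<not> finished I (p a j)" using plan_finished[OF wf v a, of j "Suc j"] d by auto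
    hence nf': "\<not> finished I (p a (Suc j))" using ne(2)[OF a] by (simp add: ends_def)
    then obtain w where w: "p a (Suc j) = Some w" "w \<noteq> target I" by (cases "p a (Suc j)") (auto simp: finished_def)
    obtain u where u: "p a j = Some u" "u = w \<or> {u, w} \<in> edges I" using plan_step[OF wf v a w(1)] by blast
    have "u \<noteq> target I" using nf u(1) by (simp add: finished_def)
    have "w \<noteq> source I" using plan_source[OF wf v a, of j] w(1) d by auto
    hence "u \<noteq> source I" using ne(1)[OF a] u(1) w(1) by (auto simp: leaves_def)
    have "gadj I (fr j) u w" unfolding gadj_def
      using infr[OF a] u w d \<open>u \<noteq> target I\<close> \<open>w \<noteq> source I\<close> \<open>u \<noteq> source I\<close> by auto
    thus ?thesis using u(1) w(1) a by simp
  qed (auto simp: C_def)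
  have "\<exists>a'\<in>assets I. p a' j \<noteq> p a' (j + 1)" using v unfinished[OF j(1)] j1 unfolding valid_plan_def by blast
  hence "C j \<noteq> C (Suc j)" by (metis C_asset Suc_eq_plus1)
  thus ?thesis unfolding static_def shift_step_def using same c st by blast
qed

text \<open>Either an actual round of the plan, or a stretched reversible step between
  configurations that need not occur in the plan. The last conjunct excludes deaths in the rounds
  skipped, so that both plans trigger the same traps at the same times.\<close>

definition link :: "nat \<times> ('a => 'v option) => nat \<times> ('a => 'v option) => bool" where
  "link = (\<lambda>(t, X) (t', X'). t' = Suc t \<and> X = C t \<and> X' = C t' \<or>
     t < t' \<and> odd (t' - t) \<and> (\<exists>W. W \<subseteq> verts I \<and> source I \<notin> W \<and> target I \<notin> W \<and> shift_step I W X X' \<and>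
       (\<forall>r\<in>W \<inter> traps I. \<not> active I p r t') \<and> (\<forall>a\<in>assets I. \<forall>j. t \<le> j \<and> j < t' --> p a (Suc j) = None --> p a j = None)))"

definition dist_bound :: nat where "dist_bound = card (assets I) * (2 * (card (verts I) * card (verts I)))"
definition static_bound :: nat where "static_bound = 3 * dist_bound + 3"

text \<open>In a static stretch the usable places are constant, so a long walk may be replaced by a
  short one of the same parity to the last but one configuration.\<close>

lemma static_run:
  assumes ab: "a \<le> b" and st: "\<And>j. a \<le> j ==> j < b ==> static j"
  shows "\<exists>H\<le>static_bound. (link ^^ H) (a, C a) (b, C b)"
proof (cases "a = b")
  case True
  thus ?thesis by (intro exI[of _ 0]) simp
next
  case False
  let ?W = "fr a"
  have W: "?W \<subseteq> verts I" "source I \<notin> ?W" "target I \<notin> ?W" by (auto simp: fr_def)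
  have act: "active I p r j \<longleftrightarrow> active I p r a" if "a \<le> j" "j \<le> b" "r \<in> traps I" for r j
    using that
  proof (induction j rule: dec_induct)
    case (step j)
    thus ?case using st[of j] by (simp add: static_def)
  qed simp
  have frj: "fr j = ?W" if "a \<le> j" "j \<le> b" for j using act[OF that] by (auto simp: fr_def)
  have ss: "shift_step I ?W (C j) (C (Suc j))" if "a \<le> j" "j < b" for j
    using st[OF that] frj[of j] that by (simp add: static_def)
  have alive: "p x j = None" if "x \<in> assets I" "a \<le> j" "j < b" "p x (Suc j) = None" for x j
  proof -
    have "C (Suc j) x = C j x \<or> (\<exists>u v. C j x = Some u \<and> C (Suc j) x = Some v \<and> gadj I ?W u v)"
      using ss[OF that(2,3)] unfolding shift_step_def by blast
    thus ?thesis using that by auto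
  qed
  have lk: "link (t, X) (t', X')" if "a \<le> t" "t < t'" "t' \<le> b" "odd (t' - t)" "shift_step I ?W X X'" for t t' X X'
    unfolding link_def prod.case
  proof (intro disjI2 conjI exI[of _ ?W] ballI allI impI)
    fix r assume "r \<in> ?W \<inter> traps I"
    thus "\<not> active I p r t'" using act[of t' r] that by (auto simp: fr_def)
  next
    fix x j assume "x \<in> assets I" "t \<le> j \<and> j < t'" "p x (Suc j) = None"
    thus "p x j = None" using alive that by simp
  qed (use that W in simp_all)
  have lks: "(link ^^ k) (a, X) (a + k, Y)" if "(shift_step I ?W ^^ k) X Y" "a + k \<le> b" for k X Y
    using that
  proof (induction k arbitrary: Y)
    case (Suc k)
    then obtain Z where Z: "(shift_step I ?W ^^ k) X Z" "shift_step I ?W Z Y" by auto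
    have "link (a + k, Z) (a + Suc k, Y)" by (rule lk) (use Suc.prems Z in simp_all)
    thus ?case using Suc.IH[OF Z(1)] Suc.prems(2) by (intro relpowp_Suc_I) simp_all
  qed simp
  have path: "(shift_step I ?W ^^ k) (C a) (C (a + k))" if "a + k \<le> b" for k
    using that
  proof (induction k)
    case (Suc k)
    thus ?case using ss[of "a + k"] by (intro relpowp_Suc_I) simp_all
  qed simp
  show ?thesis
  proof (cases "b - a \<le> static_bound")
    case True
    thus ?thesis using lks[OF path[of "b - a"]] ab by (intro exI[of _ "b - a"]) simp
  next
    \<comment> \<open>The final step, from \<open>b - 1\<close> to \<open>b\<close>, is the one that
      is stretched: the short walk has the parity of \<open>b - 1 - a\<close>, so an odd number of
      rounds remains for it.\<close>
    case long: False
    have bd: "b - 1 = a + (b - 1 - a)" "a + (b - 1 - a) \<le> b" "a \<le> b - 1" "b - 1 < b" "Suc (b - 1) = b" using False ab by simp_all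
    have w: "(shift_step I ?W ^^ (b - 1 - a)) (C a) (C (b - 1))" using path[OF bd(2)] bd(1) by simp
    have cf: "conf I ?W (C a)" using ss[of a] False ab unfolding shift_step_def by simp
    obtain l where l: "l \<le> 3 * dist_bound + 1" "(shift_step I ?W ^^ l) (C a) (C (b - 1))" "even l = even (b - 1 - a)"
      using walk_parity[OF symp_shift_step shift_step_near[OF wf W cf, folded dist_bound_def] w] by blast
    have lb: "a + l < b" using l(1) long unfolding static_bound_def by simp
    have "link (a + l, C (b - 1)) (b, C b)"
    proof (rule lk)
      have "b - (a + l) = Suc (b - 1 - a - l)" using lb by simp
      moreover have "l \<le> b - 1 - a" using lb by simp
      hence "even (b - 1 - a - l)" unfolding even_diff_nat using l(3) by simp
      ultimately show "odd (b - (a + l))" by simp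
      show "shift_step I ?W (C (b - 1)) (C b)" using ss[OF bd(3,4)] bd(5) by simp
    qed (use lb in simp_all)
    hence "(link ^^ Suc l) (a, C a) (b, C b)" using lks[OF l(2)] lb by (intro relpowp_Suc_I) simp_all
    moreover have "Suc l \<le> static_bound" using l(1) by (simp add: static_bound_def)
    ultimately show ?thesis by blast
  qed
qed

text \<open>Induction on the last event before \<open>i\<close>: the event itself is one actual
  round, and the rounds after it form a static stretch.\<close>

lemma links_upto:
  assumes "i \<le> len"
  shows "\<exists>H\<le>card {j\<in>events. j < i} * Suc static_bound + static_bound. (link ^^ H) (0, C 0) (i, C i)"
  using assms
proof (induction i rule: less_induct)
  case (less i)
  show ?case
  proof (cases "{j\<in>events. j < i} = {}")
    case True
    hence "\<exists>H\<le>static_bound. (link ^^ H) (0, C 0) (i, C i)" using less.prems by (intro static_run static_step) auto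
    thus ?thesis using trans_le_add2 by blast
  next
    case False
    have fin: "finite {j\<in>events. j < i}" by simp
    define k where "k = Max {j\<in>events. j < i}"
    have k: "k \<in> events" "k < i" using Max_in[OF fin False] unfolding k_def by blast+
    have kmax: "j \<le> k" if "j \<in> events" "j < i" for j using Max_ge[OF fin] that unfolding k_def by blast
    obtain H where H: "H \<le> card {j\<in>events. j < k} * Suc static_bound + static_bound" "(link ^^ H) (0, C 0) (k, C k)"
      using less.IH[OF k(2)] k(2) less.prems by auto
    have "link (k, C k) (Suc k, C (Suc k))" by (simp add: link_def)
    hence 1: "(link ^^ Suc H) (0, C 0) (Suc k, C (Suc k))" by (rule relpowp_Suc_I[OF H(2)])
    have "\<exists>H\<le>static_bound. (link ^^ H) (Suc k, C (Suc k)) (i, C i)"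
    proof (rule static_run)
      fix j assume j: "Suc k \<le> j" "j < i"
      show "static j" using kmax[of j] j less.prems by (intro static_step) auto
    qed (use k in simp)
    then obtain H' where H': "H' \<le> static_bound" "(link ^^ H') (Suc k, C (Suc k)) (i, C i)" by blast
    have "(link ^^ (Suc H + H')) (0, C 0) (i, C i)" using 1 H'(2) by (rule relpowp_trans)
    moreover have "insert k {j\<in>events. j < k} \<subseteq> {j\<in>events. j < i}" using k by auto
    hence "card (insert k {j\<in>events. j < k}) \<le> card {j\<in>events. j < i}" by (rule card_mono[OF fin])
    hence "Suc (card {j\<in>events. j < k}) * Suc static_bound \<le> card {j\<in>events. j < i} * Suc static_bound"
      by (intro mult_le_mono1) simp
    hence "Suc H + H' \<le> card {j\<in>events. j < i} * Suc static_bound + static_bound" using H(1) H'(1) by simp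
    ultimately show ?thesis by blast
  qed
qed

definition entries_bound :: nat where
  "entries_bound = (4 * card (assets I) + 1) * Suc static_bound + static_bound"

lemma links: "\<exists>H\<le>entries_bound. (link ^^ H) (0, C 0) (len, C len)"
proof -
  obtain H where H: "H \<le> card {j\<in>events. j < len} * Suc static_bound + static_bound" "(link ^^ H) (0, C 0) (len, C len)"
    using links_upto[of len] by blast
  have "card {j\<in>events. j < len} \<le> card events" using card_events(1) by (intro card_mono) auto
  hence "card {j\<in>events. j < len} * Suc static_bound \<le> (4 * card (assets I) + 1) * Suc static_bound"
    using card_events(2) by (intro mult_le_mono1) simp
  thus ?thesis using H unfolding entries_bound_def by (intro exI[of _ H]) simp
qed

text \<open>Activity described by deaths instead of the recursion, which is the form that
  \<open>act\<close> uses for compressed plans.\<close>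

lemma active_deaths:
  assumes r: "r \<in> traps I"
  shows "active I p r j \<longleftrightarrow> \<not> (\<exists>i<j. (\<exists>a\<in>assets I. p a i = Some r \<and> p a (Suc i) = None) \<and> j \<le> i + reload I r)"
proof
  assume a: "active I p r j"
  show "\<not> (\<exists>i<j. (\<exists>a\<in>assets I. p a i = Some r \<and> p a (Suc i) = None) \<and> j \<le> i + reload I r)"
  proof
    assume "\<exists>i<j. (\<exists>a\<in>assets I. p a i = Some r \<and> p a (Suc i) = None) \<and> j \<le> i + reload I r"
    then obtain i x where i: "i < j" "x \<in> assets I" "p x i = Some r" "p x (Suc i) = None" "j \<le> i + reload I r" by blast
    hence "active I p r i" using plan_killed[OF wf v] by blast
    thus False using activeD[OF a i(1) _ i(2,3)] i(5) by simp
  qed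
next
  assume n: "\<not> (\<exists>i<j. (\<exists>a\<in>assets I. p a i = Some r \<and> p a (Suc i) = None) \<and> j \<le> i + reload I r)"
  show "active I p r j"
  proof (rule ccontr)
    assume "\<not> active I p r j"
    then obtain i x where i: "i < j" "active I p r i" "x \<in> assets I" "p x i = Some r" "j \<le> i + reload I r"
      by (rule not_activeE)
    hence "p x (Suc i) = None" using plan_kill[OF wf v _ r] by blast
    thus False using n i by blast
  qed
qed

lemma compressed_exists: "\<exists>ti X. \<exists>H\<le>entries_bound. compressed I ti X H"
proof -
  obtain H where H: "H \<le> entries_bound" "(link ^^ H) (0, C 0) (len, C len)" using links by blast
  obtain f where f: "f 0 = (0, C 0)" "f H = (len, C len)" "\<And>h. h < H ==> link (f h) (f (Suc h))"
    using H(2) unfolding relpowp_fun_conv by blast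
  define ti where "ti h = fst (f h)" for h
  define X where "X h = snd (f h)" for h
  have lk: "link (ti h, X h) (ti (Suc h), X (Suc h))" if "h < H" for h using f(3)[OF that] by (simp add: ti_def X_def)
  have inc: "ti h < ti (Suc h)" if "h < H" for h using lk[OF that] by (auto simp: link_def)
  have ge: "h \<le> H ==> h \<le> ti h" for h
  proof (induction h)
    case (Suc h)
    thus ?case using inc[of h] by simp
  qed simp
  have mono: "g < h ==> h \<le> H ==> ti g < ti h" for g h
  proof (induction h)
    case (Suc h)
    thus ?case using inc[of h] by (cases "g = h") auto
  qed simp
  have rev_None: "X (Suc h) a = None ==> X h a = None" if "shift_step I W (X h) (X (Suc h))" for h W a
    using that unfolding shift_step_def by (metis option.distinct(1))
  \<comment> \<open>A reversible step kills nobody, and no death of the plan lies in a skipped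
    round. Hence all deaths sit in unit links, where the entries are the configurations of the
    plan.\<close>
  have death: "(\<exists>g<h. ti g = i \<and> (\<exists>a\<in>assets I. X g a = Some r \<and> X (Suc g) a = None)) \<longleftrightarrow>
      i < ti h \<and> (\<exists>a\<in>assets I. p a i = Some r \<and> p a (Suc i) = None)" if h: "h \<le> H" for h i r
  proof
    assume "\<exists>g<h. ti g = i \<and> (\<exists>a\<in>assets I. X g a = Some r \<and> X (Suc g) a = None)"
    then obtain g a where g: "g < h" "ti g = i" "a \<in> assets I" "X g a = Some r" "X (Suc g) a = None" by blast
    have "link (ti g, X g) (ti (Suc g), X (Suc g))" using lk g(1) h by simp
    moreover have "\<not> shift_step I W (X g) (X (Suc g))" for W using rev_None[of W g a] g(4,5) by auto
    ultimately have "ti (Suc g) = Suc (ti g)" "X g = C (ti g)" "X (Suc g) = C (ti (Suc g))" by (auto simp: link_def)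
    thus "i < ti h \<and> (\<exists>a\<in>assets I. p a i = Some r \<and> p a (Suc i) = None)"
      using g mono[OF g(1) h] by auto
  next
    assume *: "i < ti h \<and> (\<exists>a\<in>assets I. p a i = Some r \<and> p a (Suc i) = None)"
    then obtain a where a: "a \<in> assets I" "p a i = Some r" "p a (Suc i) = None" by blast
    have "h \<le> H ==> i < ti h ==> \<exists>g<h. ti g \<le> i \<and> i < ti (Suc g)" for h
    proof (induction h)
      case 0
      thus ?case using f(1) by (simp add: ti_def)
    next
      case (Suc h)
      show ?case
      proof (cases "i < ti h")
        case True
        then obtain g where "g < h" "ti g \<le> i" "i < ti (Suc g)" using Suc by auto
        thus ?thesis by (intro exI[of _ g]) simp
      next
        case False
        thus ?thesis using Suc.prems by (intro exI[of _ h]) simp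
      qed
    qed
    then obtain g where g: "g < h" "ti g \<le> i" "i < ti (Suc g)" using * h by blast
    have "link (ti g, X g) (ti (Suc g), X (Suc g))" using lk g(1) h by simp
    moreover have "\<not> (\<forall>a\<in>assets I. \<forall>j. ti g \<le> j \<and> j < ti (Suc g) --> p a (Suc j) = None --> p a j = None)"
    proof
      assume "\<forall>a\<in>assets I. \<forall>j. ti g \<le> j \<and> j < ti (Suc g) --> p a (Suc j) = None --> p a j = None"
      from this[rule_format, OF a(1), of i] show False using g a by simp
    qed
    ultimately have "ti (Suc g) = Suc (ti g)" "X g = C (ti g)" "X (Suc g) = C (ti (Suc g))"
      unfolding link_def prod.case by blast+
    moreover hence "i = ti g" using g by simp
    ultimately show "\<exists>g<h. ti g = i \<and> (\<exists>a\<in>assets I. X g a = Some r \<and> X (Suc g) a = None)"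
      using g(1) a by (intro exI[of _ g]) auto
  qed
  have act: "act I ti X h r \<longleftrightarrow> active I p r (ti h)" if h: "h \<le> H" and r: "r \<in> traps I" for h r
  proof -
    have "act I ti X h r \<longleftrightarrow> \<not> (\<exists>i. (\<exists>g<h. ti g = i \<and> (\<exists>a\<in>assets I. X g a = Some r \<and> X (Suc g) a = None)) \<and> ti h \<le> i + reload I r)"
      unfolding act_def by blast
    thus ?thesis unfolding death[OF h] active_deaths[OF r] by blast
  qed
  have step: "ti h < ti (Suc h) \<and> odd (ti (Suc h) - ti h) \<and> (unit_step I ti X h \<or> rev_step I ti X h)" if h: "h < H" for h
  proof -
    from lk[OF h] consider "ti (Suc h) = Suc (ti h)" "X h = C (ti h)" "X (Suc h) = C (ti (Suc h))"
      | W where "ti h < ti (Suc h)" "odd (ti (Suc h) - ti h)" "source I \<notin> W" "target I \<notin> W"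
        "shift_step I W (X h) (X (Suc h))" "\<forall>r\<in>W \<inter> traps I. \<not> active I p r (ti (Suc h))"
      unfolding link_def prod.case by blast
    thus ?thesis
    proof cases
      case 1
      let ?j = "ti h"
      have "unit_step I ti X h"
        unfolding unit_step_def
      proof (intro conjI ballI impI)
        show "ti (Suc h) = Suc ?j" by (rule 1(1))
        fix a assume a: "a \<in> assets I"
        have X: "X h a = p a ?j" "X (Suc h) a = p a (Suc ?j)" using 1 a by simp_all
        show "X (Suc h) a = X h a" if "finished I (X h a)"
          using plan_finished[OF wf v a, of ?j "Suc ?j"] that unfolding X by simp
        show "X (Suc h) a = None \<longleftrightarrow> (\<exists>r\<in>traps I. X h a = Some r \<and> act I ti X h r)" if nn: "X h a \<noteq> None"
        proof
          assume n: "X (Suc h) a = None"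
          obtain u where u: "X h a = Some u" using nn by auto
          hence "u \<in> traps I" "active I p u ?j" using plan_killed[OF wf v a] n unfolding X by blast+
          thus "\<exists>r\<in>traps I. X h a = Some r \<and> act I ti X h r" using u act h by auto
        next
          assume "\<exists>r\<in>traps I. X h a = Some r \<and> act I ti X h r"
          then obtain r where "r \<in> traps I" "X h a = Some r" "active I p r ?j" using act h by auto
          thus "X (Suc h) a = None" using plan_kill[OF wf v a] unfolding X by blast
        qed
        show "X (Suc h) a = X h a \<or> adj_opt I (X h a) (X (Suc h) a)" if nw: "X (Suc h) a \<noteq> None"
        proof -
          obtain w where w: "p a (Suc ?j) = Some w" using nw X by auto
          obtain u where "p a ?j = Some u" "u = w \<or> {u, w} \<in> edges I" using plan_step[OF wf v a w] by blast
          thus ?thesis unfolding X w by auto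
        qed
        show "X h a = Some (source I)" if "X (Suc h) a = Some (source I)"
          using plan_source[OF wf v a] that unfolding X by blast
      next
        show "h = 0 \<or> (\<exists>a\<in>assets I. X (Suc h) a \<noteq> X h a) \<or> (\<forall>a\<in>assets I. finished I (X h a))"
        proof (cases "h = 0 \<or> (\<forall>a\<in>assets I. finished I (X h a))")
          case False
          then obtain a where a: "a \<in> assets I" "\<not> finished I (p a ?j)" using 1 by auto
          have "1 \<le> ?j" using ge[of h] h False by simp
          hence "\<exists>a'\<in>assets I. p a' ?j \<noteq> p a' (?j + 1)" using v a unfolding valid_plan_def by blast
          thus ?thesis using 1 by (metis C_asset Suc_eq_plus1)
        qed blast
      qed
      thus ?thesis using 1(1) by simp
    next
      case (2 W)
      have c: "conf I W (X h)" "conf I W (X (Suc h))" "X h \<noteq> X (Suc h)"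
        "\<And>a. X (Suc h) a = X h a \<or> (\<exists>u v. X h a = Some u \<and> X (Suc h) a = Some v \<and> gadj I W u v)"
        using 2(5) unfolding shift_step_def by blast+
      have "rev_step I ti X h"
        unfolding rev_step_def
      proof (intro conjI ballI impI)
        fix a assume "a \<in> assets I"
        show "X (Suc h) a = X h a \<or> inner_adj I (X h a) (X (Suc h) a)"
          using c(4)[of a] 2(3,4) unfolding gadj_def by blast
      next
        obtain a where a: "X (Suc h) a \<noteq> X h a" using c(3) by (metis ext)
        hence "a \<in> assets I" using c(1,2) unfolding conf_def by metis
        thus "\<exists>a\<in>assets I. X (Suc h) a \<noteq> X h a" using a by blast
      next
        fix a r assume a: "a \<in> assets I" and r: "r \<in> traps I" and x: "X h a = Some r \<or> X (Suc h) a = Some r"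
        have "r \<in> W \<or> r = source I \<or> r = target I" using c(1,2) x unfolding conf_def by blast
        hence "r \<in> W" using trap_wf[OF wf v r] by blast
        thus "\<not> act I ti X (Suc h) r" using 2(6) act[of "Suc h" r] h r by simp
      qed
      thus ?thesis using 2(1,2) by blast
    qed
  qed
  \<comment> \<open>Entries need not be configurations of the plan; an entry reached by a shift step
    satisfies the occupancy condition by \<open>conf\<close>.\<close>
  have config: "X h a \<in> {Some (source I), Some (target I), None}"
    if h: "h \<le> H" and a: "a \<in> assets I" "a' \<in> assets I" "a \<noteq> a'" "X h a = X h a'" for h a a'
  proof -
    have "(\<exists>j. X h = C j) \<or> (\<exists>W. conf I W (X h))"
    proof (cases h)
      case 0
      thus ?thesis using f(1) by (auto simp: X_def)
    next
      case (Suc g)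
      thus ?thesis using lk[of g] h by (auto simp: link_def shift_step_def)
    qed
    thus ?thesis
    proof (elim disjE exE)
      fix j assume "X h = C j"
      hence "p a j = p a' j" "X h a = p a j" using a by simp_all
      thus ?thesis using plan_distinct[OF wf v a(1,2), of j] a(3) by (cases "p a j") auto
    next
      fix W assume W: "conf I W (X h)"
      show ?thesis
      proof (cases "X h a")
        case (Some x)
        hence "x \<notin> W" using W a(3,4) unfolding conf_def by metis
        thus ?thesis using W Some unfolding conf_def by auto
      qed simp
    qed
  qed
  have fin: "\<forall>a\<in>assets I. finished I (X H a)" using len(2) f(2) by (simp add: X_def)
  have "{a \<in> assets I. survives I p a} \<subseteq> {a \<in> assets I. X H a = Some (target I)}"
  proof (intro subsetI CollectI conjI; elim CollectE conjE)
    fix a assume a: "a \<in> assets I" "survives I p a"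
    then obtain j where j: "p a j = Some (target I)" using survives_iff[OF wf v] by blast
    have "p a len = Some (target I)"
    proof (cases "len \<le> j")
      case True
      thus ?thesis using plan_finished[OF wf v a(1) len(2)[OF a(1)]] j by metis
    next
      case False
      thus ?thesis using plan_target[OF wf v a(1) j] by simp
    qed
    thus "X H a = Some (target I)" using f(2) a(1) by (simp add: X_def)
  qed
  moreover have "finite (assets I)" using wf by (simp add: wf_routing_def)
  ultimately have "card {a \<in> assets I. survives I p a} \<le> card {a \<in> assets I. X H a = Some (target I)}"
    by (intro card_mono) simp_all
  hence goal: "goal I \<le> card {a \<in> assets I. X H a = Some (target I)}" using sol by (simp add: solution_def)
  have "ti 0 = 0" "\<forall>a\<in>assets I. X 0 a = Some (source I)" using f(1) plan_start[OF wf v] by (simp_all add: ti_def X_def)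
  hence "compressed I ti X H" unfolding compressed_def using config step fin goal by blast
  thus ?thesis using H(1) by blast
qed

end

section \<open>Normal forms: prescribed number of entries and bounded times\<close>

lemma act_cong:
  assumes "h \<le> H" "\<And>h. h \<le> H ==> t' h = t h" "\<And>h a. h \<le> H ==> a \<in> assets I ==> X' h a = X h a"
  shows "act I t' X' h r \<longleftrightarrow> act I t X h r"
proof -
  have "((\<exists>a\<in>assets I. X' g a = Some r \<and> X' (Suc g) a = None) \<and> t' h \<le> t' g + reload I r) \<longleftrightarrow>
    ((\<exists>a\<in>assets I. X g a = Some r \<and> X (Suc g) a = None) \<and> t h \<le> t g + reload I r)" if "g < h" for g
    using assms that by simp
  thus ?thesis unfolding act_def by blast
qed

lemma compressed_cong:
  assumes c: "compressed I t X H"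
    and t: "\<And>h. h \<le> H ==> t' h = t h" and x: "\<And>h a. h \<le> H ==> a \<in> assets I ==> X' h a = X h a"
  shows "compressed I t' X' H"
proof -
  note a = act_cong[where H = H and t = t and X = X and t' = t' and X' = X', OF _ t x]
  have "unit_step I t' X' h \<longleftrightarrow> unit_step I t X h" if "h < H" for h
    unfolding unit_step_def using that by (simp add: a t x)
  moreover have "rev_step I t' X' h \<longleftrightarrow> rev_step I t X h" if "h < H" for h
    unfolding rev_step_def using that by (simp add: a t x)
  moreover have "{a \<in> assets I. X' H a = Some (target I)} = {a \<in> assets I. X H a = Some (target I)}" using x by auto
  ultimately show ?thesis using c unfolding compressed_def by (simp add: t x)
qed

text \<open>The certificate has a fixed number of rows, so a shorter compressed plan is continued by
  repeating its final configuration; once all assets are finished, a unit step without a mover is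
  legal.\<close>

lemma compressed_pad:
  assumes wf: "wf_routing I" and c: "compressed I t X H" and HH: "H \<le> H'"
  defines "t' \<equiv> \<lambda>h. if h \<le> H then t h else t H + (h - H)" and "X' \<equiv> \<lambda>h. X (min h H)"
  shows "compressed I t' X' H'"
proof -
  have t: "t' h = t h" and x: "X' h = X h" if "h \<le> H" for h using that by (simp_all add: t'_def X'_def)
  have x2: "X' h = X H" if "H \<le> h" for h using that by (simp add: X'_def)
  have t2: "t' (Suc h) = Suc (t' h)" if "H \<le> h" for h
    by (cases "h = H") (use that in \<open>simp_all add: t'_def Suc_diff_le\<close>)
  have "compressed I t' X' H" by (rule compressed_cong[OF c]) (simp_all add: t x)
  note c' = this[unfolded compressed_def]
  have fin: "\<forall>a\<in>assets I. finished I (X H a)" using c by (simp add: compressed_def)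
  have tt: "r \<in> traps I ==> target I \<noteq> r" for r using wf by (auto simp: wf_routing_def)
  have late: "unit_step I t' X' h" if "H \<le> h" for h
  proof -
    have e: "X' h = X H" "X' (Suc h) = X H" using x2 that by simp_all
    have n: "\<not> (\<exists>r\<in>traps I. X H a = Some r \<and> act I t' X' h r)" if "X H a \<noteq> None" "a \<in> assets I" for a
      using fin that tt unfolding finished_def by force
    have n2: "\<forall>a\<in>assets I. X H a \<noteq> None --> (X H a = None \<longleftrightarrow> (\<exists>r\<in>traps I. X H a = Some r \<and> act I t' X' h r))"
      using n by blast
    show ?thesis unfolding unit_step_def e using t2[OF that] fin n2 by blast
  qed
  have "t' h < t' (Suc h) \<and> odd (t' (Suc h) - t' h) \<and> (unit_step I t' X' h \<or> rev_step I t' X' h)" if "h < H'" for h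
  proof (cases "h < H")
    case True
    thus ?thesis using c' by blast
  next
    case False
    thus ?thesis using late[of h] t2[of h] by simp
  qed
  moreover have "X' h a \<in> {Some (source I), Some (target I), None}" if "a \<in> assets I" "a' \<in> assets I" "a \<noteq> a' \<and> X' h a = X' h a'" for h a a'
  proof (cases "h \<le> H")
    case True
    thus ?thesis using c' that by blast
  next
    case False
    thus ?thesis using fin that(1) by (auto simp: x2 finished_def)
  qed
  moreover have "X' H' = X H" using x2[OF HH] .
  ultimately show ?thesis using c' x[of H] unfolding compressed_def by auto
qed

text \<open>Once a gap exceeds every reload time, its length only matters up to parity.\<close>

definition shorten :: "nat => nat => nat" where
  "shorten c d = (if d \<le> c + 2 then d else if even (c + 1) = even d then c + 1 else c + 2)"

lemma shorten: "0 < d ==> 0 < shorten c d" "even (shorten c d) = even d" "shorten c d \<le> c + 2"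
  "shorten c (Suc 0) = Suc 0" "shorten c d = d \<or> c < d \<and> c < shorten c d"
  by (auto simp: shorten_def)

text \<open>Times enter only through their parity and through comparisons with reload times. Capping
  every gap slightly above \<open>cm\<close> preserves both and makes the times short enough to be
  written down.\<close>

lemma compressed_shorten:
  assumes wf: "wf_routing I" and c: "compressed I t X H" and cm: "\<And>r. r \<in> traps I ==> reload I r \<le> cm"
  defines "t' \<equiv> \<lambda>h. \<Sum>g<h. shorten cm (t (Suc g) - t g)"
  shows "compressed I t' X H" "h \<le> H ==> t' h \<le> h * (cm + 2)"
proof -
  have st: "t h < t (Suc h)" "odd (t (Suc h) - t h)" "unit_step I t X h \<or> rev_step I t X h" if "h < H" for h
    using c that unfolding compressed_def by blast+
  have S: "t' (Suc h) = t' h + shorten cm (t (Suc h) - t h)" for h by (simp add: t'_def)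
  show "t' h \<le> h * (cm + 2)" if "h \<le> H" for h
    using that
  proof (induction h)
    case (Suc h)
    thus ?case unfolding S using shorten(3)[of cm "t (Suc h) - t h"] by simp
  qed (simp add: t'_def)
  \<comment> \<open>The dichotomy survives summation: either no gap between \<open>g\<close> and
    \<open>h\<close> was changed, or both distances exceed every reload time.\<close>
  have diff: "t g \<le> t h \<and> t' g \<le> t' h \<and> (t h - t g = t' h - t' g \<or> cm < t h - t g \<and> cm < t' h - t' g)"
    if "g \<le> h" "h \<le> H" for g h
    using that
  proof (induction h rule: dec_induct)
    case (step h)
    have 1: "t h < t (Suc h)" using st(1)[of h] step.prems by simp
    thus ?case using step.IH step.prems shorten(5)[of cm "t (Suc h) - t h"] unfolding S by auto
  qed simp
  have act: "act I t' X h r \<longleftrightarrow> act I t X h r" if h: "h \<le> H" and r: "r \<in> traps I" for h r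
  proof -
    have "t' h \<le> t' g + reload I r \<longleftrightarrow> t h \<le> t g + reload I r" if "g < h" for g
      using diff[of g h] cm[OF r] that h by auto
    thus ?thesis unfolding act_def by blast
  qed
  have "t' h < t' (Suc h) \<and> odd (t' (Suc h) - t' h) \<and> (unit_step I t' X h \<or> rev_step I t' X h)" if h: "h < H" for h
  proof -
    have e: "(\<exists>r\<in>traps I. Q r \<and> act I t' X h r) \<longleftrightarrow> (\<exists>r\<in>traps I. Q r \<and> act I t X h r)" for Q
      using act[of h] h by auto
    have u: "unit_step I t' X h" if "unit_step I t X h"
    proof -
      have "t (Suc h) - t h = Suc 0" using that unfolding unit_step_def by simp
      hence "t' (Suc h) = Suc (t' h)" unfolding S using shorten(4) by simp
      thus ?thesis using that unfolding unit_step_def e by (elim conjE) (intro conjI; assumption)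
    qed
    have r: "rev_step I t' X h" if "rev_step I t X h"
      using that act[of "Suc h"] h unfolding rev_step_def by simp
    show ?thesis using st[OF h] u r shorten(1)[of "t (Suc h) - t h" cm] shorten(2)[of cm "t (Suc h) - t h"]
      unfolding S by (auto simp del: even_diff_nat)
  qed
  thus "compressed I t' X H" using c unfolding compressed_def by (simp add: t'_def)
qed

lemma compressed_complete:
  assumes wf: "wf_routing I" and sol: "solution I \<rho>" and cm: "\<And>r. r \<in> traps I ==> reload I r \<le> cm"
    and H': "solved.entries_bound I \<le> H'"
  obtains t X where "compressed I t X H'" "\<And>h. h \<le> H' ==> t h \<le> H' * (cm + 2)"
proof -
  interpret solved I \<rho> by unfold_locales (rule wf, rule sol)
  obtain t X H where H: "H \<le> entries_bound" "compressed I t X H" using compressed_exists by blast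
  let ?t = "\<lambda>h. \<Sum>g<h. shorten cm (t (Suc g) - t g)"
  let ?t' = "\<lambda>h. if h \<le> H then ?t h else ?t H + (h - H)"
  note s = compressed_shorten[OF wf H(2) cm]
  have HH: "H \<le> H'" using H(1) H' by simp
  have "compressed I ?t' (\<lambda>h. X (min h H)) H'" by (rule compressed_pad[OF wf s(1) HH])
  moreover have "?t' h \<le> H' * (cm + 2)" if "h \<le> H'" for h
  proof -
    have "?t' h \<le> h * (cm + 2)"
    proof (cases "h \<le> H")
      case True
      thus ?thesis using s(2)[of h] by simp
    next
      case False
      have "?t H + (h - H) \<le> H * (cm + 2) + (h - H) * (cm + 2)" by (intro add_mono s(2)) simp_all
      also have "\<dots> = h * (cm + 2)" using False by (simp add: add_mult_distrib[symmetric])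
      finally show ?thesis using False by simp
    qed
    also have "\<dots> \<le> H' * (cm + 2)" using that by (rule mult_le_mono1)
    finally show ?thesis .
  qed
  ultimately show ?thesis using that by blast
qed

section \<open>The verifier and its certificates\<close>

section \<open>Binary arithmetic by formulas\<close>

definition numb :: "nat => (nat => bool) => nat" where
  "numb P f = (\<Sum>d<P. if f d then 2 ^ d else 0)"

lemma numb_0 [simp]: "numb 0 f = 0" by (simp add: numb_def)
lemma numb_Suc: "numb (Suc P) f = numb P f + (if f P then 2 ^ P else 0)" by (simp add: numb_def)

lemma numb_less: "numb P f < 2 ^ P"
  by (induction P) (auto simp: numb_Suc)

lemma numb_eq_iff: "numb P f = numb P g \<longleftrightarrow> (\<forall>d<P. f d = g d)"
proof (induction P)
  case (Suc P)
  have "numb (Suc P) f = numb (Suc P) g \<longleftrightarrow> f P = g P \<and> numb P f = numb P g"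
    using numb_less[of P f] numb_less[of P g] by (auto simp: numb_Suc)
  thus ?case using Suc by (auto simp: less_Suc_eq)
qed simp

lemma numb_cong: "(\<And>d. d < P ==> f d = g d) ==> numb P f = numb P g"
  by (simp add: numb_eq_iff)

text \<open>The comparison is decided at the highest position in which the digits differ.\<close>

lemma numb_less_iff: "numb P f < numb P g \<longleftrightarrow> (\<exists>d<P. \<not> f d \<and> g d \<and> (\<forall>e<P. d < e --> f e = g e))"
proof (induction P)
  case (Suc P)
  have "numb (Suc P) f < numb (Suc P) g \<longleftrightarrow> \<not> f P \<and> g P \<or> f P = g P \<and> numb P f < numb P g"
    using numb_less[of P f] numb_less[of P g] by (auto simp: numb_Suc)
  also have "\<dots> \<longleftrightarrow> (\<exists>d<Suc P. \<not> f d \<and> g d \<and> (\<forall>e<Suc P. d < e --> f e = g e))"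
    unfolding Suc.IH by (auto simp: less_Suc_eq)
  finally show ?case .
qed simp

text \<open>Carry lookahead: a carry into position \<open>d\<close> is generated at some lower
  position and propagated by all positions in between. This avoids the recursion of schoolbook
  addition, which formulas could not follow.\<close>

definition carry :: "(nat => bool) => (nat => bool) => nat => bool" where
  "carry f g d \<longleftrightarrow> (\<exists>e<d. f e \<and> g e \<and> (\<forall>b<d. e < b --> f b \<or> g b))"

lemma carry_Suc: "carry f g (Suc d) \<longleftrightarrow> f d \<and> g d \<or> (f d \<or> g d) \<and> carry f g d"
  unfolding carry_def by (auto simp: less_Suc_eq)

lemma numb_add: "numb P f + numb P g = numb P (\<lambda>d. f d \<noteq> (g d \<noteq> carry f g d)) + (if carry f g P then 2 ^ P else 0)"
proof (induction P)
  case 0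
  thus ?case by (simp add: carry_def)
next
  case (Suc P)
  thus ?case by (auto simp: numb_Suc carry_Suc)
qed

lemma numb_add_iff: "numb P h = numb P f + numb P g \<longleftrightarrow> (\<forall>d<P. h d \<longleftrightarrow> f d \<noteq> (g d \<noteq> carry f g d)) \<and> \<not> carry f g P"
  using numb_less[of P h] unfolding numb_add by (auto simp: numb_eq_iff)

lemma numb_pos_iff: "numb P f = 0 \<longleftrightarrow> \<not> (\<exists>d<P. f d)"
  by (auto simp: numb_def)

lemma numb_bits: "x < 2 ^ P ==> numb P (\<lambda>d. odd (x div 2 ^ d)) = x"
proof -
  have "numb P (\<lambda>d. odd (x div 2 ^ d)) = x mod 2 ^ P"
  proof (induction P)
    case (Suc P)
    have "x mod 2 ^ Suc P = 2 ^ P * (x div 2 ^ P mod 2) + x mod 2 ^ P"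
      using mod_mult2_eq[of x "2 ^ P" 2] by (simp add: mult.commute)
    thus ?case using Suc by (simp add: numb_Suc odd_iff_mod_2_eq_one)
  qed simp
  thus "x < 2 ^ P ==> ?thesis" by simp
qed

lemma numb_shift: "numb (Suc P) f = (if f 0 then 1 else 0) + 2 * numb P (\<lambda>d. f (Suc d))"
  unfolding numb_def by (subst sum.lessThan_Suc_shift) (simp add: sum_distrib_left if_distrib cong: if_cong)

lemma numb_odd: "0 < P ==> odd (numb P f) \<longleftrightarrow> f 0"
  by (cases P) (simp_all add: numb_shift)

text \<open>Rows have fixed width, whereas \<open>binary\<close> has no leading zeros: a digit is
  kept if it or a higher one is set.\<close>

lemma binary_numb: "binary (numb P f) = map f (filter (\<lambda>d. \<exists>e<P. d \<le> e \<and> f e) [0..<P])"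
proof (induction P arbitrary: f)
  case 0
  thus ?case by (simp add: binary.simps)
next
  case (Suc P)
  have u: "[0..<Suc P] = 0 # map Suc [0..<P]" by (simp add: upt_conv_Cons map_Suc_upt del: upt_Suc)
  have e: "(\<exists>e<Suc P. Suc d \<le> e \<and> f e) \<longleftrightarrow> (\<exists>e<P. d \<le> e \<and> f (Suc e))" for d
    by (metis Suc_le_D Suc_le_mono Suc_mono not_less_eq)
  show ?case
  proof (cases "numb (Suc P) f = 0")
    case True
    thus ?thesis by (simp add: binary.simps numb_pos_iff del: upt_Suc)
  next
    case False
    hence z: "\<exists>e<Suc P. f e" by (simp add: numb_pos_iff)
    have "binary (numb (Suc P) f) = odd (numb (Suc P) f) # binary (numb (Suc P) f div 2)"
      using False by (subst binary.simps) simp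
    also have "odd (numb (Suc P) f) = f 0" by (simp add: numb_odd)
    also have "numb (Suc P) f div 2 = numb P (\<lambda>d. f (Suc d))" by (simp add: numb_shift)
    finally show ?thesis unfolding u using z by (simp add: Suc e filter_map o_def del: upt_Suc)
  qed
qed

section \<open>The verifier\<close>

text \<open>
  A certificate is a table of bits with ten channels, each of which holds \<open>P * P\<close> numbers with \<open>P\<close>
  binary digits. The channels 0 to 3 list the assets, vertices, edges and traps with reload times,
  where column 1 (for 0, 1) or 2 (for 2, 3) marks the rows in use; channel 4 holds source, target and
  goal, and channel 5 the number of each row. For step \<open>i\<close> of a compressed plan, channel 6 contains
  the locations, 7 marks the eliminated assets, 8 contains the time, and 9 the times up to which the
  traps stay inactive if they are triggered at step \<open>i\<close>.
\<close>

definition verP :: exp where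
  "verP = Sum 99 (Plus Len (N 1)) (Times (eEq (Times (N 10) (Times (V 99) (Times (V 99) (V 99)))) Len) (V 99))"

definition Pw :: "bool list => nat" where "Pw w = val w (\<lambda>_. 0) verP"

lemma fv_verP [simp]: "fv verP = {}" by (auto simp: verP_def)

lemma val_verP [simp]: "val w s verP = Pw w"
  unfolding Pw_def by (rule val_cong) simp

text \<open>The table size is recovered from the length of the certificate as a cube root:
  \<open>v = P\<close> is the only term of the sum that can survive.\<close>

lemma Pw_eq: "length w = 10 * (P * (P * P)) ==> Pw w = P"
proof -
  assume l: "length w = 10 * (P * (P * P))"
  have "10 * (v * (v * v)) = length w \<longleftrightarrow> v = P" for v :: nat
  proof
    assume "10 * (v * (v * v)) = length w"
    hence "v ^ 3 = P ^ 3" using l by (simp add: power3_eq_cube mult.assoc)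
    thus "v = P" by (simp add: power_eq_iff_eq_base)
  qed (simp add: l)
  moreover have "val w s (eEq a b) = (if val w s a = val w s b then 1 else 0)" for s a b
    by (auto simp: eEq_def eNot_def)
  ultimately have "Pw w = (\<Sum>v<length w + 1. (if v = P then 1 else 0) * v)"
    unfolding Pw_def verP_def by (simp del: sum.lessThan_Suc)
  also have "\<dots> = (\<Sum>v<length w + 1. if v = P then P else 0)" by (rule sum.cong) simp_all
  finally have "Pw w = (\<Sum>v<length w + 1. if v = P then P else 0)" .
  moreover have "P \<le> length w" unfolding l by (cases P) auto
  ultimately show "Pw w = P" by simp
qed

definition tab :: "bool list => nat => nat => nat => nat => bool" where
  "tab w ch i j d \<longleftrightarrow> ccode (Pw w) ch i j d < length w \<and> w ! ccode (Pw w) ch i j d"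

definition num :: "bool list => nat => nat => nat => nat" where
  "num w ch i j = numb (Pw w) (tab w ch i j)"

definition rowE :: "nat => exp => exp => exp => exp" where
  "rowE ch i j d = Bit (Plus (Times (Plus (Times (Plus (Times (N ch) verP) i) verP) j) verP) d)"

lemma tr_rowE [simp]: "tr w s (rowE ch i j d) \<longleftrightarrow> tab w ch (val w s i) (val w s j) (val w s d)"
  by (simp add: rowE_def tab_def ccode_def)

lemma fv_rowE [simp]: "fv (rowE ch i j d) = fv i \<union> fv j \<union> fv d" by (auto simp: rowE_def)

definition eIff :: "exp => exp => exp" where "eIff a b = Plus (Times a b) (Times (eNot a) (eNot b))"
definition eImp :: "exp => exp => exp" where "eImp a b = Plus (eNot a) b"

lemma tr_eIff [simp]: "tr w s (eIff a b) \<longleftrightarrow> (tr w s a \<longleftrightarrow> tr w s b)"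
  "tr w s (eImp a b) \<longleftrightarrow> (tr w s a --> tr w s b)"
  by (auto simp: eIff_def eImp_def)

text \<open>A number with \<open>P\<close> digits is too large to be a value of an expression. It is
  therefore represented by a map that sends a digit position to the formula for that digit.\<close>

definition eqE :: "(exp => exp) => (exp => exp) => exp" where
  "eqE X Y = eAll 80 verP (eIff (X (V 80)) (Y (V 80)))"
definition ltE :: "(exp => exp) => (exp => exp) => exp" where
  "ltE X Y = Sum 80 verP (Times (eNot (X (V 80))) (Times (Y (V 80))
     (eAll 81 verP (eImp (Less (V 80) (V 81)) (eIff (X (V 81)) (Y (V 81)))))))"
text \<open>The formula for \<open>carry\<close>; position 80 is already in use by
  \<open>addE\<close>, hence the bound variables 81 and 82.\<close>

definition carryE :: "(exp => exp) => (exp => exp) => exp => exp" where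
  "carryE X Y d = Sum 81 d (Times (X (V 81)) (Times (Y (V 81))
     (eAll 82 d (eImp (Less (V 81) (V 82)) (Plus (X (V 82)) (Y (V 82)))))))"
definition addE :: "(exp => exp) => (exp => exp) => (exp => exp) => exp" where
  "addE X Y Z = Times (eAll 80 verP (eIff (Z (V 80)) (eNot (eIff (X (V 80)) (eNot (eIff (Y (V 80)) (carryE X Y (V 80))))))))
     (eNot (carryE X Y verP))"

text \<open>The variables 80, 81, 82 are reserved for the digits of numbers.\<close>

definition denotes :: "bool list => (nat => nat) => (exp => exp) => (nat => bool) => bool" where
  "denotes w s X f \<longleftrightarrow> (\<forall>s'. (\<forall>v<80. s' v = s v) -->
     (tr w s' (X (V 80)) \<longleftrightarrow> f (s' 80)) \<and> (tr w s' (X (V 81)) \<longleftrightarrow> f (s' 81)) \<and> (tr w s' (X (V 82)) \<longleftrightarrow> f (s' 82)))"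

lemma denotes_row:
  assumes "fv i \<subseteq> {..<80}" "fv j \<subseteq> {..<80}"
  shows "denotes w s (rowE ch i j) (tab w ch (val w s i) (val w s j))"
  unfolding denotes_def
proof (intro allI impI)
  fix s' :: "nat => nat" assume "\<forall>v<80. s' v = s v"
  hence "val w s' i = val w s i" "val w s' j = val w s j" using assms by (auto intro!: val_cong)
  thus "(tr w s' (rowE ch i j (V 80)) \<longleftrightarrow> tab w ch (val w s i) (val w s j) (s' 80)) \<and>
    (tr w s' (rowE ch i j (V 81)) \<longleftrightarrow> tab w ch (val w s i) (val w s j) (s' 81)) \<and>
    (tr w s' (rowE ch i j (V 82)) \<longleftrightarrow> tab w ch (val w s i) (val w s j) (s' 82))"
    by simp
qed

definition oneE :: "exp => exp" where "oneE d = eEq d (N 0)"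

lemma denotes_one: "denotes w s oneE (\<lambda>d. d = 0)"
  by (simp add: denotes_def oneE_def)

lemma numb_one: "0 < P ==> numb P (\<lambda>d. d = 0) = 1"
  by (cases P) (simp_all add: numb_shift numb_pos_iff)

lemma denotesD:
  assumes "denotes w s X f"
  shows "tr w (s(80 := d)) (X (V 80)) \<longleftrightarrow> f d" "tr w (s(80 := d, 81 := e)) (X (V 81)) \<longleftrightarrow> f e"
    "tr w (s(80 := d, 81 := e, 82 := b)) (X (V 82)) \<longleftrightarrow> f b"
    "tr w (s(81 := e)) (X (V 81)) \<longleftrightarrow> f e" "tr w (s(81 := e, 82 := b)) (X (V 82)) \<longleftrightarrow> f b"
  using assms[unfolded denotes_def, rule_format, of "s(80 := d)"]
    assms[unfolded denotes_def, rule_format, of "s(80 := d, 81 := e)"]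
    assms[unfolded denotes_def, rule_format, of "s(80 := d, 81 := e, 82 := b)"]
    assms[unfolded denotes_def, rule_format, of "s(81 := e)"]
    assms[unfolded denotes_def, rule_format, of "s(81 := e, 82 := b)"] by simp_all

lemma tr_eqE: "denotes w s X f ==> denotes w s Y g ==> tr w s (eqE X Y) \<longleftrightarrow> numb (Pw w) f = numb (Pw w) g"
  by (simp add: eqE_def denotesD numb_eq_iff)

lemma tr_ltE: "denotes w s X f ==> denotes w s Y g ==> tr w s (ltE X Y) \<longleftrightarrow> numb (Pw w) f < numb (Pw w) g"
  by (simp add: ltE_def denotesD numb_less_iff)

lemma tr_addE:
  "denotes w s X f ==> denotes w s Y g ==> denotes w s Z h ==>
    tr w s (addE X Y Z) \<longleftrightarrow> numb (Pw w) h = numb (Pw w) f + numb (Pw w) g"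
  unfolding numb_add_iff by (simp add: addE_def carryE_def denotesD carry_def)

lemma tr_eq_row [simp]:
  assumes "fv i \<union> fv j \<union> fv i' \<union> fv j' \<subseteq> {..<80}"
  shows "tr w s (eqE (rowE ch i j) (rowE ch' i' j')) \<longleftrightarrow>
    num w ch (val w s i) (val w s j) = num w ch' (val w s i') (val w s j')"
  unfolding num_def using assms by (intro tr_eqE denotes_row) auto

lemma tr_lt_row [simp]:
  assumes "fv i \<union> fv j \<union> fv i' \<union> fv j' \<subseteq> {..<80}"
  shows "tr w s (ltE (rowE ch i j) (rowE ch' i' j')) \<longleftrightarrow>
    num w ch (val w s i) (val w s j) < num w ch' (val w s i') (val w s j')"
  unfolding num_def using assms by (intro tr_ltE denotes_row) auto

lemma tr_add_row [simp]:
  assumes "fv i \<union> fv j \<union> fv i' \<union> fv j' \<union> fv i'' \<union> fv j'' \<subseteq> {..<80}"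
  shows "tr w s (addE (rowE ch i j) (rowE ch' i' j') (rowE ch'' i'' j'')) \<longleftrightarrow>
    num w ch'' (val w s i'') (val w s j'') = num w ch (val w s i) (val w s j) + num w ch' (val w s i') (val w s j')"
  unfolding num_def using assms by (intro tr_addE denotes_row) auto

lemma tr_succ_row [simp]:
  assumes "fv i \<union> fv j \<union> fv i'' \<union> fv j'' \<subseteq> {..<80}" "0 < Pw w"
  shows "tr w s (addE (rowE ch i j) oneE (rowE ch'' i'' j'')) \<longleftrightarrow>
    num w ch'' (val w s i'') (val w s j'') = Suc (num w ch (val w s i) (val w s j))"
proof -
  have "tr w s (addE (rowE ch i j) oneE (rowE ch'' i'' j'')) \<longleftrightarrow>
    num w ch'' (val w s i'') (val w s j'') = num w ch (val w s i) (val w s j) + numb (Pw w) (\<lambda>d. d = 0)"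
    unfolding num_def using assms by (intro tr_addE denotes_row denotes_one) auto
  thus ?thesis by (simp add: numb_one[OF assms(2)])
qed

definition zeroE :: "(exp => exp) => exp" where "zeroE X = eNot (Sum 80 verP (X (V 80)))"

lemma tr_zero_row [simp]:
  assumes "fv i \<union> fv j \<subseteq> {..<80}"
  shows "tr w s (zeroE (rowE ch i j)) \<longleftrightarrow> num w ch (val w s i) (val w s j) = 0"
  unfolding zeroE_def num_def numb_pos_iff using denotesD(1)[OF denotes_row[of i j w s ch]] assms by simp

section \<open>Emitting the listing of a certificate\<close>

text \<open>The counterpart of \<open>emitN\<close> for numbers stored as rows of digits.\<close>

definition emitR :: "(exp => exp) => com" where
  "emitR X = CSeq (CFor 80 verP (CIf (Sum 81 verP (Times (eLe (V 80) (V 81)) (X (V 81))))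
     (CSeq (CEmit 1) (CIf (X (V 80)) (CEmit 2) (CEmit 1))) CNop)) (CSeq (CEmit 2) (CEmit 1))"

lemma out_emitR:
  assumes "fv i \<union> fv j \<subseteq> {..<80}"
  shows "out w s (emitR (rowE ch i j)) = map bit_symbol (encode_nat (num w ch (val w s i) (val w s j)))"
proof -
  let ?f = "tab w ch (val w s i) (val w s j)"
  have d: "denotes w s (rowE ch i j) ?f" using assms by (intro denotes_row) auto
  have "out w (s(80 := d)) (CIf (Sum 81 verP (Times (eLe (V 80) (V 81)) (rowE ch i j (V 81))))
     (CSeq (CEmit 1) (CIf (rowE ch i j (V 80)) (CEmit 2) (CEmit 1))) CNop) =
     (if \<exists>e<Pw w. d \<le> e \<and> ?f e then [1, bit_symbol (?f d)] else [])" for d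
  proof -
    have "tr w (s(80 := d)) (Sum 81 verP (Times (eLe (V 80) (V 81)) (rowE ch i j (V 81)))) \<longleftrightarrow> (\<exists>e<Pw w. d \<le> e \<and> ?f e)"
      using denotesD(2)[OF d] by (simp del: tr_rowE)
    thus ?thesis using denotesD(1)[OF d] by (auto simp del: tr_rowE tr_simps simp: bit_symbol_def)
  qed
  hence "out w s (emitR (rowE ch i j)) =
      concat (map (\<lambda>d. if \<exists>e<Pw w. d \<le> e \<and> ?f e then [1, bit_symbol (?f d)] else []) [0..<Pw w]) @ [2, 1]"
    unfolding emitR_def by (simp del: out_CIf add: o_def)
  also have "\<dots> = map bit_symbol (encode_nat (num w ch (val w s i) (val w s j)))"
    unfolding concat_filter encode_nat_def num_def binary_numb by (simp add: map_concat o_def bit_symbol_def)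
  finally show ?thesis .
qed

lemma syms_emitR [simp]: "syms (emitR X) = {1, 2}" by (auto simp: emitR_def)

definition asset_list :: "bool list => nat list" where
  "asset_list w = map (\<lambda>i. num w 0 i 0) (filter (\<lambda>i. tab w 0 i 1 0) [0..<Pw w])"
definition vert_list :: "bool list => nat list" where
  "vert_list w = map (\<lambda>i. num w 1 i 0) (filter (\<lambda>i. tab w 1 i 1 0) [0..<Pw w])"
definition edge_list :: "bool list => (nat \<times> nat) list" where
  "edge_list w = map (\<lambda>i. (num w 2 i 0, num w 2 i 1)) (filter (\<lambda>i. tab w 2 i 2 0) [0..<Pw w])"
definition trap_list :: "bool list => (nat \<times> nat) list" where
  "trap_list w = map (\<lambda>i. (num w 3 i 0, num w 3 i 1)) (filter (\<lambda>i. tab w 3 i 2 0) [0..<Pw w])"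
definition listing_of :: "bool list => listing" where
  "listing_of w = (asset_list w, vert_list w, edge_list w, num w 4 0 0, num w 4 1 0, trap_list w, num w 4 2 0)"

definition emit_listing :: com where
  "emit_listing = cseqs
    [CFor 10 verP (CIf (rowE 0 (V 10) (N 1) (N 0)) (emitR (rowE 0 (V 10) (N 0))) CNop), emit_end,
     CFor 10 verP (CIf (rowE 1 (V 10) (N 1) (N 0)) (emitR (rowE 1 (V 10) (N 0))) CNop), emit_end,
     CFor 10 verP (CIf (rowE 2 (V 10) (N 2) (N 0)) (CSeq (emitR (rowE 2 (V 10) (N 0))) (emitR (rowE 2 (V 10) (N 1)))) CNop), emit_end,
     emitR (rowE 4 (N 0) (N 0)), emitR (rowE 4 (N 1) (N 0)), emit_end,
     CFor 10 verP (CIf (rowE 3 (V 10) (N 2) (N 0)) (CSeq (emitR (rowE 3 (V 10) (N 0))) (emitR (rowE 3 (V 10) (N 1)))) CNop), emit_end,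
     emitR (rowE 4 (N 2) (N 0)), emit_end]"

lemma out_emit_listing: "out w (\<lambda>_. 0) emit_listing = map bit_symbol (encode (listing_of w))"
proof -
  let ?e = "\<lambda>n. map bit_symbol (encode_nat n)"
  have en: "out w s emit_end = [2, 2]" for s by (simp add: emit_end_def)
  have un: "concat (map ?e (unpair ps)) = concat (map (\<lambda>x. ?e (fst x) @ ?e (snd x)) ps)" for ps
    by (simp add: unpair_def concat_map_concat o_def split_beta case_prod_unfold)
  show ?thesis
    unfolding listing_of_def encode.simps map_append map_bs_encode_list un
    unfolding emit_listing_def asset_list_def vert_list_def edge_list_def trap_list_def
    by (simp add: out_emitR en o_def concat_filter[symmetric] cong: if_cong)
qed

definition eAnds :: "exp list => exp" where "eAnds es = foldr Times es (N 1)"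

lemma tr_eAnds [simp]: "tr w s (eAnds es) \<longleftrightarrow> (\<forall>e\<in>set es. tr w s e)"
  by (induction es) (auto simp: eAnds_def)

definition As :: "bool list => nat set" where "As w = {i. i < Pw w \<and> tab w 0 i 1 0}"
definition Vs :: "bool list => nat set" where "Vs w = {i. i < Pw w \<and> tab w 1 i 1 0}"
definition Es :: "bool list => nat set" where "Es w = {i. i < Pw w \<and> tab w 2 i 2 0}"
definition Rs :: "bool list => nat set" where "Rs w = {i. i < Pw w \<and> tab w 3 i 2 0}"

lemma index_ball:
  "(\<forall>i\<in>As w. Q i) \<longleftrightarrow> (\<forall>i<Pw w. tab w 0 i 1 0 --> Q i)" "(\<forall>i\<in>Es w. Q i) \<longleftrightarrow> (\<forall>i<Pw w. tab w 2 i 2 0 --> Q i)"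
  "(\<forall>i\<in>Rs w. Q i) \<longleftrightarrow> (\<forall>i<Pw w. tab w 3 i 2 0 --> Q i)"
  by (auto simp: As_def Es_def Rs_def)

lemma index_bex:
  "(\<exists>i\<in>As w. Q i) \<longleftrightarrow> (\<exists>i<Pw w. tab w 0 i 1 0 \<and> Q i)" "(\<exists>i\<in>Es w. Q i) \<longleftrightarrow> (\<exists>i<Pw w. tab w 2 i 2 0 \<and> Q i)"
  "(\<exists>i\<in>Rs w. Q i) \<longleftrightarrow> (\<exists>i<Pw w. tab w 3 i 2 0 \<and> Q i)"
  by (auto simp: As_def Es_def Rs_def)

text \<open>Well-formedness of the listing in terms of row indices, apart from the bound of the goal
  by the number of assets, which will follow from the survivors of an accepted plan.\<close>

definition well_formed :: "bool list => bool" where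
  "well_formed w \<longleftrightarrow>
     inj_on (\<lambda>i. num w 0 i 0) (As w) \<and> inj_on (\<lambda>i. num w 1 i 0) (Vs w) \<and> inj_on (\<lambda>i. num w 3 i 0) (Rs w) \<and>
     inj_on (\<lambda>i. {num w 2 i 0, num w 2 i 1}) (Es w) \<and>
     (\<forall>i\<in>Es w. num w 2 i 0 \<noteq> num w 2 i 1 \<and> num w 2 i 0 \<in> (\<lambda>i. num w 1 i 0) ` Vs w \<and> num w 2 i 1 \<in> (\<lambda>i. num w 1 i 0) ` Vs w) \<and>
     num w 4 0 0 \<in> (\<lambda>i. num w 1 i 0) ` Vs w \<and> num w 4 1 0 \<in> (\<lambda>i. num w 1 i 0) ` Vs w \<and> num w 4 0 0 \<noteq> num w 4 1 0 \<and>
     (\<forall>i\<in>Rs w. num w 3 i 0 \<in> (\<lambda>i. num w 1 i 0) ` Vs w \<and> num w 3 i 0 \<noteq> num w 4 0 0 \<and> num w 3 i 0 \<noteq> num w 4 1 0 \<and> num w 3 i 1 \<noteq> 0) \<and>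
     num w 4 2 0 \<noteq> 0"

definition injE :: "nat => nat => exp" where
  "injE ch j = eAll 10 verP (eAll 11 verP (eImp (eAnds [rowE ch (V 10) (N j) (N 0), rowE ch (V 11) (N j) (N 0),
     eqE (rowE ch (V 10) (N 0)) (rowE ch (V 11) (N 0))]) (eEq (V 10) (V 11))))"

definition vertE :: "nat => exp => exp => exp" where
  "vertE ch i j = Sum 12 verP (Times (rowE 1 (V 12) (N 1) (N 0)) (eqE (rowE ch i j) (rowE 1 (V 12) (N 0))))"

definition edgesE :: exp where
  "edgesE = eAll 10 verP (eAll 11 verP (eImp (eAnds [rowE 2 (V 10) (N 2) (N 0), rowE 2 (V 11) (N 2) (N 0),
       Plus (Times (eqE (rowE 2 (V 10) (N 0)) (rowE 2 (V 11) (N 0))) (eqE (rowE 2 (V 10) (N 1)) (rowE 2 (V 11) (N 1))))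
            (Times (eqE (rowE 2 (V 10) (N 0)) (rowE 2 (V 11) (N 1))) (eqE (rowE 2 (V 10) (N 1)) (rowE 2 (V 11) (N 0))))])
       (eEq (V 10) (V 11))))"

definition endsE :: exp where
  "endsE = eAll 10 verP (eImp (rowE 2 (V 10) (N 2) (N 0))
     (eAnds [eNot (eqE (rowE 2 (V 10) (N 0)) (rowE 2 (V 10) (N 1))), vertE 2 (V 10) (N 0), vertE 2 (V 10) (N 1)]))"

definition trapsE :: exp where
  "trapsE = eAll 10 verP (eImp (rowE 3 (V 10) (N 2) (N 0))
     (eAnds [vertE 3 (V 10) (N 0), eNot (eqE (rowE 3 (V 10) (N 0)) (rowE 4 (N 0) (N 0))),
       eNot (eqE (rowE 3 (V 10) (N 0)) (rowE 4 (N 1) (N 0))), eNot (zeroE (rowE 3 (V 10) (N 1)))]))"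

definition wfE :: exp where
  "wfE = eAnds [injE 0 1, injE 1 1, injE 3 2, edgesE, endsE,
     vertE 4 (N 0) (N 0), vertE 4 (N 1) (N 0), eNot (eqE (rowE 4 (N 0) (N 0)) (rowE 4 (N 1) (N 0))),
     trapsE, eNot (zeroE (rowE 4 (N 2) (N 0)))]"

lemma tr_injE: "tr w s (injE ch j) \<longleftrightarrow> inj_on (\<lambda>i. num w ch i 0) {i. i < Pw w \<and> tab w ch i j 0}"
  unfolding injE_def inj_on_def by (simp add: conj_ac) blast

lemma tr_vertE: "fv i \<union> fv j \<subseteq> {..<12} ==>
  tr w s (vertE ch i j) \<longleftrightarrow> num w ch (val w s i) (val w s j) \<in> (\<lambda>i. num w 1 i 0) ` Vs w"
proof -
  assume a: "fv i \<union> fv j \<subseteq> {..<12}"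
  hence 1: "fv i \<subseteq> {..<80}" "fv j \<subseteq> {..<80}" "12 \<notin> fv i" "12 \<notin> fv j" by auto
  thus ?thesis unfolding vertE_def Vs_def by (auto simp: image_iff)
qed

lemma tr_edgesE: "tr w s edgesE \<longleftrightarrow> inj_on (\<lambda>i. {num w 2 i 0, num w 2 i 1}) (Es w)"
proof -
  have "tr w s edgesE \<longleftrightarrow> (\<forall>i<Pw w. \<forall>j<Pw w. tab w 2 i 2 0 \<and> tab w 2 j 2 0 \<and>
    (num w 2 i 0 = num w 2 j 0 \<and> num w 2 i 1 = num w 2 j 1 \<or> num w 2 i 0 = num w 2 j 1 \<and> num w 2 i 1 = num w 2 j 0) --> i = j)"
    by (simp add: edgesE_def)
  also have "\<dots> \<longleftrightarrow> inj_on (\<lambda>i. {num w 2 i 0, num w 2 i 1}) (Es w)"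
    unfolding inj_on_def Es_def doubleton_eq_iff by blast
  finally show ?thesis .
qed

lemma tr_endsE: "tr w s endsE \<longleftrightarrow> (\<forall>i\<in>Es w. num w 2 i 0 \<noteq> num w 2 i 1 \<and>
    num w 2 i 0 \<in> (\<lambda>i. num w 1 i 0) ` Vs w \<and> num w 2 i 1 \<in> (\<lambda>i. num w 1 i 0) ` Vs w)"
  unfolding index_ball by (simp add: endsE_def tr_vertE)

lemma tr_trapsE: "tr w s trapsE \<longleftrightarrow> (\<forall>i\<in>Rs w. num w 3 i 0 \<in> (\<lambda>i. num w 1 i 0) ` Vs w \<and>
    num w 3 i 0 \<noteq> num w 4 0 0 \<and> num w 3 i 0 \<noteq> num w 4 1 0 \<and> num w 3 i 1 \<noteq> 0)"
  unfolding index_ball by (simp add: trapsE_def tr_vertE)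

lemma tr_wfE: "tr w s wfE \<longleftrightarrow> well_formed w"
proof -
  have i: "tr w s (injE 0 1) \<longleftrightarrow> inj_on (\<lambda>i. num w 0 i 0) (As w)" "tr w s (injE 1 1) \<longleftrightarrow> inj_on (\<lambda>i. num w 1 i 0) (Vs w)"
    "tr w s (injE 3 2) \<longleftrightarrow> inj_on (\<lambda>i. num w 3 i 0) (Rs w)"
    by (simp_all only: tr_injE As_def Vs_def Rs_def)
  have v: "tr w s (vertE 4 (N 0) (N 0)) \<longleftrightarrow> num w 4 0 0 \<in> (\<lambda>i. num w 1 i 0) ` Vs w"
    "tr w s (vertE 4 (N 1) (N 0)) \<longleftrightarrow> num w 4 1 0 \<in> (\<lambda>i. num w 1 i 0) ` Vs w"
    by (simp_all add: tr_vertE)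
  have n: "tr w s (eNot (eqE (rowE 4 (N 0) (N 0)) (rowE 4 (N 1) (N 0)))) \<longleftrightarrow> num w 4 0 0 \<noteq> num w 4 1 0"
    "tr w s (eNot (zeroE (rowE 4 (N 2) (N 0)))) \<longleftrightarrow> num w 4 2 0 \<noteq> 0"
    by simp_all
  show ?thesis
    unfolding wfE_def well_formed_def tr_eAnds
    by (simp only: list.set ball_simps i v n tr_edgesE tr_endsE tr_trapsE simp_thms)
qed

lemma set_lists:
  "set (asset_list w) = (\<lambda>i. num w 0 i 0) ` As w" "set (vert_list w) = (\<lambda>i. num w 1 i 0) ` Vs w"
  "set (edge_list w) = (\<lambda>i. (num w 2 i 0, num w 2 i 1)) ` Es w"
  "set (trap_list w) = (\<lambda>i. (num w 3 i 0, num w 3 i 1)) ` Rs w"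
  by (simp_all add: asset_list_def vert_list_def edge_list_def trap_list_def As_def Vs_def Es_def Rs_def)

abbreviation "Iw w \<equiv> routing_of (listing_of w)"

lemma Iw_simps:
  "assets (Iw w) = (\<lambda>i. num w 0 i 0) ` As w" "verts (Iw w) = (\<lambda>i. num w 1 i 0) ` Vs w"
  "edges (Iw w) = (\<lambda>i. {num w 2 i 0, num w 2 i 1}) ` Es w" "source (Iw w) = num w 4 0 0" "target (Iw w) = num w 4 1 0"
  "traps (Iw w) = (\<lambda>i. num w 3 i 0) ` Rs w" "goal (Iw w) = num w 4 2 0"
  by (simp_all add: listing_of_def set_lists image_image)

lemma distinct_filter_map: "distinct (map f (filter Q [0..<n])) \<longleftrightarrow> inj_on f {i. i < n \<and> Q i}"
proof -
  have "set (filter Q [0..<n]) = {i. i < n \<and> Q i}" by auto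
  thus ?thesis unfolding distinct_map by simp
qed

lemma reload_Iw:
  assumes "inj_on (\<lambda>i. num w 3 i 0) (Rs w)" "i \<in> Rs w"
  shows "reload (Iw w) (num w 3 i 0) = num w 3 i 1"
proof -
  have "distinct (map fst (trap_list w))"
    using assms(1) unfolding trap_list_def Rs_def by (simp add: o_def distinct_filter_map)
  hence "map_of (trap_list w) (num w 3 i 0) = Some (num w 3 i 1)"
    by (rule map_of_is_SomeI) (use assms(2) set_lists(4) in force)
  thus ?thesis by (simp add: listing_of_def)
qed

lemma wf_listing_iff: "wf_listing (listing_of w) \<longleftrightarrow> well_formed w \<and> num w 4 2 0 \<le> card (assets (Iw w))"
proof -
  have d: "distinct (asset_list w) \<longleftrightarrow> inj_on (\<lambda>i. num w 0 i 0) (As w)"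
    "distinct (vert_list w) \<longleftrightarrow> inj_on (\<lambda>i. num w 1 i 0) (Vs w)"
    "distinct (map (\<lambda>(u, v). {u, v}) (edge_list w)) \<longleftrightarrow> inj_on (\<lambda>i. {num w 2 i 0, num w 2 i 1}) (Es w)"
    "distinct (map fst (trap_list w)) \<longleftrightarrow> inj_on (\<lambda>i. num w 3 i 0) (Rs w)"
    unfolding asset_list_def vert_list_def edge_list_def trap_list_def As_def Vs_def Es_def Rs_def
    by (simp_all add: o_def distinct_filter_map)
  have fin: "finite (assets (Iw w))" "finite (verts (Iw w))" by (simp_all add: Iw_simps As_def Vs_def)
  have c2: "card {a, b} = 2 \<longleftrightarrow> a \<noteq> b" for a b :: nat by (simp add: card_insert_if)
  have "wf_listing (listing_of w) \<longleftrightarrow> distinct (asset_list w) \<and> distinct (vert_list w) \<and>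
     distinct (map (\<lambda>(u, v). {u, v}) (edge_list w)) \<and> distinct (map fst (trap_list w)) \<and> wf_routing (Iw w)"
    by (simp add: listing_of_def del: routing_of.simps)
  moreover have "wf_routing (Iw w) \<longleftrightarrow>
     (\<forall>i\<in>Es w. num w 2 i 0 \<noteq> num w 2 i 1 \<and> num w 2 i 0 \<in> (\<lambda>i. num w 1 i 0) ` Vs w \<and> num w 2 i 1 \<in> (\<lambda>i. num w 1 i 0) ` Vs w) \<and>
     num w 4 0 0 \<in> (\<lambda>i. num w 1 i 0) ` Vs w \<and> num w 4 1 0 \<in> (\<lambda>i. num w 1 i 0) ` Vs w \<and> num w 4 0 0 \<noteq> num w 4 1 0 \<and>
     (\<forall>i\<in>Rs w. num w 3 i 0 \<in> (\<lambda>i. num w 1 i 0) ` Vs w \<and> num w 3 i 0 \<noteq> num w 4 0 0 \<and> num w 3 i 0 \<noteq> num w 4 1 0 \<and> num w 3 i 1 \<noteq> 0) \<and>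
     num w 4 2 0 \<noteq> 0 \<and> num w 4 2 0 \<le> card (assets (Iw w))" if i: "inj_on (\<lambda>i. num w 3 i 0) (Rs w)"
  proof -
    have 1: "(\<forall>r\<in>traps (Iw w). 0 < reload (Iw w) r) \<longleftrightarrow> (\<forall>i\<in>Rs w. num w 3 i 1 \<noteq> 0)"
      unfolding Iw_simps using reload_Iw[OF i] by (simp del: routing_of.simps)
    have 2: "(\<forall>e\<in>edges (Iw w). e \<subseteq> verts (Iw w) \<and> card e = 2) \<longleftrightarrow> (\<forall>i\<in>Es w. num w 2 i 0 \<noteq> num w 2 i 1 \<and>
      num w 2 i 0 \<in> (\<lambda>i. num w 1 i 0) ` Vs w \<and> num w 2 i 1 \<in> (\<lambda>i. num w 1 i 0) ` Vs w)"
      unfolding Iw_simps by (auto simp: c2)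
    have 3: "traps (Iw w) \<subseteq> verts (Iw w) - {source (Iw w), target (Iw w)} \<longleftrightarrow>
      (\<forall>i\<in>Rs w. num w 3 i 0 \<in> (\<lambda>i. num w 1 i 0) ` Vs w \<and> num w 3 i 0 \<noteq> num w 4 0 0 \<and> num w 3 i 0 \<noteq> num w 4 1 0)"
      unfolding Iw_simps by auto
    have 4: "1 \<le> goal (Iw w) \<longleftrightarrow> num w 4 2 0 \<noteq> 0" unfolding Iw_simps by linarith
    have 5: "finite (assets (Iw w)) \<longleftrightarrow> True" "finite (verts (Iw w)) \<longleftrightarrow> True" using fin by blast+
    show ?thesis unfolding wf_routing_def 1 2 3 4 5 unfolding Iw_simps(2,4,5,7) ball_conj_distrib by satx
  qed
  ultimately show ?thesis unfolding well_formed_def d by satx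
qed

section \<open>Checking a compressed plan\<close>

definition pos :: "bool list => nat => nat => nat option" where
  "pos w h a = (if tab w 7 h a 0 then None else Some (num w 6 h a))"

text \<open>The sum of trigger time and reload time is taken from channel 9, so that a comparison of
  two rows remains.\<close>

definition act_at :: "bool list => nat => nat => bool" where
  "act_at w h i \<longleftrightarrow> \<not> (\<exists>g<h. (\<exists>a\<in>As w. pos w g a = Some (num w 3 i 0) \<and> pos w (Suc g) a = None) \<and> num w 8 h 0 \<le> num w 9 g i)"

definition along :: "bool list => nat => nat => bool" where
  "along w h a \<longleftrightarrow> (\<exists>e\<in>Es w. pos w h a = Some (num w 2 e 0) \<and> pos w (Suc h) a = Some (num w 2 e 1) \<or>
     pos w h a = Some (num w 2 e 1) \<and> pos w (Suc h) a = Some (num w 2 e 0))"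

definition done_at :: "bool list => nat => nat => bool" where
  "done_at w h a \<longleftrightarrow> pos w h a = None \<or> pos w h a = Some (num w 4 1 0)"

definition unit_at :: "bool list => nat => bool" where
  "unit_at w h \<longleftrightarrow> num w 8 (Suc h) 0 = Suc (num w 8 h 0) \<and>
     (\<forall>a\<in>As w. (done_at w h a --> pos w (Suc h) a = pos w h a) \<and>
       (pos w h a \<noteq> None --> (pos w (Suc h) a = None \<longleftrightarrow> (\<exists>i\<in>Rs w. pos w h a = Some (num w 3 i 0) \<and> act_at w h i))) \<and>
       (pos w (Suc h) a \<noteq> None --> pos w (Suc h) a = pos w h a \<or> along w h a) \<and>
       (pos w (Suc h) a = Some (num w 4 0 0) --> pos w h a = Some (num w 4 0 0))) \<and>
     (h = 0 \<or> (\<exists>a\<in>As w. pos w (Suc h) a \<noteq> pos w h a) \<or> (\<forall>a\<in>As w. done_at w h a))"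

definition rev_at :: "bool list => nat => bool" where
  "rev_at w h \<longleftrightarrow>
     (\<forall>a\<in>As w. pos w (Suc h) a = pos w h a \<or> along w h a \<and>
        pos w h a \<noteq> Some (num w 4 0 0) \<and> pos w (Suc h) a \<noteq> Some (num w 4 0 0) \<and>
        pos w h a \<noteq> Some (num w 4 1 0) \<and> pos w (Suc h) a \<noteq> Some (num w 4 1 0)) \<and>
     (\<exists>a\<in>As w. pos w (Suc h) a \<noteq> pos w h a) \<and>
     (\<forall>a\<in>As w. \<forall>i\<in>Rs w. pos w h a = Some (num w 3 i 0) \<or> pos w (Suc h) a = Some (num w 3 i 0) --> \<not> act_at w (Suc h) i)"

definition plan_ok :: "bool list => bool" where
  "plan_ok w \<longleftrightarrow> num w 8 0 0 = 0 \<and> (\<forall>a\<in>As w. pos w 0 a = Some (num w 4 0 0)) \<and>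
     (\<forall>h<Pw w. \<forall>a\<in>As w. \<forall>b\<in>As w. a \<noteq> b \<and> pos w h a = pos w h b --> pos w h a = Some (num w 4 0 0) \<or> done_at w h a) \<and>
     (\<forall>h<Pw w. Suc h < Pw w --> num w 8 h 0 < num w 8 (Suc h) 0 \<and>
        (tab w 8 h 0 0 \<noteq> tab w 8 (Suc h) 0 0) \<and> (unit_at w h \<or> rev_at w h)) \<and>
     (\<forall>h<Pw w. Suc h = Pw w --> (\<forall>a\<in>As w. done_at w h a))"

text \<open>Channel 5 translates row indices into binary, which is needed to compare the binary goal
  with a count of assets. Channel 9 is checked once here, so that no addition occurs inside the test
  of activity.\<close>

definition aux_ok :: "bool list => bool" where
  "aux_ok w \<longleftrightarrow> num w 5 0 0 = 0 \<and> (\<forall>i<Pw w. Suc i < Pw w --> num w 5 (Suc i) 0 = Suc (num w 5 i 0)) \<and>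
     (\<forall>g<Pw w. \<forall>i\<in>Rs w. num w 9 g i = num w 8 g 0 + num w 3 i 1)"

text \<open>The row whose number equals the goal supplies the goal as a small value, which can be
  compared with the number of survivors.\<close>

definition goal_ok :: "bool list => bool" where
  "goal_ok w \<longleftrightarrow> (\<exists>i<Pw w. num w 5 i 0 = num w 4 2 0 \<and> i \<le> card {a \<in> As w. pos w (Pw w - 1) a = Some (num w 4 1 0)})"

definition atE :: "exp => exp => nat => exp => exp => exp" where
  "atE h a ch i j = Times (eNot (rowE 7 h a (N 0))) (eqE (rowE 6 h a) (rowE ch i j))"
definition sameE :: "exp => exp => exp => exp => exp" where
  "sameE h a h' a' = Plus (Times (rowE 7 h a (N 0)) (rowE 7 h' a' (N 0)))
     (eAnds [eNot (rowE 7 h a (N 0)), eNot (rowE 7 h' a' (N 0)), eqE (rowE 6 h a) (rowE 6 h' a')])"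
definition actE :: "exp => exp => exp" where
  "actE h i = eNot (Sum 40 h (Times (Sum 41 verP (Times (rowE 0 (V 41) (N 1) (N 0))
     (Times (atE (V 40) (V 41) 3 i (N 0)) (rowE 7 (Plus (V 40) (N 1)) (V 41) (N 0)))))
     (eNot (ltE (rowE 9 (V 40) i) (rowE 8 h (N 0))))))"
definition killE :: "exp => exp => exp" where
  "killE h a = Sum 30 verP (Times (rowE 3 (V 30) (N 2) (N 0)) (Times (atE h a 3 (V 30) (N 0)) (actE h (V 30))))"
definition alongE :: "exp => exp => exp" where
  "alongE h a = Sum 31 verP (Times (rowE 2 (V 31) (N 2) (N 0))
     (Plus (Times (atE h a 2 (V 31) (N 0)) (atE (Plus h (N 1)) a 2 (V 31) (N 1)))
           (Times (atE h a 2 (V 31) (N 1)) (atE (Plus h (N 1)) a 2 (V 31) (N 0)))))"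
definition doneE :: "exp => exp => exp" where
  "doneE h a = Plus (rowE 7 h a (N 0)) (atE h a 4 (N 1) (N 0))"
definition allA :: "exp => exp" where "allA e = eAll 20 verP (eImp (rowE 0 (V 20) (N 1) (N 0)) e)"
definition exA :: "exp => exp" where "exA e = Sum 20 verP (Times (rowE 0 (V 20) (N 1) (N 0)) e)"

lemma tr_atE [simp]: "fv h \<union> fv a \<union> fv i \<union> fv j \<subseteq> {..<80} ==>
  tr w s (atE h a ch i j) \<longleftrightarrow> pos w (val w s h) (val w s a) = Some (num w ch (val w s i) (val w s j))"
  by (auto simp: atE_def pos_def)

lemma tr_sameE [simp]: "fv h \<union> fv a \<union> fv h' \<union> fv a' \<subseteq> {..<80} ==>
  tr w s (sameE h a h' a') \<longleftrightarrow> pos w (val w s h) (val w s a) = pos w (val w s h') (val w s a')"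
  by (auto simp: sameE_def pos_def)

lemma tr_none [simp]: "tab w 7 h a 0 \<longleftrightarrow> pos w h a = None"
  by (simp add: pos_def)

lemma tr_actE [simp]: "fv h \<union> fv i \<subseteq> {..<40} ==> tr w s (actE h i) \<longleftrightarrow> act_at w (val w s h) (val w s i)"
proof -
  assume a: "fv h \<union> fv i \<subseteq> {..<40}"
  hence "fv h \<subseteq> {..<80}" "fv i \<subseteq> {..<80}" "40 \<notin> fv h" "40 \<notin> fv i" "41 \<notin> fv h" "41 \<notin> fv i" by auto
  thus ?thesis unfolding actE_def act_at_def index_bex by (simp add: not_less)
qed

lemma tr_killE [simp]: "fv h \<union> fv a \<subseteq> {..<30} ==> tr w s (killE h a) \<longleftrightarrow>
  (\<exists>i\<in>Rs w. pos w (val w s h) (val w s a) = Some (num w 3 i 0) \<and> act_at w (val w s h) i)"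
proof -
  assume a: "fv h \<union> fv a \<subseteq> {..<30}"
  hence "fv h \<subseteq> {..<80}" "fv a \<subseteq> {..<80}" "30 \<notin> fv h" "30 \<notin> fv a" "fv h \<subseteq> {..<40}" by auto
  thus ?thesis unfolding killE_def index_bex by simp
qed

lemma tr_alongE [simp]: "fv h \<union> fv a \<subseteq> {..<30} ==> tr w s (alongE h a) \<longleftrightarrow> along w (val w s h) (val w s a)"
proof -
  assume a: "fv h \<union> fv a \<subseteq> {..<30}"
  hence "fv h \<subseteq> {..<80}" "fv a \<subseteq> {..<80}" "31 \<notin> fv h" "31 \<notin> fv a" by auto
  thus ?thesis unfolding alongE_def along_def index_bex by simp
qed

lemma tr_doneE [simp]: "fv h \<union> fv a \<subseteq> {..<80} ==> tr w s (doneE h a) \<longleftrightarrow> done_at w (val w s h) (val w s a)"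
  by (simp add: doneE_def done_at_def)

lemma tr_allA [simp]: "tr w s (allA e) \<longleftrightarrow> (\<forall>a\<in>As w. tr w (s(20 := a)) e)"
  "tr w s (exA e) \<longleftrightarrow> (\<exists>a\<in>As w. tr w (s(20 := a)) e)"
  unfolding index_ball index_bex by (simp_all add: allA_def exA_def del: tr_none)

definition unitE :: exp where
  "unitE = eAnds [addE (rowE 8 (V 10) (N 0)) oneE (rowE 8 (Plus (V 10) (N 1)) (N 0)),
     allA (eAnds [eImp (doneE (V 10) (V 20)) (sameE (Plus (V 10) (N 1)) (V 20) (V 10) (V 20)),
       eImp (eNot (rowE 7 (V 10) (V 20) (N 0))) (eIff (rowE 7 (Plus (V 10) (N 1)) (V 20) (N 0)) (killE (V 10) (V 20))),
       eImp (eNot (rowE 7 (Plus (V 10) (N 1)) (V 20) (N 0)))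
         (Plus (sameE (Plus (V 10) (N 1)) (V 20) (V 10) (V 20)) (alongE (V 10) (V 20))),
       eImp (atE (Plus (V 10) (N 1)) (V 20) 4 (N 0) (N 0)) (atE (V 10) (V 20) 4 (N 0) (N 0))]),
     eOrs [eEq (V 10) (N 0), exA (eNot (sameE (Plus (V 10) (N 1)) (V 20) (V 10) (V 20))), allA (doneE (V 10) (V 20))]]"

definition revE :: exp where
  "revE = eAnds [
     allA (Plus (sameE (Plus (V 10) (N 1)) (V 20) (V 10) (V 20))
       (eAnds [alongE (V 10) (V 20),
         eNot (atE (V 10) (V 20) 4 (N 0) (N 0)), eNot (atE (Plus (V 10) (N 1)) (V 20) 4 (N 0) (N 0)),
         eNot (atE (V 10) (V 20) 4 (N 1) (N 0)), eNot (atE (Plus (V 10) (N 1)) (V 20) 4 (N 1) (N 0))])),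
     exA (eNot (sameE (Plus (V 10) (N 1)) (V 20) (V 10) (V 20))),
     allA (eAll 21 verP (eImp (rowE 3 (V 21) (N 2) (N 0))
       (eImp (Plus (atE (V 10) (V 20) 3 (V 21) (N 0)) (atE (Plus (V 10) (N 1)) (V 20) 3 (V 21) (N 0)))
         (eNot (actE (Plus (V 10) (N 1)) (V 21))))))]"

lemma tr_unitE: "0 < Pw w ==> tr w s unitE \<longleftrightarrow> unit_at w (s 10)"
  unfolding unitE_def unit_at_def by simp

lemma tr_revE: "tr w s revE \<longleftrightarrow> rev_at w (s 10)"
  unfolding revE_def rev_at_def index_ball(3) by simp

definition planE :: exp where
  "planE = eAnds [zeroE (rowE 8 (N 0) (N 0)), allA (atE (N 0) (V 20) 4 (N 0) (N 0)),
     eAll 10 verP (allA (eAll 21 verP (eImp (rowE 0 (V 21) (N 1) (N 0))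
       (eImp (Times (eNot (eEq (V 20) (V 21))) (sameE (V 10) (V 20) (V 10) (V 21)))
         (Plus (atE (V 10) (V 20) 4 (N 0) (N 0)) (doneE (V 10) (V 20))))))),
     eAll 10 verP (eImp (Less (Plus (V 10) (N 1)) verP) (eAnds [ltE (rowE 8 (V 10) (N 0)) (rowE 8 (Plus (V 10) (N 1)) (N 0)),
       eNot (eIff (rowE 8 (V 10) (N 0) (N 0)) (rowE 8 (Plus (V 10) (N 1)) (N 0) (N 0))), Plus unitE revE])),
     eAll 10 verP (eImp (eEq (Plus (V 10) (N 1)) verP) (allA (doneE (V 10) (V 20))))]"

definition auxE :: exp where
  "auxE = eAnds [zeroE (rowE 5 (N 0) (N 0)),
     eAll 10 verP (eImp (Less (Plus (V 10) (N 1)) verP) (addE (rowE 5 (V 10) (N 0)) oneE (rowE 5 (Plus (V 10) (N 1)) (N 0)))),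
     eAll 10 verP (eAll 21 verP (eImp (rowE 3 (V 21) (N 2) (N 0)) (addE (rowE 8 (V 10) (N 0)) (rowE 3 (V 21) (N 1)) (rowE 9 (V 10) (V 21)))))]"

text \<open>A true formula may have any positive value; the double negation turns it into 1, so that
  the sum counts assets.\<close>

definition goalE :: exp where
  "goalE = Sum 11 verP (Times (eqE (rowE 5 (V 11) (N 0)) (rowE 4 (N 2) (N 0)))
     (Sum 10 verP (Times (eEq (Plus (V 10) (N 1)) verP)
       (eLe (V 11) (Sum 20 verP (eNot (eNot (Times (rowE 0 (V 20) (N 1) (N 0)) (atE (V 10) (V 20) 4 (N 1) (N 0))))))))))"

lemma tr_planE: "0 < Pw w ==> tr w s planE \<longleftrightarrow> plan_ok w"
proof -
  assume P: "0 < Pw w"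
  have "(\<forall>b\<in>As w. R b) \<longleftrightarrow> (\<forall>b<Pw w. tab w 0 b 1 0 --> R b)" for R by (rule index_ball)
  thus ?thesis unfolding planE_def plan_ok_def by (simp add: tr_unitE[OF P] tr_revE)
qed

lemma tr_auxE: "0 < Pw w ==> tr w s auxE \<longleftrightarrow> aux_ok w"
  unfolding auxE_def aux_ok_def index_ball by simp

lemma val_eNot2: "val w s (eNot (eNot e)) = of_bool (tr w s e)"
  by (simp add: eNot_def tr_def)

lemma tr_goalE: "0 < Pw w ==> tr w s goalE \<longleftrightarrow> goal_ok w"
proof -
  assume P: "0 < Pw w"
  have s: "(\<Sum>a<Pw w. of_bool (tab w 0 a 1 0 \<and> pos w h a = Some (num w 4 1 0))) = card {a \<in> As w. pos w h a = Some (num w 4 1 0)}" for h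
  proof -
    have "{..<Pw w} \<inter> {a. tab w 0 a 1 0 \<and> pos w h a = Some (num w 4 1 0)} = {a \<in> As w. pos w h a = Some (num w 4 1 0)}"
      by (auto simp: As_def)
    thus ?thesis by (simp add: sum_of_bool_eq)
  qed
  have h: "(\<exists>h<Pw w. Suc h = Pw w \<and> R h) \<longleftrightarrow> R (Pw w - 1)" for R using P by (cases "Pw w") auto
  show ?thesis unfolding goalE_def goal_ok_def
    using s[unfolded One_nat_def] h by (simp add: val_eNot2)
qed

definition okE :: exp where "okE = eAnds [Less (N 0) verP, wfE, planE, auxE, goalE]"

lemma tr_okE: "tr w s okE \<longleftrightarrow> 0 < Pw w \<and> well_formed w \<and> plan_ok w \<and> aux_ok w \<and> goal_ok w"
  by (cases "0 < Pw w") (simp_all add: okE_def tr_wfE tr_planE tr_auxE tr_goalE)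

section \<open>Agreement of the checks with compressed plans\<close>

text \<open>The table speaks about row indices of assets and traps, while plans speak about their
  names; injectivity of the naming makes the description well defined on assets.\<close>

definition plan_of :: "bool list => nat => nat => nat option" where
  "plan_of w h x = pos w h (THE a. a \<in> As w \<and> num w 0 a 0 = x)"

definition time_of :: "bool list => nat => nat" where "time_of w h = num w 8 h 0"

context
  fixes w :: "bool list"
  assumes wf: "well_formed w" and aux: "aux_ok w" and P: "0 < Pw w"
begin

lemma plan_of_pos: "a \<in> As w ==> plan_of w h (num w 0 a 0) = pos w h a"
proof -
  assume a: "a \<in> As w"
  have "inj_on (\<lambda>i. num w 0 i 0) (As w)" using wf by (simp add: well_formed_def)
  hence "(THE b. b \<in> As w \<and> num w 0 b 0 = num w 0 a 0) = a"
    using a by (intro the_equality) (auto dest: inj_onD)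
  thus ?thesis by (simp add: plan_of_def)
qed

lemma assets_ball: "(\<forall>x\<in>assets (Iw w). Q x) \<longleftrightarrow> (\<forall>a\<in>As w. Q (num w 0 a 0))"
  "(\<exists>x\<in>assets (Iw w). Q x) \<longleftrightarrow> (\<exists>a\<in>As w. Q (num w 0 a 0))"
  "(\<forall>x\<in>traps (Iw w). Q x) \<longleftrightarrow> (\<forall>i\<in>Rs w. Q (num w 3 i 0))"
  "(\<exists>x\<in>traps (Iw w). Q x) \<longleftrightarrow> (\<exists>i\<in>Rs w. Q (num w 3 i 0))"
  unfolding Iw_simps by auto

lemma act_at_iff:
  assumes "h < Pw w" "i \<in> Rs w"
  shows "act (Iw w) (time_of w) (plan_of w) h (num w 3 i 0) \<longleftrightarrow> act_at w h i"
proof -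
  have inj: "inj_on (\<lambda>i. num w 3 i 0) (Rs w)" using wf by (simp add: well_formed_def)
  have s: "num w 9 g i = time_of w g + reload (Iw w) (num w 3 i 0)" if "g < h" for g
    unfolding reload_Iw[OF inj assms(2)] using aux that assms unfolding aux_ok_def time_of_def by simp
  have "((\<exists>a\<in>assets (Iw w). plan_of w g a = Some (num w 3 i 0) \<and> plan_of w (Suc g) a = None) \<and>
      time_of w h \<le> time_of w g + reload (Iw w) (num w 3 i 0)) \<longleftrightarrow>
    ((\<exists>a\<in>As w. pos w g a = Some (num w 3 i 0) \<and> pos w (Suc g) a = None) \<and> num w 8 h 0 \<le> num w 9 g i)" if "g < h" for g
    unfolding assets_ball s[OF that] by (simp add: plan_of_pos time_of_def del: routing_of.simps)
  thus ?thesis unfolding act_def act_at_def by blast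
qed

lemma along_iff: "along w h a \<longleftrightarrow> (\<exists>u v. pos w h a = Some u \<and> pos w (Suc h) a = Some v \<and> {u, v} \<in> edges (Iw w))"
  unfolding Iw_simps along_def image_iff doubleton_eq_iff by blast

lemma done_iff: "finished (Iw w) p \<longleftrightarrow> p = None \<or> p = Some (num w 4 1 0)"
  unfolding finished_def Iw_simps by blast

lemma unit_iff:
  assumes "Suc h < Pw w"
  shows "unit_step (Iw w) (time_of w) (plan_of w) h \<longleftrightarrow> unit_at w h"
proof -
  have k: "(\<exists>r\<in>traps (Iw w). pos w h a = Some r \<and> act (Iw w) (time_of w) (plan_of w) h r) \<longleftrightarrow>
    (\<exists>i\<in>Rs w. pos w h a = Some (num w 3 i 0) \<and> act_at w h i)" for a
    unfolding assets_ball using act_at_iff[of h] assms by (intro bex_cong) (simp_all del: routing_of.simps)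
  show ?thesis
    unfolding unit_step_def unit_at_def assets_ball(1,2) along_iff done_iff done_at_def
    by (simp add: plan_of_pos k time_of_def Iw_simps(4) del: routing_of.simps cong: ball_cong bex_cong)
qed

lemma rev_iff:
  assumes "Suc h < Pw w"
  shows "rev_step (Iw w) (time_of w) (plan_of w) h \<longleftrightarrow> rev_at w h"
proof -
  have e: "(\<exists>u v. pos w h a = Some u \<and> pos w (Suc h) a = Some v \<and> {u, v} \<in> edges (Iw w) \<and>
        u \<noteq> source (Iw w) \<and> v \<noteq> source (Iw w) \<and> u \<noteq> target (Iw w) \<and> v \<noteq> target (Iw w)) \<longleftrightarrow>
     along w h a \<and> pos w h a \<noteq> Some (num w 4 0 0) \<and> pos w (Suc h) a \<noteq> Some (num w 4 0 0) \<and>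
        pos w h a \<noteq> Some (num w 4 1 0) \<and> pos w (Suc h) a \<noteq> Some (num w 4 1 0)" for a
    unfolding along_iff Iw_simps(4,5) by auto
  show ?thesis
    unfolding rev_step_def rev_at_def assets_ball
    by (intro conj_cong ball_cong bex_cong refl) (simp_all only: plan_of_pos e act_at_iff[OF assms])
qed

lemma final_card: "card {x \<in> assets (Iw w). plan_of w h x = Some (target (Iw w))} = card {a \<in> As w. pos w h a = Some (num w 4 1 0)}"
proof -
  have inj: "inj_on (\<lambda>i. num w 0 i 0) (As w)" using wf by (simp add: well_formed_def)
  have "{x \<in> assets (Iw w). plan_of w h x = Some (target (Iw w))} = (\<lambda>i. num w 0 i 0) ` {a \<in> As w. pos w h a = Some (num w 4 1 0)}"
    unfolding Iw_simps by (auto simp: plan_of_pos)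
  moreover have "inj_on (\<lambda>i. num w 0 i 0) {a \<in> As w. pos w h a = Some (num w 4 1 0)}"
    using inj by (rule inj_on_subset) auto
  ultimately show ?thesis by (simp only: card_image)
qed

text \<open>The entries are numbered from 0 to \<open>Pw w - 1\<close>, so the plan has
  \<open>Pw w - 1\<close> steps. Oddness of a time difference is tested by comparing the lowest
  digits.\<close>

lemma compressed_iff:
  "compressed (Iw w) (time_of w) (plan_of w) (Pw w - 1) \<longleftrightarrow>
     plan_ok w \<and> num w 4 2 0 \<le> card {a \<in> As w. pos w (Pw w - 1) a = Some (num w 4 1 0)}"
proof -
  have ne: "num w 0 a 0 = num w 0 b 0 \<longleftrightarrow> a = b" if "a \<in> As w" "b \<in> As w" for a b
    using wf that unfolding well_formed_def by (meson inj_onD)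
  have 1: "(\<forall>a\<in>assets (Iw w). \<forall>a'\<in>assets (Iw w). a \<noteq> a' \<and> plan_of w h a = plan_of w h a' -->
      plan_of w h a \<in> {Some (source (Iw w)), Some (target (Iw w)), None}) \<longleftrightarrow>
    (\<forall>a\<in>As w. \<forall>b\<in>As w. a \<noteq> b \<and> pos w h a = pos w h b --> pos w h a = Some (num w 4 0 0) \<or> done_at w h a)" for h
    unfolding assets_ball done_at_def
    by (intro ball_cong refl) (simp add: plan_of_pos ne Iw_simps(4,5) disj_commute del: routing_of.simps)
  have 2: "odd (time_of w (Suc h) - time_of w h) \<longleftrightarrow> (tab w 8 h 0 0 \<noteq> tab w 8 (Suc h) 0 0)"
    if "time_of w h < time_of w (Suc h)" for h
    using that numb_odd[OF P] by (auto simp: time_of_def num_def)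
  have 3: "(\<forall>h<Pw w - 1. time_of w h < time_of w (Suc h) \<and> odd (time_of w (Suc h) - time_of w h) \<and>
        (unit_step (Iw w) (time_of w) (plan_of w) h \<or> rev_step (Iw w) (time_of w) (plan_of w) h)) \<longleftrightarrow>
    (\<forall>h<Pw w. Suc h < Pw w --> num w 8 h 0 < num w 8 (Suc h) 0 \<and>
        (tab w 8 h 0 0 \<noteq> tab w 8 (Suc h) 0 0) \<and> (unit_at w h \<or> rev_at w h))"
  proof -
    have "(time_of w h < time_of w (Suc h) \<and> odd (time_of w (Suc h) - time_of w h) \<and>
        (unit_step (Iw w) (time_of w) (plan_of w) h \<or> rev_step (Iw w) (time_of w) (plan_of w) h)) \<longleftrightarrow>
      (num w 8 h 0 < num w 8 (Suc h) 0 \<and> (tab w 8 h 0 0 \<noteq> tab w 8 (Suc h) 0 0) \<and> (unit_at w h \<or> rev_at w h))" if "Suc h < Pw w" for h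
      using 2[of h] unit_iff[OF that] rev_iff[OF that] unfolding time_of_def by blast
    thus ?thesis by (metis Suc_lessD less_diff_conv add.commute plus_1_eq_Suc)
  qed
  have 4: "(\<forall>h<Pw w. Suc h = Pw w --> (\<forall>a\<in>As w. done_at w h a)) \<longleftrightarrow> (\<forall>a\<in>As w. done_at w (Pw w - 1) a)"
    using P by (cases "Pw w") auto
  have 5: "(\<forall>h\<le>Pw w - 1. R h) \<longleftrightarrow> (\<forall>h<Pw w. R h)" for R using P by (auto simp: le_less_Suc_eq less_eq_Suc_le[symmetric])
  have 6: "(\<forall>a\<in>assets (Iw w). finished (Iw w) (plan_of w h a)) \<longleftrightarrow> (\<forall>a\<in>As w. done_at w h a)" for h
    unfolding assets_ball done_iff done_at_def by (simp add: plan_of_pos del: routing_of.simps)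
  have 7: "(\<forall>a\<in>assets (Iw w). plan_of w 0 a = Some (source (Iw w))) \<longleftrightarrow> (\<forall>a\<in>As w. pos w 0 a = Some (num w 4 0 0))"
    unfolding assets_ball by (simp add: plan_of_pos Iw_simps(4) del: routing_of.simps)
  show ?thesis
    unfolding compressed_def plan_ok_def 1 3 4 5 6 7 final_card unfolding Iw_simps(7) time_of_def by satx
qed

lemma bin_rows: "i < Pw w ==> num w 5 i 0 = i"
proof (induction i)
  case 0
  thus ?case using aux by (simp add: aux_ok_def)
next
  case (Suc i)
  thus ?case using aux unfolding aux_ok_def by simp
qed

lemma goal_ok_iff: "goal_ok w \<longleftrightarrow> num w 4 2 0 < Pw w \<and> num w 4 2 0 \<le> card {a \<in> As w. pos w (Pw w - 1) a = Some (num w 4 1 0)}"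
  unfolding goal_ok_def using bin_rows by auto

end

lemma verifier_sound:
  assumes "tr w p okE"
  shows "encode (listing_of w) \<in> ROUTING_PLAN"
proof -
  have ok: "0 < Pw w" "well_formed w" "plan_ok w" "aux_ok w" "goal_ok w" using assms unfolding tr_okE by blast+
  have g: "num w 4 2 0 \<le> card {a \<in> As w. pos w (Pw w - 1) a = Some (num w 4 1 0)}"
    using ok(5) goal_ok_iff[OF ok(2,4,1)] by blast
  have c: "compressed (Iw w) (time_of w) (plan_of w) (Pw w - 1)" using compressed_iff[OF ok(2,4,1)] ok(3) g by blast
  \<comment> \<open>The survivors are assets and their number is at least the goal, which supplies
    the condition on the goal that \<open>well_formed\<close> leaves out.\<close>
  have "card {x \<in> assets (Iw w). plan_of w (Pw w - 1) x = Some (target (Iw w))} \<le> card (assets (Iw w))"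
    by (rule card_mono) (auto simp: Iw_simps(1) As_def simp del: routing_of.simps)
  hence wfl: "wf_listing (listing_of w)" unfolding wf_listing_iff using ok(2) g final_card[OF ok(2,4,1)] by simp
  hence wf: "wf_routing (Iw w)" by (simp add: listing_of_def)
  interpret compressed_plan "Iw w" "time_of w" "plan_of w" "Pw w - 1" by unfold_locales (rule wf, rule c)
  show ?thesis unfolding ROUTING_PLAN_def using wfl compressed_solution by blast
qed

lemma compressed_verts:
  assumes wf: "wf_routing I" and c: "compressed I ti X H" and a: "a \<in> assets I"
  shows "h \<le> H ==> X h a = Some v ==> v \<in> verts I"
proof (induction h arbitrary: v)
  case 0
  thus ?case using wf c a by (simp add: wf_routing_def compressed_def)
next
  case (Suc h)
  have e: "{u, v} \<in> edges I ==> v \<in> verts I" for u v using wf unfolding wf_routing_def by blast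
  have "unit_step I ti X h \<or> rev_step I ti X h" using c Suc.prems(1) unfolding compressed_def by simp
  hence "X (Suc h) a = X h a \<or> adj_opt I (X h a) (X (Suc h) a)"
    using a Suc.prems(2) unfolding unit_step_def rev_step_def by fastforce
  thus ?case using Suc e by auto
qed

section \<open>Certificates\<close>

lemma encode_list_length:
  "length ns \<le> length (encode_list ns)" "x \<in> set ns ==> x < 2 ^ length (encode_list ns)"
proof -
  have b: "x < 2 ^ length (binary x)" for x
  proof (induction x rule: less_induct)
    case (less x)
    show ?case
    proof (cases "x = 0")
      case False
      hence "x div 2 < 2 ^ length (binary (x div 2))" using less[of "x div 2"] by simp
      thus ?thesis using False by (subst binary.simps) simp
    qed simp
  qed
  have e: "length (encode_nat x) = 2 * length (binary x) + 2" for x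
    by (simp add: encode_nat_def length_concat o_def sum_list_triv)
  show "length ns \<le> length (encode_list ns)"
    by (induction ns) (simp_all add: encode_list_def e)
  assume "x \<in> set ns"
  hence "length (encode_nat x) \<le> length (encode_list ns)"
    by (induction ns) (auto simp: encode_list_def)
  hence "length (binary x) \<le> length (encode_list ns)" using e[of x] by simp
  thus "x < 2 ^ length (encode_list ns)" using b[of x] power_increasing[of _ _ "2::nat"] by (meson less_le_trans one_le_numeral)
qed

lemma length_unpair: "length (unpair ps) = 2 * length ps"
  by (induction ps) (auto simp: unpair_def)

lemma set_unpair: "(u, v) \<in> set ps ==> u \<in> set (unpair ps) \<and> v \<in> set (unpair ps)"
  by (force simp: unpair_def)

lemma listing_bounds:
  assumes "length (encode (as, vs, es, s, t, rs, k)) = n"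
  shows "length as \<le> n" "length vs \<le> n" "length es \<le> n" "length rs \<le> n"
    "x \<in> set as \<union> set vs \<union> {s, t, k} ==> x < 2 ^ n" "p \<in> set es \<union> set rs ==> fst p < 2 ^ n \<and> snd p < 2 ^ n"
proof -
  have n: "n = length (encode_list as) + length (encode_list vs) + length (encode_list (unpair es)) +
      length (encode_list [s, t]) + length (encode_list (unpair rs)) + length (encode_list [k])"
    using assms by simp
  show "length as \<le> n" "length vs \<le> n" "length es \<le> n" "length rs \<le> n"
    unfolding n using encode_list_length(1)[of as] encode_list_length(1)[of vs] encode_list_length(1)[of "unpair es"]
      encode_list_length(1)[of "unpair rs"] by (simp_all add: length_unpair)
  have le: "y < 2 ^ n" if "y \<in> set ns" "length (encode_list ns) \<le> n" for y ns
  proof -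
    have "y < 2 ^ length (encode_list ns)" by (rule encode_list_length(2)[OF that(1)])
    also have "\<dots> \<le> 2 ^ n" using that(2) by (intro power_increasing) simp_all
    finally show ?thesis .
  qed
  show "x < 2 ^ n" if xx: "x \<in> set as \<union> set vs \<union> {s, t, k}"
  proof -
    consider "x \<in> set as" | "x \<in> set vs" | "x \<in> set [s, t]" | "x \<in> set [k]" using xx by auto
    thus ?thesis by cases (erule le; simp add: n)+
  qed
  show "fst p < 2 ^ n \<and> snd p < 2 ^ n" if p: "p \<in> set es \<union> set rs"
  proof (cases "p \<in> set es")
    case True
    hence "fst p \<in> set (unpair es)" "snd p \<in> set (unpair es)" using set_unpair[of "fst p" "snd p" es] by simp_all
    thus ?thesis using le[of _ "unpair es"] by (simp add: n)
  next
    case False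
    hence "fst p \<in> set (unpair rs)" "snd p \<in> set (unpair rs)" using p set_unpair[of "fst p" "snd p" rs] by simp_all
    thus ?thesis using le[of _ "unpair rs"] by (simp add: n)
  qed
qed

definition table :: "nat => (nat => nat => nat => nat) => bool list" where
  "table P f = map (\<lambda>x. odd (f (x div P div P div P) (x div P div P mod P) (x div P mod P) div 2 ^ (x mod P))) [0..<10 * (P * (P * P))]"

lemma table:
  assumes "0 < P"
  shows "Pw (table P f) = P"
    "ch < 10 ==> i < P ==> j < P ==> d < P ==> tab (table P f) ch i j d \<longleftrightarrow> odd (f ch i j div 2 ^ d)"
    "ch < 10 ==> i < P ==> j < P ==> f ch i j < 2 ^ P ==> num (table P f) ch i j = f ch i j"
proof -
  show Pw: "Pw (table P f) = P" by (rule Pw_eq) (simp add: table_def)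
  show t: "tab (table P f) ch i j d \<longleftrightarrow> odd (f ch i j div 2 ^ d)" if "ch < 10" "i < P" "j < P" "d < P" for d
  proof -
    have "ccode P ch i j d < 10 * P * P * P" unfolding ccode_def using that by (intro radix_less)
    hence l: "ccode P ch i j d < 10 * (P * (P * P))" by (simp add: mult.assoc)
    have "ccode P ch i j d mod P = d" "ccode P ch i j d div P mod P = j" "ccode P ch i j d div P div P mod P = i"
      "ccode P ch i j d div P div P div P = ch" unfolding ccode_def using that by simp_all
    thus ?thesis unfolding tab_def Pw using l by (simp add: table_def)
  qed
  show "num (table P f) ch i j = f ch i j" if "ch < 10" "i < P" "j < P" "f ch i j < 2 ^ P"
  proof -
    have "num (table P f) ch i j = numb P (\<lambda>d. odd (f ch i j div 2 ^ d))"
      unfolding num_def Pw by (rule numb_cong) (use t that in simp)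
    thus ?thesis using numb_bits[OF that(4)] by simp
  qed
qed

text \<open>The number of entries of a compressed plan, with \<open>n\<close> in place of the
  numbers of assets and vertices: at most \<open>4 * n + 1\<close> events, each followed by a static
  stretch, whose length is about three times the diameter bound.\<close>

definition max_entries :: "nat => nat" where
  "max_entries n = (4 * n + 1) * (3 * (n * (2 * (n * n))) + 4) + (3 * (n * (2 * (n * n))) + 3)"

definition cert_size :: "nat => nat" where "cert_size n = max_entries n + 2 * n + 10"

text \<open>With gaps of at most \<open>2 ^ n + 2\<close> and one row per entry, every time plus one
  further reload time fits into \<open>P\<close> digits.\<close>

lemma cert_size_power: "cert_size n * (2 ^ n + 2) + 2 ^ n < 2 ^ cert_size n"
proof -
  let ?P = "cert_size n"
  define m where "m = ?P - n - 2"
  have m: "?P = m + n + 2" "n + 3 \<le> m" by (simp_all add: m_def cert_size_def)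
  have "m - 1 < 2 ^ (m - 1)" by (rule less_exp)
  moreover have "2 ^ m = 2 * (2::nat) ^ (m - 1)" using m(2) power_Suc[of "2::nat" "m - 1"] by simp
  ultimately have "2 * m \<le> 2 ^ m" using m(2) by linarith
  hence "?P < 2 ^ m" using m by simp
  hence "?P * (4 * 2 ^ n) < 2 ^ m * (4 * 2 ^ n)" by simp
  moreover have "2 ^ m * (4 * 2 ^ n) = (2::nat) ^ ?P" unfolding m(1) by (simp add: power_add)
  moreover have "?P * (2 ^ n + 2) + 2 ^ n \<le> ?P * (4 * 2 ^ n)"
  proof -
    have "?P * (2 ^ n + 2) + 2 ^ n \<le> ?P * (2 ^ n + 2) + ?P * 2 ^ n" using m by simp
    also have "\<dots> = ?P * (2 ^ n + 2 + 2 ^ n)" by (simp only: distrib_left)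
    also have "\<dots> \<le> ?P * (4 * 2 ^ n)" using one_le_power[of "2::nat" n] by (intro mult_le_mono2) linarith
    finally show ?thesis .
  qed
  ultimately show ?thesis by linarith
qed

lemma map_nth_filter: "length xs \<le> P ==> map f (filter (\<lambda>i. i < length xs) [0..<P]) = map f [0..<length xs]"
proof -
  assume l: "length xs \<le> P"
  have "[0..<P] = [0..<length xs] @ [length xs..<P]" using l upt_add_eq_append[of 0 "length xs" "P - length xs"] by simp
  hence "filter (\<lambda>i. i < length xs) [0..<P] = filter (\<lambda>i. i < length xs) [0..<length xs] @ filter (\<lambda>i. i < length xs) [length xs..<P]"
    by simp
  also have "filter (\<lambda>i. i < length xs) [0..<length xs] = [0..<length xs]" by (rule filter_True) simp
  also have "filter (\<lambda>i. i < length xs) [length xs..<P] = []" by simp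
  finally show ?thesis by simp
qed

lemma verifier_complete:
  assumes x: "x \<in> ROUTING_PLAN"
  shows "\<exists>w. length w = 10 * (cert_size (length x) * (cert_size (length x) * cert_size (length x))) \<and> tr w (\<lambda>_. 0) okE \<and>
    encode (listing_of w) = x"
proof -
  define n where "n = length x"
  define P where "P = cert_size n"
  obtain I p where I: "x = encode I" "wf_listing I" "solution (routing_of I) p" using x unfolding ROUTING_PLAN_def by blast
  obtain as vs es s t rs k where L: "I = (as, vs, es, s, t, rs, k)" by (cases I)
  have "length (encode (as, vs, es, s, t, rs, k)) = n" using I(1) L n_def by simp
  note lb = listing_bounds[OF this]
  let ?I = "routing_of I"
  have wf: "wf_routing ?I" using I(2) L by simp
  have IL: "assets ?I = set as" "verts ?I = set vs" "goal ?I = k" "traps ?I = fst ` set rs" using L by simp_all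
  have P: "0 < P" "n < P" "n + n < P" "2 < P" by (simp_all add: P_def cert_size_def)
  have nP: "(2::nat) ^ n \<le> 2 ^ P" using P by (intro power_increasing) simp_all
  have up: "y < 2 ^ P" if "y < 2 ^ n" for y :: nat using that nP by (rule order.strict_trans2)
  have pow: "P * (2 ^ n + 2) + 2 ^ n < 2 ^ P" unfolding P_def by (rule cert_size_power)
  have card: "card (assets ?I) \<le> n" "card (verts ?I) \<le> n"
    unfolding IL using card_length[of as] card_length[of vs] lb(1,2) by simp_all
  \<comment> \<open>The table has rows for \<open>P\<close> entries, that is for
    \<open>P - 1\<close> steps.\<close>
  have ent: "solved.entries_bound ?I \<le> P - 1"
  proof -
    interpret solved ?I p by unfold_locales (rule wf, rule I(3))
    have d: "dist_bound \<le> n * (2 * (n * n))" unfolding dist_bound_def using card by (intro mult_le_mono) simp_all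
    hence "Suc static_bound \<le> 3 * (n * (2 * (n * n))) + 4" by (simp add: static_bound_def)
    hence "(4 * card (assets ?I) + 1) * Suc static_bound \<le> (4 * n + 1) * (3 * (n * (2 * (n * n))) + 4)"
      using card(1) by (intro mult_le_mono) simp_all
    hence "entries_bound \<le> max_entries n" using d unfolding entries_bound_def max_entries_def by (simp add: static_bound_def)
    thus ?thesis by (simp add: P_def cert_size_def)
  qed
  have rl: "reload ?I r \<le> 2 ^ n" for r
  proof (cases "map_of rs r")
    case (Some c)
    hence "snd (r, c) < 2 ^ n" using lb(6)[of "(r, c)"] map_of_SomeD[OF Some] by simp
    thus ?thesis using Some L by simp
  qed (simp add: L)
  obtain ti X where c: "compressed ?I ti X (P - 1)" and tb: "\<And>h. h \<le> P - 1 ==> ti h \<le> (P - 1) * (2 ^ n + 2)"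
    using compressed_complete[OF wf I(3) rl ent] by blast
  have tb2: "ti h + y < 2 ^ P" if "h < P" "y \<le> 2 ^ n" for h y
  proof -
    have "ti h \<le> (P - 1) * (2 ^ n + 2)" using tb[of h] that(1) by simp
    also have "\<dots> \<le> P * (2 ^ n + 2)" by (rule mult_le_mono1) simp
    finally show ?thesis using pow that(2) by linarith
  qed
  \<comment> \<open>For rows in use, the columns behind the stored numbers are filled with 1, which
    provides the mark in column 1 or 2; all other rows of these channels are 0.\<close>
  define f where "f ch i j =
    (if ch = 0 then (if i < length as then if j = 0 then as ! i else 1 else 0)
     else if ch = 1 then (if i < length vs then if j = 0 then vs ! i else 1 else 0)
     else if ch = 2 then (if i < length es then if j = 0 then fst (es ! i) else if j = 1 then snd (es ! i) else 1 else 0)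
     else if ch = 3 then (if i < length rs then if j = 0 then fst (rs ! i) else if j = 1 then snd (rs ! i) else 1 else 0)
     else if ch = 4 then (if i = 0 then s else if i = 1 then t else k)
     else if ch = 5 then i
     else if ch = 6 then (if j < length as then case X i (as ! j) of None => 0 | Some v => v else 0)
     else if ch = 7 then (if j < length as \<and> X i (as ! j) = None then 1 else 0)
     else if ch = 8 then ti i
     else (if j < length rs then ti i + snd (rs ! j) else 0))" for ch i j :: nat
  define w where "w = table P f"
  have small: "(1::nat) < 2 ^ P" "0 < (2::nat) ^ P" by (rule one_less_power) (use P in simp_all)
  have mem: "as ! i < 2 ^ P" if "i < length as" for i using lb(5)[of "as ! i"] that up by simp
  have mem2: "vs ! i < 2 ^ P" if "i < length vs" for i using lb(5)[of "vs ! i"] that up by simp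
  have mem3: "fst (es ! i) < 2 ^ P" "snd (es ! i) < 2 ^ P" if "i < length es" for i
    using lb(6)[of "es ! i"] that up by simp_all
  have mem4: "fst (rs ! i) < 2 ^ P" "snd (rs ! i) < 2 ^ n" if "i < length rs" for i
    using lb(6)[of "rs ! i"] that up by simp_all
  have mem5: "s < 2 ^ P" "t < 2 ^ P" "k < 2 ^ P" using lb(5)[of s] lb(5)[of t] lb(5)[of k] up by simp_all
  have memX: "v < 2 ^ P" if "i < P" "j < length as" "X i (as ! j) = Some v" for i j v
  proof -
    have "v \<in> set vs" using compressed_verts[OF wf c, of "as ! j" i v] that unfolding IL by simp
    thus ?thesis using lb(5)[of v] up by simp
  qed
  have fb: "f ch i j < 2 ^ P" if "i < P" "j < P" for ch i j
  proof -
    have i: "i < 2 ^ P" using that(1) less_exp[of P] by (rule less_trans)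
    have 9: "ti i + snd (rs ! j) < 2 ^ P" if "j < length rs" using tb2[OF \<open>i < P\<close>, of "snd (rs ! j)"] mem4(2)[OF that] by simp
    have 8: "ti i < 2 ^ P" using tb2[OF \<open>i < P\<close>, of 0] by simp
    have 6: "(case X i (as ! j) of None => 0 | Some v => v) < 2 ^ P" if "j < length as"
      using memX[OF \<open>i < P\<close> that] small by (cases "X i (as ! j)") simp_all
    have split: "(b ==> x < c) ==> (\<not> b ==> y < c) ==> (if b then x else y) < c" for b and x y c :: nat
      by simp
    show ?thesis unfolding f_def
      by (intro split; (rule small i 8 mem5 | erule mem mem2 mem3 mem4(1) up[OF mem4(2)] 9 6))
  qed
  have Pw: "Pw w = P" unfolding w_def by (rule table(1)[OF P(1)])
  have num: "num w ch i j = f ch i j" if "ch < 10" "i < P" "j < P" for ch i j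
    unfolding w_def by (rule table(3)[where f = f, OF P(1) that]) (rule fb[OF that(2,3)])
  have tab0: "tab w ch i j 0 \<longleftrightarrow> odd (f ch i j)" if "ch < 10" "i < P" "j < P" for ch i j
    unfolding w_def using table(2)[OF P(1) that P(1), of f] by simp
  have c01: "(1::nat) < P" using P by simp
  have lens: "length as \<le> P" "length vs \<le> P" "length es \<le> P" "length rs \<le> P" using lb(1-4) P(2) by simp_all
  have flt: "filter (\<lambda>i. tab w 0 i 1 0) [0..<P] = filter (\<lambda>i. i < length as) [0..<P]"
    "filter (\<lambda>i. tab w 1 i 1 0) [0..<P] = filter (\<lambda>i. i < length vs) [0..<P]"
    "filter (\<lambda>i. tab w 2 i 2 0) [0..<P] = filter (\<lambda>i. i < length es) [0..<P]"
    "filter (\<lambda>i. tab w 3 i 2 0) [0..<P] = filter (\<lambda>i. i < length rs) [0..<P]"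
    by (rule filter_cong[OF refl]; use tab0 c01 P(4) in \<open>simp add: f_def\<close>)+
  have nth: "map (\<lambda>i. (fst (xs ! i), snd (xs ! i))) [0..<length xs] = xs" for xs :: "(nat \<times> nat) list"
    by (rule nth_equalityI) simp_all
  have "asset_list w = as" "vert_list w = vs" "edge_list w = es" "trap_list w = rs"
  proof -
    have "asset_list w = map (\<lambda>i. as ! i) [0..<length as]"
      unfolding asset_list_def Pw flt map_nth_filter[OF lens(1)] using num lens(1) P(1) by (intro map_cong) (simp_all add: f_def)
    thus "asset_list w = as" by (simp add: map_nth)
    have "vert_list w = map (\<lambda>i. vs ! i) [0..<length vs]"
      unfolding vert_list_def Pw flt map_nth_filter[OF lens(2)] using num lens(2) P(1) by (intro map_cong) (simp_all add: f_def)
    thus "vert_list w = vs" by (simp add: map_nth)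
    have "edge_list w = map (\<lambda>i. (fst (es ! i), snd (es ! i))) [0..<length es]"
      unfolding edge_list_def Pw flt map_nth_filter[OF lens(3)] using num lens(3) P(1) c01 by (intro map_cong) (simp_all add: f_def)
    thus "edge_list w = es" unfolding nth .
    have "trap_list w = map (\<lambda>i. (fst (rs ! i), snd (rs ! i))) [0..<length rs]"
      unfolding trap_list_def Pw flt map_nth_filter[OF lens(4)] using num lens(4) P(1) c01 by (intro map_cong) (simp_all add: f_def)
    thus "trap_list w = rs" unfolding nth .
  qed
  hence LI: "listing_of w = I" unfolding listing_of_def L using num P(1,4) c01 by (simp add: f_def)
  have k: "num w 4 2 0 = k" using num P(1,4) by (simp add: f_def)
  have As: "As w = {i. i < length as}"
    unfolding As_def Pw using tab0 c01 lens(1) by (auto simp: f_def split: if_splits)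
  have Rs: "Rs w = {i. i < length rs}"
    unfolding Rs_def Pw using tab0 P(4) lens(4) by (auto simp: f_def split: if_splits)
  have wfd: "well_formed w" using I(2) wf_listing_iff[of w] unfolding LI by blast
  have aux: "aux_ok w"
    unfolding aux_ok_def Pw Rs using num P(1) c01 lens(4) by (auto simp: f_def)
  have P0: "0 < Pw w" using P(1) Pw by simp
  have "compressed (Iw w) (time_of w) (plan_of w) (Pw w - 1)"
    unfolding LI Pw
  proof (rule compressed_cong[OF c])
    fix h assume h: "h \<le> P - 1"
    show "time_of w h = ti h" unfolding time_of_def using num h P(1) by (simp add: f_def)
    fix a assume "a \<in> assets ?I"
    then obtain i where i: "i < length as" "a = as ! i" unfolding IL by (auto simp: in_set_conv_nth)
    have hp: "h < P" "i < P" using h i(1) lens(1) P(1) by simp_all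
    have "num w 0 i 0 = a" using num hp P(1) i by (simp add: f_def)
    hence "plan_of w h a = pos w h i" using plan_of_pos[OF wfd aux P0, of i h] i(1) As by simp
    also have "\<dots> = X h a"
    proof (cases "X h a")
      case None
      hence "tab w 7 h i 0" using tab0[of 7 h i] hp i by (simp add: f_def)
      thus ?thesis using None by simp
    next
      case (Some v)
      hence "\<not> tab w 7 h i 0" using tab0[of 7 h i] hp i by (simp add: f_def)
      moreover have "num w 6 h i = v" using num hp i Some by (simp add: f_def)
      ultimately show ?thesis using Some unfolding pos_def by (simp del: tr_none)
    qed
    finally show "plan_of w h a = X h a" .
  qed
  hence pl: "plan_ok w" "num w 4 2 0 \<le> card {a \<in> As w. pos w (Pw w - 1) a = Some (num w 4 1 0)}"
    using compressed_iff[OF wfd aux P0] by blast+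
  \<comment> \<open>The goal is at most the number of assets and thus smaller than \<open>P\<close>,
    so some row carries it as its number.\<close>
  have "k \<le> n" using wf card(1) unfolding wf_routing_def IL by linarith
  hence "goal_ok w" unfolding goal_ok_iff[OF wfd aux P0] using pl(2) k P(2) Pw by simp
  hence "tr w (\<lambda>_. 0) okE" unfolding tr_okE using P0 wfd pl(1) aux by blast
  moreover have "length w = 10 * (P * (P * P))" by (simp add: w_def table_def)
  ultimately show ?thesis using LI I(1) unfolding P_def n_def by blast
qed

theorem in_NP_ROUTING_PLAN: "in_NP ROUTING_PLAN"
proof (rule in_NP_com)
  \<comment> \<open>Symbol 3 codes no bit, so emitting it after a failed check spoils the comparison
    with any input.\<close>
  let ?c = "CSeq (CIf okE CNop (CEmit 3)) emit_listing"
  let ?q = "\<lambda>n. 10 * (cert_size n * (cert_size n * cert_size n))"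
  have o: "out u (\<lambda>_. 0) ?c = (if tr u (\<lambda>_. 0) okE then [] else [3]) @ map bit_symbol (encode (listing_of u))" for u
    by (simp add: out_emit_listing)
  have inj: "inj bit_symbol" by (auto simp: inj_def bit_symbol_def split: if_splits)
  show "x \<in> ROUTING_PLAN" if h: "out u (\<lambda>_. 0) ?c = map bit_symbol x" for x u
  proof -
    have "tr u (\<lambda>_. 0) okE"
    proof (rule ccontr)
      assume "\<not> tr u (\<lambda>_. 0) okE"
      hence "3 # map bit_symbol (encode (listing_of u)) = map bit_symbol x" using h unfolding o by simp
      hence "3 \<in> set (map bit_symbol x)" by (metis list.set_intros(1))
      thus False by (auto simp: bit_symbol_def split: if_splits)
    qed
    thus ?thesis using verifier_sound[of u "\<lambda>_. 0"] h inj_map_eq_map[OF inj] unfolding o by simp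
  qed
  show "\<exists>u. length u \<le> ?q (length x) \<and> out u (\<lambda>_. 0) ?c = map bit_symbol x" if h: "x \<in> ROUTING_PLAN" for x
  proof -
    obtain w where "length w = ?q (length x)" "tr w (\<lambda>_. 0) okE" "encode (listing_of w) = x"
      using verifier_complete[OF h] by blast
    thus ?thesis unfolding o by (intro exI[of _ w]) simp
  qed
  show "PB ?q" unfolding cert_size_def max_entries_def by (intro PB_mult PB_add PB_const PB_id)
qed

theorem theorem4:
  "NP_complete ROUTING_PLAN \<and> NP_complete_on (crossing_bounded 6) ROUTING_PLAN"
  unfolding NP_complete_def NP_complete_on_def
  using in_NP_ROUTING_PLAN NP_hard_ROUTING_PLAN[of UNIV] NP_hard_ROUTING_PLAN[of "crossing_bounded 6"] by simp

end
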